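(* Let $s\in(0,1)$, and let $L$ be any stable operator of order $2s$ on $\mathbb{R}^n$ with ellipticity constants $0<\lambda\le\Lambda<\infty$. Let $u$ be any weak solution to $$\partial_t u-Lu=f\quad\text{in }(-1,0)\times B_1 .$$ Let $\alpha\in(0,1)$ be such that $\frac{\alpha}{2s}\in(0,1)$ and $\alpha+2s$ is not an integer. Let $$C_\alpha:=\|u\|_{C^{\frac{\alpha}{2s},\alpha}_{t,x}((-1,0)\times\mathbb{R}^n)}+\|f\|_{C^{\frac{\alpha}{2s},\alpha}_{t,x}((-1,0)\times B_1)} .$$ Then $$\|u\|_{C^{1+\frac{\alpha}{2s}}_t\left(\left(-\frac12,0\right)\times B_{1/2}\right)}+\|u\|_{C^{2s+\alpha}_x\left(\left(-\frac12,0\right)\times B_{1/2}\right)}\le C\,C_\alpha,$$ for some constant $C$ depending only on $n$, $s$, $\alpha$, $\lambda$ and $\Lambda$.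
   Context: $B_r\subset\mathbb{R}^n$ is the ball of radius $r$ centred at the origin. A stable operator of order $2s$ with ellipticity constants $0<\lambda\le\Lambda<\infty$ is an operator of the form $$Lw(t,x)=\int_{S^{n-1}}\int_{-\infty}^{\infty}\bigl(w(t,x+\theta r)+w(t,x-\theta r)-2w(t,x)\bigr)\frac{dr}{|r|^{1+2s}}\,d\mu(\theta),$$ where the spectral measure $\mu$ is a nonnegative measure on $S^{n-1}$ (possibly singular) with $$\lambda\le\inf_{\nu\in S^{n-1}}\int_{S^{n-1}}|\nu\cdot\theta|^{2s}\,d\mu(\theta),\qquad \int_{S^{n-1}}d\mu\le\Lambda .$$ Weak solution: $\partial_tu-Lu=f$ in $I\times D$ means $\int_{I\times\mathbb{R}^n}u(-\partial_t\eta-L\eta)\,dx\,dt=\int_{I\times D}f\eta\,dx\,dt$ for all $\eta\in C_c^\infty(I\times D)$. Norms: for $\alpha,\beta\in(0,1)$, $[u]_{C^{\beta,\alpha}_{t,x}(I\times D)}=\sup\frac{|u(t,x)-u(t',x')|}{|t-t'|^\beta+|x-x'|^\alpha}$ over distinct points $(t,x),(t',x')\in I\times D$, and $\|u\|_{C^{\beta,\alpha}_{t,x}}=\|u\|_{L^\infty}+[u]_{C^{\beta,\alpha}_{t,x}}$. For $\gamma>0$, $\|u\|_{C^\gamma_x(I\times D)}=\sup_{t\in I}\|u(t,\cdot)\|_{C^\gamma(D)}$ and $\|u\|_{C^\gamma_t(I\times D)}=\sup_{x\in D}\|u(\cdot,x)\|_{C^\gamma(I)}$, where $C^\gamma$ for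 non-integer $\gamma$ is the usual Hölder space $C^{\lfloor\gamma\rfloor,\gamma-\lfloor\gamma\rfloor}$. *)

theory Defs
  imports "HOL-Analysis.Analysis" "HOL-Probability.Essential_Supremum"
begin

text \<open>Norms take values in the extended nonnegative reals, so that they are defined for every
  function and are infinite when the function is not in the corresponding space.\<close>

subsection \<open>Derivatives on open sets\<close>

text \<open>Intended for open \<open>D\<close>. Continuity of the lower-order derivatives is implied by
  differentiability.\<close>

fun Ck_on :: "nat \<Rightarrow> 'a::euclidean_space set \<Rightarrow> ('a \<Rightarrow> real) \<Rightarrow> bool" where
  "Ck_on 0 D v \<longleftrightarrow> continuous_on D v"
| "Ck_on (Suc k) D v \<longleftrightarrow>
     (\<forall>x\<in>D. v differentiable (at x)) \<and>
     (\<forall>e\<in>Basis. Ck_on k D (\<lambda>x. frechet_derivative v (at x) e))"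

text \<open>The list gives the directions in which one differentiates, the head first; lists of basis
  vectors play the role of multi-indices.\<close>

fun iter_deriv :: "'a list \<Rightarrow> ('a::euclidean_space \<Rightarrow> real) \<Rightarrow> 'a \<Rightarrow> real" where
  "iter_deriv [] v = v"
| "iter_deriv (e # es) v = iter_deriv es (\<lambda>x. frechet_derivative v (at x) e)"

definition test_function :: "'a::euclidean_space set \<Rightarrow> ('a \<Rightarrow> real) \<Rightarrow> bool" where
  "test_function U \<eta> \<longleftrightarrow>
     (\<forall>k. Ck_on k UNIV \<eta>) \<and>
     compact (closure {x. \<eta> x \<noteq> 0}) \<and> closure {x. \<eta> x \<noteq> 0} \<subseteq> U"

subsection \<open>Hoelder norms\<close>

definition holder_seminorm :: "real \<Rightarrow> 'a::euclidean_space set \<Rightarrow> ('a \<Rightarrow> real) \<Rightarrow> ennreal" where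
  "holder_seminorm \<beta> D v =
     (SUP (x, y)\<in>{(x, y). x \<in> D \<and> y \<in> D \<and> x \<noteq> y}. ennreal (\<bar>v x - v y\<bar> / dist x y powr \<beta>))"

text \<open>The norm of \<open>C\<^sup>k\<^sup>,\<^sup>\<beta>(D)\<close> with \<open>k = \<lfloor>\<gamma>\<rfloor>\<close> and \<open>\<beta> = \<gamma> - \<lfloor>\<gamma>\<rfloor>\<close>, for open \<open>D\<close> and noninteger
  \<open>\<gamma> > 0\<close>. A mixed derivative is counted once for each order of differentiation, which changes
  the norm only up to a factor depending on \<open>k\<close> and the dimension.\<close>

definition holder_norm :: "real \<Rightarrow> 'a::euclidean_space set \<Rightarrow> ('a \<Rightarrow> real) \<Rightarrow> ennreal" where
  "holder_norm \<gamma> D v =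
     (let k = nat \<lfloor>\<gamma>\<rfloor>; \<beta> = frac \<gamma> in
      if Ck_on k D v then
        (\<Sum>es\<in>{es. set es \<subseteq> Basis \<and> length es \<le> k}. SUP x\<in>D. ennreal \<bar>iter_deriv es v x\<bar>)
        + (\<Sum>es\<in>{es. set es \<subseteq> Basis \<and> length es = k}. holder_seminorm \<beta> D (iter_deriv es v))
      else \<infinity>)"

definition holder_norm_x ::
  "real \<Rightarrow> real set \<Rightarrow> 'a::euclidean_space set \<Rightarrow> (real \<times> 'a \<Rightarrow> real) \<Rightarrow> ennreal" where
  "holder_norm_x \<gamma> I D u = (SUP t\<in>I. holder_norm \<gamma> D (\<lambda>x. u (t, x)))"

definition holder_norm_t ::
  "real \<Rightarrow> real set \<Rightarrow> 'a::euclidean_space set \<Rightarrow> (real \<times> 'a \<Rightarrow> real) \<Rightarrow> ennreal" where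
  "holder_norm_t \<gamma> I D u = (SUP x\<in>D. holder_norm \<gamma> I (\<lambda>t. u (t, x)))"

definition holder_seminorm_tx ::
  "real \<Rightarrow> real \<Rightarrow> real set \<Rightarrow> 'a::euclidean_space set \<Rightarrow> (real \<times> 'a \<Rightarrow> real) \<Rightarrow> ennreal" where
  "holder_seminorm_tx \<beta> \<alpha> I D u =
     (SUP ((t, x), (t', x'))\<in>{(p, q). p \<in> I \<times> D \<and> q \<in> I \<times> D \<and> p \<noteq> q}.
        ennreal (\<bar>u (t, x) - u (t', x')\<bar> / (\<bar>t - t'\<bar> powr \<beta> + norm (x - x') powr \<alpha>)))"

definition holder_norm_tx ::
  "real \<Rightarrow> real \<Rightarrow> real set \<Rightarrow> 'a::euclidean_space set \<Rightarrow> (real \<times> 'a \<Rightarrow> real) \<Rightarrow> ennreal" where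
  "holder_norm_tx \<beta> \<alpha> I D u =
     esssup (lebesgue_on (I \<times> D)) (\<lambda>p. ennreal \<bar>u p\<bar>) + holder_seminorm_tx \<beta> \<alpha> I D u"

subsection \<open>Stable operators and weak solutions\<close>

definition spectral_measure ::
  "real \<Rightarrow> real \<Rightarrow> real \<Rightarrow> 'a::euclidean_space measure \<Rightarrow> bool" where
  "spectral_measure s lam Lam \<mu> \<longleftrightarrow>
     sets \<mu> = sets (restrict_space borel (sphere 0 1)) \<and>
     ennreal lam \<le> (INF \<nu>\<in>sphere 0 1. \<integral>\<^sup>+\<theta>. ennreal (\<bar>\<nu> \<bullet> \<theta>\<bar> powr (2 * s)) \<partial>\<mu>) \<and>
     emeasure \<mu> (space \<mu>) \<le> ennreal Lam"

definition stable_op ::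
  "real \<Rightarrow> 'a::euclidean_space measure \<Rightarrow> (real \<times> 'a \<Rightarrow> real) \<Rightarrow> real \<times> 'a \<Rightarrow> real" where
  "stable_op s \<mu> w = (\<lambda>(t, x).
     LINT \<theta>|\<mu>. LINT r|lborel.
       (w (t, x + r *\<^sub>R \<theta>) + w (t, x - r *\<^sub>R \<theta>) - 2 * w (t, x)) / \<bar>r\<bar> powr (1 + 2 * s))"

definition time_deriv :: "(real \<times> 'a \<Rightarrow> real) \<Rightarrow> real \<times> 'a \<Rightarrow> real" where
  "time_deriv w = (\<lambda>(t, x). deriv (\<lambda>\<tau>. w (\<tau>, x)) t)"

text \<open>Both integrals are required to exist, since the Bochner integral of a nonintegrable function
  is \<open>0\<close> by convention. For bounded measurable \<open>u\<close> and \<open>f\<close> this is automatic.\<close>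

definition weak_solution ::
  "real \<Rightarrow> 'a::euclidean_space measure \<Rightarrow> real set \<Rightarrow> 'a set \<Rightarrow>
   (real \<times> 'a \<Rightarrow> real) \<Rightarrow> (real \<times> 'a \<Rightarrow> real) \<Rightarrow> bool" where
  "weak_solution s \<mu> I D u f \<longleftrightarrow>
     (\<forall>\<eta>. test_function (I \<times> D) \<eta> \<longrightarrow>
        set_integrable lebesgue (I \<times> UNIV) (\<lambda>p. u p * (- time_deriv \<eta> p - stable_op s \<mu> \<eta> p)) \<and>
        set_integrable lebesgue (I \<times> D) (\<lambda>p. f p * \<eta> p) \<and>
        (LINT p:I \<times> UNIV|lebesgue. u p * (- time_deriv \<eta> p - stable_op s \<mu> \<eta> p))
          = (LINT p:I \<times> D|lebesgue. f p * \<eta> p))"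

end

(* The fundamental solution of the truncated operator L1 (jumps of length at most rho) is studied through its symbol
A(xi) = int 2 (1 - cos (y . xi)) dnu(y). After rescaling to unit size the symbol splits into a smooth part coming from
jumps of length at most 1, whose derivatives are bounded uniformly over all spectral measures and which is elliptic by
the lower bound in the definition, and a bounded convolution part. This gives weighted L1 bounds for all kernels
d^es A^j exp(-sigma A), uniformly in the measure.

A weak solution is mollified in (t, x), so that it solves the equation pointwise; the large jumps are moved to the
right-hand side. Let V(sigma; t, x) be the integral of k(sigma, x - y) zeta(y) u(t - sigma, y) over y, where zeta is a
cutoff. By the equation the sigma-derivatives of V and of its x- and t-derivatives involve only f and the commutator
of L1 with zeta, and are O(sigma^((alpha - order)/(2 s))). Integrating from sigma = T down, and splitting a difference
quotient with increment h at sigma = |h|^(2 s) (resp. |h| in time), bounds the required Hoelder norms of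
V(epsilon; ., .) by the data. Letting epsilon and the mollification parameter tend to 0 gives the claim for u. *)
theory Submission
 imports Defs
begin

text \<open>The spectral measure may be singular, so the fundamental solution has no useful
  pointwise bound; kernels are measured only in integrated form, with the weights 1, |x|^al and
  |x|^2. Each weight has its own task: 1 turns sup bounds of u into derivative bounds, |x|^al
  exploits that differentiated kernels have mean zero, and |x|^2 controls the mass away from the
  pole, which is all that the commutator sees, because the cutoff is constant near the evaluation
  point. The untruncated kernel has no second moment; this is why the jumps are cut off. An order k
  of differentiation leads to the sigma-integral of sigma^((alpha - k)/(2 s)). It converges at 0 for
  k < 2 s + alpha and is governed by its lower end for k > 2 s + alpha; the two regimes supply the
  sup bounds and the mean value bounds of the Hoelder splitting. The borderline k = 2 s + alpha is
  logarithmic and is excluded because 2 s + alpha is not an integer. In time, the orders 2 s and 4 s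
  lie on the two sides because alpha < 2 s. Real cosines with a free phase keep every derivative of
  a kernel in the same family.\<close>

abbreviation bm :: "('a::topological_space => 'b::topological_space) => bool" where
 "bm f == f \<in> borel_measurable borel"

abbreviation LI :: "('a::euclidean_space => real) => bool" where
 "LI f == integrable lborel f"

abbreviation nnL :: "('a::euclidean_space => ennreal) => ennreal" (binder "NN " 10) where
 "nnL f == integral\<^sup>N lborel f"

subsection \<open>Integration over Euclidean space\<close>

lemma nn_integral_lborel_affine:
 fixes f :: "'a::euclidean_space => ennreal"
 assumes [measurable]: "bm f" and "a ~= 0"
 shows "(NN x. f x) = ennreal (abs a ^ DIM('a)) * (NN x. f (t + a *\<^sub>R x))"
 by (subst lborel_affine[OF \<open>a ~= 0\<close>, of t])
   (simp add: nn_integral_density nn_integral_distr nn_integral_cmult)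

lemma integrable_lborel_affine:
 fixes f :: "'a::euclidean_space => real"
 assumes "LI f" "a ~= 0"
 shows "LI (%x. f (t + a *\<^sub>R x))"
proof -
 have [measurable]: "bm f" using assms(1) by auto
 have "(NN x. norm (f x)) < \<infinity>" using assms(1) by (auto simp: integrable_iff_bounded)
 hence "ennreal (abs a ^ DIM('a)) * (NN x. norm (f (t + a *\<^sub>R x))) < \<infinity>"
  by (subst (asm) nn_integral_lborel_affine[OF _ \<open>a ~= 0\<close>, of _ t]) auto
 thus ?thesis using \<open>a ~= 0\<close>
  by (auto simp: integrable_iff_bounded ennreal_mult_less_top)
qed

lemma integral_lborel_affine:
 fixes f :: "'a::euclidean_space => real"
 assumes [measurable]: "bm f" and "a ~= 0"
 shows "(LBINT x. f x) = abs a ^ DIM('a) * (LBINT x. f (t + a *\<^sub>R x))"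
 by (subst lborel_affine[OF \<open>a ~= 0\<close>, of t]) (simp add: integral_density integral_distr)

lemma nn_integral_translate:
 fixes f :: "'a::euclidean_space => ennreal"
 assumes "bm f"
 shows "(NN x. f (x + t)) = (NN x. f x)"
  "(NN x. f (x - t)) = (NN x. f x)"
  "(NN x. f (t - x)) = (NN x. f x)"
 using nn_integral_lborel_affine[OF assms, of 1 t] nn_integral_lborel_affine[OF assms, of 1 "-t"]
  nn_integral_lborel_affine[OF assms, of "-1" t]
 by (auto simp: algebra_simps)

lemma integral_translate:
 fixes f :: "'a::euclidean_space => real"
 assumes "bm f"
 shows "(LBINT x. f (x + t)) = (LBINT x. f x)"
  "(LBINT x. f (x - t)) = (LBINT x. f x)"
  "(LBINT x. f (t - x)) = (LBINT x. f x)"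
 using integral_lborel_affine[OF assms, of 1 t] integral_lborel_affine[OF assms, of 1 "-t"]
  integral_lborel_affine[OF assms, of "-1" t]
 by (auto simp: algebra_simps)

lemma integrable_translate:
 fixes f :: "'a::euclidean_space => real"
 assumes "LI f"
 shows "LI (%x. f (x + t))" "LI (%x. f (x - t))"
  "LI (%x. f (t - x))"
 using integrable_lborel_affine[OF assms, of 1 t] integrable_lborel_affine[OF assms, of 1 "-t"]
  integrable_lborel_affine[OF assms, of "-1" t]
 by (auto simp: algebra_simps)

lemma integrable_bound_real:
 fixes f g :: "'b => real"
 assumes "integrable M g" "f \<in> borel_measurable M" "!!x. x \<in> space M ==> abs (f x) <= g x"
 shows "integrable M f"
proof (rule Bochner_Integration.integrable_bound[OF assms(1,2)])
 show "AE x in M. norm (f x) <= norm (g x)"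
  using assms(3) by (intro AE_I2) (force intro: order_trans)
qed

text \<open>Comparison with a series over the balls of radius k + 1, where k is the integer part of
  |x|: a ball costs (1 + k)^n, and the two spare powers leave the series of 1/(1 + k)^2.\<close>

lemma integrable_decay:
 assumes "N >= DIM('a::euclidean_space) + 2"
 shows "LI (%x::'a. 1 / (1 + norm x) ^ N)"
proof -
 define V where "V = unit_ball_vol (real DIM('a))"
 let ?f = "%(k::nat) x::'a. ennreal (1 / (1 + real k) ^ N) * indicator (ball 0 (1 + real k)) x"
 have le: "ennreal (1 / (1 + norm x) ^ N) <= (\<Sum>k. ?f k x)" for x :: 'a
 proof -
  define k where "k = nat \<lfloor>norm x\<rfloor>"
  have k: "real k <= norm x" "norm x < 1 + real k"
   unfolding k_def by (auto simp: of_nat_nat) linarith+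
  have "ennreal (1 / (1 + norm x) ^ N) <= ?f k x"
   using k by (auto intro!: ennreal_leI divide_left_mono power_mono simp: add_pos_nonneg)
  also have "... <= (\<Sum>k. ?f k x)"
  proof -
   define g where "g = (%k. ?f k x)"
   have "sum g {k} <= (\<Sum>k. g k)" by (rule sum_le_suminf) auto
   thus ?thesis by (simp add: g_def[symmetric] fun_cong[OF g_def, symmetric])
  qed
  finally show ?thesis .
 qed
 have [measurable]: "ball (0::'a) (1 + real k) \<in> sets borel" for k by simp
 have Vp: "0 <= V" by (simp add: V_def)
 have "(NN x. ennreal (1 / (1 + norm (x::'a)) ^ N)) <= (NN x. (\<Sum>k. ?f k x))"
  by (intro nn_integral_mono le)
 also have "... = (\<Sum>k. \<integral>\<^sup>+x. ?f k x \<partial>lborel)"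
  by (rule nn_integral_suminf) measurable
 also have "... = (\<Sum>k. ennreal (1 / (1 + real k) ^ N * (V * (1 + real k) ^ DIM('a))))"
 proof (intro suminf_cong)
  fix k
  have "(NN x. ?f k x) = ennreal (1 / (1 + real k) ^ N) * emeasure lborel (ball (0::'a) (1 + real k))"
   by (rule nn_integral_cmult_indicator) simp
  also have "emeasure lborel (ball (0::'a) (1 + real k)) = ennreal (V * (1 + real k) ^ DIM('a))"
   unfolding V_def by (rule emeasure_ball) simp
  finally show "(NN x. ?f k x) = ennreal (1 / (1 + real k) ^ N * (V * (1 + real k) ^ DIM('a)))"
   using Vp by (subst ennreal_mult) auto
 qed
 also have "... <= (\<Sum>k. ennreal (V * (1 / (1 + real k) ^ 2)))"
 proof (intro suminf_le ennreal_leI)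
  fix k
  have "(1 + real k) ^ DIM('a) * (1 + real k) ^ 2 <= (1 + real k) ^ N"
   unfolding power_add[symmetric] using assms by (intro power_increasing) auto
  hence "(1 + real k) ^ DIM('a) / (1 + real k) ^ N <= 1 / (1 + real k) ^ 2"
   by (simp add: field_simps)
  hence "V * ((1 + real k) ^ DIM('a) / (1 + real k) ^ N) <= V * (1 / (1 + real k) ^ 2)"
   by (rule mult_left_mono[OF _ Vp])
  thus "1 / (1 + real k) ^ N * (V * (1 + real k) ^ DIM('a)) <= V * (1 / (1 + real k) ^ 2)"
   by (simp add: mult_ac)
 qed auto
 also have "... < \<infinity>"
 proof -
  have "summable (%n. 1 / real (Suc n) ^ 2)"
   using inverse_power_summable[of 2, where ?'a=real] by (subst summable_Suc_iff) (simp add: inverse_eq_divide)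
  hence "summable (%k. V * (1 / (1 + real k) ^ 2))"
   by (intro summable_mult) (simp add: add.commute)
  thus ?thesis using Vp by (subst suminf_ennreal2) auto
 qed
 finally show ?thesis
  by (simp add: integrable_iff_bounded)
qed

text \<open>Replaces integration by parts in the frequency variable.\<close>

lemma integral_directional_derivative_eq_0:
 fixes F F' :: "'a::euclidean_space => real" and e :: 'a
 assumes der: "!!x. ((%z. F (x + z *\<^sub>R e)) has_real_derivative F' x) (at 0)"
  and cont: "continuous_on UNIV F'"
  and int: "LI F" "LI F'"
 shows "(LBINT x. F' x) = 0"
proof -
 have [measurable]: "bm F'" "bm F" using int by auto
 have dz: "((%z. F (x + z *\<^sub>R e)) has_real_derivative F' (x + z *\<^sub>R e)) (at z)" for x z
 proof -
  have "((%w. F ((x + z *\<^sub>R e) + (w - z) *\<^sub>R e)) has_real_derivative F' (x + z *\<^sub>R e)) (at z)"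
   using DERIV_chain2[of "%w. F ((x + z *\<^sub>R e) + w *\<^sub>R e)" "F' (x + z *\<^sub>R e)" "%w. w - z" z 1 UNIV]
   der[of "x + z *\<^sub>R e"] by (simp add: DERIV_diff[OF DERIV_ident DERIV_const, simplified])
  moreover have "(x + z *\<^sub>R e) + (w - z) *\<^sub>R e = x + w *\<^sub>R e" for w
   by (simp add: algebra_simps)
  ultimately show ?thesis by simp
 qed
 have ftc: "(LBINT z. indicator {0..1} z *\<^sub>R F' (x + z *\<^sub>R e)) = F (x + e) - F x" for x
 proof -
  have "(LBINT z. indicator {0..1} z *\<^sub>R F' (x + z *\<^sub>R e))
    = F (x + 1 *\<^sub>R e) - F (x + 0 *\<^sub>R e)"
   by (rule integral_FTC_atLeastAtMost)
    (auto intro!: continuous_intros continuous_on_compose2[OF cont] has_field_derivative_at_within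
     dz simp flip: has_real_derivative_iff_has_vector_derivative)
  thus ?thesis by simp
 qed
 have I: "integrable (lborel \<Otimes>\<^sub>M lborel) (%(z::real, x). indicator {0..1} z *\<^sub>R F' (x + z *\<^sub>R e))"
 proof (rule lborel_pair.Fubini_integrable)
  show "LI (%z. \<integral>x. norm (case (z, x) of (z::real, x) => indicator {0..1} z *\<^sub>R F' (x + z *\<^sub>R e)) \<partial>lborel)"
  proof -
   have "(LBINT x. norm (F' (x + z *\<^sub>R e))) = (LBINT x. norm (F' x))" for z
    by (rule integral_translate(1)[of "%x. norm (F' x)"]) simp
   thus ?thesis by (simp add: abs_mult)
  qed
 qed (use integrable_translate(1)[OF int(2)] in auto)
 \<comment> \<open>By translation invariance the integral may be averaged over the shifts by z e
   with z in [0, 1]. Fubini and the one-dimensional fundamental theorem turn the average into the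
   integral of \<open>F (x + e) - F x\<close>, which vanishes by translation invariance
   again.\<close>
 have "(LBINT x. F' x) = (LBINT z. indicator {0..1} (z::real) * (LBINT x. F' x))" by simp
 also have "... = (LBINT z. (LBINT x. indicator {0..1} z *\<^sub>R F' (x + z *\<^sub>R e)))"
  by (simp add: integral_translate)
 also have "... = (LBINT x. (LBINT z. indicator {0..1} z *\<^sub>R F' (x + z *\<^sub>R e)))"
  by (rule lborel_pair.Fubini_integral[symmetric]) (rule I)
 also have "... = (LBINT x. F (x + e) - F x)" by (simp only: ftc)
 also have "... = 0"
  using integrable_translate(1)[OF int(1), of e] int(1) by (simp add: integral_translate)
 finally show ?thesis .
qed

lemma abs_integral_le:
 fixes f g :: "'b => real"
 assumes "integrable M g" "f \<in> borel_measurable M" "AE x in M. abs (f x) <= g x"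
 shows "integrable M f" "abs (\<integral>x. f x \<partial>M) <= (\<integral>x. g x \<partial>M)"
proof -
 show i: "integrable M f"
  by (rule Bochner_Integration.integrable_bound[OF assms(1,2)]) (use assms(3) in eventually_elim, auto)
 have "abs (\<integral>x. f x \<partial>M) <= (\<integral>x. abs (f x) \<partial>M)" by simp
 also have "... <= (\<integral>x. g x \<partial>M)"
  by (rule integral_mono_AE) (use i assms in auto)
 finally show "abs (\<integral>x. f x \<partial>M) <= (\<integral>x. g x \<partial>M)" .
qed

subsection \<open>Quadratic remainders\<close>

lemma quadratic_remainder:
 fixes f :: "real => real"
 assumes "!!z. (f has_real_derivative f' z) (at z)" "!!z. (f' has_real_derivative f'' z) (at z)"
  and "!!z. abs (f'' z) <= B"
 shows "abs (f (a + h) - f a - h * f' a) <= B * h^2"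
proof (cases "h = 0")
 case False
 have B: "0 <= B" using assms(3)[of 0] by linarith
 have "\<exists>t. (if a + h < a then a + h < t \<and> t < a else a < t \<and> t < a + h) \<and>
  f (a + h) = (\<Sum>m<2. ((if m = 0 then f else if m = 1 then f' else f'') a / fact m) * ((a + h) - a)^m)
   + ((if (2::nat) = 0 then f else if (2::nat) = 1 then f' else f'') t / fact 2) * ((a + h) - a)^2"
  by (rule Taylor[where a = "a - abs h" and b = "a + abs h"]) (use assms False in \<open>auto simp: less_2_cases_iff\<close>)
 then obtain t where t: "f (a + h) = f a + f' a * h + f'' t / 2 * h^2"
  by (auto simp: numeral_2_eq_2 split: if_splits)
 have "abs (f (a + h) - f a - h * f' a) = abs (f'' t) / 2 * h^2"
  by (simp add: t abs_mult)
 also have "... <= B * h^2"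
  using assms(3)[of t] B by (intro mult_right_mono) auto
 finally show ?thesis .
qed auto

text \<open>The route to all derivatives under an integral sign: a quadratic bound for the remainder
  of the integrand integrates to a quadratic bound for the remainder of the integral, which this
  criterion turns back into a derivative. Dominated convergence is avoided.\<close>

lemma has_derivative_of_quadratic_remainder:
 fixes f :: "'a::real_normed_vector => real"
 assumes "bounded_linear f'" "d > 0" "!!h. norm h < d ==> abs (f (x + h) - f x - f' h) <= B * (norm h)^2"
 shows "(f has_derivative f') (at x)"
proof (rule has_derivativeI[OF assms(1)], rule Lim_null_comparison)
 show "\<forall>\<^sub>F y in at x. norm ((f y - f x - f' (y - x)) /\<^sub>R norm (y - x)) <= B * norm (y - x)"
  unfolding eventually_at
 proof (intro exI[of _ d] conjI ballI impI)
  fix y assume "y ~= x \<and> dist y x < d"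
  hence y: "norm (y - x) < d" "norm (y - x) > 0" by (auto simp: dist_norm)
  have "abs (f y - f x - f' (y - x)) <= B * (norm (y - x))^2"
   using assms(3)[OF y(1)] by simp
  thus "norm ((f y - f x - f' (y - x)) /\<^sub>R norm (y - x)) <= B * norm (y - x)"
   using y(2) by (simp add: abs_mult field_simps power2_eq_square)
 qed (fact assms)
 show "((%y. B * norm (y - x)) \<longlongrightarrow> 0) (at x)"
  by (auto intro!: tendsto_eq_intros)
qed

lemma has_real_derivative_of_quadratic_remainder:
 fixes f :: "real => real"
 assumes "d > 0" "!!h. abs h < d ==> abs (f (x + h) - f x - h * D) <= B * h^2"
 shows "(f has_real_derivative D) (at x)"
 unfolding has_field_derivative_def
 by (rule has_derivative_of_quadratic_remainder[OF _ assms(1)])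
   (use assms(2) in \<open>auto simp: bounded_linear_mult_right mult.commute\<close>)

lemma cos_quadratic_remainder: "abs (cos (a + b) - cos a + b * sin a) <= (b::real)^2"
 using quadratic_remainder[OF DERIV_cos DERIV_minus[OF DERIV_sin], of 1 a b] by (simp add: algebra_simps)

lemma one_minus_cos_le: "1 - cos b <= (b::real)^2"
 using cos_quadratic_remainder[of 0 b] by auto

lemma abs_cos_diff_le: "abs (cos a - cos b) <= abs (a - b) * abs (a + b)" "abs (cos a - cos b) <= abs (a - (b::real))"
proof -
 have e: "abs (cos a - cos b) = 2 * (abs (sin ((a + b) / 2)) * abs (sin ((b - a) / 2)))"
  by (simp add: cos_diff_cos abs_mult)
 have b: "abs (sin ((b - a) / 2)) <= abs (a - b) / 2"
  using abs_sin_x_le_abs_x[of "(b - a)/2"] by (simp add: abs_minus_commute)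
 have "abs (sin ((a + b) / 2)) * abs (sin ((b - a) / 2)) <= 1 * (abs (a - b) / 2)"
  by (intro mult_mono b) auto
 thus "abs (cos a - cos b) <= abs (a - b)" unfolding e by simp
 have "abs (sin ((a + b) / 2)) * abs (sin ((b - a) / 2)) <= abs (a + b) * (abs (a - b) / 2)"
  by (intro mult_mono b order_trans[OF abs_sin_x_le_abs_x]) auto
 thus "abs (cos a - cos b) <= abs (a - b) * abs (a + b)" unfolding e by (simp add: mult_ac)
qed

text \<open>With w = |z|/2 <= 1/2 one has sin w >= w - w^2 >= w/2, so 1 - cos z = 2 (sin w)^2 >=
  w^2/2 = z^2/8.\<close>

lemma one_minus_cos_ge:
 assumes "abs z <= 1"
 shows "z^2 / 8 <= 1 - cos (z::real)"
proof -
 define w where "w = abs z / 2"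
 have w: "0 <= w" "w <= 1/2" using assms by (auto simp: w_def)
 have "abs (sin w - w) <= w^2"
  using quadratic_remainder[of sin cos "%z. - sin z" 1 0 w] by simp
 also have "... <= 1/2 * w" using mult_right_mono[OF w(2,1)] by (simp add: power2_eq_square)
 finally have "w / 2 <= sin w" by linarith
 hence "(w / 2)^2 <= (sin w)^2" using w by (intro power_mono) auto
 moreover have "cos z = cos (abs z)" by simp
 moreover have "1 - cos (abs z) = 2 * (sin w)^2"
  using cos_double_sin[of w] by (simp add: w_def)
 ultimately show ?thesis by (simp add: w_def power2_eq_square)
qed

subsection \<open>Uniform families of symbols\<close>

text \<open>The constants are chosen before the index in \<open>P\<close>. The index will be a
  measure together with a time, and this order of quantifiers is what keeps the final constant
  independent of the spectral measure.\<close>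

definition rapid :: "'i set => ('i => 'a::euclidean_space => real) => bool" where
 "rapid P h \<longleftrightarrow> (\<forall>i\<in>P. h i \<in> borel_measurable borel) \<and>
   (\<forall>N. \<exists>C. \<forall>i\<in>P. \<forall>x. abs (h i x) <= C / (1 + norm x) ^ N)"

definition polybd :: "'i set => ('i => 'a::euclidean_space => real) => bool" where
 "polybd P p \<longleftrightarrow> (\<forall>i\<in>P. continuous_on UNIV (p i)) \<and>
   (\<exists>C N. \<forall>i\<in>P. \<forall>x. abs (p i x) <= C * (1 + norm x) ^ N)"

lemma rapidD: "rapid P h ==> i \<in> P ==> h i \<in> borel_measurable borel"
 "rapid P h ==> \<exists>C. \<forall>i\<in>P. \<forall>x. abs (h i x) <= C / (1 + norm x) ^ N"
 by (auto simp: rapid_def)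

lemma polybd_measurable: "polybd P p ==> i \<in> P ==> p i \<in> borel_measurable borel"
 by (auto simp: polybd_def intro: borel_measurable_continuous_onI)

lemma polybd_const: "polybd P (%i x. c)"
 unfolding polybd_def by (intro conjI exI[of _ "abs c"] exI[of _ 0]) (auto intro!: continuous_intros)

lemma polybd_inner:
 fixes e :: "'a::euclidean_space"
 shows "polybd P (%i x. x \<bullet> e)"
 unfolding polybd_def
proof (intro conjI exI ballI allI)
 fix x
 have "abs (x \<bullet> e) <= norm x * norm e" by (rule Cauchy_Schwarz_ineq2)
 also have "... <= norm e * (1 + norm x) ^ 1" by (simp add: algebra_simps)
 finally show "abs (x \<bullet> e) <= norm e * (1 + norm x) ^ 1" .
qed (auto intro!: continuous_intros)

lemma polybd_mult:
 assumes "polybd P p" "polybd P q"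
 shows "polybd P (%i x. p i x * q i x)"
proof -
 obtain C N where 1: "!!i x. i \<in> P ==> abs (p i x) <= C * (1 + norm x) ^ N"
  using assms(1) unfolding polybd_def by blast
 obtain D M where 2: "!!i x. i \<in> P ==> abs (q i x) <= D * (1 + norm x) ^ M"
  using assms(2) unfolding polybd_def by blast
 have "abs (p i x * q i x) <= (C * D) * (1 + norm x) ^ (N + M)" if "i \<in> P" for i x
  using mult_mono'[OF 1[OF that, of x] 2[OF that, of x]]
  by (simp add: abs_mult power_add mult_ac)
 thus ?thesis using assms unfolding polybd_def
  by (intro conjI) (blast intro: continuous_on_mult)+
qed

lemma polybd_add:
 assumes "polybd P p" "polybd P q"
 shows "polybd P (%i x. p i x + q i x)"
proof -
 obtain C N where 1: "!!i x. i \<in> P ==> abs (p i x) <= C * (1 + norm x) ^ N"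
  using assms(1) unfolding polybd_def by blast
 obtain D M where 2: "!!i x. i \<in> P ==> abs (q i x) <= D * (1 + norm x) ^ M"
  using assms(2) unfolding polybd_def by blast
 have "abs (p i x + q i x) <= (abs C + abs D) * (1 + norm x) ^ (N + M)" if "i \<in> P" for i x
 proof -
  have "C * (1 + norm x) ^ N <= abs C * (1 + norm x) ^ (N + M)"
   "D * (1 + norm x) ^ M <= abs D * (1 + norm x) ^ (N + M)"
   by (intro mult_mono power_increasing; simp)+
  thus ?thesis using 1[OF that, of x] 2[OF that, of x] by (simp add: distrib_right)
 qed
 thus ?thesis using assms unfolding polybd_def
  by (intro conjI) (blast intro: continuous_on_add)+
qed

lemma rapid_mult_polybd:
 assumes "polybd P p" "rapid P h"
 shows "rapid P (%i x. p i x * h i x)"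
 unfolding rapid_def
proof (intro conjI allI ballI)
 fix i assume "i \<in> P" thus "bm (%x. p i x * h i x)"
  using polybd_measurable[OF assms(1)] rapidD(1)[OF assms(2)] by auto
next
 fix N
 obtain C M where 1: "!!i x. i \<in> P ==> abs (p i x) <= C * (1 + norm x) ^ M"
  using assms(1) unfolding polybd_def by blast
 obtain D where 2: "!!i x. i \<in> P ==> abs (h i x) <= D / (1 + norm x) ^ (M + N)"
  using rapidD(2)[OF assms(2), of "M + N"] by blast
 have "abs (p i x * h i x) <= C * D / (1 + norm x) ^ N" if "i \<in> P" for i x
 proof -
  have "abs (p i x * h i x) <= (C * (1 + norm x) ^ M) * (D / (1 + norm x) ^ (M + N))"
   using mult_mono'[OF 1[OF that, of x] 2[OF that, of x]] by (simp add: abs_mult)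
  also have "... = C * D / (1 + norm x) ^ N"
  proof -
   have "1 + norm x ~= 0" using norm_ge_zero[of x] by linarith
   thus ?thesis by (simp add: power_add)
  qed
  finally show ?thesis .
 qed
 thus "\<exists>C. \<forall>i\<in>P. \<forall>x. abs (p i x * h i x) <= C / (1 + norm x) ^ N" by blast
qed

lemma rapid_add:
 assumes "rapid P g" "rapid P h"
 shows "rapid P (%i x. g i x + h i x)"
 unfolding rapid_def
proof (intro conjI allI ballI)
 fix i assume "i \<in> P" thus "bm (%x. g i x + h i x)"
  using rapidD(1)[OF assms(1)] rapidD(1)[OF assms(2)] by auto
next
 fix N
 obtain C where 1: "!!i x. i \<in> P ==> abs (g i x) <= C / (1 + norm x) ^ N"
  using rapidD(2)[OF assms(1), of N] by blast
 obtain D where 2: "!!i x. i \<in> P ==> abs (h i x) <= D / (1 + norm x) ^ N"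
  using rapidD(2)[OF assms(2), of N] by blast
 have "abs (g i x + h i x) <= (C + D) / (1 + norm x) ^ N" if "i \<in> P" for i x
  using 1[OF that, of x] 2[OF that, of x] by (simp add: add_divide_distrib)
 thus "\<exists>C. \<forall>i\<in>P. \<forall>x. abs (g i x + h i x) <= C / (1 + norm x) ^ N" by blast
qed

lemma rapid_dominated:
 assumes "rapid P h" "!!i. i \<in> P ==> g i \<in> borel_measurable borel"
  and "!!i x. i \<in> P ==> abs (g i x) <= c * abs (h i x)"
 shows "rapid P g"
 unfolding rapid_def
proof (intro conjI allI ballI)
 fix N
 obtain C where 1: "!!i x. i \<in> P ==> abs (h i x) <= C / (1 + norm x) ^ N"
  using rapidD(2)[OF assms(1), of N] by blast
 have "abs (g i x) <= (abs c * C) / (1 + norm x) ^ N" if "i \<in> P" for i x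
 proof -
  have "abs (g i x) <= abs c * abs (h i x)"
   using assms(3)[OF that, of x] mult_right_mono[OF abs_ge_self[of c] abs_ge_zero[of "h i x"]]
   by linarith
  also have "... <= abs c * (C / (1 + norm x) ^ N)" by (intro mult_left_mono 1 that) auto
  finally show ?thesis by simp
 qed
 thus "\<exists>C. \<forall>i\<in>P. \<forall>x. abs (g i x) <= C / (1 + norm x) ^ N" by blast
qed (use assms in auto)

lemma rapid_integrable:
 fixes h :: "'i => 'a::euclidean_space => real"
 assumes "rapid P h" "i \<in> P"
 shows "LI (h i)"
proof -
 obtain C where "!!i x. i \<in> P ==> abs (h i x) <= C / (1 + norm x) ^ (DIM('a) + 2)"
  using rapidD(2)[OF assms(1)] by blast
 thus ?thesis using rapidD(1)[OF assms] assms(2)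
  by (intro integrable_bound_real[OF integrable_mult_right[OF integrable_decay[of "DIM('a)+2"], of C]])
    auto
qed

lemma rapid_integral_bound:
 fixes h :: "'i => 'a::euclidean_space => real"
 assumes "rapid P h"
 shows "\<exists>C. \<forall>i\<in>P. (LBINT x. abs (h i x)) <= C"
proof -
 obtain C where "!!i x. i \<in> P ==> abs (h i x) <= C / (1 + norm x) ^ (DIM('a) + 2)"
  using rapidD(2)[OF assms(1)] by blast
 hence "(LBINT x. abs (h i x)) <= (LBINT x. C * (1 / (1 + norm (x::'a)) ^ (DIM('a) + 2)))" if "i \<in> P" for i
  using that rapid_integrable[OF assms that]
  by (intro integral_mono integrable_mult_right integrable_decay) auto
 thus ?thesis by blast
qed

subsection \<open>The cosine transform\<close>

text \<open>A real form of the Fourier transform: the phase covers cosine and sine at once, and a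
  derivative in \<open>x\<close> only multiplies the symbol by a coordinate and adds pi/2 to the
  phase.\<close>

definition ft :: "('a::euclidean_space => real) => real => 'a => real" where
 "ft h ph x = (LBINT xi. h xi * cos (x \<bullet> xi + ph))"

lemma integrable_mult_cos:
 assumes "LI (h :: 'a::euclidean_space => real)"
 shows "LI (%xi. h xi * cos (x \<bullet> xi + ph))"
proof (rule integrable_bound_real[OF integrable_abs[OF assms]])
 have [measurable]: "bm h" using assms by auto
 show "(%xi. h xi * cos (x \<bullet> xi + ph)) \<in> borel_measurable lborel" by measurable
qed (auto simp: abs_mult mult_left_le)

lemma abs_ft_le:
 assumes "LI h"
 shows "abs (ft h ph x) <= (LBINT xi. abs (h xi))"
 unfolding ft_def by (rule abs_integral_le(2))
  (use assms in \<open>auto simp: abs_mult mult_left_le intro: integrable_mult_cos[THEN borel_measurable_integrable]\<close>)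

lemma ft_add:
 assumes "LI g" "LI h"
 shows "ft (%xi. g xi + h xi) ph x = ft g ph x + ft h ph x"
 unfolding ft_def using assms[THEN integrable_mult_cos, of x ph]
 by (simp add: distrib_right)

lemma ft_cmult: "ft (%xi. c * h xi) ph x = c * ft h ph x"
 unfolding ft_def by (simp add: mult.assoc)

subsection \<open>Symbols of small jumps\<close>

text \<open>The lower bound is required at every scale \<open>r\<close>, because at frequency xi
  only the jumps of length at most 1/|xi| yield a usable lower bound for the symbol.\<close>

definition small_jumps :: "real => real => real => 'a::euclidean_space measure => bool" where
 "small_jumps s c C ka \<longleftrightarrow> sets ka = sets borel \<and> (AE y in ka. norm y <= 1) \<and>
   (\<integral>\<^sup>+y. ennreal ((norm y)^2) \<partial>ka) <= ennreal C \<and>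
   (\<forall>r e. 0 < r --> r <= 1 --> norm e = 1 -->
    ennreal (c * r powr (2 - 2 * s)) <= (\<integral>\<^sup>+y. ennreal ((y \<bullet> e)^2 * indicator (cball 0 r) y) \<partial>ka))"

definition monom :: "'a list => 'a::euclidean_space => real" where
 "monom es y = prod_list (map (%e. y \<bullet> e) es)"

text \<open>Integrand of the symbol, \<open>2 (1 - cos (y \<bullet> xi))\<close>, differentiated in \<open>xi\<close> along \<open>es\<close>; each derivative shifts
the phase by \<open>pi/2\<close>.\<close>

definition symint :: "'a list => 'a => 'a::euclidean_space => real" where
 "symint es xi y = 2 * monom es y * (of_bool (es = []) - cos (y \<bullet> xi + real (length es) * (pi / 2)))"

definition sym :: "'a::euclidean_space measure => 'a list => 'a => real" where
 "sym ka es xi = (\<integral>y. symint es xi y \<partial>ka)"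

lemma monom_simps [simp]: "monom [] y = 1" "monom (e # es) y = (y \<bullet> e) * monom es y"
 by (auto simp: monom_def)

lemma monom_measurable [measurable]: "bm (monom es)"
 by (induction es) (auto simp: monom_def)

lemma symint_measurable [measurable]: "bm (symint es xi)"
 unfolding symint_def by measurable

lemma abs_inner_Basis_le: "e \<in> Basis ==> abs (y \<bullet> e) <= norm y"
 by (rule Basis_le_norm)

lemma abs_monom_le:
 assumes "set es \<subseteq> Basis"
 shows "abs (monom es y) <= norm y ^ length es"
 using assms
proof (induction es)
 case (Cons e es)
 thus ?case
  using mult_mono[OF abs_inner_Basis_le[of e y] Cons.IH] by (auto simp: abs_mult)
qed simp

lemma abs_monom_le_1:
 assumes "set es \<subseteq> Basis" "norm y <= 1"
 shows "abs (monom es y) <= 1" "es ~= [] ==> abs (monom es y) <= norm y"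
  "length es >= 2 ==> abs (monom es y) <= (norm y)^2"
proof -
 have 1: "norm y ^ length es <= norm y ^ k" if "k <= length es" for k
  using that assms(2) by (intro power_decreasing) auto
 show "abs (monom es y) <= 1" using abs_monom_le[OF assms(1), of y] 1[of 0] by simp
 show "es ~= [] ==> abs (monom es y) <= norm y"
  using abs_monom_le[OF assms(1), of y] 1[of 1] by (cases es) auto
 show "length es >= 2 ==> abs (monom es y) <= (norm y)^2"
  using abs_monom_le[OF assms(1), of y] 1[of 2] by simp
qed

text \<open>Only |y|^2 is known to be integrable near the origin, so two powers of |y| must be
  found. For \<open>es = []\<close> both come from the evenness of the cosine, through |a - b| |a +
  b|; otherwise the monomial gives one and the Lipschitz bound of the cosine the other.\<close>

lemma symint_diff_le:
 assumes "set es \<subseteq> Basis" "norm y <= 1"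
 shows "abs (symint es xi y - symint es et y) <= 2 * norm (xi - et) * (1 + norm xi + norm et) * (norm y)^2"
proof -
 define k where "k = real (length es) * (pi / 2)"
 define m where "m = monom es y"
 have ip: "abs (y \<bullet> xi - y \<bullet> et) <= norm y * norm (xi - et)"
  using Cauchy_Schwarz_ineq2[of y "xi - et"] by (simp add: inner_diff_right)
 have ip2: "abs (y \<bullet> xi + y \<bullet> et) <= norm y * (norm xi + norm et)"
  using Cauchy_Schwarz_ineq2[of y xi] Cauchy_Schwarz_ineq2[of y et] by (simp add: algebra_simps)
 have eq: "abs (symint es xi y - symint es et y) = 2 * abs m * abs (cos (y \<bullet> xi + k) - cos (y \<bullet> et + k))"
  by (simp add: symint_def k_def m_def abs_mult flip: right_diff_distrib abs_minus_commute)
 have main: "abs m * abs (cos (y \<bullet> xi + k) - cos (y \<bullet> et + k)) <= norm (xi - et) * (1 + norm xi + norm et) * (norm y)^2"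
 proof (cases "es = []")
  case True
  hence "abs m * abs (cos (y \<bullet> xi + k) - cos (y \<bullet> et + k)) <= abs (y \<bullet> xi - y \<bullet> et) * abs (y \<bullet> xi + y \<bullet> et)"
   using abs_cos_diff_le(1)[of "y \<bullet> xi" "y \<bullet> et"] by (simp add: m_def k_def)
  also have "... <= (norm y * norm (xi - et)) * (norm y * (norm xi + norm et))"
   by (intro mult_mono ip ip2) auto
  also have "... = (norm (xi - et) * (norm y)^2) * (norm xi + norm et)" by (simp add: power2_eq_square mult_ac)
  also have "... <= (norm (xi - et) * (norm y)^2) * (1 + norm xi + norm et)" by (intro mult_left_mono) auto
  finally show ?thesis by (simp add: mult_ac)
 next
  case False
  have "abs m * abs (cos (y \<bullet> xi + k) - cos (y \<bullet> et + k)) <= norm y * (norm y * norm (xi - et))"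
   using abs_monom_le_1(2)[OF assms False] ip abs_cos_diff_le(2)[of "y \<bullet> xi + k" "y \<bullet> et + k"]
   by (intro mult_mono) (auto simp: m_def)
  also have "... = (norm (xi - et) * (norm y)^2) * 1" by (simp add: power2_eq_square mult_ac)
  also have "... <= (norm (xi - et) * (norm y)^2) * (1 + norm xi + norm et)" by (intro mult_left_mono) auto
  finally show ?thesis by (simp add: mult_ac)
 qed
 thus ?thesis unfolding eq by (simp add: mult_ac)
qed

text \<open>Monomials of degree at least 2 supply |y|^2 themselves. In degree 0 and 1 the integrand
  vanishes at frequency 0, so the difference bound against 0 applies.\<close>

lemma abs_symint_le:
 assumes "set es \<subseteq> Basis" "norm y <= 1"
 shows "abs (symint es xi y) <= 2 * (1 + norm xi)^2 * (norm y)^2"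
proof (cases "length es >= 2")
 case True
 have "abs (monom es y) * abs (cos (y \<bullet> xi + real (length es) * (pi / 2))) <= (norm y)^2 * 1"
  using abs_monom_le_1(3)[OF assms True] by (intro mult_mono) auto
 hence "abs (symint es xi y) <= 2 * ((norm y)^2 * 1)"
  using True by (auto simp: symint_def abs_mult)
 also have "... <= 2 * ((norm y)^2 * (1 + norm xi)^2)"
  by (intro mult_left_mono) (auto intro!: one_le_power)
 finally show ?thesis by (simp add: mult_ac)
next
 case False
 then consider "es = []" | "length es = 1" by (cases es) (auto simp: Suc_le_eq)
 hence "symint es 0 y = 0" by cases (auto simp: symint_def)
 hence "abs (symint es xi y) <= 2 * norm xi * (1 + norm xi) * (norm y)^2"
  using symint_diff_le[OF assms, of xi 0] by simp
 also have "... <= 2 * (1 + norm xi) * (1 + norm xi) * (norm y)^2"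
  by (intro mult_right_mono) auto
 finally show ?thesis by (simp only: power2_eq_square mult.assoc)
qed

lemma symint_remainder:
 assumes "set es \<subseteq> Basis" "norm y <= 1" "e \<in> Basis"
 shows "abs (symint es (xi + z *\<^sub>R e) y - symint es xi y - z * symint (e # es) xi y) <= 2 * z^2 * (norm y)^2"
proof -
 define k where "k = real (length es) * (pi / 2)"
 define m where "m = monom es y"
 define a where "a = y \<bullet> xi + k"
 define b where "b = z * (y \<bullet> e)"
 have "cos (y \<bullet> xi + real (length (e # es)) * (pi / 2)) = - sin a"
  using cos_add[of a "pi/2"] by (simp add: a_def k_def algebra_simps add_divide_distrib)
 hence "symint es (xi + z *\<^sub>R e) y - symint es xi y - z * symint (e # es) xi y
   = 2 * m * (- (cos (a + b) - cos a + b * sin a))"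
  by (simp add: symint_def a_def b_def k_def m_def inner_add_right algebra_simps)
 hence "abs (symint es (xi + z *\<^sub>R e) y - symint es xi y - z * symint (e # es) xi y)
   = 2 * (abs m * abs (cos (a + b) - cos a + b * sin a))" by (simp only: abs_mult abs_minus_cancel)
 also have "... <= 2 * (1 * b^2)"
  using abs_monom_le_1(1)[OF assms(1,2)] cos_quadratic_remainder[of a b]
  by (intro mult_left_mono mult_mono) (auto simp: m_def)
 also have "... <= 2 * (z^2 * (norm y)^2)"
  using abs_inner_Basis_le[OF assms(3), of y]
  by (simp add: b_def power_mult_distrib abs_le_square_iff[symmetric] mult_left_mono)
 finally show ?thesis by simp
qed

lemma small_jumpsD:
 assumes "small_jumps s c C ka" "0 <= C"
 shows "sets ka = sets borel" "AE y in ka. norm y <= 1"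
  "integrable ka (%y. (norm y)^2)" "(\<integral>y. (norm y)^2 \<partial>ka) <= C"
proof -
 show s: "sets ka = sets borel" "AE y in ka. norm y <= 1" using assms by (auto simp: small_jumps_def)
 have le: "(\<integral>\<^sup>+y. ennreal ((norm y)^2) \<partial>ka) <= ennreal C" using assms by (auto simp: small_jumps_def)
 have [measurable]: "(%y. (norm y)^2) \<in> borel_measurable ka" by (simp add: measurable_cong_sets[OF s(1) refl])
 show i: "integrable ka (%y. (norm y)^2)"
  using le by (auto simp: integrable_iff_bounded intro: le_less_trans)
 show "(\<integral>y. (norm y)^2 \<partial>ka) <= C"
  using le nn_integral_eq_integral[OF i] assms(2) by auto
qed

lemma integrable_symint:
 assumes "small_jumps s c C ka" "0 <= C" "set es \<subseteq> Basis"
 shows "integrable ka (symint es xi)" "abs (sym ka es xi) <= 2 * C * (1 + norm xi)^2"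
proof -
 note D = small_jumpsD[OF assms(1,2)]
 have m: "symint es xi \<in> borel_measurable ka" by (simp add: measurable_cong_sets[OF D(1) refl])
 have ae: "AE y in ka. abs (symint es xi y) <= 2 * (1 + norm xi)^2 * (norm y)^2"
  using D(2) by eventually_elim (rule abs_symint_le[OF assms(3)])
 show "integrable ka (symint es xi)"
  by (rule abs_integral_le(1)[OF _ m ae]) (use D in auto)
 have "abs (sym ka es xi) <= (\<integral>y. 2 * (1 + norm xi)^2 * (norm y)^2 \<partial>ka)"
  unfolding sym_def by (rule abs_integral_le(2)[OF _ m ae]) (use D in auto)
 also have "... <= 2 * (1 + norm xi)^2 * C"
  using D(4) by (simp add: mult_left_mono)
 finally show "abs (sym ka es xi) <= 2 * C * (1 + norm xi)^2" by (simp add: mult_ac)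
qed

lemma sym_diff_le:
 assumes "small_jumps s c C ka" "0 <= C" "set es \<subseteq> Basis"
 shows "abs (sym ka es xi - sym ka es et) <= 2 * norm (xi - et) * (1 + norm xi + norm et) * C"
proof -
 note D = small_jumpsD[OF assms(1,2)]
 note I = integrable_symint(1)[OF assms]
 have ae: "AE y in ka. abs (symint es xi y - symint es et y) <= 2 * norm (xi - et) * (1 + norm xi + norm et) * (norm y)^2"
  using D(2) by eventually_elim (rule symint_diff_le[OF assms(3)])
 have "abs (\<integral>y. symint es xi y - symint es et y \<partial>ka) <= (\<integral>y. 2 * norm (xi - et) * (1 + norm xi + norm et) * (norm y)^2 \<partial>ka)"
  by (rule abs_integral_le(2)[OF _ _ ae]) (use D I in auto)
 also have "... <= 2 * norm (xi - et) * (1 + norm xi + norm et) * C"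
  using D(4) by (simp add: mult_left_mono)
 finally show ?thesis using I by (simp add: sym_def)
qed

lemma sym_continuous:
 assumes "small_jumps s c C ka" "0 <= C" "set es \<subseteq> Basis"
 shows "continuous_on UNIV (sym ka es)"
 unfolding continuous_on_def
proof
 fix x :: 'a
 have "((%y. sym ka es y - sym ka es x) \<longlongrightarrow> 0) (at x within UNIV)"
 proof (rule Lim_null_comparison)
  show "\<forall>\<^sub>F y in at x. norm (sym ka es y - sym ka es x) <= 2 * norm (y - x) * (1 + norm y + norm x) * C"
   using sym_diff_le[OF assms] by (intro always_eventually) auto
  show "((%y. 2 * norm (y - x) * (1 + norm y + norm x) * C) \<longlongrightarrow> 0) (at x)"
   by (auto intro!: tendsto_eq_intros)
 qed
 thus "(sym ka es \<longlongrightarrow> sym ka es x) (at x within UNIV)" by (simp add: LIM_zero_iff)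
qed

lemma sym_has_derivative:
 assumes "small_jumps s c C ka" "0 <= C" "set es \<subseteq> Basis" "e \<in> Basis"
 shows "((%z. sym ka es (xi + z *\<^sub>R e)) has_real_derivative sym ka (e # es) xi) (at 0)"
proof (rule has_real_derivative_of_quadratic_remainder[where d=1])
 fix z :: real
 note D = small_jumpsD[OF assms(1,2)]
 note I = integrable_symint(1)[OF assms(1,2)]
 have ae: "AE y in ka. abs (symint es (xi + z *\<^sub>R e) y - symint es xi y - z * symint (e # es) xi y) <= 2 * z^2 * (norm y)^2"
  using D(2) by eventually_elim (rule symint_remainder[OF assms(3) _ assms(4)])
 have II: "integrable ka (symint es (xi + z *\<^sub>R e))" "integrable ka (symint es xi)" "integrable ka (symint (e # es) xi)"
  using I assms(3,4) by auto
 have "abs (\<integral>y. symint es (xi + z *\<^sub>R e) y - symint es xi y - z * symint (e # es) xi y \<partial>ka) <= (\<integral>y. 2 * z^2 * (norm y)^2 \<partial>ka)"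
  by (rule abs_integral_le(2)[OF _ _ ae]) (use D II in auto)
 also have "... <= 2 * C * z^2"
  using mult_left_mono[OF D(4), of "2 * z^2"] by (simp add: mult_ac)
 finally show "abs (sym ka es (xi + (0 + z) *\<^sub>R e) - sym ka es (xi + 0 *\<^sub>R e) - z * sym ka (e # es) xi) <= 2 * C * z^2"
  using II by (simp add: sym_def)
qed simp

lemma symint_nonneg: "0 <= symint [] xi y"
 by (simp add: symint_def)

lemma sym_Nil_nonneg: "0 <= sym ka [] xi"
 unfolding sym_def symint_def by (intro integral_nonneg_AE AE_I2) (simp add: cos_le_one)

text \<open>Ellipticity with the sharp power. Jumps of length at most r = 1/|xi| satisfy |y . xi| <=
  1, where 1 - cos is comparable with the square; the lower bound of \<open>small_jumps\<close> at
  exactly this scale then gives |xi|^2 r^(2 - 2s) = |xi|^(2s).\<close>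

lemma sym_Nil_ge:
 assumes "small_jumps s c C ka" "0 <= C" "0 < c" "1 <= norm xi"
 shows "c / 4 * norm xi powr (2 * s) <= sym ka [] xi"
proof -
 note D = small_jumpsD[OF assms(1,2)]
 define n where "n = norm xi"
 define r where "r = 1 / n"
 define e where "e = (1 / n) *\<^sub>R xi"
 have n: "1 <= n" using assms by (simp add: n_def)
 have r: "0 < r" "r <= 1" "norm e = 1" using n by (auto simp: r_def e_def n_def divide_simps)
 have xi: "y \<bullet> xi = n * (y \<bullet> e)" for y using n by (simp add: e_def)
 have le: "(y \<bullet> e)^2 * indicator (cball 0 r) y <= (4 / n^2) * symint [] xi y" for y
 proof (cases "norm y <= r")
  case True
  have "abs (y \<bullet> xi) <= norm y * n" using Cauchy_Schwarz_ineq2[of y xi] by (simp add: n_def)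
  also have "... <= 1" using True n by (simp add: r_def field_simps)
  finally have "(y \<bullet> xi)^2 / 8 <= 1 - cos (y \<bullet> xi)" by (rule one_minus_cos_ge)
  hence "n^2 * (y \<bullet> e)^2 <= 4 * symint [] xi y"
   by (simp add: symint_def xi power_mult_distrib)
  thus ?thesis using n True by (simp add: field_simps indicator_def)
 next
  case False
  thus ?thesis using n by (simp add: symint_def)
 qed
 have "ennreal (c * r powr (2 - 2 * s)) <= (\<integral>\<^sup>+y. ennreal ((y \<bullet> e)^2 * indicator (cball 0 r) y) \<partial>ka)"
  using assms(1) r unfolding small_jumps_def by blast
 also have "... <= (\<integral>\<^sup>+y. ennreal ((4 / n^2) * symint [] xi y) \<partial>ka)"
  by (intro nn_integral_mono ennreal_leI le)
 also have "... = ennreal (\<integral>y. (4 / n^2) * symint [] xi y \<partial>ka)"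
  by (rule nn_integral_eq_integral)
    (use integrable_symint(1)[OF assms(1,2), of "[]" xi] n in
     \<open>auto simp: symint_nonneg simp del: times_divide_eq_left\<close>)
 finally have "c * r powr (2 - 2 * s) <= (4 / n^2) * sym ka [] xi"
  using sym_Nil_nonneg[of ka xi] by (subst (asm) ennreal_le_iff) (auto simp: sym_def)
 moreover have "r powr (2 - 2 * s) = n powr (2 * s) / n^2"
  using n by (simp add: r_def powr_divide powr_diff)
 ultimately have "c * n powr (2 * s) <= 4 * sym ka [] xi"
  using n by (simp add: field_simps)
 thus ?thesis by (simp add: n_def)
qed

text \<open>From exp u >= (u/m)^m with m large enough that m b >= N.\<close>

lemma power_mult_exp_bounded:
 fixes a b :: real
 assumes "0 < a" "0 < b"
 shows "\<exists>C\<ge>0. \<forall>x\<ge>1. exp (- (a * x powr b)) <= C / x ^ N"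
proof -
 obtain m :: nat where m: "real N / b < real m" "m > 0"
  using reals_Archimedean2[of "max 1 (real N / b)"] by auto
 have "exp (- (a * x powr b)) <= ((real m / a) ^ m) / x ^ N" if "1 <= x" for x
 proof -
  define u where "u = a * x powr b"
  have u: "0 < u" using that assms by (simp add: u_def)
  have "(u / real m) ^ m <= (1 + u / real m) ^ m" using u m by (intro power_mono) auto
  also have "... <= exp u" using u m by (intro exp_ge_one_plus_x_over_n_power_n) auto
  finally have 1: "exp (- u) <= (real m / u) ^ m"
   using u m by (simp add: exp_minus field_simps)
  have "x ^ N = x powr real N" using that by (simp add: powr_realpow)
  also have "... <= x powr (b * real m)"
   using that m assms by (intro powr_mono) (auto simp: field_simps)
  also have "... = (x powr b) ^ m" using that by (simp add: powr_powr[symmetric] powr_realpow)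
  finally have "(real m / a) ^ m / (x powr b) ^ m <= (real m / a) ^ m / x ^ N"
   using that assms by (intro divide_left_mono) auto
  thus ?thesis using 1 by (simp add: u_def power_divide power_mult_distrib)
 qed
 moreover have "0 <= (real m / a) ^ m" using assms by simp
 ultimately show ?thesis by blast
qed

lemma rapid_exp_sym:
 assumes "!!i. i \<in> P ==> small_jumps s c C (ka i)" "0 <= C" "0 < c" "0 < s"
 shows "rapid P (%i xi. exp (- sym (ka i) [] xi))"
 unfolding rapid_def
proof (intro conjI allI ballI)
 fix i assume "i \<in> P"
 hence "continuous_on UNIV (sym (ka i) [])"
  using sym_continuous[OF assms(1) assms(2), of i "[]"] by simp
 thus "bm (%xi. exp (- sym (ka i) [] xi))"
  by (intro borel_measurable_continuous_onI continuous_intros)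
next
 fix N
 obtain D where D: "0 <= D" "!!x. 1 <= x ==> exp (- (c / 4 * x powr (2 * s))) <= D / x ^ N"
  using power_mult_exp_bounded[of "c / 4" "2 * s" N] assms by auto
 have "abs (exp (- sym (ka i) [] xi)) <= (2 ^ N * (D + 1)) / (1 + norm xi) ^ N" if i: "i \<in> P" for i xi
 proof (cases "norm xi <= 1")
  case True
  have "(1 + norm xi) ^ N <= 2 ^ N" using True by (intro power_mono) auto
  hence "exp (- sym (ka i) [] xi) * (1 + norm xi) ^ N <= 1 * 2 ^ N"
   using sym_Nil_nonneg[of "ka i" xi] by (intro mult_mono) auto
  also have "... <= 2 ^ N * (D + 1)" using D by simp
  finally show ?thesis by (simp add: pos_le_divide_eq add_pos_nonneg)
 next
  case False
  have "exp (- sym (ka i) [] xi) <= exp (- (c / 4 * norm xi powr (2 * s)))"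
   using sym_Nil_ge[OF assms(1)[OF i] assms(2,3), of xi] False by simp
  also have "... <= D / norm xi ^ N" using D False by auto
  also have "... <= (2 ^ N * (D + 1)) / (2 * norm xi) ^ N"
   using D False by (simp add: power_mult_distrib divide_right_mono)
  also have "... <= (2 ^ N * (D + 1)) / (1 + norm xi) ^ N"
   using D False by (intro divide_left_mono power_mono mult_pos_pos zero_less_power) (auto intro: add_pos_nonneg)
  finally show ?thesis by simp
 qed
 thus "\<exists>C. \<forall>i\<in>P. \<forall>xi. abs (exp (- sym (ka i) [] xi)) <= C / (1 + norm xi) ^ N" by blast
qed

text \<open>The derivatives along basis vectors exist up to order \<open>k\<close> and are
  polynomially bounded, uniformly over \<open>P\<close>. Any polynomial growth is harmless, since
  these functions are only used as factors of the rapidly decaying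
  \<open>exp (- sym)\<close>.\<close>

primrec tame :: "nat => 'i set => ('i => 'a::euclidean_space => real) => bool" where
 "tame 0 P p \<longleftrightarrow> polybd P p"
| "tame (Suc k) P p \<longleftrightarrow> polybd P p \<and> (\<forall>e\<in>Basis. \<exists>p'. tame k P p' \<and>
   (\<forall>i\<in>P. \<forall>x. ((%z. p i (x + z *\<^sub>R e)) has_real_derivative p' i x) (at 0)))"

lemma tame_polybd: "tame k P p ==> polybd P p"
 by (cases k) auto

lemma tame_Suc_imp:
 fixes p :: "'i => 'a::euclidean_space => real"
 shows "tame (Suc k) P p ==> tame k P p"
proof (induction k arbitrary: p)
 case (Suc k)
 show ?case
  unfolding tame.simps(2)
 proof (intro conjI ballI)
  show "polybd P p" using Suc.prems by simp
  fix e :: 'a assume "e \<in> Basis"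
  then obtain p' where "tame (Suc k) P p'"
   "\<forall>i\<in>P. \<forall>x. ((%z. p i (x + z *\<^sub>R e)) has_real_derivative p' i x) (at 0)"
   using Suc.prems by auto
  thus "\<exists>p'. tame k P p' \<and> (\<forall>i\<in>P. \<forall>x. ((%z. p i (x + z *\<^sub>R e)) has_real_derivative p' i x) (at 0))"
   using Suc.IH by blast
 qed
qed simp

lemma tame_const: "tame k P (%i x. c)"
 by (induction k arbitrary: c) (auto simp: polybd_const intro!: exI[of _ "%i x. 0"])

lemma tame_inner:
 fixes b :: "'a::euclidean_space"
 shows "tame k P (%i x. x \<bullet> b)"
proof (cases k)
 case (Suc k')
 have "((%z. (x + z *\<^sub>R e) \<bullet> b) has_real_derivative e \<bullet> b) (at 0)" for x e :: 'a
  unfolding inner_add_left inner_scaleR_left by (auto intro!: derivative_eq_intros)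
 thus ?thesis unfolding Suc
  using tame_const[of k' P] by (auto simp: polybd_inner intro!: exI[of _ "%i x. _ \<bullet> b"])
qed (simp add: polybd_inner)

lemma tame_add:
 fixes p :: "'i => 'a::euclidean_space => real"
 shows "tame k P p ==> tame k P q ==> tame k P (%i x. p i x + q i x)"
proof (induction k arbitrary: p q)
 case (Suc k)
 show ?case
  unfolding tame.simps(2)
 proof (intro conjI ballI)
  show "polybd P (%i x. p i x + q i x)" using Suc.prems by (auto intro: polybd_add)
  fix e :: 'a assume e: "e \<in> Basis"
  obtain p' where p': "tame k P p'"
   "\<forall>i\<in>P. \<forall>x. ((%z. p i (x + z *\<^sub>R e)) has_real_derivative p' i x) (at 0)"
   using Suc.prems(1) e by auto
  obtain q' where q': "tame k P q'"
   "\<forall>i\<in>P. \<forall>x. ((%z. q i (x + z *\<^sub>R e)) has_real_derivative q' i x) (at 0)"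
   using Suc.prems(2) e by auto
  show "\<exists>r. tame k P r \<and> (\<forall>i\<in>P. \<forall>x. ((%z. p i (x + z *\<^sub>R e) + q i (x + z *\<^sub>R e)) has_real_derivative r i x) (at 0))"
   using Suc.IH[OF p'(1) q'(1)] p'(2) q'(2)
   by (intro exI[of _ "%i x. p' i x + q' i x"]) (auto intro!: derivative_eq_intros)
 qed
qed (auto intro: polybd_add)

lemma tame_mult:
 fixes p :: "'i => 'a::euclidean_space => real"
 shows "tame k P p ==> tame k P q ==> tame k P (%i x. p i x * q i x)"
proof (induction k arbitrary: p q)
 case (Suc k)
 show ?case
  unfolding tame.simps(2)
 proof (intro conjI ballI)
  show "polybd P (%i x. p i x * q i x)" using Suc.prems by (auto intro: polybd_mult)
  fix e :: 'a assume e: "e \<in> Basis"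
  obtain p' where p': "tame k P p'"
   "\<forall>i\<in>P. \<forall>x. ((%z. p i (x + z *\<^sub>R e)) has_real_derivative p' i x) (at 0)"
   using Suc.prems(1) e by auto
  obtain q' where q': "tame k P q'"
   "\<forall>i\<in>P. \<forall>x. ((%z. q i (x + z *\<^sub>R e)) has_real_derivative q' i x) (at 0)"
   using Suc.prems(2) e by auto
  have "tame k P (%i x. p' i x * q i x + p i x * q' i x)"
   using Suc.prems[THEN tame_Suc_imp] p'(1) q'(1) by (intro tame_add Suc.IH)
  moreover have "((%z. p i (x + z *\<^sub>R e) * q i (x + z *\<^sub>R e)) has_real_derivative
    p' i x * q i x + p i x * q' i x) (at 0)" if "i \<in> P" for i x
   using DERIV_mult[OF p'(2)[rule_format, OF that, of x] q'(2)[rule_format, OF that, of x]]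
   by (simp add: mult.commute)
  ultimately show "\<exists>r. tame k P r \<and> (\<forall>i\<in>P. \<forall>x. ((%z. p i (x + z *\<^sub>R e) * q i (x + z *\<^sub>R e)) has_real_derivative r i x) (at 0))"
   by (intro exI[of _ "%i x. p' i x * q i x + p i x * q' i x"]) blast
 qed
qed (auto intro: polybd_mult)

lemma tame_monom: "tame k P (%i x. monom es x)"
 by (induction es) (auto intro: tame_const tame_mult tame_inner)

section \<open>Rapid decay of the kernels of unit-size jumps\<close>

locale small_family =
 fixes P :: "'i set" and ka :: "'i => 'a::euclidean_space measure" and s c C :: real
 assumes small: "!!i. i \<in> P ==> small_jumps s c C (ka i)"
  and C0: "0 <= C" and c0: "0 < c" and s0: "0 < s"
begin

lemma polybd_sym: "set es \<subseteq> Basis ==> polybd P (%i. sym (ka i) es)"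
 unfolding polybd_def
 using sym_continuous[OF small C0] integrable_symint(2)[OF small C0]
 by (intro conjI exI[of _ "2 * C"] exI[of _ 2]) blast+

lemma tame_sym: "set es \<subseteq> Basis ==> tame k P (%i. sym (ka i) es)"
proof (induction k arbitrary: es)
 case (Suc k)
 show ?case
  unfolding tame.simps(2)
 proof (intro conjI ballI)
  fix e :: 'a assume e: "e \<in> Basis"
  show "\<exists>p'. tame k P p' \<and> (\<forall>i\<in>P. \<forall>x. ((%z. sym (ka i) es (x + z *\<^sub>R e)) has_real_derivative p' i x) (at 0))"
   using Suc.IH[of "e # es"] Suc.prems e sym_has_derivative[OF small C0 Suc.prems e]
   by (intro exI[of _ "%i. sym (ka i) (e # es)"]) auto
 qed (use Suc.prems polybd_sym in auto)
qed (use polybd_sym in auto)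

definition E :: "'i => 'a => real" where "E i xi = exp (- sym (ka i) [] xi)"

lemma rapid_E: "rapid P E"
 unfolding E_def[abs_def] by (rule rapid_exp_sym[OF small C0 c0 s0])

lemma rapid_tame: "tame k P p ==> rapid P (%i xi. p i xi * E i xi)"
 by (rule rapid_mult_polybd[OF tame_polybd rapid_E])

lemma E_derivative:
 assumes "i \<in> P" "e \<in> Basis"
 shows "((%z. E i (xi + z *\<^sub>R e)) has_real_derivative - sym (ka i) [e] xi * E i xi) (at 0)"
 unfolding E_def using sym_has_derivative[OF small[OF assms(1)] C0, of "[]" e xi] assms(2)
 by (auto intro!: derivative_eq_intros)

text \<open>A factor \<open>x \<bullet> b\<close> is traded for one derivative of the symbol along
  \<open>b\<close>. The result is again a tame function times \<open>E\<close>, with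
  \<open>q = p' - p * sym [b]\<close>, so the induction runs over all tame \<open>p\<close> and all
  phases at once.\<close>

lemma ft_tame_decay_dir:
 assumes "tame k P p" "b \<in> Basis"
 shows "\<exists>D. \<forall>i\<in>P. \<forall>ph x. abs (x \<bullet> b) ^ k * abs (ft (%xi. p i xi * E i xi) ph x) <= D"
 using assms(1)
proof (induction k arbitrary: p)
 case 0
 have r: "rapid P (%i xi. p i xi * E i xi)" using rapid_tame[OF 0] .
 obtain D where "!!i. i \<in> P ==> (LBINT xi. abs (p i xi * E i xi)) <= D"
  using rapid_integral_bound[OF r] by blast
 hence "abs (ft (%xi. p i xi * E i xi) ph x) <= D" if "i \<in> P" for i ph x
  using abs_ft_le[OF rapid_integrable[OF r that], of ph x] that by (blast intro: order_trans)
 thus ?case by (intro exI[of _ D]) simp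
next
 case (Suc k)
 obtain p' where p': "tame k P p'"
  "!!i x. i \<in> P ==> ((%z. p i (x + z *\<^sub>R b)) has_real_derivative p' i x) (at 0)"
  using Suc.prems assms(2) by auto
 define q where "q i xi = p' i xi + (- 1) * (p i xi * sym (ka i) [b] xi)" for i xi
 have q: "tame k P q" unfolding q_def using p'(1) tame_Suc_imp[OF Suc.prems] assms(2)
  by (intro tame_add tame_mult tame_const tame_sym) auto
 obtain D where D: "!!i ph x. i \<in> P ==> abs (x \<bullet> b) ^ k * abs (ft (%xi. q i xi * E i xi) ph x) <= D"
  using Suc.IH[OF q] by blast
 have key: "(x \<bullet> b) * ft (%xi. p i xi * E i xi) ph x = - ft (%xi. q i xi * E i xi) (ph - pi/2) x"
  if i: "i \<in> P" for i ph x
 proof -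
  \<comment> \<open>The shifted phase makes the cosine a sine, whose derivative along
    \<open>b\<close> is the original cosine times \<open>x \<bullet> b\<close>; that the integral of
    \<open>F'\<close> vanishes is then the desired identity.\<close>
  define F where "F xi = (p i xi * E i xi) * cos (x \<bullet> xi + (ph - pi/2))" for xi
  define F' where "F' xi = (q i xi * E i xi) * cos (x \<bullet> xi + (ph - pi/2))
   + (x \<bullet> b) * ((p i xi * E i xi) * cos (x \<bullet> xi + ph))" for xi
  have sc: "sin (ph + x \<bullet> xi - pi/2) = - cos (ph + x \<bullet> xi)" for xi
   using sin_diff[of "ph + x \<bullet> xi" "pi/2"] by simp
  have ip: "LI (%xi. p i xi * E i xi)" by (rule rapid_integrable[OF rapid_tame[OF Suc.prems] i])
  have iq: "LI (%xi. q i xi * E i xi)" by (rule rapid_integrable[OF rapid_tame[OF q] i])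
  have "(LBINT xi. F' xi) = 0"
  proof (rule integral_directional_derivative_eq_0[where F=F and e=b])
   fix xi
   have "((%z. (p i (xi + z *\<^sub>R b) * E i (xi + z *\<^sub>R b)) * cos (x \<bullet> xi + z * (x \<bullet> b) + (ph - pi/2)))
     has_real_derivative F' xi) (at 0)"
    using p'(2)[OF i, of xi] E_derivative[OF i assms(2), of xi]
    by (auto intro!: derivative_eq_intros simp: F'_def q_def algebra_simps sc)
   thus "((%z. F (xi + z *\<^sub>R b)) has_real_derivative F' xi) (at 0)"
    by (simp add: F_def inner_add_right)
  next
   have cE: "continuous_on UNIV (E i)" unfolding E_def[abs_def]
    using polybd_sym[of "[]"] i by (intro continuous_intros) (auto simp: polybd_def)
   have cp: "continuous_on UNIV (p i)" "continuous_on UNIV (q i)"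
    using tame_polybd[OF q] tame_polybd[OF Suc.prems] i by (auto simp: polybd_def)
   show "continuous_on UNIV F'" unfolding F'_def[abs_def]
    by (intro continuous_intros cE cp)
   show "LI F" "LI F'" unfolding F_def[abs_def] F'_def[abs_def]
    using integrable_mult_cos[OF ip] integrable_mult_cos[OF iq] by auto
  qed
  thus ?thesis
   using integrable_mult_cos[OF ip] integrable_mult_cos[OF iq]
   by (simp add: F'_def ft_def)
 qed
 have "abs (x \<bullet> b) ^ Suc k * abs (ft (%xi. p i xi * E i xi) ph x) <= D" if "i \<in> P" for i ph x
 proof -
  have "abs (x \<bullet> b) ^ Suc k * abs (ft (%xi. p i xi * E i xi) ph x)
    = abs (x \<bullet> b) ^ k * abs ((x \<bullet> b) * ft (%xi. p i xi * E i xi) ph x)"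
   by (simp add: abs_mult)
  thus ?thesis using D[OF that, of x "ph - pi/2"] by (simp only: key[OF that] abs_minus_cancel)
 qed
 thus ?case by blast
qed

lemma ft_tame_decay:
 assumes "!!k. tame k P p"
 shows "\<exists>D. \<forall>i\<in>P. \<forall>ph x. abs (ft (%xi. p i xi * E i xi) ph x) <= D / (1 + norm x) ^ N"
proof -
 let ?n = "real DIM('a)"
 let ?K = "%i ph x. abs (ft (%xi. p i xi * E i xi) ph x)"
 have "\<forall>b\<in>Basis. \<exists>D. \<forall>i\<in>P. \<forall>ph x. abs (x \<bullet> b) ^ N * ?K i ph x <= D"
  using ft_tame_decay_dir[OF assms] by blast
 then obtain D where D: "!!b i ph x. b \<in> Basis ==> i \<in> P ==> abs (x \<bullet> b) ^ N * ?K i ph x <= D b"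
  by metis
 obtain b0 :: 'a where b0: "b0 \<in> Basis" using nonempty_Basis by blast
 obtain D0 where D0: "!!i ph x. i \<in> P ==> abs (x \<bullet> b0) ^ 0 * ?K i ph x <= D0"
  using ft_tame_decay_dir[OF assms b0, of 0] by blast
 have "?K i ph x <= (2 ^ N * (D0 + ?n ^ N * (\<Sum>b\<in>Basis. D b))) / (1 + norm x) ^ N" if i: "i \<in> P" for i ph x
 proof -
  have Dp: "0 <= D b" if "b \<in> Basis" for b
   by (rule order_trans[OF _ D[OF that i, of x ph]]) simp
  \<comment> \<open>Some coordinate carries at least 1/n of the norm, so the bounds along basis
    directions control powers of |x|.\<close>
  obtain b where b: "b \<in> Basis" "norm x <= ?n * abs (x \<bullet> b)"
  proof (rule ccontr)
   assume "\<not> thesis"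
   hence *: "!!b. b \<in> Basis ==> ?n * abs (x \<bullet> b) < norm x" using that by force
   have "?n * norm x <= ?n * (\<Sum>b\<in>Basis. abs (x \<bullet> b))" by (intro mult_left_mono norm_le_l1) auto
   also have "... = (\<Sum>b\<in>Basis. ?n * abs (x \<bullet> b))" by (simp add: sum_distrib_left)
   also have "... < (\<Sum>b\<in>(Basis::'a set). norm x)" using * by (intro sum_strict_mono) auto
   finally show False by simp
  qed
  have "(1 + norm x) ^ N <= 2 ^ N * (1 + norm x ^ N)"
  proof (cases "norm x <= 1")
   case True
   hence "(1 + norm x) ^ N <= 2 ^ N * 1" by (auto intro!: power_mono)
   also have "... <= 2 ^ N * (1 + norm x ^ N)" by (intro mult_left_mono) auto
   finally show ?thesis .
  next
   case False
   hence "(1 + norm x) ^ N <= (2 * norm x) ^ N" by (intro power_mono) auto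
   also have "... <= 2 ^ N * (1 + norm x ^ N)" by (simp add: power_mult_distrib)
   finally show ?thesis .
  qed
  hence "(1 + norm x) ^ N * ?K i ph x <= 2 ^ N * (1 + norm x ^ N) * ?K i ph x"
   by (rule mult_right_mono) simp
  also have "... = 2 ^ N * (?K i ph x + norm x ^ N * ?K i ph x)" by (simp add: algebra_simps)
  also have "... <= 2 ^ N * (D0 + ?n ^ N * (\<Sum>b\<in>Basis. D b))"
  proof (intro mult_left_mono add_mono)
   show "?K i ph x <= D0" using D0[OF i, of x ph] by simp
   have "norm x ^ N * ?K i ph x <= (?n * abs (x \<bullet> b)) ^ N * ?K i ph x"
    using b by (intro mult_right_mono power_mono) auto
   also have "... = ?n ^ N * (abs (x \<bullet> b) ^ N * ?K i ph x)" by (simp add: power_mult_distrib)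
   also have "... <= ?n ^ N * (\<Sum>b\<in>Basis. D b)"
    using D[OF b(1) i, of x ph] member_le_sum[of b Basis D] Dp b by (intro mult_left_mono) auto
   finally show "norm x ^ N * ?K i ph x <= ?n ^ N * (\<Sum>b\<in>Basis. D b)" .
  qed auto
  finally show ?thesis by (simp add: pos_le_divide_eq add_pos_nonneg mult.commute)
 qed
 thus ?thesis by blast
qed

end

subsection \<open>Weighted norms and large jumps\<close>

definition wint :: "('a::euclidean_space => real) => ('a => real) => ennreal" where
 "wint w g = (NN x. ennreal (w x * abs (g x)))"

text \<open>Tailored to 1, |x|^al and |x|^2. Quasi-additivity, whose constant 2 is that of the
  square, distributes a weight over a convolution; the growth bound makes weights integrable against
  rapidly decaying kernels.\<close>

definition weight :: "('a::euclidean_space => real) => bool" where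
 "weight w \<longleftrightarrow> w \<in> borel_measurable borel \<and> (\<forall>x. 0 <= w x) \<and> (\<forall>x y. w (x + y) <= 2 * (w x + w y)) \<and>
   (\<forall>x. w (- x) = w x) \<and> (\<forall>x. w x <= (1 + norm x)^2)"

lemma weight_1: "weight (%x. 1)"
 by (auto simp: weight_def)

lemma weight_sq: "weight (%x. (norm x)^2)"
 unfolding weight_def
proof (intro conjI allI)
 fix x y :: 'a
 have "(norm (x + y))^2 <= (norm x + norm y)^2" by (intro power_mono norm_triangle_ineq) auto
 also have "... <= 2 * ((norm x)^2 + (norm y)^2)"
  using sum_squares_bound[of "norm x" "norm y"] by (simp add: power2_sum)
 finally show "(norm (x + y))^2 <= 2 * ((norm x)^2 + (norm y)^2)" .
qed (auto intro!: power_mono)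

lemma powr_add_le:
 fixes a b al :: real
 assumes "0 <= a" "0 <= b" "0 < al" "al <= 1"
 shows "(a + b) powr al <= a powr al + b powr al"
proof (cases "a = 0 \<or> b = 0")
 case False
 hence p: "0 < a" "0 < b" using assms by auto
 have "a / (a + b) <= (a / (a + b)) powr al" "b / (a + b) <= (b / (a + b)) powr al"
  using p assms powr_mono'[of al 1 "a / (a + b)"] powr_mono'[of al 1 "b / (a + b)"] by auto
 moreover have "a / (a + b) + b / (a + b) = 1" using p by (simp flip: add_divide_distrib)
 ultimately have "1 <= (a / (a + b)) powr al + (b / (a + b)) powr al" by linarith
 also have "... = (a powr al + b powr al) / (a + b) powr al"
  using p by (simp add: powr_divide add_divide_distrib)
 finally show ?thesis using p by (simp add: field_simps)
qed auto

lemma weight_powr: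
 assumes "0 < al" "al <= 1"
 shows "weight (%x. norm x powr al)"
 unfolding weight_def
proof (intro conjI allI)
 fix x y :: 'a
 have "norm (x + y) powr al <= (norm x + norm y) powr al"
  using assms by (intro powr_mono2 norm_triangle_ineq) auto
 also have "... <= norm x powr al + norm y powr al" using assms by (intro powr_add_le) auto
 also have "... <= 2 * (norm x powr al + norm y powr al)" by simp
 finally show "norm (x + y) powr al <= 2 * (norm x powr al + norm y powr al)" .
 have "norm x powr al <= (1 + norm x) powr al" using assms by (intro powr_mono2) auto
 also have "... <= (1 + norm x) powr 2" using assms by (intro powr_mono) auto
 finally show "norm x powr al <= (1 + norm x)^2" by simp
qed auto

lemma ft_measurable [measurable]:
 assumes [measurable]: "bm h"
 shows "bm (ft h ph)"
 unfolding ft_def by measurable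

lemma wint_add_le:
 assumes "weight w" and [measurable]: "bm f" "bm g"
 shows "wint w (%x. f x + g x) <= wint w f + wint w g"
proof -
 have [measurable]: "bm w" and w: "!!x. 0 <= w x" using assms by (auto simp: weight_def)
 have "wint w (%x. f x + g x) <= (NN x. ennreal (w x * abs (f x)) + ennreal (w x * abs (g x)))"
  unfolding wint_def using w
  by (intro nn_integral_mono)
    (auto simp flip: ennreal_plus distrib_left intro!: ennreal_leI mult_left_mono abs_triangle_ineq)
 also have "... = wint w f + wint w g" unfolding wint_def by (rule nn_integral_add) auto
 finally show ?thesis .
qed

lemma wint_cmult:
 assumes "weight w" and [measurable]: "bm f"
 shows "wint w (%x. a * f x) = ennreal (abs a) * wint w f"
proof -
 have [measurable]: "bm w" and w: "!!x. 0 <= w x" using assms by (auto simp: weight_def)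
 have "ennreal (w x * abs (a * f x)) = ennreal (abs a) * ennreal (w x * abs (f x))" for x
  using w[of x] by (subst ennreal_mult[symmetric]) (auto simp: abs_mult mult_ac)
 thus ?thesis unfolding wint_def by (simp add: nn_integral_cmult)
qed

text \<open>Multiplying a symbol by this function convolves its kernel with \<open>b\<close> and its
  reflection. Long jumps are treated in this way, because the derivatives of their symbol have no
  uniform bounds.\<close>

definition bsym :: "'a::euclidean_space measure => 'a => real" where
 "bsym b xi = (\<integral>y. 2 * cos (y \<bullet> xi) \<partial>b)"

locale big_jumps = finite_measure b for b :: "'a::euclidean_space measure" +
 assumes sets_b [measurable_cong]: "sets b = sets borel"
begin

lemma bsym_measurable [measurable]: "bm (bsym b)"
 unfolding bsym_def by measurable

lemma integrable_cos_b: "integrable b (%y. 2 * cos (y \<bullet> xi + ph))"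
 by (rule integrable_bound_real[of b "%_. 2"]) (auto simp: abs_mult)

lemma abs_bsym_le: "abs (bsym b xi) <= 2 * measure b (space b)"
proof -
 have "abs (bsym b xi) <= (\<integral>y. 2 \<partial>b)" unfolding bsym_def
  by (rule abs_integral_le(2)) (auto simp: abs_mult)
 thus ?thesis by simp
qed

lemma integrable_mult_bsym:
 assumes "LI h"
 shows "LI (%xi. h xi * bsym b xi)"
proof (rule integrable_bound_real[OF integrable_mult_right[OF integrable_abs[OF assms], of "2 * measure b (space b)"]])
 have [measurable]: "bm h" using assms by auto
 show "(%xi. h xi * bsym b xi) \<in> borel_measurable lborel" by measurable
 show "abs (h x * bsym b x) <= 2 * measure b (space b) * abs (h x)" for x
  using mult_left_mono[OF abs_bsym_le[of x] abs_ge_zero[of "h x"]] by (simp add: abs_mult mult_ac)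
qed

lemma ft_mult_bsym:
 assumes "LI h"
 shows "ft (%xi. h xi * bsym b xi) ph x = (\<integral>y. ft h ph (x + y) + ft h ph (x - y) \<partial>b)"
proof -
 have [measurable]: "bm h" using assms by auto
 interpret B: pair_sigma_finite lborel b
  by (rule pair_sigma_finite.intro) (auto intro: sigma_finite_lborel sigma_finite_measure_axioms)
 have tr: "cos ((x + y) \<bullet> xi + ph) + cos ((x - y) \<bullet> xi + ph) = 2 * cos (x \<bullet> xi + ph) * cos (y \<bullet> xi)" for y xi
  using cos_add[of "x \<bullet> xi + ph" "y \<bullet> xi"] cos_diff[of "x \<bullet> xi + ph" "y \<bullet> xi"]
  by (simp add: inner_add_left inner_diff_left algebra_simps)
 have int: "integrable (lborel \<Otimes>\<^sub>M b) (%(xi, y). h xi * (2 * cos (x \<bullet> xi + ph) * cos (y \<bullet> xi)))"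
 proof (rule B.Fubini_integrable)
  have le: "abs (h xi * (2 * cos (x \<bullet> xi + ph) * cos (y \<bullet> xi))) <= 2 * abs (h xi)" for xi y
  proof -
   have "abs (cos (x \<bullet> xi + ph)) * abs (cos (y \<bullet> xi)) <= 1 * 1" by (intro mult_mono) auto
   hence "abs (h xi) * (2 * (abs (cos (x \<bullet> xi + ph)) * abs (cos (y \<bullet> xi)))) <= abs (h xi) * 2"
    by (intro mult_left_mono) auto
   thus ?thesis by (simp add: abs_mult mult_ac)
  qed
  have i: "integrable b (%y. h xi * (2 * cos (x \<bullet> xi + ph) * cos (y \<bullet> xi)))" for xi
   by (rule integrable_bound_real[of b "%_. 2 * abs (h xi)"]) (use le in auto)
  thus "AE xi in lborel. integrable b (%y. case (xi, y) of (xi, y) => h xi * (2 * cos (x \<bullet> xi + ph) * cos (y \<bullet> xi)))"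
   by simp
  show "LI (%xi. \<integral>y. norm (case (xi, y) of (xi, y) => h xi * (2 * cos (x \<bullet> xi + ph) * cos (y \<bullet> xi))) \<partial>b)"
  proof (rule integrable_bound_real[OF integrable_mult_right[OF integrable_abs[OF assms], of "2 * measure b (space b)"]])
   fix xi
   have "abs (\<integral>y. norm (h xi * (2 * cos (x \<bullet> xi + ph) * cos (y \<bullet> xi))) \<partial>b) <= (\<integral>y. 2 * abs (h xi) \<partial>b)"
    by (rule abs_integral_le(2)) (use le in auto)
   thus "abs (\<integral>y. norm (case (xi, y) of (xi, y) => h xi * (2 * cos (x \<bullet> xi + ph) * cos (y \<bullet> xi))) \<partial>b)
    <= 2 * measure b (space b) * abs (h xi)" by (simp add: mult_ac)
  qed measurable
 qed measurable
 have ic: "LI (%xi. h xi * cos (z \<bullet> xi + ph))" for z by (rule integrable_mult_cos[OF assms])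
 have "ft (%xi. h xi * bsym b xi) ph x = (LBINT xi. (\<integral>y. h xi * (2 * cos (x \<bullet> xi + ph) * cos (y \<bullet> xi)) \<partial>b))"
  by (simp add: ft_def bsym_def mult_ac)
 also have "... = (\<integral>y. (LBINT xi. h xi * (2 * cos (x \<bullet> xi + ph) * cos (y \<bullet> xi))) \<partial>b)"
  by (rule B.Fubini_integral[OF int, symmetric])
 also have "... = (\<integral>y. ft h ph (x + y) + ft h ph (x - y) \<partial>b)"
  unfolding ft_def using ic by (simp add: tr[symmetric] distrib_left)
 finally show ?thesis .
qed

text \<open>A weighted Young inequality: quasi-additivity splits the weight at the shifted point
  between the kernel and the shift, and the shift part leaves the unweighted norm of the
  kernel.\<close>

lemma wint_mult_bsym:
 assumes "LI h" "weight w"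
 shows "wint w (ft (%xi. h xi * bsym b xi) ph)
  <= 4 * emeasure b (space b) * wint w (ft h ph) + 4 * (\<integral>\<^sup>+y. ennreal (w y) \<partial>b) * wint (%x. 1) (ft h ph)"
proof -
 have [measurable]: "bm h" using assms by auto
 have [measurable]: "bm w" and w: "!!x. 0 <= w x"
  and wa: "!!x y. w (x + y) <= 2 * (w x + w y)" "!!x. w (- x) = w x"
  using assms by (auto simp: weight_def)
 interpret B: pair_sigma_finite lborel b
  by (rule pair_sigma_finite.intro) (auto intro: sigma_finite_lborel sigma_finite_measure_axioms)
 let ?g = "%x. abs (ft h ph x)"
 have bd: "abs (ft h ph x) <= (LBINT xi. abs (h xi))" for x by (rule abs_ft_le[OF assms(1)])
 have "wint w (ft (%xi. h xi * bsym b xi) ph) <= (NN x. (\<integral>\<^sup>+y. ennreal (w x * (?g (x + y) + ?g (x - y))) \<partial>b))"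
  unfolding wint_def
 proof (rule nn_integral_mono)
  fix x :: 'a
  have i: "integrable b (%y. ft h ph (x + y) + ft h ph (x - y))"
   by (rule integrable_bound_real[of b "%_. 2 * (LBINT xi. abs (h xi))"])
     (use add_mono[OF bd bd] in \<open>auto intro!: order_trans[OF abs_triangle_ineq]\<close>)
  have "ennreal (abs (ft (%xi. h xi * bsym b xi) ph x)) <= (\<integral>\<^sup>+y. ennreal (norm (ft h ph (x + y) + ft h ph (x - y))) \<partial>b)"
   unfolding ft_mult_bsym[OF assms(1)] using integral_norm_bound_ennreal[OF i] by simp
  also have "... <= (\<integral>\<^sup>+y. ennreal (?g (x + y) + ?g (x - y)) \<partial>b)"
   by (intro nn_integral_mono ennreal_leI) simp
  finally have "ennreal (w x) * ennreal (abs (ft (%xi. h xi * bsym b xi) ph x))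
    <= ennreal (w x) * (\<integral>\<^sup>+y. ennreal (?g (x + y) + ?g (x - y)) \<partial>b)" by (rule mult_left_mono) simp
  also have "... = (\<integral>\<^sup>+y. ennreal (w x * (?g (x + y) + ?g (x - y))) \<partial>b)"
   by (subst nn_integral_cmult[symmetric]) (use w in \<open>auto simp: ennreal_mult\<close>)
  finally show "ennreal (w x * abs (ft (%xi. h xi * bsym b xi) ph x)) <= ..."
   using w by (simp add: ennreal_mult)
 qed
 also have "... = (\<integral>\<^sup>+y. (NN x. ennreal (w x * (?g (x + y) + ?g (x - y)))) \<partial>b)"
  by (rule B.Fubini'[symmetric]) measurable
 also have "... <= (\<integral>\<^sup>+y. 4 * wint w (ft h ph) + ennreal (4 * w y) * wint (%x. 1) (ft h ph) \<partial>b)"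
 proof (rule nn_integral_mono)
  fix y :: 'a
  have "(NN x. ennreal (w x * (?g (x + y) + ?g (x - y))))
   = (NN x. ennreal (w x * ?g (x + y))) + (NN x. ennreal (w x * ?g (x - y)))"
   using w by (subst nn_integral_add[symmetric]) (auto simp: distrib_left)
  also have "(NN x. ennreal (w x * ?g (x + y))) = (NN x. ennreal (w (x - y) * ?g x))"
   using nn_integral_translate(2)[of "%x. ennreal (w x * ?g (x + y))" y] by simp
  also have "(NN x. ennreal (w x * ?g (x - y))) = (NN x. ennreal (w (x + y) * ?g x))"
   using nn_integral_translate(1)[of "%x. ennreal (w x * ?g (x - y))" y] by simp
  also have "(NN x. ennreal (w (x - y) * ?g x)) + ...
    = (NN x. ennreal (w (x - y) * ?g x + w (x + y) * ?g x))"
   using w by (subst nn_integral_add[symmetric]) auto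
  also have "... <= (NN x. 4 * ennreal (w x * ?g x) + ennreal (4 * w y) * ennreal (1 * ?g x))"
  proof (rule nn_integral_mono)
   fix x
   have "w (x - y) + w (x + y) <= 4 * w x + 4 * w y"
    using wa(1)[of x "-y"] wa(1)[of x y] wa(2)[of y] by simp
   hence "(w (x - y) + w (x + y)) * ?g x <= (4 * w x + 4 * w y) * ?g x" by (rule mult_right_mono) simp
   hence "ennreal (w (x - y) * ?g x + w (x + y) * ?g x) <= ennreal (4 * (w x * ?g x) + 4 * w y * ?g x)"
    by (intro ennreal_leI) (simp add: algebra_simps)
   also have "... = ennreal (4 * (w x * ?g x)) + ennreal (4 * w y * ?g x)"
    using w by (intro ennreal_plus) auto
   also have "... = 4 * ennreal (w x * ?g x) + ennreal (4 * w y) * ennreal (1 * ?g x)"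
    using w by (simp add: ennreal_mult)
   finally show "ennreal (w (x - y) * ?g x + w (x + y) * ?g x) <= ..." .
  qed
  also have "... = 4 * wint w (ft h ph) + ennreal (4 * w y) * wint (%x. 1) (ft h ph)"
   unfolding wint_def by (subst nn_integral_add) (auto simp: nn_integral_cmult)
  finally show "(NN x. ennreal (w x * (?g (x + y) + ?g (x - y)))) <= ..." .
 qed
 also have "... = 4 * wint w (ft h ph) * emeasure b (space b) + (\<integral>\<^sup>+y. ennreal (4 * w y) \<partial>b) * wint (%x. 1) (ft h ph)"
  by (subst nn_integral_add) (auto simp: nn_integral_multc)
 also have "(\<integral>\<^sup>+y. ennreal (4 * w y) \<partial>b) = 4 * (\<integral>\<^sup>+y. ennreal (w y) \<partial>b)"
  using w by (simp add: ennreal_mult nn_integral_cmult)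
 finally show ?thesis by (simp add: mult_ac)
qed

lemma integrable_mult_bsym_power:
 assumes "LI h"
 shows "LI (%xi. h xi * bsym b xi ^ k)"
proof (induction k)
 case (Suc k)
 thus ?case using integrable_mult_bsym[OF Suc] by (simp add: mult_ac)
qed (simp add: assms)

lemma ft_mult_exp_bsym:
 assumes "LI h"
 shows "(%k. ft (%xi. h xi * bsym b xi ^ k) ph x / fact k) sums ft (%xi. h xi * exp (bsym b xi)) ph x"
proof -
 define B where "B = 2 * measure b (space b)"
 define f where "f k xi = (h xi * bsym b xi ^ k) * cos (x \<bullet> xi + ph) / fact k" for k xi
 have int: "LI (f k)" for k
  unfolding f_def using integrable_mult_cos[OF integrable_mult_bsym_power[OF assms]] by simp
 have bd: "norm (f k xi) <= abs (h xi) * (B ^ k / fact k)" for k xi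
 proof -
  have "abs (bsym b xi) ^ k * abs (cos (x \<bullet> xi + ph)) <= B ^ k * 1"
   using abs_bsym_le[of xi] by (intro mult_mono power_mono) (auto simp: B_def)
  hence "abs (h xi) * (abs (bsym b xi) ^ k * abs (cos (x \<bullet> xi + ph))) / fact k <= abs (h xi) * (B ^ k * 1) / fact k"
   by (intro divide_right_mono mult_left_mono) auto
  thus ?thesis by (simp add: f_def abs_mult power_abs mult_ac)
 qed
 have se: "summable (%k. B ^ k / fact k)" using summable_exp[of B] by (simp add: divide_inverse mult.commute)
 have sum: "(%k. f k xi) sums (h xi * exp (bsym b xi) * cos (x \<bullet> xi + ph))" for xi
  using sums_mult[OF exp_converges[of "bsym b xi"], of "h xi * cos (x \<bullet> xi + ph)"]
  by (simp add: f_def divide_inverse mult_ac scaleR_conv_of_real)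
 have "(%k. \<integral>xi. f k xi \<partial>lborel) sums (LBINT xi. (\<Sum>k. f k xi))"
 proof (rule sums_integral[OF int])
  show "AE xi in lborel. summable (%k. norm (f k xi))"
   using bd se by (intro AE_I2 summable_comparison_test'[OF summable_mult[OF se]]) auto
  show "summable (%k. \<integral>xi. norm (f k xi) \<partial>lborel)"
  proof (rule summable_comparison_test'[OF summable_mult[OF se, of "LBINT xi. abs (h xi)"]])
   fix k
   have "(LBINT xi. norm (f k xi)) <= (LBINT xi. abs (h xi) * (B ^ k / fact k))"
    using int assms bd by (intro integral_mono) auto
   thus "norm (LBINT xi. norm (f k xi)) <= (LBINT xi. abs (h xi)) * (B ^ k / fact k)"
    by simp
  qed
 qed
 moreover have "(\<Sum>k. f k xi) = h xi * exp (bsym b xi) * cos (x \<bullet> xi + ph)" for xi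
  using sum by (rule sums_unique[symmetric])
 ultimately show ?thesis by (simp add: ft_def f_def)
qed

text \<open>The weighted norm alone does not reproduce itself under multiplication by
  \<open>bsym b\<close>, but its sum with \<open>S\<close> times the unweighted norm does. The
  growth factor is free of \<open>S\<close>; this matters because \<open>S\<close> is unbounded for
  the quadratic weight, and it makes the exponential series cost only a constant.\<close>

lemma wint_mult_bsym_power:
 assumes "LI h" "weight w" "(\<integral>\<^sup>+y. ennreal (w y) \<partial>b) <= ennreal S"
  and "emeasure b (space b) <= ennreal C" "0 <= S" "0 <= C"
 shows "wint w (ft (%xi. h xi * bsym b xi ^ k) ph) + ennreal S * wint (%x. 1) (ft (%xi. h xi * bsym b xi ^ k) ph)
  <= ennreal ((8 * C + 4) ^ k) * (wint w (ft h ph) + ennreal S * wint (%x. 1) (ft h ph))"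
proof (induction k)
 case (Suc k)
 define g where "g = (%xi. h xi * bsym b xi ^ k)"
 define W where "W = wint w (ft g ph)"
 define N where "N = wint (%x. 1) (ft g ph)"
 have ig: "LI g" unfolding g_def by (rule integrable_mult_bsym_power[OF assms(1)])
 have gS: "(%xi. h xi * bsym b xi ^ Suc k) = (%xi. g xi * bsym b xi)" by (simp add: g_def mult_ac)
 have 1: "wint w (ft (%xi. g xi * bsym b xi) ph) <= 4 * ennreal C * W + 4 * ennreal S * N"
  using wint_mult_bsym[OF ig assms(2), of ph] assms(3,4) unfolding W_def N_def
  by (elim order_trans) (intro add_mono mult_mono, auto)
 have "(\<integral>\<^sup>+y. ennreal 1 \<partial>b) <= ennreal C" using assms(4) by simp
 hence 2: "wint (%x. 1) (ft (%xi. g xi * bsym b xi) ph) <= 4 * ennreal C * N + 4 * ennreal C * N"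
  using wint_mult_bsym[OF ig weight_1, of ph] assms(4) unfolding N_def
  by (elim order_trans) (intro add_mono mult_mono, auto)
 have "wint w (ft (%xi. g xi * bsym b xi) ph) + ennreal S * wint (%x. 1) (ft (%xi. g xi * bsym b xi) ph)
  <= (4 * ennreal C * W + 4 * ennreal S * N) + ennreal S * (4 * ennreal C * N + 4 * ennreal C * N)"
  by (intro add_mono mult_left_mono 1 2) auto
 also have "... <= (8 * ennreal C + 4) * (W + ennreal S * N)"
 proof -
  have e8: "8 * x = 4 * x + 4 * x" for x :: ennreal by (simp flip: distrib_right)
  have "(8 * ennreal C + 4) * (W + ennreal S * N) = ((4 * ennreal C * W + 4 * ennreal S * N) + ennreal S * (4 * ennreal C * N + 4 * ennreal C * N)) + (4 * ennreal C * W + 4 * W)"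
   by (simp only: distrib_left distrib_right mult.assoc e8) (simp only: ac_simps)
  thus ?thesis by simp
 qed
 also have "8 * ennreal C + 4 = ennreal (8 * C + 4)" using assms by (simp add: ennreal_mult)
 also have "ennreal (8 * C + 4) * (W + ennreal S * N)
  <= ennreal (8 * C + 4) * (ennreal ((8 * C + 4) ^ k) * (wint w (ft h ph) + ennreal S * wint (%x. 1) (ft h ph)))"
  using Suc unfolding W_def N_def g_def by (intro mult_left_mono) auto
 also have "... = ennreal ((8 * C + 4) ^ Suc k) * (wint w (ft h ph) + ennreal S * wint (%x. 1) (ft h ph))"
  using assms by (simp add: ennreal_mult mult.assoc)
 finally show ?case unfolding gS .
qed simp

lemma wint_mult_exp_bsym:
 assumes "LI h" "weight w" "(\<integral>\<^sup>+y. ennreal (w y) \<partial>b) <= ennreal S"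
  and "emeasure b (space b) <= ennreal C" "0 <= S" "0 <= C"
 shows "wint w (ft (%xi. h xi * exp (bsym b xi)) ph)
  <= ennreal (exp (8 * C + 4)) * (wint w (ft h ph) + ennreal S * wint (%x. 1) (ft h ph))"
proof -
 have [measurable]: "bm h" using assms by auto
 have [measurable]: "bm w" and w: "!!x. 0 <= w x"
  using assms by (auto simp: weight_def)
 define g where "g k = (%xi. h xi * bsym b xi ^ k)" for k
 have [measurable]: "bm (g k)" for k unfolding g_def by measurable
 define X where "X = wint w (ft h ph) + ennreal S * wint (%x. 1) (ft h ph)"
 have le: "ennreal (w x * abs (ft (%xi. h xi * exp (bsym b xi)) ph x))
   <= (\<Sum>k. ennreal (1 / fact k) * ennreal (w x * abs (ft (g k) ph x)))" for x
 proof -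
  let ?a = "%k. ft (g k) ph x / fact k"
  have s: "?a sums ft (%xi. h xi * exp (bsym b xi)) ph x"
   unfolding g_def by (rule ft_mult_exp_bsym[OF assms(1)])
  have "ennreal (abs (ft (%xi. h xi * exp (bsym b xi)) ph x)) <= (\<Sum>k. ennreal (abs (?a k)))"
  proof (rule LIMSEQ_le_const2)
   show "(%n. ennreal (abs (sum ?a {..<n}))) \<longlonglongrightarrow> ennreal (abs (ft (%xi. h xi * exp (bsym b xi)) ph x))"
    using s unfolding sums_def by (intro tendsto_ennrealI tendsto_rabs)
   have "ennreal (abs (sum ?a {..<n})) <= (\<Sum>k. ennreal (abs (?a k)))" for n
   proof -
    have "ennreal (abs (sum ?a {..<n})) <= ennreal (\<Sum>k<n. abs (?a k))" by (intro ennreal_leI sum_abs)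
    also have "... = (\<Sum>k<n. ennreal (abs (?a k)))" by simp
    also have "... <= (\<Sum>k. ennreal (abs (?a k)))" by (intro sum_le_suminf) auto
    finally show ?thesis .
   qed
   thus "\<exists>N. \<forall>n\<ge>N. ennreal (abs (sum ?a {..<n})) <= (\<Sum>k. ennreal (abs (?a k)))" by blast
  qed
  hence "ennreal (w x) * ennreal (abs (ft (%xi. h xi * exp (bsym b xi)) ph x)) <= ennreal (w x) * (\<Sum>k. ennreal (abs (?a k)))"
   by (rule mult_left_mono) simp
  also have "... = (\<Sum>k. ennreal (w x) * ennreal (abs (?a k)))" by (rule ennreal_suminf_cmult[symmetric])
  also have "... = (\<Sum>k. ennreal (1 / fact k) * ennreal (w x * abs (ft (g k) ph x)))"
   using w by (intro suminf_cong) (simp flip: ennreal_mult add: mult_ac)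
  finally show ?thesis using w by (simp add: ennreal_mult)
 qed
 have "wint w (ft (%xi. h xi * exp (bsym b xi)) ph)
   <= (NN x. (\<Sum>k. ennreal (1 / fact k) * ennreal (w x * abs (ft (g k) ph x))))"
  unfolding wint_def by (intro nn_integral_mono le)
 also have "... = (\<Sum>k. \<integral>\<^sup>+x. ennreal (1 / fact k) * ennreal (w x * abs (ft (g k) ph x)) \<partial>lborel)"
  by (rule nn_integral_suminf) measurable
 also have "... = (\<Sum>k. ennreal (1 / fact k) * wint w (ft (g k) ph))"
  unfolding wint_def by (intro suminf_cong nn_integral_cmult) measurable
 also have "... <= (\<Sum>k. ennreal ((8 * C + 4) ^ k / fact k) * X)"
 proof (intro suminf_le)
  fix k
  have "wint w (ft (g k) ph) <= wint w (ft (g k) ph) + ennreal S * wint (%x. 1) (ft (g k) ph)" by simp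
  also have "... <= ennreal ((8 * C + 4) ^ k) * X"
   unfolding g_def X_def by (rule wint_mult_bsym_power[OF assms])
  finally have "ennreal (1 / fact k) * wint w (ft (g k) ph) <= ennreal (1 / fact k) * (ennreal ((8 * C + 4) ^ k) * X)"
   by (rule mult_left_mono) simp
  also have "... = ennreal ((8 * C + 4) ^ k / fact k) * X"
   using assms by (simp add: mult.assoc[symmetric] flip: ennreal_mult)
  finally show "ennreal (1 / fact k) * wint w (ft (g k) ph) <= ..." .
 qed auto
 also have "... = (\<Sum>k. ennreal ((8 * C + 4) ^ k / fact k)) * X" by (rule ennreal_suminf_multc)
 also have "(\<Sum>k. ennreal ((8 * C + 4) ^ k / fact k)) = ennreal (exp (8 * C + 4))"
 proof -
  have "(%k. (8 * C + 4) ^ k / fact k) sums exp (8 * C + 4)"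
   using exp_converges[of "8 * C + 4"] by (simp add: divide_inverse mult.commute scaleR_conv_of_real)
  thus ?thesis using assms by (intro suminf_ennreal_eq) auto
 qed
 finally show ?thesis unfolding X_def .
qed

end

section \<open>Kernels with short and long jumps combined\<close>

locale unit_family = small_family P ka s c C
 for P :: "'i set" and ka :: "'i => 'a::euclidean_space measure" and s c C :: real +
 fixes be :: "'i => 'a measure" and w :: "'a => real" and S :: "'i => real"
 assumes sets_be: "!!i. i \<in> P ==> sets (be i) = sets borel"
  and mass_be: "!!i. i \<in> P ==> emeasure (be i) (space (be i)) <= ennreal C"
  and weight_w: "weight w"
  and w_be: "!!i. i \<in> P ==> (\<integral>\<^sup>+y. ennreal (w y) \<partial>be i) <= ennreal (S i)"
  and S0: "!!i. i \<in> P ==> 0 <= S i"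
begin

lemma big: "i \<in> P ==> big_jumps (be i)"
 using mass_be[of i] sets_be[of i]
 by (intro big_jumps.intro finite_measureI big_jumps_axioms.intro) (auto simp: top_unique)

lemma measure_be_le: "i \<in> P ==> measure (be i) (space (be i)) <= C"
 using mass_be[of i] C0 by (auto simp: measure_def intro: enn2real_leI)

text \<open>The weighted norm may grow linearly in \<open>S i\<close>, the weighted mass of the long
  jumps. The unweighted norm may not, since each convolution with the long jumps multiplies it by
  \<open>S i\<close>.\<close>

definition good :: "('i => 'a => real) => bool" where
 "good h \<longleftrightarrow> rapid P h \<and> (\<exists>D\<ge>0. \<forall>i\<in>P. \<forall>ph. wint w (ft (h i) ph) <= ennreal (D * (1 + S i)) \<and>
   wint (%x. 1) (ft (h i) ph) <= ennreal D)"

lemma goodI: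
 assumes "rapid P h" "0 <= D"
  and "!!i ph. i \<in> P ==> wint w (ft (h i) ph) <= ennreal (D * (1 + S i))"
  and "!!i ph. i \<in> P ==> wint (%x. 1) (ft (h i) ph) <= ennreal D"
 shows "good h"
 using assms unfolding good_def by blast

lemma goodE:
 assumes "good h"
 obtains D where "0 <= D" "!!i ph. i \<in> P ==> wint w (ft (h i) ph) <= ennreal (D * (1 + S i))"
  "!!i ph. i \<in> P ==> wint (%x. 1) (ft (h i) ph) <= ennreal D"
 using assms unfolding good_def by blast

lemma good_rapid: "good h ==> rapid P h"
 by (simp add: good_def)

lemma good_cong: "good g ==> (!!i xi. i \<in> P ==> g i xi = h i xi) ==> good h"
proof -
 assume g: "good g" and eq: "!!i xi. i \<in> P ==> g i xi = h i xi"
 have e: "h i = g i" if "i \<in> P" for i using eq[OF that] by auto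
 have r: "rapid P h" using good_rapid[OF g] e unfolding rapid_def by simp
 obtain D where D: "0 <= D" "!!i ph. i \<in> P ==> wint w (ft (g i) ph) <= ennreal (D * (1 + S i))"
  "!!i ph. i \<in> P ==> wint (%x. 1) (ft (g i) ph) <= ennreal D" using goodE[OF g] by metis
 show "good h" by (rule goodI[OF r D(1)]) (use D e in auto)
qed

lemma good_add:
 assumes "good g" "good h"
 shows "good (%i xi. g i xi + h i xi)"
proof -
 obtain D where D: "0 <= D" "!!i ph. i \<in> P ==> wint w (ft (g i) ph) <= ennreal (D * (1 + S i))"
  "!!i ph. i \<in> P ==> wint (%x. 1) (ft (g i) ph) <= ennreal D" using goodE[OF assms(1)] by metis
 obtain B where B: "0 <= B" "!!i ph. i \<in> P ==> wint w (ft (h i) ph) <= ennreal (B * (1 + S i))"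
  "!!i ph. i \<in> P ==> wint (%x. 1) (ft (h i) ph) <= ennreal B" using goodE[OF assms(2)] by metis
 have r: "rapid P g" "rapid P h" using assms by (auto intro: good_rapid)
 note [measurable] = rapidD(1)[OF r(1)] rapidD(1)[OF r(2)]
 have ft: "ft (%xi. g i xi + h i xi) ph = (%x. ft (g i) ph x + ft (h i) ph x)" if "i \<in> P" for i ph
  using ft_add[OF rapid_integrable[OF r(1) that] rapid_integrable[OF r(2) that]] by auto
 show ?thesis
 proof (rule goodI[where D = "D + B"])
  fix i ph assume i: "i \<in> P"
  show "wint w (ft (%xi. g i xi + h i xi) ph) <= ennreal ((D + B) * (1 + S i))"
   unfolding ft[OF i] distrib_right using S0[OF i] D(1) B(1) i
   by (subst ennreal_plus) (auto intro!: order_trans[OF wint_add_le[OF weight_w]] add_mono D B)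
  show "wint (%x. 1) (ft (%xi. g i xi + h i xi) ph) <= ennreal (D + B)"
   unfolding ft[OF i] using D(1) B(1) i
   by (subst ennreal_plus) (auto intro!: order_trans[OF wint_add_le[OF weight_1]] add_mono D B)
 qed (use D B r rapid_add in auto)
qed

lemma good_scale:
 assumes "good h" "!!i. i \<in> P ==> abs (a i) <= A"
 shows "good (%i xi. a i * h i xi)"
proof -
 obtain D where D: "0 <= D" "!!i ph. i \<in> P ==> wint w (ft (h i) ph) <= ennreal (D * (1 + S i))"
  "!!i ph. i \<in> P ==> wint (%x. 1) (ft (h i) ph) <= ennreal D" using goodE[OF assms(1)] by metis
 note r = good_rapid[OF assms(1)]
 note [measurable] = rapidD(1)[OF r]
 have ft: "ft (%xi. a i * h i xi) ph = (%x. a i * ft (h i) ph x)" for i ph by (rule ext) (rule ft_cmult)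
 show ?thesis
 proof (rule goodI[where D = "abs A * D"])
  show "rapid P (%i xi. a i * h i xi)"
   by (rule rapid_dominated[OF r, of _ "A"]) (auto simp: abs_mult intro!: mult_right_mono assms(2))
  fix i ph assume i: "i \<in> P"
  have a: "ennreal (abs (a i)) <= ennreal (abs A)" using assms(2)[OF i] by (intro ennreal_leI) auto
  have "ennreal (abs (a i)) * wint w (ft (h i) ph) <= ennreal (abs A) * ennreal (D * (1 + S i))"
   by (intro mult_mono a D i) auto
  thus "wint w (ft (%xi. a i * h i xi) ph) <= ennreal (abs A * D * (1 + S i))"
   unfolding ft using i S0[OF i] D(1) by (subst wint_cmult[OF weight_w]) (auto simp: ennreal_mult mult.assoc)
  have "ennreal (abs (a i)) * wint (%x. 1) (ft (h i) ph) <= ennreal (abs A) * ennreal D"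
   by (intro mult_mono a D i) auto
  thus "wint (%x. 1) (ft (%xi. a i * h i xi) ph) <= ennreal (abs A * D)"
   unfolding ft using i D(1) by (subst wint_cmult[OF weight_1]) (auto simp: ennreal_mult)
 qed (use D in auto)
qed

lemma one_be: "i \<in> P ==> (\<integral>\<^sup>+y. ennreal 1 \<partial>be i) <= ennreal C"
 using mass_be[of i] by simp

lemma good_bsym:
 assumes "good h"
 shows "good (%i xi. h i xi * bsym (be i) xi)"
proof -
 obtain D where D: "0 <= D" "!!i ph. i \<in> P ==> wint w (ft (h i) ph) <= ennreal (D * (1 + S i))"
  "!!i ph. i \<in> P ==> wint (%x. 1) (ft (h i) ph) <= ennreal D" using goodE[OF assms(1)] by metis
 note r = good_rapid[OF assms(1)]
 show ?thesis
 proof (rule goodI[where D = "(8 * C + 4) * D"])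
  show "rapid P (%i xi. h i xi * bsym (be i) xi)"
  proof (rule rapid_dominated[OF r, of _ "2 * C"])
   fix i assume i: "i \<in> P"
   interpret B: big_jumps "be i" by (rule big[OF i])
   note [measurable] = rapidD(1)[OF r i]
   show "bm (%xi. h i xi * bsym (be i) xi)" by measurable
   fix x
   have "abs (bsym (be i) x) <= 2 * C" using B.abs_bsym_le[of x] measure_be_le[OF i] by simp
   thus "abs (h i x * bsym (be i) x) <= 2 * C * abs (h i x)"
    using mult_left_mono[of "abs (bsym (be i) x)" "2 * C" "abs (h i x)"] by (simp add: abs_mult mult_ac)
  qed
  fix i ph assume i: "i \<in> P"
  interpret B: big_jumps "be i" by (rule big[OF i])
  have "wint w (ft (%xi. h i xi * bsym (be i) xi) ph) <= 4 * ennreal C * ennreal (D * (1 + S i)) + 4 * ennreal (S i) * ennreal D"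
   by (rule order_trans[OF B.wint_mult_bsym[OF rapid_integrable[OF r i] weight_w]])
     (intro add_mono mult_mono mass_be[OF i] w_be[OF i] D i order_refl; simp)
  also have "... = ennreal (4 * C * (D * (1 + S i)) + 4 * S i * D)"
   using C0 D(1) S0[OF i] by (simp add: ennreal_mult)
  also have "... <= ennreal ((8 * C + 4) * D * (1 + S i))"
  proof (rule ennreal_leI)
   have "(8 * C + 4) * D * (1 + S i) - (4 * C * (D * (1 + S i)) + 4 * S i * D) = 4 * D + 4 * C * (D * (1 + S i))"
    by (simp add: algebra_simps)
   moreover have "0 <= 4 * D + 4 * C * (D * (1 + S i))" using C0 D(1) S0[OF i] by simp
   ultimately show "4 * C * (D * (1 + S i)) + 4 * S i * D <= (8 * C + 4) * D * (1 + S i)" by linarith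
  qed
  finally show "wint w (ft (%xi. h i xi * bsym (be i) xi) ph) <= ennreal ((8 * C + 4) * D * (1 + S i))" .
  have "wint (%x. 1) (ft (%xi. h i xi * bsym (be i) xi) ph) <= 4 * ennreal C * ennreal D + 4 * ennreal C * ennreal D"
   by (rule order_trans[OF B.wint_mult_bsym[OF rapid_integrable[OF r i] weight_1]])
     (intro add_mono mult_mono mass_be[OF i] one_be[OF i] D i order_refl; simp)
  also have "... = ennreal (4 * C * D) + ennreal (4 * C * D)" using C0 D(1) by (simp add: ennreal_mult)
  also have "... = ennreal (4 * C * D + 4 * C * D)" using C0 D(1) by (intro ennreal_plus[symmetric]) auto
  also have "... <= ennreal ((8 * C + 4) * D)"
   using C0 D(1) by (intro ennreal_leI) (simp add: algebra_simps)
  finally show "wint (%x. 1) (ft (%xi. h i xi * bsym (be i) xi) ph) <= ennreal ((8 * C + 4) * D)" .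
 qed (use D C0 in auto)
qed

lemma good_exp_bsym:
 assumes "good h"
 shows "good (%i xi. h i xi * exp (bsym (be i) xi))"
proof -
 obtain D where D: "0 <= D" "!!i ph. i \<in> P ==> wint w (ft (h i) ph) <= ennreal (D * (1 + S i))"
  "!!i ph. i \<in> P ==> wint (%x. 1) (ft (h i) ph) <= ennreal D" using goodE[OF assms(1)] by metis
 note r = good_rapid[OF assms(1)]
 define q where "q = exp (8 * C + 4)"
 have q: "0 <= q" by (simp add: q_def)
 show ?thesis
 proof (rule goodI[where D = "q * ((2 + C) * D)"])
  show "rapid P (%i xi. h i xi * exp (bsym (be i) xi))"
  proof (rule rapid_dominated[OF r, of _ "exp (2 * C)"])
   fix i assume i: "i \<in> P"
   interpret B: big_jumps "be i" by (rule big[OF i])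
   note [measurable] = rapidD(1)[OF r i]
   show "bm (%xi. h i xi * exp (bsym (be i) xi))" by measurable
   fix x
   have "exp (bsym (be i) x) <= exp (2 * C)" using B.abs_bsym_le[of x] measure_be_le[OF i] by simp
   thus "abs (h i x * exp (bsym (be i) x)) <= exp (2 * C) * abs (h i x)"
    using mult_left_mono[of "exp (bsym (be i) x)" "exp (2 * C)" "abs (h i x)"] by (simp add: abs_mult mult_ac)
  qed
  fix i ph assume i: "i \<in> P"
  interpret B: big_jumps "be i" by (rule big[OF i])
  have "wint w (ft (%xi. h i xi * exp (bsym (be i) xi)) ph) <= ennreal q * (ennreal (D * (1 + S i)) + ennreal (S i) * ennreal D)"
   unfolding q_def
   by (rule order_trans[OF B.wint_mult_exp_bsym[OF rapid_integrable[OF r i] weight_w w_be[OF i] mass_be[OF i] S0[OF i] C0]])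
     (intro add_mono mult_mono D i order_refl; simp)
  also have "... = ennreal (q * (D * (1 + S i) + S i * D))"
   using q D(1) S0[OF i] by (simp add: ennreal_mult)
  also have "... <= ennreal (q * ((2 + C) * D) * (1 + S i))"
  proof (rule ennreal_leI)
   have "q * ((2 + C) * D) * (1 + S i) - q * (D * (1 + S i) + S i * D) = q * D + q * (C * (D * (1 + S i)))"
    by (simp add: algebra_simps)
   moreover have "0 <= q * D + q * (C * (D * (1 + S i)))" using q C0 D(1) S0[OF i] by simp
   ultimately show "q * (D * (1 + S i) + S i * D) <= q * ((2 + C) * D) * (1 + S i)" by linarith
  qed
  finally show "wint w (ft (%xi. h i xi * exp (bsym (be i) xi)) ph) <= ennreal (q * ((2 + C) * D) * (1 + S i))" .
  have "wint (%x. 1) (ft (%xi. h i xi * exp (bsym (be i) xi)) ph) <= ennreal q * (ennreal D + ennreal C * ennreal D)"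
   unfolding q_def
   by (rule order_trans[OF B.wint_mult_exp_bsym[OF rapid_integrable[OF r i] weight_1 one_be[OF i] mass_be[OF i] C0 C0]])
     (intro add_mono mult_mono D i order_refl; simp)
  also have "... = ennreal (q * (D + C * D))" using q C0 D(1) by (simp add: ennreal_mult)
  also have "... <= ennreal (q * ((2 + C) * D))"
   using q C0 D(1) by (intro ennreal_leI mult_left_mono) (simp_all add: algebra_simps)
  finally show "wint (%x. 1) (ft (%xi. h i xi * exp (bsym (be i) xi)) ph) <= ennreal (q * ((2 + C) * D))" .
 qed (use D C0 q in auto)
qed

lemma good_tame:
 assumes "!!k. tame k P p"
 shows "good (%i xi. p i xi * E i xi)"
proof -
 \<comment> \<open>Weights grow at most like (1 + |x|)^2, so decay of order n + 4 leaves the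
   integrable order n + 2.\<close>
 let ?N = "DIM('a) + 4"
 obtain D where D: "!!i ph x. i \<in> P ==> abs (ft (%xi. p i xi * E i xi) ph x) <= D / (1 + norm x) ^ ?N"
  using ft_tame_decay[OF assms, of ?N] by blast
 define J where "J = (LBINT x. 1 / (1 + norm (x::'a)) ^ (DIM('a) + 2))"
 have J: "0 <= J" unfolding J_def by (intro integral_nonneg_AE AE_I2) simp
 have bd: "wint v (ft (%xi. p i xi * E i xi) ph) <= ennreal (abs D * J)" if i: "i \<in> P" and v: "weight v" for v i ph
 proof -
  have v0: "0 <= v x" "v x <= (1 + norm x)^2" for x using v by (auto simp: weight_def)
  have "wint v (ft (%xi. p i xi * E i xi) ph) <= (NN x. ennreal (abs D * (1 / (1 + norm (x::'a)) ^ (DIM('a) + 2))))"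
   unfolding wint_def
  proof (intro nn_integral_mono ennreal_leI)
   fix x :: 'a
   have n0: "1 + norm x > 0" by (simp add: add_pos_nonneg)
   have "abs (ft (%xi. p i xi * E i xi) ph x) <= abs D / (1 + norm x) ^ ?N"
    by (rule order_trans[OF D[OF i]]) (use n0 in \<open>auto intro!: divide_right_mono\<close>)
   hence "v x * abs (ft (%xi. p i xi * E i xi) ph x) <= (1 + norm x)^2 * (abs D / (1 + norm x) ^ ?N)"
    using v0 by (intro mult_mono) auto
   also have "(1 + norm x) ^ ?N = (1 + norm x)^2 * (1 + norm x) ^ (DIM('a) + 2)"
    unfolding power_add[symmetric] by (intro arg_cong[where f = "%m. (1 + norm x) ^ m"]) simp
   finally show "v x * abs (ft (%xi. p i xi * E i xi) ph x) <= abs D * (1 / (1 + norm x) ^ (DIM('a) + 2))"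
    using n0 by simp
  qed
  also have "... = ennreal (LBINT x. abs D * (1 / (1 + norm (x::'a)) ^ (DIM('a) + 2)))"
   by (intro nn_integral_eq_integral integrable_mult_right integrable_decay) auto
  also have "... = ennreal (abs D * J)" by (simp only: J_def integral_mult_right_zero)
  finally show ?thesis .
 qed
 show ?thesis
 proof (rule goodI[OF rapid_tame[OF assms]])
  show "0 <= abs D * J" using J by simp
  fix i ph assume i: "i \<in> P"
  show "wint w (ft (%xi. p i xi * E i xi) ph) <= ennreal (abs D * J * (1 + S i))"
   using J S0[OF i] by (intro order_trans[OF bd[OF i weight_w]] ennreal_leI) (simp add: distrib_left)
  show "wint (%x. 1) (ft (%xi. p i xi * E i xi) ph) <= ennreal (abs D * J)" by (rule bd[OF i weight_1])
 qed
qed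

text \<open>The bracket is the integral of 2 (1 - cos (y . xi)) over the long jumps: their finite
  mass allows the constant and the cosine to be separated.\<close>

definition A :: "'i => 'a => real" where
 "A i xi = sym (ka i) [] xi + (2 * measure (be i) (space (be i)) - bsym (be i) xi)"

text \<open>Factors \<open>A\<close> are split off one at a time: the short-jump part is tame and is
  absorbed into \<open>p\<close>, while the long-jump part is a bounded constant minus
  \<open>bsym\<close>. The exponential itself is \<open>E\<close> times \<open>exp (bsym)\<close>
  times a constant that is at most 1.\<close>

lemma good_tame_A:
 assumes "!!k. tame k P p"
 shows "good (%i xi. p i xi * A i xi ^ j * exp (- A i xi))"
 using assms
proof (induction j arbitrary: p)
 case 0
 have "good (%i xi. exp (- (2 * measure (be i) (space (be i)))) * ((p i xi * E i xi) * exp (bsym (be i) xi)))"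
  by (rule good_scale[OF good_exp_bsym[OF good_tame[OF 0]], of _ 1]) simp
 thus ?case
  by (rule good_cong) (simp add: A_def E_def exp_minus exp_add exp_diff field_simps)
next
 case (Suc j)
 let ?g = "%i xi. p i xi * A i xi ^ j * exp (- A i xi)"
 have 1: "good (%i xi. (p i xi * sym (ka i) [] xi) * A i xi ^ j * exp (- A i xi))"
  by (rule Suc.IH) (intro tame_mult Suc.prems tame_sym, simp)
 have 2: "good ?g" by (rule Suc.IH[OF Suc.prems])
 have 3: "good (%i xi. (2 * measure (be i) (space (be i))) * ?g i xi)"
  by (rule good_scale[OF 2, of _ "2 * C"]) (use measure_be_le in auto)
 have 4: "good (%i xi. (- 1) * (?g i xi * bsym (be i) xi))"
  by (rule good_scale[OF good_bsym[OF 2], of _ 1]) simp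
 show ?case
  by (rule good_cong[OF good_add[OF 1 good_add[OF 3 4]]]) (simp add: A_def algebra_simps)
qed

end

subsection \<open>Integrals of cosine transforms\<close>

definition gauss :: "'a::euclidean_space => real" where "gauss x = exp (- (norm x)\<^sup>2 / 2)"

lemma gauss_measurable [measurable]: "bm gauss"
 unfolding gauss_def by measurable

lemma gauss_poly_integrable: "LI (%x::'a::euclidean_space. (1 + norm x) ^ k * gauss x)"
proof -
 let ?N = "DIM('a) + 2"
 have "\<exists>C\<ge>0::real. \<forall>x\<ge>1. exp (- (1/8 * x powr 2)) <= C / x ^ (k + ?N)"
  by (rule power_mult_exp_bounded) auto
 then obtain C :: real where C: "0 <= C" "!!x. 1 <= x ==> exp (- (1/8 * x powr 2)) <= C / x ^ (k + ?N)"
  by blast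
 show ?thesis
 proof (rule integrable_bound_real[OF integrable_mult_right[OF integrable_decay[of ?N], of "exp (1/2) * C"]])
  fix x :: 'a
  define y where "y = 1 + norm x"
  have y: "1 <= y" by (simp add: y_def)
  have "y^2 / 8 <= (norm x)^2 / 2 + 1/2"
  proof -
   define q where "q = (norm x)^2"
   have "0 <= (norm x - 1)^2" by (rule zero_le_power2)
   hence "2 * norm x <= q + 1" by (simp add: q_def power2_diff)
   moreover have "0 <= q" by (simp add: q_def)
   ultimately show ?thesis unfolding y_def power2_sum q_def[symmetric] by simp
  qed
  hence "gauss x <= exp (1/2) * exp (- (1/8 * y powr 2))"
   using y by (simp add: gauss_def flip: exp_add)
  also have "... <= exp (1/2) * (C / y ^ (k + ?N))" using C y by (intro mult_left_mono) auto
  finally have "y ^ k * gauss x <= y ^ k * (exp (1/2) * (C / y ^ (k + ?N)))"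
   using y by (intro mult_left_mono) auto
  also have "... = exp (1/2) * C * (1 / y ^ ?N)" using y by (simp add: power_add)
  finally show "abs ((1 + norm x) ^ k * gauss x) <= exp (1/2) * C * (1 / (1 + norm x) ^ ?N)"
   by (simp add: y_def abs_mult gauss_def)
 qed auto
qed

lemma gauss_integrable: "LI (gauss :: 'a::euclidean_space => real)"
 using gauss_poly_integrable[of 0] by simp

text \<open>Along the ray t x the transform g satisfies g' = - t |x|^2 g: differentiation produces
  the factor xi . x, and integration by parts against the Gaussian turns it into t |x|^2. Hence g(t)
  exp (t^2 |x|^2 / 2) is constant in t.\<close>

lemma ft_gauss: "ft gauss 0 x = ft gauss 0 (0 :: 'a) * gauss (x :: 'a::euclidean_space)"
proof -
 define n where "n = (norm x)^2"
 have I1: "LI (%xi. (xi \<bullet> x) * gauss xi * f xi)"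
  if [measurable]: "bm f" and "!!xi. abs (f xi) <= 1" for f :: "'a => real"
 proof (rule integrable_bound_real[OF integrable_mult_right[OF gauss_poly_integrable[of 1], of "norm x"]])
  fix xi :: 'a
  have "abs (xi \<bullet> x) <= norm x * (1 + norm xi)"
   using Cauchy_Schwarz_ineq2[of xi x] by (simp add: distrib_left mult.commute add_increasing)
  hence "(abs (xi \<bullet> x) * gauss xi) * abs (f xi) <= (norm x * (1 + norm xi) * gauss xi) * 1"
   using that(2) by (intro mult_mono) (auto simp: gauss_def)
  thus "abs ((xi \<bullet> x) * gauss xi * f xi) <= norm x * ((1 + norm xi) ^ 1 * gauss xi)"
   by (simp add: abs_mult mult_ac gauss_def)
 qed measurable
 have I0: "LI (%xi. gauss xi * f xi)"
  if [measurable]: "bm f" and "!!xi. abs (f xi) <= 1" for f :: "'a => real"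
  by (rule integrable_bound_real[OF gauss_integrable]) (use that in \<open>auto simp: abs_mult mult_left_le gauss_def\<close>)
 define g where "g t = ft gauss 0 (t *\<^sub>R x)" for t
 define d where "d t = (LBINT xi. (xi \<bullet> x) * gauss xi * sin (t * (xi \<bullet> x)))" for t
 have geq: "g t = (LBINT xi. gauss xi * cos (t * (xi \<bullet> x)))" for t
  by (simp add: g_def ft_def inner_commute)
 have dg: "d t = t * n * g t" for t
 proof -
  have "(LBINT xi. - ((xi \<bullet> x) * gauss xi * sin (t * (xi \<bullet> x))) + (t * n) * (gauss xi * cos (t * (xi \<bullet> x)))) = 0"
  proof (rule integral_directional_derivative_eq_0[where e = x and F = "%xi. gauss xi * sin (t * (xi \<bullet> x))"])
   fix xi
   have sq: "(norm (xi + z *\<^sub>R x))^2 = (norm xi)^2 + 2 * z * (xi \<bullet> x) + z^2 * n" for z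
    unfolding n_def power2_norm_eq_inner
    by (simp add: inner_add_left inner_add_right inner_commute[of x xi] power2_eq_square algebra_simps)
   have ip: "(xi + z *\<^sub>R x) \<bullet> x = xi \<bullet> x + z * n" for z by (simp add: n_def inner_add_left power2_norm_eq_inner)
   show "((%z. gauss (xi + z *\<^sub>R x) * sin (t * ((xi + z *\<^sub>R x) \<bullet> x))) has_real_derivative
     - ((xi \<bullet> x) * gauss xi * sin (t * (xi \<bullet> x))) + (t * n) * (gauss xi * cos (t * (xi \<bullet> x)))) (at 0)"
    unfolding gauss_def sq ip by (auto intro!: derivative_eq_intros)
  next
   show "continuous_on UNIV (%xi. - ((xi \<bullet> x) * gauss xi * sin (t * (xi \<bullet> x))) + (t * n) * (gauss xi * cos (t * (xi \<bullet> x))))"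
    unfolding gauss_def by (intro continuous_intros) auto
   show "LI (%xi. - ((xi \<bullet> x) * gauss xi * sin (t * (xi \<bullet> x))) + (t * n) * (gauss xi * cos (t * (xi \<bullet> x))))"
    by (intro Bochner_Integration.integrable_add Bochner_Integration.integrable_minus integrable_mult_right I0 I1) auto
   show "LI (%xi. gauss xi * sin (t * (xi \<bullet> x)))" by (intro I0) auto
  qed
  thus ?thesis
   using I0[of "%xi. cos (t * (xi \<bullet> x))"] I1[of "%xi. sin (t * (xi \<bullet> x))"]
   by (simp add: d_def geq)
 qed
 have "(g has_real_derivative - d t) (at t)" for t
 proof (rule has_real_derivative_of_quadratic_remainder[where d=1 and B="n * (LBINT xi. (1 + norm (xi::'a)) ^ 2 * gauss xi)"])
  fix h :: real
  have "abs (LBINT xi. gauss xi * cos ((t + h) * (xi \<bullet> x)) - gauss xi * cos (t * (xi \<bullet> x)) + h * ((xi \<bullet> x) * gauss xi * sin (t * (xi \<bullet> x))))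
   <= (LBINT xi. (h^2 * n) * ((1 + norm (xi::'a)) ^ 2 * gauss xi))"
  proof (rule abs_integral_le(2)[OF integrable_mult_right[OF gauss_poly_integrable]])
   show "AE xi in lborel. abs (gauss xi * cos ((t + h) * (xi \<bullet> x)) - gauss xi * cos (t * (xi \<bullet> x)) + h * ((xi \<bullet> x) * gauss xi * sin (t * (xi \<bullet> x))))
    <= (h^2 * n) * ((1 + norm (xi::'a)) ^ 2 * gauss xi)"
   proof (rule AE_I2)
    fix xi :: 'a
    let ?a = "t * (xi \<bullet> x)" and ?b = "h * (xi \<bullet> x)"
    have "gauss xi * cos ((t + h) * (xi \<bullet> x)) - gauss xi * cos (t * (xi \<bullet> x)) + h * ((xi \<bullet> x) * gauss xi * sin (t * (xi \<bullet> x)))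
     = gauss xi * (cos (?a + ?b) - cos ?a + ?b * sin ?a)" by (simp add: algebra_simps)
    hence "abs (gauss xi * cos ((t + h) * (xi \<bullet> x)) - gauss xi * cos (t * (xi \<bullet> x)) + h * ((xi \<bullet> x) * gauss xi * sin (t * (xi \<bullet> x))))
     = gauss xi * abs (cos (?a + ?b) - cos ?a + ?b * sin ?a)" by (simp add: abs_mult gauss_def)
    also have "... <= gauss xi * ?b^2"
     by (intro mult_left_mono cos_quadratic_remainder) (simp add: gauss_def)
    also have "?b^2 <= h^2 * (norm xi * norm x)^2"
    proof -
     have "(xi \<bullet> x)^2 <= (norm xi * norm x)^2"
      using Cauchy_Schwarz_ineq2[of xi x] by (subst abs_le_square_iff[symmetric]) simp
     thus ?thesis by (simp add: power_mult_distrib[of h] mult_left_mono)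
    qed
    also have "h^2 * (norm xi * norm x)^2 <= h^2 * n * (1 + norm xi) ^ 2"
    proof -
     have "(norm xi)^2 <= (1 + norm xi)^2" by (intro power_mono) auto
     hence "(h^2 * n) * (norm xi)^2 <= (h^2 * n) * (1 + norm xi)^2"
      by (rule mult_left_mono) (simp add: n_def)
     thus ?thesis by (simp add: n_def power_mult_distrib mult_ac)
    qed
    finally show "abs (gauss xi * cos ((t + h) * (xi \<bullet> x)) - gauss xi * cos (t * (xi \<bullet> x)) + h * ((xi \<bullet> x) * gauss xi * sin (t * (xi \<bullet> x))))
     <= (h^2 * n) * ((1 + norm (xi::'a)) ^ 2 * gauss xi)"
     by (simp add: gauss_def mult_ac)
   qed
  qed measurable
  thus "abs (g (t + h) - g t - h * - d t) <= n * (LBINT xi. (1 + norm (xi::'a)) ^ 2 * gauss xi) * h^2"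
   using I0[of "%xi. cos (t * (xi \<bullet> x))"] I0[of "%xi. cos ((t + h) * (xi \<bullet> x))"] I1[of "%xi. sin (t * (xi \<bullet> x))"]
   by (simp add: d_def geq) (simp only: mult_ac)
 qed simp
 hence "((%t. g t * exp (t^2 * n / 2)) has_real_derivative 0) (at t)" for t
  by (auto intro!: derivative_eq_intros simp: dg algebra_simps)
 hence "g 1 * exp (1^2 * n / 2) = g 0 * exp (0^2 * n / 2)"
  by (rule DERIV_isconst_all[rule_format, of "%t. g t * exp (t^2 * n / 2)"])
 thus ?thesis by (simp add: g_def gauss_def n_def exp_minus field_simps)
qed

text \<open>The constant (2 pi)^n of Fourier inversion. It only normalizes the kernels, so
  positivity is proved and the value is left open.\<close>

definition ft_const :: "'a::euclidean_space itself => real" where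
 "ft_const _ = (LBINT x. ft gauss 0 (x::'a))"

lemma ft_const_pos: "0 < ft_const TYPE('a::euclidean_space)"
proof -
 have "(LBINT x. gauss (x::'a)) > 0"
 proof -
  have "(LBINT x. gauss (x::'a)) ~= 0"
  proof
   assume "(LBINT x. gauss (x::'a)) = 0"
   hence "AE x in lborel. gauss (x::'a) = 0"
    by (subst (asm) integral_nonneg_eq_0_iff_AE[OF gauss_integrable]) (auto simp: gauss_def)
   hence "AE x in (lborel :: 'a measure). False" by eventually_elim (simp add: gauss_def)
   thus False by (simp add: eventually_False ae_filter_eq_bot_iff)
  qed
  moreover have "0 <= (LBINT x. gauss (x::'a))" by (intro integral_nonneg_AE AE_I2) (simp add: gauss_def)
  ultimately show ?thesis by simp
 qed
 moreover have "ft gauss 0 (0::'a) = (LBINT x. gauss (x::'a))" by (simp add: ft_def)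
 moreover have "ft_const TYPE('a) = ft gauss 0 (0::'a) * (LBINT x. gauss (x::'a))"
 proof -
  have "(LBINT x. ft gauss 0 (x::'a)) = (LBINT x. ft gauss 0 (0::'a) * gauss (x::'a))"
   by (intro Bochner_Integration.integral_cong refl ft_gauss)
  thus ?thesis by (simp add: ft_const_def)
 qed
 ultimately show ?thesis by simp
qed

text \<open>Evenness of the Gaussian identifies the phases \<open>ph\<close> and
  \<open>- ph\<close>, and the sum of the two transforms is \<open>2 * cos ph\<close> times the one
  at phase 0.\<close>

lemma ft_gauss_phase: "ft gauss ph x = cos ph * ft gauss 0 (x :: 'a::euclidean_space)"
proof -
 have "ft gauss ph x = ft gauss (- ph) x"
 proof -
  have "bm (%xi. gauss xi * cos (x \<bullet> xi + ph))" by measurable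
  from integral_translate(3)[OF this, of 0]
  have "ft gauss ph x = (LBINT xi. gauss (- xi) * cos (x \<bullet> (- xi) + ph))" by (simp add: ft_def)
  also have "... = ft gauss (- ph) x"
   unfolding ft_def
  proof (intro Bochner_Integration.integral_cong refl)
   fix xi :: 'a
   have "cos (x \<bullet> (- xi) + ph) = cos (- (x \<bullet> xi + (- ph)))" by simp
   also have "... = cos (x \<bullet> xi + (- ph))" by (rule cos_minus)
   finally show "gauss (- xi) * cos (x \<bullet> (- xi) + ph) = gauss xi * cos (x \<bullet> xi + (- ph))"
    by (simp add: gauss_def)
  qed
  finally show ?thesis .
 qed
 moreover have "ft gauss ph x + ft gauss (- ph) x = 2 * cos ph * ft gauss 0 x"
 proof -
  have "gauss xi * cos (x \<bullet> xi + ph) + gauss xi * cos (x \<bullet> xi + - ph) = 2 * cos ph * (gauss xi * cos (x \<bullet> xi + 0))" for xi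
   by (simp add: cos_add cos_diff algebra_simps)
  thus ?thesis
   unfolding ft_def using integrable_mult_cos[OF gauss_integrable, of x] integrable_mult_cos[OF gauss_integrable, of x "- ph"]
   by (subst Bochner_Integration.integral_add[symmetric]) auto
 qed
 ultimately show ?thesis by simp
qed

lemma integrable_prod:
 fixes f :: "'a::euclidean_space => real" and g :: "'b::euclidean_space => real"
 assumes "LI f" "LI g"
 shows "integrable (lborel \<Otimes>\<^sub>M lborel) (%(x, y). f x * g y)"
proof (rule lborel_pair.Fubini_integrable)
 have [measurable]: "bm f" "bm g" using assms by auto
 show "(%(x, y). f x * g y) \<in> borel_measurable (lborel \<Otimes>\<^sub>M lborel)" by measurable
 show "LI (%x. \<integral>y. norm (case (x, y) of (x, y) => f x * g y) \<partial>lborel)"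
  using assms by (simp add: abs_mult)
qed (use assms in auto)

text \<open>Fourier inversion at the origin, tested against a widening Gaussian.\<close>

lemma integral_ft:
 fixes h :: "'a::euclidean_space => real"
 assumes h: "LI h" and B: "!!xi. abs (h xi) <= B" and cont: "isCont h 0"
  and int: "LI (ft h ph)"
 shows "(LBINT x. ft h ph x) = ft_const TYPE('a) * h 0 * cos ph"
proof -
 have [measurable]: "bm h" using h by auto
 define e where "e k = 1 / (1 + real k)" for k
 have e: "0 < e k" for k by (simp add: e_def)
 have e0: "e \<longlonglongrightarrow> 0" unfolding e_def using LIMSEQ_inverse_real_of_nat by (simp add: inverse_eq_divide add.commute)
 define I where "I k = (LBINT x. ft h ph x * gauss (e k *\<^sub>R x))" for k
 have g1: "0 <= gauss x" "gauss x <= 1" for x :: 'a by (auto simp: gauss_def)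
 have lim: "(%k. e k *\<^sub>R x) \<longlonglongrightarrow> 0" for x :: 'a
  using tendsto_scaleR[OF e0 tendsto_const[of x]] by simp
 have L1: "I \<longlonglongrightarrow> (LBINT x. ft h ph x)"
  unfolding I_def
 proof (rule integral_dominated_convergence[where w = "%x. abs (ft h ph x)"])
  show "AE x in lborel. (%k. ft h ph x * gauss (e k *\<^sub>R x)) \<longlonglongrightarrow> ft h ph x"
  proof (rule AE_I2)
   fix x :: 'a
   have "isCont gauss (0::'a)" unfolding gauss_def by (intro continuous_intros) auto
   hence "(%k. gauss (e k *\<^sub>R x)) \<longlonglongrightarrow> gauss (0::'a)" by (rule isCont_tendsto_compose[OF _ lim])
   from tendsto_mult[OF tendsto_const[of "ft h ph x"] this]
   show "(%k. ft h ph x * gauss (e k *\<^sub>R x)) \<longlonglongrightarrow> ft h ph x" by (simp add: gauss_def)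
  qed
  show "AE x in lborel. norm (ft h ph x * gauss (e k *\<^sub>R x)) <= abs (ft h ph x)" for k
   using g1 by (auto simp: abs_mult mult_left_le)
 qed (use int in auto)
 have ig: "LI (ft gauss 0 :: 'a => real)"
 proof -
  have "(ft gauss 0 :: 'a => real) = (%x. ft gauss 0 (0::'a) * gauss x)" by (rule ext) (rule ft_gauss)
  thus ?thesis by (rule ssubst) (rule integrable_mult_right[OF gauss_integrable])
 qed
 \<comment> \<open>Fubini moves the widening Gaussian to the frequency side, where it concentrates
   at the origin; after rescaling, \<open>h\<close> is evaluated at points tending to 0.\<close>
 have eq: "I k = cos ph * (LBINT et. h (e k *\<^sub>R et) * ft gauss 0 et)" for k
 proof -
  have igk: "LI (%x::'a. gauss (e k *\<^sub>R x))"
   using integrable_lborel_affine[OF gauss_integrable, of "e k" 0] e[of k] by simp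
  have i2: "integrable (lborel \<Otimes>\<^sub>M lborel) (%(xi, x). (h xi * cos (x \<bullet> xi + ph)) * gauss (e k *\<^sub>R x))"
  proof (rule Bochner_Integration.integrable_bound[OF integrable_prod[OF h igk]])
   show "AE p in lborel \<Otimes>\<^sub>M lborel. norm (case p of (xi, x) => (h xi * cos (x \<bullet> xi + ph)) * gauss (e k *\<^sub>R x))
    <= norm (case p of (xi, x) => h xi * gauss (e k *\<^sub>R x))"
   proof (rule AE_I2)
    fix p :: "'a \<times> 'a"
    obtain xi x where p: "p = (xi, x)" by force
    have "abs (cos (x \<bullet> xi + ph)) * (abs (h xi) * abs (gauss (e k *\<^sub>R x))) <= 1 * (abs (h xi) * abs (gauss (e k *\<^sub>R x)))"
     by (intro mult_right_mono) auto
    thus "norm (case p of (xi, x) => (h xi * cos (x \<bullet> xi + ph)) * gauss (e k *\<^sub>R x))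
     <= norm (case p of (xi, x) => h xi * gauss (e k *\<^sub>R x))" by (simp add: p abs_mult mult_ac)
   qed
  qed measurable
  have "I k = (LBINT x. (LBINT xi. (h xi * cos (x \<bullet> xi + ph)) * gauss (e k *\<^sub>R x)))"
   by (simp add: I_def ft_def)
  also have "... = (LBINT xi. (LBINT x. (h xi * cos (x \<bullet> xi + ph)) * gauss (e k *\<^sub>R x)))"
   by (rule lborel_pair.Fubini_integral[OF i2])
  also have "... = (LBINT xi. h xi * ((1 / e k) ^ DIM('a) * (cos ph * ft gauss 0 ((1 / e k) *\<^sub>R xi))))"
  proof (intro Bochner_Integration.integral_cong refl)
   fix xi :: 'a
   have m: "bm (%x. cos (x \<bullet> xi + ph) * gauss (e k *\<^sub>R x))" by measurable
   have "(LBINT x. (h xi * cos (x \<bullet> xi + ph)) * gauss (e k *\<^sub>R x)) = h xi * (LBINT x. cos (x \<bullet> xi + ph) * gauss (e k *\<^sub>R x))"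
    by (simp add: mult.assoc)
   also have "(LBINT x. cos (x \<bullet> xi + ph) * gauss (e k *\<^sub>R x))
     = (1 / e k) ^ DIM('a) * ft gauss ph ((1 / e k) *\<^sub>R xi)"
    using e[of k] by (subst integral_lborel_affine[OF m, of "1 / e k" 0])
     (auto simp: ft_def inner_commute mult.commute)
   finally show "(LBINT x. (h xi * cos (x \<bullet> xi + ph)) * gauss (e k *\<^sub>R x))
     = h xi * ((1 / e k) ^ DIM('a) * (cos ph * ft gauss 0 ((1 / e k) *\<^sub>R xi)))"
    by (subst (asm) ft_gauss_phase) 
  qed
  also have "... = cos ph * ((1 / e k) ^ DIM('a) * (LBINT xi. h xi * ft gauss 0 ((1 / e k) *\<^sub>R xi)))"
   by (simp add: mult_ac flip: integral_mult_right_zero)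
  also have "(1 / e k) ^ DIM('a) * (LBINT xi. h xi * ft gauss 0 ((1 / e k) *\<^sub>R xi))
    = (LBINT et. h (e k *\<^sub>R et) * ft gauss 0 et)"
  proof -
   have m: "bm (%xi. h xi * ft gauss 0 ((1 / e k) *\<^sub>R xi))" by measurable
   show ?thesis
    using e[of k] by (subst integral_lborel_affine[OF m, of "e k" 0]) (auto simp: field_simps power_divide)
  qed
  finally show ?thesis .
 qed
 have "(%k. \<integral>et. h (e k *\<^sub>R et) * ft gauss 0 et \<partial>lborel) \<longlonglongrightarrow> (LBINT et. h 0 * ft gauss 0 (et::'a))"
 proof (rule integral_dominated_convergence[where w = "%x. abs B * abs (ft gauss 0 x)"])
  show "AE et in lborel. (%k. h (e k *\<^sub>R et) * ft gauss 0 et) \<longlonglongrightarrow> h 0 * ft gauss 0 et"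
   by (intro AE_I2 tendsto_mult tendsto_const isCont_tendsto_compose[OF cont lim])
  show "AE et in lborel. norm (h (e k *\<^sub>R et) * ft gauss 0 et) <= abs B * abs (ft gauss 0 et)" for k
   using B by (auto simp: abs_mult intro!: mult_right_mono order_trans[OF B])
 qed (use ig in auto)
 hence "I \<longlonglongrightarrow> cos ph * (h 0 * ft_const TYPE('a))"
  unfolding eq[abs_def] ft_const_def by (intro tendsto_mult tendsto_const) simp
 thus ?thesis using LIMSEQ_unique[OF L1] by (simp add: mult_ac)
qed

subsection \<open>Levy measures\<close>

text \<open>Every bound is homogeneous in the radius with the exponent of a 2s-stable measure, so
  the class is invariant under parabolic rescaling. The upper bounds control in turn the second
  moment of short jumps, the number of long jumps and their \<open>al\<close>-moment; the last
  condition is ellipticity.\<close>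

definition levy :: "real => real => real => real => 'a::euclidean_space measure => bool" where
 "levy s al c C nu \<longleftrightarrow> sets nu = sets borel \<and> emeasure nu {0} = 0 \<and>
  (\<forall>r>0. (\<integral>\<^sup>+y. ennreal ((norm y)^2 * indicator (cball 0 r) y) \<partial>nu) <= ennreal (C * r powr (2 - 2 * s))) \<and>
  (\<forall>r>0. (\<integral>\<^sup>+y. ennreal (indicator (- cball 0 r) y) \<partial>nu) <= ennreal (C * r powr (- 2 * s))) \<and>
  (\<forall>r>0. (\<integral>\<^sup>+y. ennreal (norm y powr al * indicator (- cball 0 r) y) \<partial>nu) <= ennreal (C * r powr (al - 2 * s))) \<and>
  (\<forall>r>0. \<forall>e. norm e = 1 -->
    ennreal (c * r powr (2 - 2 * s)) <= (\<integral>\<^sup>+y. ennreal ((y \<bullet> e)^2 * indicator (cball 0 r) y) \<partial>nu))"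

definition scaled :: "real => real => 'a::euclidean_space set => 'a measure => 'a measure" where
 "scaled sg ta B nu = density (distr nu borel (%y. y /\<^sub>R ta)) (%y. ennreal (sg * indicator B y))"

lemma sets_scaled [measurable_cong, simp]: "sets (scaled sg ta B nu) = sets borel"
 by (simp add: scaled_def)

lemma nn_integral_scaled:
 assumes [measurable]: "B \<in> sets borel" "bm f" and s: "sets nu = sets borel" and "0 <= sg"
  and nn: "!!y. 0 <= f y"
 shows "(\<integral>\<^sup>+y. ennreal (f y) \<partial>scaled sg ta B nu) = (\<integral>\<^sup>+y. ennreal (sg * (indicator B (y /\<^sub>R ta) * f (y /\<^sub>R ta))) \<partial>nu)"
proof -
 have [measurable_cong]: "sets nu = sets borel" by (rule s)
 show ?thesis unfolding scaled_def
  by (subst nn_integral_density, measurable, subst nn_integral_distr, measurable)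
    (use assms in \<open>auto simp flip: ennreal_mult simp: mult.assoc\<close>)
qed

lemma integral_scaled:
 fixes f :: "'a::euclidean_space => real"
 assumes [measurable]: "B \<in> sets borel" "bm f" and s: "sets nu = sets borel" and "0 <= sg"
 shows "(\<integral>y. f y \<partial>scaled sg ta B nu) = (\<integral>y. sg * (indicator B (y /\<^sub>R ta) * f (y /\<^sub>R ta)) \<partial>nu)"
  "integrable (scaled sg ta B nu) f \<longleftrightarrow> integrable nu (%y. sg * (indicator B (y /\<^sub>R ta) * f (y /\<^sub>R ta)))"
proof -
 have [measurable_cong]: "sets nu = sets borel" by (rule s)
 show "(\<integral>y. f y \<partial>scaled sg ta B nu) = (\<integral>y. sg * (indicator B (y /\<^sub>R ta) * f (y /\<^sub>R ta)) \<partial>nu)"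
  unfolding scaled_def
  by (subst integral_density, measurable) (use assms in \<open>auto simp: integral_distr mult.assoc\<close>)
 show "integrable (scaled sg ta B nu) f \<longleftrightarrow> integrable nu (%y. sg * (indicator B (y /\<^sub>R ta) * f (y /\<^sub>R ta)))"
  unfolding scaled_def
  by (subst integrable_density, measurable) (use assms in \<open>auto simp: integrable_distr_eq mult.assoc\<close>)
qed

lemma levyD:
 assumes "levy s al c C nu"
 shows "sets nu = sets borel" "emeasure nu {0} = 0"
  "!!r. 0 < r ==> (\<integral>\<^sup>+y. ennreal ((norm y)^2 * indicator (cball 0 r) y) \<partial>nu) <= ennreal (C * r powr (2 - 2 * s))"
  "!!r. 0 < r ==> (\<integral>\<^sup>+y. ennreal (indicator (- cball 0 r) y) \<partial>nu) <= ennreal (C * r powr (- 2 * s))"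
  "!!r. 0 < r ==> (\<integral>\<^sup>+y. ennreal (norm y powr al * indicator (- cball 0 r) y) \<partial>nu) <= ennreal (C * r powr (al - 2 * s))"
  "!!r e. 0 < r ==> norm e = 1 ==>
    ennreal (c * r powr (2 - 2 * s)) <= (\<integral>\<^sup>+y. ennreal ((y \<bullet> e)^2 * indicator (cball 0 r) y) \<partial>nu)"
 using assms unfolding levy_def by blast+

section \<open>Rescaling a Levy measure to unit size\<close>

locale stable_setting =
 fixes s al c C rh :: real
 assumes s: "0 < s" "s < 1" and al: "0 < al" "al < 1" "al < 2 * s"
  and c: "0 < c" and C: "0 <= C" and rh: "0 < rh" "rh <= 1"
begin

text \<open>The length belonging to the time \<open>sg\<close> under the parabolic scaling, where
  length to the power 2s is a time.\<close>

definition tau :: "real => real" where "tau sg = sg powr (1 / (2 * s))"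

lemma tau_pos [simp]: "0 < sg ==> 0 < tau sg"
 by (simp add: tau_def)

lemma tau_powr: "0 < sg ==> tau sg powr (2 * s) = sg"
 using s by (simp add: tau_def powr_powr)

definition trunc :: "'a::euclidean_space measure => 'a measure" where
 "trunc nu = scaled 1 1 (cball 0 rh) nu"

definition lev :: "'a::euclidean_space measure => bool" where
 "lev nu \<longleftrightarrow> levy s al c C nu"

definition symb :: "'a::euclidean_space measure => 'a => real" where
 "symb nu = sym (trunc nu) []"

definition hsym :: "'a list => nat => 'a::euclidean_space measure => real => 'a => real" where
 "hsym es j nu sg xi = monom es xi * symb nu xi ^ j * exp (- (sg * symb nu xi))"

text \<open>When \<open>ph\<close> is pi/2 times the length of \<open>es\<close>, this is the
  derivative along \<open>es\<close> of (- d/d sigma)^j of the fundamental solution. Bounds are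
  proved for all phases at once, which spares any bookkeeping of signs.\<close>

definition kern :: "'a list => nat => real => 'a::euclidean_space measure => real => 'a => real" where
 "kern es j ph nu sg x = ft (hsym es j nu sg) ph x / ft_const TYPE('a)"

text \<open>For these times the truncation radius is at least one rescaled unit of length, so no
  jump of rescaled length at most 1 is lost.\<close>

definition PP :: "('a::euclidean_space measure \<times> real) set" where
 "PP = {(nu, sg). lev nu \<and> 0 < sg \<and> tau sg <= rh}"

definition kap :: "'a::euclidean_space measure \<times> real => 'a measure" where
 "kap i = scaled (snd i) (tau (snd i)) (cball 0 1) (fst i)"

definition bet :: "'a::euclidean_space measure \<times> real => 'a measure" where
 "bet i = scaled (snd i) (tau (snd i)) (cball 0 (rh / tau (snd i)) - cball 0 1) (fst i)"

lemma levD: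
 assumes "lev nu"
 shows "sets nu = sets borel" "emeasure nu {0} = 0"
  "!!r. 0 < r ==> (\<integral>\<^sup>+y. ennreal ((norm y)^2 * indicator (cball 0 r) y) \<partial>nu) <= ennreal (C * r powr (2 - 2 * s))"
  "!!r. 0 < r ==> (\<integral>\<^sup>+y. ennreal (indicator (- cball 0 r) y) \<partial>nu) <= ennreal (C * r powr (- 2 * s))"
  "!!r. 0 < r ==> (\<integral>\<^sup>+y. ennreal (norm y powr al * indicator (- cball 0 r) y) \<partial>nu) <= ennreal (C * r powr (al - 2 * s))"
  "!!r e. 0 < r ==> norm e = 1 ==>
    ennreal (c * r powr (2 - 2 * s)) <= (\<integral>\<^sup>+y. ennreal ((y \<bullet> e)^2 * indicator (cball 0 r) y) \<partial>nu)"
 using levyD[OF assms[unfolded lev_def]] by blast+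

lemma cball_measurable [measurable]: "cball x r \<in> sets borel"
 by simp

lemma mem_cball_scaled: "0 < ta ==> y /\<^sub>R ta \<in> cball 0 r \<longleftrightarrow> norm y <= r * ta"
proof -
 assume "0 < ta"
 moreover from this have "norm (y /\<^sub>R ta) = norm y / ta" by (simp add: divide_inverse mult.commute)
 ultimately show ?thesis unfolding mem_cball_0 by (simp add: pos_divide_le_eq)
qed

lemma indicator_cball_scaled:
 fixes y :: "'a::real_normed_vector"
 shows "0 < ta ==> indicator (cball 0 r) (y /\<^sub>R ta) = (indicator (cball 0 (r * ta)) y :: real)"
 unfolding indicator_def by (simp only: mem_cball_scaled mem_cball_0[of y])

lemma nn_integral_ennreal_cmult:
 assumes "f \<in> borel_measurable M" "0 <= a"
 shows "(\<integral>\<^sup>+y. ennreal (a * f y) \<partial>M) = ennreal a * (\<integral>\<^sup>+y. ennreal (f y) \<partial>M)"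
 using assms by (simp add: ennreal_mult' nn_integral_cmult)

text \<open>Since \<open>sg = tau^(2s)\<close>, the factor \<open>sg / tau^2\<close> created by the
  rescaling cancels the power \<open>tau^(2 - 2s)\<close> in the bounds of \<open>levy\<close>; the
  constants therefore do not depend on the time.\<close>

lemma small_jumps_kap:
 assumes "i \<in> PP"
 shows "small_jumps s c C (kap i)"
proof -
 obtain nu sg where i: "i = (nu, sg)" "lev nu" "0 < sg" "tau sg <= rh" using assms by (auto simp: PP_def)
 note L = levD[OF i(2)]
 have [measurable_cong]: "sets nu = sets borel" by (rule L)
 define ta where "ta = tau sg"
 have ta: "0 < ta" using i by (simp add: ta_def)
 have tas: "ta powr (2 * s) = sg" using tau_powr[OF i(3)] by (simp add: ta_def)
 have st: "sg / ta^2 * ta powr (2 - 2 * s) = 1"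
  using ta tas i(3) by (simp add: powr_diff)
 show ?thesis
  unfolding small_jumps_def
 proof (intro conjI allI impI)
  show "sets (kap i) = sets borel" by (simp add: kap_def)
  show "AE y in kap i. norm y <= 1"
   using i(3) unfolding kap_def scaled_def
   by (subst AE_density) (auto simp: indicator_def intro!: AE_I2 split: if_splits)
  have "(\<integral>\<^sup>+y. ennreal ((norm y)^2) \<partial>kap i) = (\<integral>\<^sup>+y. ennreal (sg / ta^2 * ((norm y)^2 * indicator (cball 0 ta) y)) \<partial>nu)"
   unfolding kap_def i fst_conv snd_conv ta_def[symmetric] using L(1) i ta
   by (subst nn_integral_scaled) (auto simp: indicator_cball_scaled power_divide divide_inverse power_mult_distrib power_inverse mult_ac)
  also have "... = ennreal (sg / ta^2) * (\<integral>\<^sup>+y. ennreal ((norm y)^2 * indicator (cball 0 ta) y) \<partial>nu)"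
   using i by (intro nn_integral_ennreal_cmult) auto
  also have "... <= ennreal (sg / ta^2) * ennreal (C * ta powr (2 - 2 * s))"
   by (intro mult_left_mono L(3) ta) auto
  also have "... = ennreal (C * (sg / ta^2 * ta powr (2 - 2 * s)))"
   using i C by (subst ennreal_mult[symmetric]) (auto simp: mult_ac)
  finally show "(\<integral>\<^sup>+y. ennreal ((norm y)^2) \<partial>kap i) <= ennreal C" unfolding st by simp
 next
  fix r :: real and e :: 'a assume r: "0 < r" "r <= 1" "norm e = 1"
  have "ennreal (c * r powr (2 - 2 * s)) = ennreal (sg / ta^2 * (c * (r * ta) powr (2 - 2 * s)))"
  proof -
   have "sg / ta^2 * (c * (r * ta) powr (2 - 2 * s)) = c * r powr (2 - 2 * s) * (sg / ta^2 * ta powr (2 - 2 * s))"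
    using r ta by (simp add: powr_mult mult_ac)
   thus ?thesis unfolding st by simp
  qed
  also have "... = ennreal (sg / ta^2) * ennreal (c * (r * ta) powr (2 - 2 * s))"
   using i c by (intro ennreal_mult) auto
  also have "... <= ennreal (sg / ta^2) * (\<integral>\<^sup>+y. ennreal ((y \<bullet> e)^2 * indicator (cball 0 (r * ta)) y) \<partial>nu)"
   using r ta by (intro mult_left_mono L(6)) auto
  also have "... = (\<integral>\<^sup>+y. ennreal (sg / ta^2 * ((y \<bullet> e)^2 * indicator (cball 0 (r * ta)) y)) \<partial>nu)"
   using i by (intro nn_integral_ennreal_cmult[symmetric]) auto
  also have "... = (\<integral>\<^sup>+y. ennreal ((y \<bullet> e)^2 * indicator (cball 0 r) y) \<partial>kap i)"
  proof -
   have ii: "indicator (cball 0 ta) y * indicator (cball 0 (r * ta)) y = (indicator (cball 0 (r * ta)) y :: real)" for y :: 'a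
    using r ta by (auto simp: indicator_def) (smt (verit) mult_left_le_one_le)
   have "sg / ta^2 * ((y \<bullet> e)^2 * indicator (cball 0 (r * ta)) y)
    = sg * (indicator (cball 0 1) (y /\<^sub>R ta) * (((y /\<^sub>R ta) \<bullet> e)^2 * indicator (cball 0 r) (y /\<^sub>R ta)))" for y
    using ta ii[of y] by (auto simp: indicator_cball_scaled power_mult_distrib divide_inverse power_inverse mult_ac)
   thus ?thesis
    unfolding kap_def i fst_conv snd_conv ta_def[symmetric] using L(1) i ta
    by (subst nn_integral_scaled) auto
  qed
  finally show "ennreal (c * r powr (2 - 2 * s)) <= (\<integral>\<^sup>+y. ennreal ((y \<bullet> e)^2 * indicator (cball 0 r) y) \<partial>kap i)" .
 qed
qed

lemma small_family_kap: "small_family PP kap s c C"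
 using small_jumps_kap s c C by unfold_locales auto

lemma nn_integral_bet_le:
 assumes "i = (nu, sg)" "lev nu" "0 < sg" "tau sg <= rh" and [measurable]: "bm f" "bm g"
  and "!!y. 0 <= f y" "0 <= a"
  and "!!y. tau sg < norm y ==> norm y <= rh ==> sg * f (y /\<^sub>R tau sg) <= a * g y" "!!y. 0 <= g y"
 shows "(\<integral>\<^sup>+y. ennreal (f y) \<partial>bet i) <= ennreal a * (\<integral>\<^sup>+y. ennreal (g y) \<partial>nu)"
proof -
 note L = levD[OF assms(2)]
 have [measurable_cong]: "sets nu = sets borel" by (rule L)
 have "(\<integral>\<^sup>+y. ennreal (f y) \<partial>bet i) = (\<integral>\<^sup>+y. ennreal (sg * (indicator (cball 0 (rh / tau sg) - cball 0 1) (y /\<^sub>R tau sg) * f (y /\<^sub>R tau sg))) \<partial>nu)"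
  unfolding bet_def assms(1) fst_conv snd_conv using L(1) assms
  by (subst nn_integral_scaled) auto
 also have "... <= (\<integral>\<^sup>+y. ennreal (a * g y) \<partial>nu)"
 proof (intro nn_integral_mono ennreal_leI)
  fix y
  show "sg * (indicator (cball 0 (rh / tau sg) - cball 0 1) (y /\<^sub>R tau sg) * f (y /\<^sub>R tau sg)) <= a * g y"
  proof (cases "tau sg < norm y \<and> norm y <= rh")
   case True
   thus ?thesis
    using assms(9)[of y] assms(3) mult_nonneg_nonneg[OF assms(8) assms(10)[of y]] by (auto simp: indicator_def)
  next
   case False
   hence "indicator (cball 0 (rh / tau sg) - cball 0 1) (y /\<^sub>R tau sg) = (0::real)"
    using tau_pos[OF assms(3)] assms(4)
    unfolding indicator_def Diff_iff mem_cball_scaled[OF tau_pos[OF assms(3)]] by auto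
   thus ?thesis using assms by simp
  qed
 qed
 also have "... = ennreal a * (\<integral>\<^sup>+y. ennreal (g y) \<partial>nu)"
  using assms by (intro nn_integral_ennreal_cmult) auto
 finally show ?thesis .
qed

text \<open>Mass and \<open>al\<close>-moment of the long rescaled jumps are scale-invariant tail
  integrals. The second moment is not: it is finite only through the truncation at
  \<open>rh\<close>, and its bound grows like \<open>tau^(2s - 2)\<close> for small times.\<close>

lemma bet_bounds:
 assumes "i \<in> PP"
 shows "(\<integral>\<^sup>+y. ennreal 1 \<partial>bet i) <= ennreal C" "(\<integral>\<^sup>+y. ennreal (norm y powr al) \<partial>bet i) <= ennreal C"
  "(\<integral>\<^sup>+y. ennreal ((norm y)^2) \<partial>bet i) <= ennreal (C * tau (snd i) powr (2 * s - 2))"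
proof -
 obtain nu sg where i: "i = (nu, sg)" "lev nu" "0 < sg" "tau sg <= rh" using assms by (auto simp: PP_def)
 note L = levD[OF i(2)]
 define ta where "ta = tau sg"
 have ta: "0 < ta" using i by (simp add: ta_def)
 have tas: "ta powr (2 * s) = sg" using tau_powr[OF i(3)] by (simp add: ta_def)
 have "(\<integral>\<^sup>+y. ennreal 1 \<partial>bet i) <= ennreal sg * (\<integral>\<^sup>+y. ennreal (indicator (- cball 0 ta) y) \<partial>nu)"
  by (rule nn_integral_bet_le[OF i]) (use i in \<open>auto simp: ta_def\<close>)
 also have "... <= ennreal sg * ennreal (C * ta powr (- 2 * s))" by (intro mult_left_mono L(4) ta) auto
 also have "... = ennreal (C * (sg * ta powr (- 2 * s)))"
  using i C by (subst ennreal_mult[symmetric]) (auto simp: mult_ac)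
 also have "sg * ta powr (- 2 * s) = 1" using ta tas i by (simp add: powr_minus)
 finally show "(\<integral>\<^sup>+y. ennreal 1 \<partial>bet i) <= ennreal C" by simp
 have pw: "norm (y /\<^sub>R ta) powr al = norm y powr al / ta powr al" for y :: 'a
 proof -
  have "norm (y /\<^sub>R ta) = norm y / ta" using ta by (simp add: divide_inverse mult.commute)
  thus ?thesis using ta by (simp add: powr_divide)
 qed
 have "(\<integral>\<^sup>+y. ennreal (norm y powr al) \<partial>bet i) <= ennreal (sg / ta powr al) * (\<integral>\<^sup>+y. ennreal (norm y powr al * indicator (- cball 0 ta) y) \<partial>nu)"
  by (rule nn_integral_bet_le[OF i]) (use i ta pw in \<open>auto simp: ta_def[symmetric]\<close>)
 also have "... <= ennreal (sg / ta powr al) * ennreal (C * ta powr (al - 2 * s))" by (intro mult_left_mono L(5) ta) auto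
 also have "... = ennreal (C * (sg / ta powr al * ta powr (al - 2 * s)))"
  using i C by (subst ennreal_mult[symmetric]) (auto simp: mult_ac)
 also have "sg / ta powr al * ta powr (al - 2 * s) = 1" using ta tas i by (simp add: powr_diff)
 finally show "(\<integral>\<^sup>+y. ennreal (norm y powr al) \<partial>bet i) <= ennreal C" by simp
 have "(\<integral>\<^sup>+y. ennreal ((norm y)^2) \<partial>bet i) <= ennreal (sg / ta^2) * (\<integral>\<^sup>+y. ennreal ((norm y)^2 * indicator (cball 0 rh) y) \<partial>nu)"
  by (rule nn_integral_bet_le[OF i]) (use i ta in \<open>auto simp: ta_def[symmetric] power_mult_distrib divide_inverse power_inverse
    intro!: borel_measurable_times borel_measurable_indicator\<close>)
 also have "... <= ennreal (sg / ta^2) * ennreal (C * rh powr (2 - 2 * s))" by (intro mult_left_mono L(3) rh) auto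
 also have "... = ennreal (C * (sg / ta^2) * rh powr (2 - 2 * s))"
  using i C by (subst ennreal_mult[symmetric]) (auto simp: mult_ac)
 also have "sg / ta^2 = ta powr (2 * s - 2)" using ta tas by (simp add: powr_diff)
 also have "C * ta powr (2 * s - 2) * rh powr (2 - 2 * s) <= C * ta powr (2 * s - 2) * 1"
  using C rh s by (intro mult_left_mono powr_le1) auto
 finally show "(\<integral>\<^sup>+y. ennreal ((norm y)^2) \<partial>bet i) <= ennreal (C * tau (snd i) powr (2 * s - 2))"
  by (simp add: i ta_def ennreal_leI)
qed

lemma unit_family_kap_bet:
 assumes "weight w" "!!i. i \<in> PP ==> (\<integral>\<^sup>+y. ennreal (w y) \<partial>bet i) <= ennreal (S i)" "!!i. i \<in> PP ==> 0 <= S i"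
 shows "unit_family PP kap s c C bet w S"
proof -
 interpret small_family PP kap s c C by (rule small_family_kap)
 show ?thesis
  using assms bet_bounds(1) by unfold_locales (auto simp: bet_def)
qed

subsection \<open>The truncated symbol\<close>

lemma integrable_sym_bet:
 assumes "i \<in> PP"
 shows "integrable (bet i) (symint [] et)" "(\<integral>y. symint [] et y \<partial>bet i) = 2 * measure (bet i) (space (bet i)) - bsym (bet i) et"
proof -
 interpret big_jumps "bet i"
  by (rule unit_family.big[OF unit_family_kap_bet[OF weight_1 bet_bounds(1)] assms]) (use C in auto)
 have i1: "integrable (bet i) (%y. 2 * cos (y \<bullet> et))" using integrable_cos_b[of et 0] by simp
 have eq: "symint [] et = (%y. 2 - 2 * cos (y \<bullet> et))" by (auto simp: symint_def)
 show "integrable (bet i) (symint [] et)" unfolding eq using i1 by (intro Bochner_Integration.integrable_diff) auto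
 show "(\<integral>y. symint [] et y \<partial>bet i) = 2 * measure (bet i) (space (bet i)) - bsym (bet i) et"
  unfolding eq using i1 by (subst Bochner_Integration.integral_diff) (auto simp: bsym_def)
qed

text \<open>Short and long rescaled jumps partition the rescaled truncation ball, so their symbols
  add up to the truncated symbol at the parabolic scale.\<close>

lemma A_eq:
 assumes "i = (nu, sg)" "i \<in> PP"
 shows "sym (kap i) [] et + (2 * measure (bet i) (space (bet i)) - bsym (bet i) et) = sg * symb nu (et /\<^sub>R tau sg)"
proof -
 have i: "lev nu" "0 < sg" "tau sg <= rh" using assms by (auto simp: PP_def)
 note L = levD[OF i(1)]
 have ta: "0 < tau sg" using i by simp
 have m: "bm (symint [] et)" by measurable
 have I1: "integrable (kap i) (symint [] et)"
  using integrable_symint(1)[OF small_jumps_kap[OF assms(2)] C] by simp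
 let ?f = "%B y. sg * (indicator B (y /\<^sub>R tau sg) * symint [] et (y /\<^sub>R tau sg))"
 have "sym (kap i) [] et + (2 * measure (bet i) (space (bet i)) - bsym (bet i) et)
   = (\<integral>y. ?f (cball 0 1) y \<partial>nu) + (\<integral>y. ?f (cball 0 (rh / tau sg) - cball 0 1) y \<partial>nu)"
  unfolding integrable_sym_bet(2)[OF assms(2), symmetric] sym_def
  unfolding kap_def bet_def assms(1) fst_conv snd_conv using L(1) i
  by (subst (1 2) integral_scaled) auto
 also have "... = (\<integral>y. ?f (cball 0 1) y + ?f (cball 0 (rh / tau sg) - cball 0 1) y \<partial>nu)"
  using I1 integrable_sym_bet(1)[OF assms(2), of et] L(1) i
  unfolding kap_def bet_def assms(1) fst_conv snd_conv
  by (subst (asm) (1 2) integral_scaled(2)) auto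
 also have "... = (\<integral>y. sg * (indicator (cball 0 rh) y * symint [] (et /\<^sub>R tau sg) y) \<partial>nu)"
 proof (intro Bochner_Integration.integral_cong refl)
  fix y :: 'a
  have "symint [] et (y /\<^sub>R tau sg) = symint [] (et /\<^sub>R tau sg) y" by (simp add: symint_def)
  moreover have "indicator (cball 0 1) (y /\<^sub>R tau sg) + indicator (cball 0 (rh / tau sg) - cball 0 1) (y /\<^sub>R tau sg)
    = (indicator (cball 0 rh) y :: real)"
   using ta i(3)
   unfolding indicator_def Diff_iff mem_cball_scaled[OF ta, of y 1]
    mem_cball_scaled[OF ta, of y "rh / tau sg"] mem_cball_0[of y] by simp
  ultimately show "?f (cball 0 1) y + ?f (cball 0 (rh / tau sg) - cball 0 1) y = sg * (indicator (cball 0 rh) y * symint [] (et /\<^sub>R tau sg) y)"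
   by (simp flip: distrib_left distrib_right)
 qed
 also have "... = sg * symb nu (et /\<^sub>R tau sg)"
  unfolding symb_def sym_def trunc_def using L(1) by (subst integral_scaled) auto
 finally show ?thesis .
qed

end

lemma monom_scaleR: "monom es (a *\<^sub>R y) = a ^ length es * monom es y"
 by (induction es) (auto simp: mult_ac)

lemma monom_0: "monom es 0 = of_bool (es = [])"
 by (induction es) auto

lemma polybd_monom: "polybd P (%i. monom es)"
 by (induction es) (auto intro!: polybd_const polybd_mult polybd_inner simp: monom_def)

context stable_setting
begin

text \<open>The truncated measure without rescaling, with constants depending on \<open>a\<close>
  and \<open>rh\<close>. It serves qualitative facts about a single kernel, such as integrability
  and differentiability; the quantitative bounds come from the rescaled family.\<close>

lemma small_jumps_trunc:
 assumes "lev nu" "0 < a"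
 shows "small_jumps s (a * (c * rh powr (2 - 2 * s))) (a * C) (scaled a 1 (cball 0 rh) nu)"
 unfolding small_jumps_def
proof (intro conjI allI impI)
 note L = levD[OF assms(1)]
 have [measurable_cong]: "sets nu = sets borel" by (rule L)
 show "sets (scaled a 1 (cball 0 rh) nu) = sets borel" by simp
 show "AE y in scaled a 1 (cball 0 rh) nu. norm y <= 1"
  using assms(2) rh unfolding scaled_def
  by (subst AE_density) (auto simp: indicator_def intro!: AE_I2 split: if_splits)
 have "(\<integral>\<^sup>+y. ennreal ((norm y)^2) \<partial>scaled a 1 (cball 0 rh) nu) = (\<integral>\<^sup>+y. ennreal (a * ((norm y)^2 * indicator (cball 0 rh) y)) \<partial>nu)"
  using assms L(1) by (subst nn_integral_scaled) (auto simp: mult_ac)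
 also have "... = ennreal a * (\<integral>\<^sup>+y. ennreal ((norm y)^2 * indicator (cball 0 rh) y) \<partial>nu)"
  using assms by (intro nn_integral_ennreal_cmult) auto
 also have "... <= ennreal a * ennreal (C * rh powr (2 - 2 * s))" by (intro mult_left_mono L(3) rh) auto
 also have "... <= ennreal a * ennreal (C * 1)"
  using C rh s by (intro mult_left_mono ennreal_leI powr_le1) auto
 finally show "(\<integral>\<^sup>+y. ennreal ((norm y)^2) \<partial>scaled a 1 (cball 0 rh) nu) <= ennreal (a * C)"
  using assms C by (simp add: ennreal_mult)
 fix r :: real and e :: 'a assume r: "0 < r" "r <= 1" "norm e = 1"
 \<comment> \<open>Jumps beyond \<open>rh\<close> are gone, so ellipticity is taken at
   \<open>min r rh\<close>. Both radii are at most 1, hence this is at least \<open>r * rh\<close>,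
   which explains the factor \<open>rh powr (2 - 2 * s)\<close>.\<close>
 define r' where "r' = min r rh"
 have r': "0 < r'" "r' <= r" "r' <= rh" using r rh by (auto simp: r'_def)
 have "r * rh <= r'"
  using mult_right_mono[of r 1 rh] mult_left_mono[of rh 1 r] r rh by (auto simp: r'_def)
 hence "(r * rh) powr (2 - 2 * s) <= r' powr (2 - 2 * s)" using r rh s by (intro powr_mono2) auto
 hence "a * c * (r * rh) powr (2 - 2 * s) <= a * c * r' powr (2 - 2 * s)" using assms c by (intro mult_left_mono) auto
 hence "ennreal (a * (c * rh powr (2 - 2 * s)) * r powr (2 - 2 * s)) <= ennreal (a * (c * r' powr (2 - 2 * s)))"
  using r rh by (intro ennreal_leI) (simp add: powr_mult mult_ac)
 also have "... = ennreal a * ennreal (c * r' powr (2 - 2 * s))" using assms c by (intro ennreal_mult) auto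
 also have "... <= ennreal a * (\<integral>\<^sup>+y. ennreal ((y \<bullet> e)^2 * indicator (cball 0 r') y) \<partial>nu)"
  using r r' by (intro mult_left_mono L(6)) auto
 also have "... = (\<integral>\<^sup>+y. ennreal (a * ((y \<bullet> e)^2 * indicator (cball 0 r') y)) \<partial>nu)"
  using assms by (intro nn_integral_ennreal_cmult[symmetric]) auto
 also have "... <= (\<integral>\<^sup>+y. ennreal (a * (indicator (cball 0 rh) (y /\<^sub>R 1) * ((y \<bullet> e)^2 * indicator (cball 0 r) y))) \<partial>nu)"
  using r' assms by (intro nn_integral_mono ennreal_leI mult_left_mono) (auto simp: indicator_def)
 also have "... = (\<integral>\<^sup>+y. ennreal ((y \<bullet> e)^2 * indicator (cball 0 r) y) \<partial>scaled a 1 (cball 0 rh) nu)"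
  using assms L(1) by (subst nn_integral_scaled) auto
 finally show "ennreal (a * (c * rh powr (2 - 2 * s)) * r powr (2 - 2 * s))
   <= (\<integral>\<^sup>+y. ennreal ((y \<bullet> e)^2 * indicator (cball 0 r) y) \<partial>scaled a 1 (cball 0 rh) nu)" .
qed

lemma small_jumps_trunc1:
 assumes "lev nu"
 shows "small_jumps s (c * rh powr (2 - 2 * s)) C (trunc nu)"
 using small_jumps_trunc[OF assms, of 1] by (simp add: trunc_def)

lemma sym_scaled_trunc:
 assumes "lev nu" "0 < a"
 shows "sym (scaled a 1 (cball 0 rh) nu) [] xi = a * symb nu xi"
 unfolding symb_def sym_def trunc_def using assms levD(1)[OF assms(1)]
 by (subst (1 2) integral_scaled) auto

lemma symb_nonneg: "0 <= symb nu xi"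
 by (simp add: symb_def sym_Nil_nonneg)

lemma symb_0 [simp]: "symb nu 0 = 0"
 by (simp add: symb_def sym_def symint_def)

lemma symb_continuous: "lev nu ==> continuous_on UNIV (symb nu)"
 unfolding symb_def by (rule sym_continuous[OF small_jumps_trunc1 C]) auto

lemma symb_measurable [measurable]: "lev nu ==> symb nu \<in> borel_measurable borel"
 by (intro borel_measurable_continuous_onI symb_continuous)

lemma hsym_measurable [measurable]: "lev nu ==> hsym es j nu sg \<in> borel_measurable borel"
 unfolding hsym_def by measurable

lemma polybd_symb: "lev nu ==> polybd P (%i. symb nu)"
 unfolding polybd_def
 using symb_continuous integrable_symint(2)[OF small_jumps_trunc1 C, of nu "[]"]
 by (intro conjI exI[of _ "2 * C"] exI[of _ 2]) (auto simp: symb_def)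

lemma polybd_power: "polybd P p ==> polybd P (%i x. p i x ^ j)"
 by (induction j) (auto intro: polybd_const polybd_mult)

text \<open>Here the family consists of one measure at all times from \<open>sg0\<close> on; as the
  symbol is nonnegative, the exponential at the earliest time dominates.\<close>

lemma rapid_hsym:
 assumes "lev nu" "0 < sg0"
 shows "rapid {sg0..} (hsym es j nu)"
proof -
 have "rapid {sg0..} (%sg xi. exp (- sym (scaled sg0 1 (cball 0 rh) nu) [] xi))"
  by (rule rapid_exp_sym[OF small_jumps_trunc[OF assms]]) (use assms c C rh s in auto)
 hence r: "rapid {sg0..} (%sg xi. exp (- (sg0 * symb nu xi)))"
  by (simp add: sym_scaled_trunc[OF assms])
 have "rapid {sg0..} (%sg xi. exp (- (sg * symb nu xi)))"
  by (rule rapid_dominated[OF r, of _ 1])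
    (use assms in \<open>auto intro!: mult_right_mono symb_nonneg\<close>)
 hence "rapid {sg0..} (%sg xi. (monom es xi * symb nu xi ^ j) * exp (- (sg * symb nu xi)))"
  by (intro rapid_mult_polybd polybd_mult polybd_monom polybd_power polybd_symb assms)
 thus ?thesis by (simp add: hsym_def[abs_def])
qed

lemma integrable_hsym: "lev nu ==> 0 < sg ==> LI (hsym es j nu sg)"
 by (rule rapid_integrable[OF rapid_hsym]) auto

subsection \<open>Scaling of the kernels\<close>

text \<open>The parabolic order of differentiation: a space derivative counts 1 and a power of the
  symbol, that is a time derivative, counts 2s.\<close>

definition kp :: "'a list => nat => real" where
 "kp es j = real (length es) + 2 * s * real j"

text \<open>By \<open>A_eq\<close> the kernel at time \<open>sg\<close> is a dilation by
  \<open>tau\<close> of a unit-size kernel. The symbol contributes \<open>tau^(- kp es j)\<close>, a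
  weight homogeneous of degree \<open>ga\<close> contributes \<open>tau^ga\<close>, and the powers
  \<open>tau^n\<close> from the changes of variables in frequency and space cancel.\<close>

lemma wint_kern_scaled:
 fixes nu :: "'a::euclidean_space measure"
 assumes w: "weight w" "!!t x. 0 < t ==> w (t *\<^sub>R x) = t powr ga * w x"
  and S: "!!i. i \<in> (PP :: ('a measure \<times> real) set) ==> (\<integral>\<^sup>+y. ennreal (w y) \<partial>bet i) <= ennreal (S i)"
    "!!i. i \<in> (PP :: ('a measure \<times> real) set) ==> 0 <= S i"
 shows "\<exists>D\<ge>0. \<forall>nu sg ph. lev nu --> 0 < sg --> tau sg <= rh -->
  wint w (kern es j ph nu sg) <= ennreal (D * (1 + S (nu, sg)) * tau sg powr (ga - kp es j))"
proof -
 interpret U: unit_family "PP :: ('a measure \<times> real) set" kap s c C bet w S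
  by (rule unit_family_kap_bet[OF w(1) S])
 let ?u = "%i xi. monom es xi * U.A i xi ^ j * exp (- U.A i xi)"
 have good: "U.good ?u" by (rule U.good_tame_A[OF tame_monom])
 obtain D where D: "0 <= D" "!!i ph. i \<in> PP ==> wint w (ft (?u i) ph) <= ennreal (D * (1 + S i))"
  by (rule U.goodE[OF good]) blast
 define c0 where "c0 = ft_const TYPE('a)"
 have c0: "0 < c0" unfolding c0_def by (rule ft_const_pos)
 have [measurable]: "bm w" and wn: "!!x. 0 <= w x" using w by (auto simp: weight_def)
 have "wint w (kern es j ph nu sg) <= ennreal ((D / c0) * (1 + S (nu, sg)) * tau sg powr (ga - kp es j))"
  if "lev nu" "0 < sg" "tau sg <= rh" for nu :: "'a measure" and sg ph
 proof -
  define i where "i = (nu, sg)"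
  have i: "i \<in> PP" using that by (simp add: i_def PP_def)
  define ta where "ta = tau sg"
  have ta: "0 < ta" using that by (simp add: ta_def)
  have tas: "ta powr (2 * s) = sg" using tau_powr[OF that(2)] by (simp add: ta_def)
  have A: "U.A i et = sg * symb nu (et /\<^sub>R ta)" for et
   unfolding U.A_def ta_def by (rule A_eq[OF i_def i])
  have u: "hsym es j nu sg ((1 / ta) *\<^sub>R et) = ta powr (- kp es j) * ?u i et" for et
  proof -
   have e: "et /\<^sub>R ta = (1 / ta) *\<^sub>R et" by (simp add: inverse_eq_divide)
   have "ta powr (- kp es j) = (1 / ta) ^ length es * (1 / sg) ^ j"
   proof -
    have "ta powr (- kp es j) = ta powr (- real (length es)) * (ta powr (- (2 * s))) powr real j"
    proof -
     have "- kp es j = - real (length es) + (- (2 * s)) * real j" by (simp add: kp_def)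
     thus ?thesis by (simp only: powr_add powr_powr)
    qed
    also have "ta powr (- (2 * s)) = 1 / sg" using tas by (simp add: powr_minus inverse_eq_divide)
    also have "ta powr (- real (length es)) = (1 / ta) ^ length es"
     using ta by (simp add: powr_minus powr_realpow power_one_over inverse_eq_divide)
    finally show ?thesis using that by (simp add: powr_realpow)
   qed
   thus ?thesis using that
    by (simp add: hsym_def A e monom_scaleR power_mult_distrib power_one_over)
  qed
  have k: "kern es j ph nu sg x = (ta powr (- kp es j) * (1 / ta) ^ DIM('a) / c0) * ft (?u i) ph ((1 / ta) *\<^sub>R x)" for x
  proof -
   have m: "bm (%xi. hsym es j nu sg xi * cos (x \<bullet> xi + ph))"
    using that by measurable
   have "ft (hsym es j nu sg) ph x = abs (1 / ta) ^ DIM('a) * (LBINT et. hsym es j nu sg (0 + (1 / ta) *\<^sub>R et) * cos (x \<bullet> (0 + (1 / ta) *\<^sub>R et) + ph))"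
    unfolding ft_def using ta by (intro integral_lborel_affine[OF m]) auto
   also have "... = (1 / ta) ^ DIM('a) * (LBINT et. ta powr (- kp es j) * (?u i et * cos (((1 / ta) *\<^sub>R x) \<bullet> et + ph)))"
    unfolding add_0_left u using ta by (simp add: mult.assoc)
   also have "... = (1 / ta) ^ DIM('a) * (ta powr (- kp es j) * ft (?u i) ph ((1 / ta) *\<^sub>R x))"
    by (simp only: ft_def integral_mult_right_zero)
   finally show ?thesis by (simp add: kern_def c0_def mult_ac)
  qed
  have [measurable]: "bm (ft (?u i) ph)"
   by (rule ft_measurable[OF rapidD(1)[OF U.good_rapid[OF good] i]])
  define K where "K = ta powr (- kp es j) * (1 / ta) ^ DIM('a) / c0"
  have K: "0 <= K" using ta c0 by (simp add: K_def)
  have "wint w (kern es j ph nu sg) = (NN x. ennreal (w x * abs (K * ft (?u i) ph ((1 / ta) *\<^sub>R x))))"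
   by (simp only: wint_def k K_def)
  also have "... = ennreal (abs ta ^ DIM('a)) * (NN x. ennreal (w (0 + ta *\<^sub>R x) * abs (K * ft (?u i) ph ((1 / ta) *\<^sub>R (0 + ta *\<^sub>R x)))))"
   by (rule nn_integral_lborel_affine) (use ta in auto)
  also have "(NN x. ennreal (w (0 + ta *\<^sub>R x) * abs (K * ft (?u i) ph ((1 / ta) *\<^sub>R (0 + ta *\<^sub>R x)))))
    = (NN x. ennreal ((ta powr ga * K) * (w x * abs (ft (?u i) ph x))))"
   using ta K w(2)[OF ta] by (simp add: abs_mult mult_ac)
  also have "... = ennreal (ta powr ga * K) * wint w (ft (?u i) ph)"
   unfolding wint_def using K by (intro nn_integral_ennreal_cmult) auto
  also have "ennreal (abs ta ^ DIM('a)) * ... <= ennreal (ta ^ DIM('a)) * (ennreal (ta powr ga * K) * ennreal (D * (1 + S i)))"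
   using ta by (intro mult_mono D i) auto
  also have "... = ennreal (ta ^ DIM('a) * (ta powr ga * K) * (D * (1 + S i)))"
   using K ta D(1) S(2)[OF i] by (simp add: ennreal_mult mult.assoc)
  also have "ta ^ DIM('a) * (ta powr ga * K) * (D * (1 + S i)) = (D / c0) * (1 + S i) * ta powr (ga - kp es j)"
  proof -
   have "ta ^ DIM('a) * (1 / ta) ^ DIM('a) = 1" using ta by (simp flip: power_mult_distrib)
   hence "ta ^ DIM('a) * (ta powr ga * K) = ta powr ga * ta powr (- kp es j) / c0"
    by (simp add: K_def mult_ac)
   thus ?thesis by (simp add: powr_add[symmetric] mult_ac)
  qed
  finally show ?thesis by (simp add: i_def ta_def)
 qed
 thus ?thesis using D(1) c0 by (intro exI[of _ "D / c0"]) auto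
qed

text \<open>The quadratic weight gains only \<open>tau^(2s)\<close> instead of \<open>tau^2\<close>,
  because \<open>1 + S\<close> has size \<open>tau^(2s - 2)\<close> there. For the kernel itself
  this is the familiar second moment of a jump process, linear in the time
  \<open>sg = tau^(2s)\<close>.\<close>

lemma wint_kern:
 "\<exists>D\<ge>0. \<forall>(nu :: 'a::euclidean_space measure) sg ph. lev nu --> 0 < sg --> tau sg <= rh -->
  wint (%x. 1) (kern es j ph nu sg) <= ennreal (D * tau sg powr (- kp es j)) \<and>
  wint (%x. norm x powr al) (kern es j ph nu sg) <= ennreal (D * tau sg powr (al - kp es j)) \<and>
  wint (%x. (norm x)^2) (kern es j ph nu sg) <= ennreal (D * tau sg powr (2 * s - kp es j))"
proof -
 have "\<exists>D\<ge>0. \<forall>(nu :: 'a measure) sg ph. lev nu --> 0 < sg --> tau sg <= rh -->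
  wint (%x. 1) (kern es j ph nu sg) <= ennreal (D * (1 + C) * tau sg powr (0 - kp es j))"
  using wint_kern_scaled[of "%x::'a. 1" 0 "%i. C" es j] weight_1 bet_bounds(1) C by force
 then obtain D1 where D1: "0 <= D1" "!!(nu :: 'a measure) sg ph. lev nu ==> 0 < sg ==> tau sg <= rh ==>
  wint (%x. 1) (kern es j ph nu sg) <= ennreal (D1 * (1 + C) * tau sg powr (0 - kp es j))" by blast
 have "\<exists>D\<ge>0. \<forall>(nu :: 'a measure) sg ph. lev nu --> 0 < sg --> tau sg <= rh -->
  wint (%x. norm x powr al) (kern es j ph nu sg) <= ennreal (D * (1 + C) * tau sg powr (al - kp es j))"
  by (rule wint_kern_scaled[of "%x::'a. norm x powr al" al "%i. C" es j])
    (use weight_powr[OF al(1)] bet_bounds(2) C al in \<open>auto simp: powr_mult\<close>)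
 then obtain D2 where D2: "0 <= D2" "!!(nu :: 'a measure) sg ph. lev nu ==> 0 < sg ==> tau sg <= rh ==>
  wint (%x. norm x powr al) (kern es j ph nu sg) <= ennreal (D2 * (1 + C) * tau sg powr (al - kp es j))" by blast
 have "\<exists>D\<ge>0. \<forall>(nu :: 'a measure) sg ph. lev nu --> 0 < sg --> tau sg <= rh -->
  wint (%x. (norm x)^2) (kern es j ph nu sg) <= ennreal (D * (1 + C * tau (snd (nu, sg)) powr (2 * s - 2)) * tau sg powr (2 - kp es j))"
  by (rule wint_kern_scaled[of "%x::'a. (norm x)^2" 2 "%i. C * tau (snd i) powr (2 * s - 2)" es j])
    (use weight_sq bet_bounds(3) C in \<open>auto simp: power_mult_distrib\<close>)
 then obtain D3 where D3: "0 <= D3" "!!(nu :: 'a measure) sg ph. lev nu ==> 0 < sg ==> tau sg <= rh ==>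
  wint (%x. (norm x)^2) (kern es j ph nu sg) <= ennreal (D3 * (1 + C * tau sg powr (2 * s - 2)) * tau sg powr (2 - kp es j))"
  by auto
 define D where "D = (D1 + D2 + D3) * (1 + C)"
 have le: "D1 * (1 + C) <= D" "D2 * (1 + C) <= D" "D3 * (1 + C) <= D" "0 <= D"
  using D1(1) D2(1) D3(1) C by (auto simp: D_def intro!: mult_right_mono)
 have 3: "D3 * (1 + C * tau sg powr (2 * s - 2)) * tau sg powr (2 - kp es j) <= D * tau sg powr (2 * s - kp es j)"
  if "0 < sg" "tau sg <= rh" for sg
 proof -
  define t where "t = tau sg"
  have t: "0 < t" "t <= 1" using that rh by (auto simp: t_def)
  have "1 <= t powr (2 * s - 2)"
   using t s powr_mono'[of "2 * s - 2" 0 t] by simp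
  hence "1 + C * t powr (2 * s - 2) <= (1 + C) * t powr (2 * s - 2)" by (simp add: distrib_right)
  hence "D3 * (1 + C * t powr (2 * s - 2)) * t powr (2 - kp es j) <= D3 * ((1 + C) * t powr (2 * s - 2)) * t powr (2 - kp es j)"
   using D3(1) by (intro mult_right_mono mult_left_mono) auto
  also have "... = D3 * (1 + C) * (t powr (2 * s - 2) * t powr (2 - kp es j))" by (simp add: mult_ac)
  also have "t powr (2 * s - 2) * t powr (2 - kp es j) = t powr (2 * s - kp es j)" by (simp flip: powr_add)
  also have "D3 * (1 + C) * ... <= D * ..." by (intro mult_right_mono le) auto
  finally show ?thesis by (simp add: t_def)
 qed
 show ?thesis
 proof (intro exI[of _ D] conjI allI impI)
  fix nu :: "'a measure" and sg ph assume a: "lev nu" "0 < sg" "tau sg <= rh"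
  show "wint (%x. 1) (kern es j ph nu sg) <= ennreal (D * tau sg powr (- kp es j))"
   by (rule order_trans[OF D1(2)[OF a]]) (auto intro!: ennreal_leI mult_right_mono le)
  show "wint (%x. norm x powr al) (kern es j ph nu sg) <= ennreal (D * tau sg powr (al - kp es j))"
   by (rule order_trans[OF D2(2)[OF a]]) (auto intro!: ennreal_leI mult_right_mono le)
  show "wint (%x. (norm x)^2) (kern es j ph nu sg) <= ennreal (D * tau sg powr (2 * s - kp es j))"
   by (rule order_trans[OF D3(2)[OF a]]) (intro ennreal_leI 3 a)
 qed (fact le)
qed

lemma kern_measurable [measurable]: "lev nu ==> kern es j ph nu sg \<in> borel_measurable borel"
 unfolding kern_def by measurable

lemma integrable_kern:
 fixes nu :: "'a::euclidean_space measure"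
 assumes "lev nu" "0 < sg" "tau sg <= rh"
 shows "LI (kern es j ph nu sg)"
proof -
 obtain D where "wint (%x. 1) (kern es j ph nu sg) <= ennreal (D * tau sg powr (- kp es j))"
  using wint_kern[where ?'a='a, of es j] assms by blast
 hence "wint (%x. 1) (kern es j ph nu sg) < \<infinity>" by (rule le_less_trans) simp
 thus ?thesis using assms by (simp add: integrable_iff_bounded wint_def)
qed

text \<open>The integral is the symbol at frequency 0, up to the phase. So the kernel has unit mass
  at phase 0 and all its derivatives have mean zero; this cancellation is what converts Hoelder
  continuity of the data into powers of \<open>tau\<close>.\<close>

lemma integral_kern:
 fixes nu :: "'a::euclidean_space measure"
 assumes "lev nu" "0 < sg" "tau sg <= rh"
 shows "(LBINT x. kern es j ph nu sg x) = of_bool (es = [] \<and> j = 0) * cos ph"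
proof -
 obtain B where B: "!!xi. abs (hsym es j nu sg xi) <= B / (1 + norm xi) ^ 0"
  using rapidD(2)[OF rapid_hsym[OF assms(1,2), of es j], of 0] by auto
 have c0: "0 < ft_const TYPE('a)" by (rule ft_const_pos)
 have "LI (%x. ft_const TYPE('a) * kern es j ph nu sg x)"
  using integrable_kern[OF assms] by simp
 hence i: "LI (ft (hsym es j nu sg) ph)" using c0 by (simp add: kern_def)
 have "continuous_on UNIV (hsym es j nu sg)"
  unfolding hsym_def[abs_def] using polybd_monom[of "{()}" es] symb_continuous[OF assms(1)]
  by (intro continuous_intros) (auto simp: polybd_def)
 hence "isCont (hsym es j nu sg) 0" by (simp add: continuous_on_eq_continuous_at)
 from integral_ft[OF integrable_hsym[OF assms(1,2)] _ this i, of B] B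
 have "(LBINT x. ft (hsym es j nu sg) ph x) = ft_const TYPE('a) * hsym es j nu sg 0 * cos ph" by simp
 moreover have "hsym es j nu sg 0 = of_bool (es = [] \<and> j = 0)" by (auto simp: hsym_def monom_0)
 ultimately show ?thesis using c0 by (simp add: kern_def)
qed

end

lemma exp_quadratic_remainder: "abs (exp (u::real) - 1 - u) <= u^2 * exp (abs u)"
proof -
 obtain t where t: "abs t <= abs u" "exp u = (\<Sum>m<2. u ^ m / fact m) + exp t / fact 2 * u ^ 2"
  using Maclaurin_exp_le[of u 2] by auto
 have "exp u - 1 - u = exp t / 2 * u^2" using t(2) by (simp add: numeral_2_eq_2)
 hence "abs (exp u - 1 - u) = abs (exp t / 2 * u^2)" by (rule arg_cong)
 also have "... = u^2 * (exp t / 2)" by (simp add: abs_mult)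
 also have "u^2 * (exp t / 2) <= u^2 * exp (abs u)"
 proof (rule mult_left_mono)
  have "exp t <= exp (abs u)" using t(1) by simp
  thus "exp t / 2 <= exp (abs u)" using exp_gt_zero[of "abs u"] by linarith
 qed simp
 finally show ?thesis .
qed

lemma sigma_finite_of_small_complements:
 fixes M :: "'a::euclidean_space measure"
 assumes "sets M = sets borel" "emeasure M {0} = 0" "!!r. 0 < r ==> emeasure M (- cball 0 r) < \<infinity>"
 shows "sigma_finite_measure M"
proof
 have sp: "space M = UNIV" using sets_eq_imp_space_eq[OF assms(1)] by simp
 let ?A = "insert {0} (range (%n::nat. - cball (0::'a) (1 / real (Suc n))))"
 show "\<exists>A. countable A \<and> A \<subseteq> sets M \<and> \<Union> A = space M \<and> (\<forall>a\<in>A. emeasure M a ~= \<infinity>)"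
 proof (intro exI[of _ ?A] conjI)
  show "\<Union> ?A = space M"
  proof -
   have "\<exists>n. \<not> norm x <= 1 / real (Suc n)" if "x ~= 0" for x :: 'a
    using reals_Archimedean[of "norm x"] that by (auto simp: inverse_eq_divide not_le)
   thus ?thesis unfolding sp by force
  qed
  show "\<forall>a\<in>?A. emeasure M a ~= \<infinity>" using assms(2) assms(3) by (auto simp: less_top[symmetric])
 qed (auto simp: assms(1))
qed

section \<open>Derivatives of the kernels and the truncated operator acting on them\<close>

context stable_setting
begin

lemma sigma_finite_lev: "lev nu ==> sigma_finite_measure nu"
proof (rule sigma_finite_of_small_complements)
 assume l: "lev nu"
 note L = levD[OF l]
 show "sets nu = sets borel" "emeasure nu {0} = 0" by (fact L)+
 fix r :: real assume r: "0 < r"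
 have "emeasure nu (- cball 0 r) = (\<integral>\<^sup>+y. indicator (- cball 0 r) y \<partial>nu)"
  using L(1) by (subst nn_integral_indicator) auto
 also have "... = (\<integral>\<^sup>+y. ennreal (indicator (- cball 0 r) y) \<partial>nu)"
  by (intro nn_integral_cong) (auto simp: indicator_def)
 also have "... < \<infinity>" using L(4)[OF r] by (rule le_less_trans) simp
 finally show "emeasure nu (- cball 0 r) < \<infinity>" .
qed

lemma sigma_finite_trunc: "lev nu ==> sigma_finite_measure (trunc nu)"
proof -
 assume l: "lev nu"
 note L = levD[OF l]
 have [measurable_cong]: "sets nu = sets borel" by (rule L)
 have e: "distr nu borel (%y. y /\<^sub>R 1) = nu" using L(1) by (simp add: distr_id2)
 show ?thesis unfolding trunc_def scaled_def e
  by (subst sigma_finite_measure.sigma_finite_iff_density_finite[OF sigma_finite_lev[OF l]]) auto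
qed

lemma integrable_trunc_sq:
 assumes "lev nu"
 shows "integrable (trunc nu) (%y. (norm y)^2)" "(\<integral>y. (norm y)^2 \<partial>trunc nu) <= C"
 using small_jumpsD(3,4)[OF small_jumps_trunc1[OF assms] C] .

lemma trunc_cong_sets [measurable_cong, simp]: "sets (trunc nu) = sets borel"
 by (simp add: trunc_def)

lemma kern_bounded:
 fixes nu :: "'a::euclidean_space measure"
 assumes "lev nu" "0 < sg"
 shows "\<exists>B\<ge>0. \<forall>ph x. abs (kern es j ph nu sg x) <= B"
proof -
 have c0: "0 < ft_const TYPE('a)" by (rule ft_const_pos)
 let ?B = "(LBINT xi. abs (hsym es j nu sg xi)) / ft_const TYPE('a)"
 have "abs (kern es j ph nu sg x) <= ?B" for ph x
  using abs_ft_le[OF integrable_hsym[OF assms], of es j ph x] c0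
  by (simp add: kern_def divide_right_mono)
 moreover have "0 <= ?B" using c0 by (intro divide_nonneg_pos integral_nonneg_AE AE_I2) auto
 ultimately show ?thesis by blast
qed

text \<open>The Taylor remainder of the exponential costs a factor
  \<open>exp (\<bar>h\<bar> * symb)\<close>, which the decay at time \<open>sg\<close> absorbs as
  long as \<open>\<bar>h\<bar> <= sg / 2\<close>. What is left is the symbol at time
  \<open>sg / 2\<close> with two more powers.\<close>

lemma kern_sigma_remainder:
 fixes nu :: "'a::euclidean_space measure"
 assumes "lev nu" "0 < sg"
 shows "\<exists>B. \<forall>h x. abs h <= sg / 2 -->
  abs (kern es j ph nu (sg + h) x - kern es j ph nu sg x + h * kern es (Suc j) ph nu sg x) <= B * h^2"
proof -
 define c0 where "c0 = ft_const TYPE('a)"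
 have c0: "0 < c0" unfolding c0_def by (rule ft_const_pos)
 define J where "J = (LBINT xi. abs (hsym es (j + 2) nu (sg / 2) xi))"
 have "abs (kern es j ph nu (sg + h) x - kern es j ph nu sg x + h * kern es (Suc j) ph nu sg x) <= (J / c0) * h^2"
  if h: "abs h <= sg / 2" for h x
 proof -
  have sgh: "0 < sg + h" "0 < sg / 2" using h assms by auto
  have i: "LI (%xi. hsym es j nu (sg + h) xi * cos (x \<bullet> xi + ph))"
   "LI (%xi. hsym es j nu sg xi * cos (x \<bullet> xi + ph))"
   "LI (%xi. hsym es (Suc j) nu sg xi * cos (x \<bullet> xi + ph))"
   using assms sgh by (auto intro!: integrable_mult_cos integrable_hsym)
  let ?d = "%xi. hsym es j nu (sg + h) xi * cos (x \<bullet> xi + ph) - hsym es j nu sg xi * cos (x \<bullet> xi + ph)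
    + h * (hsym es (Suc j) nu sg xi * cos (x \<bullet> xi + ph))"
  have bd: "abs (?d xi) <= h^2 * abs (hsym es (j + 2) nu (sg / 2) xi)" for xi
  proof -
   define a where "a = symb nu xi"
   have a: "0 <= a" by (simp add: a_def symb_nonneg)
   define q where "q = monom es xi * a ^ j"
   have e: "exp (- ((sg + h) * a)) = exp (- (sg * a)) * exp (- (h * a))"
    by (simp add: exp_add[symmetric] algebra_simps)
   have "?d xi = q * exp (- (sg * a)) * (exp (- (h * a)) - 1 - (- (h * a))) * cos (x \<bullet> xi + ph)"
    by (simp only: hsym_def a_def[symmetric] e q_def power_Suc) (simp add: algebra_simps)
   hence "abs (?d xi) = abs q * exp (- (sg * a)) * abs (exp (- (h * a)) - 1 - (- (h * a))) * abs (cos (x \<bullet> xi + ph))"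
    by (simp only: abs_mult abs_exp_cancel)
   also have "... <= abs q * exp (- (sg * a)) * ((- (h * a))^2 * exp (abs (- (h * a)))) * 1"
    by (intro mult_mono exp_quadratic_remainder) auto
   also have "... = h^2 * (abs q * a^2 * (exp (- (sg * a)) * exp (abs h * a)))"
    using a by (simp add: power_mult_distrib abs_mult mult_ac)
   also have "exp (- (sg * a)) * exp (abs h * a) <= exp (- (sg / 2 * a))"
    using mult_right_mono[OF h a] by (simp add: exp_add[symmetric] algebra_simps)
   hence "h^2 * (abs q * a^2 * (exp (- (sg * a)) * exp (abs h * a))) <= h^2 * (abs q * a^2 * exp (- (sg / 2 * a)))"
    by (intro mult_left_mono) auto
   also have "abs q * a^2 * exp (- (sg / 2 * a)) = abs (hsym es (j + 2) nu (sg / 2) xi)"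
    using a by (simp add: hsym_def a_def[symmetric] q_def abs_mult power_add power2_eq_square mult_ac)
   finally show ?thesis .
  qed
  have "abs (LBINT xi. ?d xi) <= (LBINT xi. h^2 * abs (hsym es (j + 2) nu (sg / 2) xi))"
  proof (rule abs_integral_le(2))
   show "LI (%xi. h^2 * abs (hsym es (j + 2) nu (sg / 2) xi))"
    using integrable_hsym[OF assms(1) sgh(2), of es "j + 2"] by simp
  qed (use i bd in auto)
  also have "... = J * h^2" by (simp add: J_def)
  finally have "abs (ft (hsym es j nu (sg + h)) ph x - ft (hsym es j nu sg) ph x + h * ft (hsym es (Suc j) nu sg) ph x) <= J * h^2"
   using i by (simp add: ft_def)
  moreover have "kern es j ph nu (sg + h) x - kern es j ph nu sg x + h * kern es (Suc j) ph nu sg x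
   = (ft (hsym es j nu (sg + h)) ph x - ft (hsym es j nu sg) ph x + h * ft (hsym es (Suc j) nu sg) ph x) / c0"
   by (simp add: kern_def c0_def add_divide_distrib diff_divide_distrib)
  ultimately show ?thesis using c0 by (simp add: abs_divide divide_right_mono)
 qed
 thus ?thesis by blast
qed

lemma integrable_hsym_norm2:
 fixes nu :: "'a::euclidean_space measure"
 assumes "lev nu" "0 < sg"
 shows "LI (%xi. (norm xi)^2 * hsym es j nu sg xi)"
proof -
 have "polybd {sg..} (%i (xi::'a). (norm xi)^2)"
  unfolding polybd_def
  by (intro conjI exI[of _ 1] exI[of _ 2]) (auto intro!: continuous_intros power_mono)
 from rapid_integrable[OF rapid_mult_polybd[OF this rapid_hsym[OF assms, of es j]], of sg] show ?thesis by simp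
qed

lemma kern_x_remainder:
 fixes nu :: "'a::euclidean_space measure"
 assumes "lev nu" "0 < sg"
 shows "\<exists>B\<ge>0. \<forall>ph x y.
  abs (kern es j ph nu sg (x + y) - kern es j ph nu sg x - (\<Sum>b\<in>Basis. (y \<bullet> b) * kern (b # es) j (ph + pi/2) nu sg x)) <= B * (norm y)^2"
proof -
 define c0 where "c0 = ft_const TYPE('a)"
 have c0: "0 < c0" unfolding c0_def by (rule ft_const_pos)
 define J where "J = (LBINT xi. abs ((norm xi)^2 * hsym es j nu sg xi))"
 have J: "0 <= J" unfolding J_def by (intro integral_nonneg_AE AE_I2) simp
 have "abs (kern es j ph nu sg (x + y) - kern es j ph nu sg x - (\<Sum>b\<in>Basis. (y \<bullet> b) * kern (b # es) j (ph + pi/2) nu sg x)) <= (J / c0) * (norm y)^2"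
  for ph x y
 proof -
  have i: "LI (%xi. hsym es j nu sg xi * cos (z \<bullet> xi + ph))"
   "LI (%xi. hsym (b # es) j nu sg xi * cos (z \<bullet> xi + (ph + pi/2)))" for z b
   using assms by (auto intro!: integrable_mult_cos integrable_hsym)
  let ?d = "%xi. hsym es j nu sg xi * cos ((x + y) \<bullet> xi + ph) - hsym es j nu sg xi * cos (x \<bullet> xi + ph)
    - (\<Sum>b\<in>Basis. (y \<bullet> b) * (hsym (b # es) j nu sg xi * cos (x \<bullet> xi + (ph + pi/2))))"
  have bd: "abs (?d xi) <= (norm y)^2 * abs ((norm xi)^2 * hsym es j nu sg xi)" for xi
  proof -
   define a where "a = x \<bullet> xi + ph"
   have "(\<Sum>b\<in>Basis. (y \<bullet> b) * (hsym (b # es) j nu sg xi * cos (x \<bullet> xi + (ph + pi/2))))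
    = (\<Sum>b\<in>Basis. (y \<bullet> b) * (xi \<bullet> b)) * (hsym es j nu sg xi * cos (x \<bullet> xi + (ph + pi/2)))"
   proof -
    have "(y \<bullet> b) * (hsym (b # es) j nu sg xi * c) = ((y \<bullet> b) * (xi \<bullet> b)) * (hsym es j nu sg xi * c)" for b c
     by (simp add: hsym_def)
    thus ?thesis by (simp only: sum_distrib_right)
   qed
   also have "(\<Sum>b\<in>Basis. (y \<bullet> b) * (xi \<bullet> b)) = y \<bullet> xi" by (rule euclidean_inner[symmetric])
   finally have S: "(\<Sum>b\<in>Basis. (y \<bullet> b) * (hsym (b # es) j nu sg xi * cos (x \<bullet> xi + (ph + pi/2))))
    = (y \<bullet> xi) * (hsym es j nu sg xi * cos (x \<bullet> xi + (ph + pi/2)))" .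
   have cs: "cos (x \<bullet> xi + (ph + pi/2)) = - sin a"
    using cos_add[of a "pi/2"] by (simp add: a_def add.assoc)
   have "?d xi = hsym es j nu sg xi * (cos (a + y \<bullet> xi) - cos a + (y \<bullet> xi) * sin a)"
    unfolding S unfolding cs by (simp add: a_def inner_add_left algebra_simps)
   hence "abs (?d xi) = abs (hsym es j nu sg xi) * abs (cos (a + y \<bullet> xi) - cos a + (y \<bullet> xi) * sin a)"
    by (simp only: abs_mult)
   also have "... <= abs (hsym es j nu sg xi) * (y \<bullet> xi)^2" by (intro mult_left_mono cos_quadratic_remainder) auto
   also have "... <= abs (hsym es j nu sg xi) * (norm y * norm xi)^2"
   proof (rule mult_left_mono)
    show "(y \<bullet> xi)^2 <= (norm y * norm xi)^2"
     using Cauchy_Schwarz_ineq2[of y xi] by (subst abs_le_square_iff[symmetric]) simp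
   qed simp
   finally show ?thesis by (simp add: abs_mult power_mult_distrib mult_ac)
  qed
  have "abs (LBINT xi. ?d xi) <= (LBINT xi. (norm y)^2 * abs ((norm xi)^2 * hsym es j nu sg xi))"
  proof (rule abs_integral_le(2))
   show "LI (%xi. (norm y)^2 * abs ((norm xi)^2 * hsym es j nu sg xi))"
    by (intro integrable_mult_right integrable_abs integrable_hsym_norm2 assms)
   show "?d \<in> borel_measurable lborel" using i by (intro borel_measurable_diff borel_measurable_sum borel_measurable_times borel_measurable_integrable) auto
  qed (use bd in auto)
  also have "... = (norm y)^2 * J" by (simp only: J_def integral_mult_right_zero)
  also have "(LBINT xi. ?d xi) = ft (hsym es j nu sg) ph (x + y) - ft (hsym es j nu sg) ph x
    - (\<Sum>b\<in>Basis. (y \<bullet> b) * ft (hsym (b # es) j nu sg) (ph + pi/2) x)"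
   using i by (simp add: ft_def Bochner_Integration.integral_diff Bochner_Integration.integral_sum)
  finally have "abs (ft (hsym es j nu sg) ph (x + y) - ft (hsym es j nu sg) ph x
    - (\<Sum>b\<in>Basis. (y \<bullet> b) * ft (hsym (b # es) j nu sg) (ph + pi/2) x)) <= (norm y)^2 * J" .
  moreover have "kern es j ph nu sg (x + y) - kern es j ph nu sg x - (\<Sum>b\<in>Basis. (y \<bullet> b) * kern (b # es) j (ph + pi/2) nu sg x)
   = (ft (hsym es j nu sg) ph (x + y) - ft (hsym es j nu sg) ph x
    - (\<Sum>b\<in>Basis. (y \<bullet> b) * ft (hsym (b # es) j nu sg) (ph + pi/2) x)) / c0"
   by (simp add: kern_def c0_def diff_divide_distrib sum_divide_distrib)
  ultimately show ?thesis using c0 by (simp add: abs_divide divide_right_mono mult.commute)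
 qed
 thus ?thesis using J c0 by (intro exI[of _ "J / c0"]) auto
qed

lemma kern_second_difference:
 fixes nu :: "'a::euclidean_space measure"
 assumes "lev nu" "0 < sg"
 shows "\<exists>B\<ge>0. \<forall>ph x y.
  abs (kern es j ph nu sg (x + y) + kern es j ph nu sg (x - y) - 2 * kern es j ph nu sg x) <= B * (norm y)^2"
proof -
 obtain B where B: "0 <= B" "!!ph x y.
  abs (kern es j ph nu sg (x + y) - kern es j ph nu sg x - (\<Sum>b\<in>Basis. (y \<bullet> b) * kern (b # es) j (ph + pi/2) nu sg x)) <= B * (norm y)^2"
  using kern_x_remainder[OF assms, of es j] by blast
 have "abs (kern es j ph nu sg (x + y) + kern es j ph nu sg (x - y) - 2 * kern es j ph nu sg x) <= (2 * B) * (norm y)^2" for ph x y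
  using B(2)[of ph x y] B(2)[of ph x "- y"] by (simp add: sum_negf)
 thus ?thesis using B(1) by (intro exI[of _ "2 * B"]) auto
qed

text \<open>A second difference in direction y multiplies the symbol by - 2 (1 - cos (y . xi)),
  whose integral over the truncated jumps is minus the symbol. Together with the derivative in
  \<open>sg\<close> this is the heat equation for the kernel; Fubini is justified by the factor
  |y|^2 |xi|^2.\<close>

lemma trunc_kern:
 fixes nu :: "'a::euclidean_space measure"
 assumes "lev nu" "0 < sg"
 shows "integrable (trunc nu) (%y. kern es j ph nu sg (x + y) + kern es j ph nu sg (x - y) - 2 * kern es j ph nu sg x)"
  "(\<integral>y. kern es j ph nu sg (x + y) + kern es j ph nu sg (x - y) - 2 * kern es j ph nu sg x \<partial>trunc nu) = - kern es (Suc j) ph nu sg x"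
proof -
 define c0 where "c0 = ft_const TYPE('a)"
 have c0: "0 < c0" unfolding c0_def by (rule ft_const_pos)
 note [measurable] = kern_measurable[OF assms(1)] hsym_measurable[OF assms(1)]
 obtain B where B: "!!ph x y. abs (kern es j ph nu sg (x + y) + kern es j ph nu sg (x - y) - 2 * kern es j ph nu sg x) <= B * (norm y)^2"
  using kern_second_difference[OF assms, of es j] by blast
 show "integrable (trunc nu) (%y. kern es j ph nu sg (x + y) + kern es j ph nu sg (x - y) - 2 * kern es j ph nu sg x)"
  by (rule integrable_bound_real[OF integrable_mult_right[OF integrable_trunc_sq(1)[OF assms(1)], of B]]) (use B in auto)
 interpret T: sigma_finite_measure "trunc nu" by (rule sigma_finite_trunc[OF assms(1)])
 interpret TL: pair_sigma_finite "trunc nu" lborel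
  by (rule pair_sigma_finite.intro) (auto intro: sigma_finite_lborel T.sigma_finite_measure_axioms)
 let ?H = "hsym es j nu sg"
 let ?f = "%y xi. symint [] xi y * (?H xi * cos (x \<bullet> xi + ph))"
 have ih: "LI (%xi. ?H xi * cos (z \<bullet> xi + ph))" for z
  by (intro integrable_mult_cos integrable_hsym assms)
 have tr: "ft ?H ph (x + y) + ft ?H ph (x - y) - 2 * ft ?H ph x = - (LBINT xi. ?f y xi)" for y
 proof -
  have "?H xi * cos ((x + y) \<bullet> xi + ph) + ?H xi * cos ((x - y) \<bullet> xi + ph) - 2 * (?H xi * cos (x \<bullet> xi + ph)) = - ?f y xi" for xi
  proof -
   have e: "(x + y) \<bullet> xi + ph = (x \<bullet> xi + ph) + y \<bullet> xi" "(x - y) \<bullet> xi + ph = (x \<bullet> xi + ph) - y \<bullet> xi"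
    by (simp_all add: inner_add_left inner_diff_left)
   show ?thesis unfolding e cos_add[of "x \<bullet> xi + ph" "y \<bullet> xi"] cos_diff[of "x \<bullet> xi + ph" "y \<bullet> xi"]
    by (simp add: symint_def algebra_simps)
  qed
  hence "(LBINT xi. - ?f y xi) = (LBINT xi. ?H xi * cos ((x + y) \<bullet> xi + ph) + ?H xi * cos ((x - y) \<bullet> xi + ph) - 2 * (?H xi * cos (x \<bullet> xi + ph)))"
   by simp
  also have "... = ft ?H ph (x + y) + ft ?H ph (x - y) - 2 * ft ?H ph x"
   unfolding ft_def using ih by (subst Bochner_Integration.integral_diff) auto
  finally show ?thesis by simp
 qed
 have smb: "(%p. symint [] (snd p) (fst p)) \<in> borel_measurable (trunc nu \<Otimes>\<^sub>M lborel)"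
  unfolding symint_def by measurable
 have bd: "abs (?f y xi) <= 2 * (norm y)^2 * abs ((norm xi)^2 * ?H xi)" for y xi
 proof -
  have "(abs (y \<bullet> xi))^2 <= (norm y * norm xi)^2" by (intro power_mono Cauchy_Schwarz_ineq2) auto
  hence s2: "abs (symint [] xi y) <= 2 * ((norm y)^2 * (norm xi)^2)"
   using one_minus_cos_le[of "y \<bullet> xi"] by (simp add: symint_def power_mult_distrib)
  have "abs (symint [] xi y) * (abs (?H xi) * abs (cos (x \<bullet> xi + ph))) <= (2 * ((norm y)^2 * (norm xi)^2)) * (abs (?H xi) * 1)"
   by (intro mult_mono s2) auto
  thus ?thesis by (simp add: abs_mult mult_ac)
 qed
 have iN: "LI (%xi. 2 * (norm y)^2 * abs ((norm xi)^2 * ?H xi))" for y :: 'a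
  by (intro integrable_mult_right integrable_abs integrable_hsym_norm2 assms)
 have int: "integrable (trunc nu \<Otimes>\<^sub>M lborel) (%(y, xi). ?f y xi)"
 proof (rule TL.Fubini_integrable)
  show "(%(y, xi). ?f y xi) \<in> borel_measurable (trunc nu \<Otimes>\<^sub>M lborel)"
   using smb by (simp add: case_prod_unfold)
  show "AE y in trunc nu. LI (%xi. case (y, xi) of (y, xi) => ?f y xi)"
  proof (rule AE_I2)
   fix y
   have "(%xi. ?f y xi) \<in> borel_measurable lborel" unfolding symint_def by measurable
   thus "LI (%xi. case (y, xi) of (y, xi) => ?f y xi)"
    unfolding prod.case by (rule integrable_bound_real[OF iN[of y]]) (rule bd)
  qed
  show "integrable (trunc nu) (%y. \<integral>xi. norm (case (y, xi) of (y, xi) => ?f y xi) \<partial>lborel)"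
  proof (rule integrable_bound_real[OF integrable_mult_right[OF integrable_trunc_sq(1)[OF assms(1)], of "2 * (LBINT xi. abs ((norm xi)^2 * ?H xi))"]])
   show "(%y. \<integral>xi. norm (case (y, xi) of (y, xi) => ?f y xi) \<partial>lborel) \<in> borel_measurable (trunc nu)"
    unfolding symint_def by measurable
   fix y
   have "(%xi. ?f y xi) \<in> borel_measurable lborel" unfolding symint_def by measurable
   hence "abs (LBINT xi. norm (?f y xi)) <= (LBINT xi. 2 * (norm y)^2 * abs ((norm xi)^2 * ?H xi))"
    using bd by (intro abs_integral_le(2)[OF iN]) auto
   also have "... = 2 * (norm y)^2 * (LBINT xi. abs ((norm xi)^2 * ?H xi))" by (rule integral_mult_right_zero)
   finally show "abs (LBINT xi. norm (case (y, xi) of (y, xi) => ?f y xi))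
     <= 2 * (LBINT xi. abs ((norm xi)^2 * ?H xi)) * (norm y)^2" by (simp add: mult_ac)
  qed
 qed
 have "(\<integral>y. (LBINT xi. ?f y xi) \<partial>trunc nu) = (LBINT xi. (\<integral>y. ?f y xi \<partial>trunc nu))"
  by (rule TL.Fubini_integral[OF int, symmetric])
 also have "... = (LBINT xi. hsym es (Suc j) nu sg xi * cos (x \<bullet> xi + ph))"
  by (simp add: symb_def[symmetric] sym_def[symmetric] hsym_def mult_ac)
 finally have F: "(\<integral>y. (LBINT xi. ?f y xi) \<partial>trunc nu) = ft (hsym es (Suc j) nu sg) ph x" by (simp add: ft_def)
 have "(\<integral>y. kern es j ph nu sg (x + y) + kern es j ph nu sg (x - y) - 2 * kern es j ph nu sg x \<partial>trunc nu)
   = (\<integral>y. (- 1 / c0) * (LBINT xi. ?f y xi) \<partial>trunc nu)"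
 proof (intro Bochner_Integration.integral_cong refl)
  fix y
  have "kern es j ph nu sg (x + y) + kern es j ph nu sg (x - y) - 2 * kern es j ph nu sg x
    = (ft ?H ph (x + y) + ft ?H ph (x - y) - 2 * ft ?H ph x) / c0"
   by (simp add: kern_def c0_def add_divide_distrib diff_divide_distrib)
  thus "kern es j ph nu sg (x + y) + kern es j ph nu sg (x - y) - 2 * kern es j ph nu sg x
    = (- 1 / c0) * (LBINT xi. ?f y xi)" unfolding tr by simp
 qed
 also have "... = (- 1 / c0) * (\<integral>y. (LBINT xi. ?f y xi) \<partial>trunc nu)" by (rule integral_mult_right_zero)
 also have "... = - kern es (Suc j) ph nu sg x" unfolding F by (simp add: kern_def c0_def)
 finally show "(\<integral>y. kern es j ph nu sg (x + y) + kern es j ph nu sg (x - y) - 2 * kern es j ph nu sg x \<partial>trunc nu) = - kern es (Suc j) ph nu sg x" .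
qed

end

subsection \<open>Commutators with a cutoff\<close>

text \<open>The commutator only sees a kernel away from its pole. Evaluation points have norm at
  most 1/2 and jumps have length at most 1/16, so the cutoff looks constant within distance 1/8; a
  shift by one jump shrinks this radius to 1/16.\<close>

definition tail_int :: "('a::euclidean_space => real) => ennreal" where
 "tail_int k = (NN z. ennreal (indicator (- ball 0 (1/16)) z * abs (k z)))"

lemma ball_measurable [measurable]: "ball x r \<in> sets borel"
 by simp

text \<open>Chebyshev with 256 = 16^2. The quadratic weight is chosen because its gain
  \<open>tau^(2s)\<close> compensates the loss \<open>tau^(- 2s)\<close> from the number of jumps of
  length about \<open>tau\<close>.\<close>

lemma tail_int_le:
 assumes [measurable]: "bm k"
 shows "tail_int k <= ennreal 256 * wint (%x. (norm x)^2) k"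
proof -
 have "tail_int k <= (NN z. ennreal (256 * ((norm z)^2 * abs (k z))))"
  unfolding tail_int_def
 proof (intro nn_integral_mono ennreal_leI)
  fix z :: 'a
  show "indicator (- ball 0 (1/16)) z * abs (k z) <= 256 * ((norm z)^2 * abs (k z))"
  proof (cases "norm z < 1/16")
   case False
   hence "(1/16)^2 <= (norm z)^2" by (intro power_mono) auto
   hence "1 <= 256 * (norm z)^2" by (simp add: power2_eq_square)
   from mult_right_mono[OF this, of "abs (k z)"] show ?thesis by (simp add: indicator_def)
  qed (simp add: indicator_def)
 qed
 also have "... = ennreal 256 * wint (%x. (norm x)^2) k"
  unfolding wint_def by (subst nn_integral_cmult[symmetric]) (auto simp: ennreal_mult')
 finally show ?thesis .
qed

lemma tail_int_shift:
 assumes [measurable]: "bm k" and y: "norm y <= 1/16"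
 shows "(NN z. ennreal (indicator (- ball 0 (1/8)) z * abs (k (z + y)))) <= tail_int k"
proof -
 have "(NN z. ennreal (indicator (- ball 0 (1/8)) z * abs (k (z + y))))
  <= (NN z. ennreal (indicator (- ball 0 (1/16)) (z + y) * abs (k (z + y))))"
 proof (intro nn_integral_mono ennreal_leI mult_right_mono)
  fix z :: 'a
  show "indicator (- ball 0 (1/8)) z <= (indicator (- ball 0 (1/16)) (z + y) :: real)"
   using y norm_triangle_ineq4[of "z + y" y] by (auto simp: indicator_def)
 qed auto
 also have "... = tail_int k"
  unfolding tail_int_def by (rule nn_integral_translate(1)[of "%z. ennreal (indicator (- ball 0 (1/16)) z * abs (k z))"]) simp
 finally show ?thesis .
qed

text \<open>The increment is an integral of derivatives over the segment from z to z + y. Every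
  point of the segment is a shift by at most 1/16, so each slice is bounded by a tail
  integral.\<close>

lemma tail_int_difference:
 fixes k :: "'a::euclidean_space => real"
 assumes der: "!!z y. ((%t. k (z + t *\<^sub>R y)) has_real_derivative (\<Sum>b\<in>Basis. (y \<bullet> b) * k' b z)) (at 0)"
  and cont: "continuous_on UNIV k" "!!b. b \<in> Basis ==> continuous_on UNIV (k' b)"
  and y: "norm y <= 1/16"
 shows "(NN z. ennreal (indicator (- ball 0 (1/8)) z * abs (k (z + y) - k z)))
  <= ennreal (norm y) * (\<Sum>b\<in>Basis. tail_int (k' b))"
proof -
 have [measurable]: "bm k" using cont(1) by (rule borel_measurable_continuous_onI)
 have mb [measurable]: "b \<in> Basis ==> k' b \<in> borel_measurable borel" for b
  using cont(2) by (rule borel_measurable_continuous_onI)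
 define D where "D z = (\<Sum>b\<in>Basis. (y \<bullet> b) * k' b z)" for z
 have contD: "continuous_on UNIV D" unfolding D_def by (intro continuous_intros cont)
 have dt: "((%t. k (z + t *\<^sub>R y)) has_real_derivative D (z + t *\<^sub>R y)) (at t)" for z t
 proof -
  have "((%w. k ((z + t *\<^sub>R y) + (w - t) *\<^sub>R y)) has_real_derivative D (z + t *\<^sub>R y)) (at t)"
   using DERIV_chain2[of "%w. k ((z + t *\<^sub>R y) + w *\<^sub>R y)" "D (z + t *\<^sub>R y)" "%w. w - t" t 1 UNIV]
   der[of "z + t *\<^sub>R y" y] by (simp add: DERIV_diff[OF DERIV_ident DERIV_const, simplified] D_def)
  moreover have "(z + t *\<^sub>R y) + (w - t) *\<^sub>R y = z + w *\<^sub>R y" for w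
   by (simp add: algebra_simps)
  ultimately show ?thesis by simp
 qed
 have pt: "ennreal (abs (k (z + y) - k z)) <= (NN t. ennreal (indicator {0..1} t * (norm y * (\<Sum>b\<in>Basis. abs (k' b (z + t *\<^sub>R y))))))" for z
 proof -
  have c: "continuous_on {0..1} (%t. D (z + t *\<^sub>R y))"
   by (intro continuous_on_compose2[OF contD] continuous_intros) auto
  have "(LBINT t. indicator {0..1} t *\<^sub>R D (z + t *\<^sub>R y)) = k (z + 1 *\<^sub>R y) - k (z + 0 *\<^sub>R y)"
   by (rule integral_FTC_atLeastAtMost)
     (auto intro!: c has_field_derivative_at_within dt simp flip: has_real_derivative_iff_has_vector_derivative)
  moreover have "LI (%t. indicator {0..1} t *\<^sub>R D (z + t *\<^sub>R y))"
   using borel_integrable_atLeastAtMost'[OF c] unfolding set_integrable_def .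
  ultimately have "ennreal (abs (k (z + y) - k z)) <= (NN t. ennreal (norm (indicator {0..1} t *\<^sub>R D (z + t *\<^sub>R y))))"
   using integral_norm_bound_ennreal[of lborel "%t. indicator {0..1} t *\<^sub>R D (z + t *\<^sub>R y)"] by simp
  also have "... <= (NN t. ennreal (indicator {0..1} t * (norm y * (\<Sum>b\<in>Basis. abs (k' b (z + t *\<^sub>R y))))))"
  proof (intro nn_integral_mono ennreal_leI)
   fix t :: real
   have "abs (D w) <= norm y * (\<Sum>b\<in>Basis. abs (k' b w))" for w
    unfolding D_def sum_distrib_left
    by (rule order_trans[OF sum_abs]) (auto simp: abs_mult intro!: sum_mono mult_right_mono Basis_le_norm)
   thus "norm (indicator {0..1} t *\<^sub>R D (z + t *\<^sub>R y)) <= indicator {0..1} t * (norm y * (\<Sum>b\<in>Basis. abs (k' b (z + t *\<^sub>R y))))"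
    by (auto simp: indicator_def)
  qed
  finally show ?thesis .
 qed
 let ?I = "indicator (- ball (0::'a) (1/8)) :: 'a => real"
 have "(NN z. ennreal (?I z * abs (k (z + y) - k z)))
  <= (NN z. (NN t. (\<Sum>b\<in>Basis. ennreal (norm y) * ennreal (indicator {0..1} t * (?I z * abs (k' b (z + t *\<^sub>R y)))))))"
 proof (rule nn_integral_mono)
  fix z :: 'a
  have "ennreal (?I z * abs (k (z + y) - k z)) = ennreal (?I z) * ennreal (abs (k (z + y) - k z))" by (intro ennreal_mult) auto
  also have "... <= ennreal (?I z) * (NN t. ennreal (indicator {0..1} t * (norm y * (\<Sum>b\<in>Basis. abs (k' b (z + t *\<^sub>R y))))))"
   by (intro mult_left_mono pt) auto
  also have "... = (NN t. ennreal (?I z) * ennreal (indicator {0..1} t * (norm y * (\<Sum>b\<in>Basis. abs (k' b (z + t *\<^sub>R y))))))"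
   by (rule nn_integral_cmult[symmetric]) measurable
  also have "... = (NN t. (\<Sum>b\<in>Basis. ennreal (norm y) * ennreal (indicator {0..1} t * (?I z * abs (k' b (z + t *\<^sub>R y))))))"
  proof (intro nn_integral_cong)
   fix t :: real
   have "ennreal (?I z) * ennreal (indicator {0..1} t * (norm y * (\<Sum>b\<in>Basis. abs (k' b (z + t *\<^sub>R y)))))
    = ennreal (\<Sum>b\<in>Basis. norm y * (indicator {0..1} t * (?I z * abs (k' b (z + t *\<^sub>R y)))))"
    by (subst ennreal_mult[symmetric]) (auto simp: sum_distrib_left mult_ac intro!: sum_nonneg)
   also have "... = (\<Sum>b\<in>Basis. ennreal (norm y) * ennreal (indicator {0..1} t * (?I z * abs (k' b (z + t *\<^sub>R y)))))"
    by (subst sum_ennreal[symmetric]) (auto simp: ennreal_mult)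
   finally show "ennreal (?I z) * ennreal (indicator {0..1} t * (norm y * (\<Sum>b\<in>Basis. abs (k' b (z + t *\<^sub>R y))))) = ..." .
  qed
  finally show "ennreal (?I z * abs (k (z + y) - k z))
   <= (NN t. (\<Sum>b\<in>Basis. ennreal (norm y) * ennreal (indicator {0..1} t * (?I z * abs (k' b (z + t *\<^sub>R y))))))" .
 qed
 also have "... = (NN t. (NN z. (\<Sum>b\<in>Basis. ennreal (norm y) * ennreal (indicator {0..1} t * (?I z * abs (k' b (z + t *\<^sub>R y)))))))"
  by (rule lborel_pair.Fubini') measurable
 also have "... <= (NN t. indicator {0..1::real} t * (ennreal (norm y) * (\<Sum>b\<in>Basis. tail_int (k' b))))"
 proof (rule nn_integral_mono)
  fix t :: real
  show "(NN z. (\<Sum>b\<in>Basis. ennreal (norm y) * ennreal (indicator {0..1} t * (?I z * abs (k' b (z + t *\<^sub>R y))))))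
   <= indicator {0..1::real} t * (ennreal (norm y) * (\<Sum>b\<in>Basis. tail_int (k' b)))"
  proof (cases "t \<in> {0..1}")
   case True
   have ty: "norm (t *\<^sub>R y) <= 1/16"
    using True y mult_mono[of "abs t" 1 "norm y" "1/16"] by simp
   have "(NN z. (\<Sum>b\<in>Basis. ennreal (norm y) * ennreal (indicator {0..1} t * (?I z * abs (k' b (z + t *\<^sub>R y))))))
    = (\<Sum>b\<in>Basis. ennreal (norm y) * (NN z. ennreal (?I z * abs (k' b (z + t *\<^sub>R y)))))"
    using True by (subst nn_integral_sum) (auto simp: nn_integral_cmult)
   also have "... <= (\<Sum>b\<in>Basis. ennreal (norm y) * tail_int (k' b))"
    by (intro sum_mono mult_left_mono tail_int_shift ty mb) auto
   also have "... = indicator {0..1::real} t * (ennreal (norm y) * (\<Sum>b\<in>Basis. tail_int (k' b)))"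
    using True by (simp add: sum_distrib_left)
   finally show ?thesis .
  qed simp
 qed
 also have "... = ennreal (norm y) * (\<Sum>b\<in>Basis. tail_int (k' b))"
  by (subst nn_integral_multc) auto
 finally show ?thesis .
qed

text \<open>A discrete product rule: each term on the right carries either two first differences or
  one second difference, hence two powers of the increment.\<close>

lemma sphere_second_difference_product:
 fixes a b c :: real
 shows "abs ((z1 - z0) * g1 + (z2 - z0) * g2) <= abs (z1 - z0) * abs (g1 - g0) + abs (z2 - z0) * abs (g2 - g0) + abs (z1 + z2 - 2 * z0) * abs (g0::real)"
proof -
 have "(z1 - z0) * g1 + (z2 - z0) * g2 = (z1 - z0) * (g1 - g0) + (z2 - z0) * (g2 - g0) + (z1 + z2 - 2 * z0) * g0"
  by (simp add: algebra_simps)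
 thus ?thesis by (simp add: abs_mult[symmetric])
qed

text \<open>The radii leave room on both sides: 3/4 exceeds the evaluation radius 1/2 by more than
  the kernel shifts in use, and 7/8 keeps truncated jumps and the mollification inside the unit
  ball. Regularity is recorded as bounds on first and second differences, the form in which the
  commutator meets it.\<close>

definition cutoff :: "real => ('a::euclidean_space => real) => bool" where
 "cutoff Z ze \<longleftrightarrow> 0 <= Z \<and> (\<forall>x. abs (ze x) <= 1) \<and> (\<forall>x y. abs (ze x - ze y) <= Z * norm (x - y)) \<and>
  (\<forall>x y. abs (ze (x + y) + ze (x - y) - 2 * ze x) <= Z * (norm y)^2) \<and>
  (\<forall>x. norm x <= 3/4 --> ze x = 1) \<and> (\<forall>x. 7/8 <= norm x --> ze x = 0)"

lemma cutoffD:
 assumes "cutoff Z ze"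
 shows "0 <= Z" "abs (ze x) <= 1" "abs (ze x - ze y) <= Z * norm (x - y)"
  "abs (ze (x + y) + ze (x - y) - 2 * ze x) <= Z * (norm y)^2"
  "norm x <= 3/4 ==> ze x = 1" "7/8 <= norm x ==> ze x = 0"
 using assms unfolding cutoff_def by blast+

lemma cutoff_measurable: "cutoff Z ze ==> ze \<in> borel_measurable borel"
proof (rule borel_measurable_continuous_onI)
 assume c: "cutoff Z ze"
 show "continuous_on UNIV ze"
  unfolding continuous_on_def
 proof
  fix x
  have "((%y. ze y - ze x) \<longlongrightarrow> 0) (at x within UNIV)"
  proof (rule Lim_null_comparison)
   show "\<forall>\<^sub>F y in at x. norm (ze y - ze x) <= Z * norm (y - x)"
    using cutoffD(3)[OF c] by (intro always_eventually) auto
   show "((%y. Z * norm (y - x)) \<longlongrightarrow> 0) (at x)" by (auto intro!: tendsto_eq_intros)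
  qed
  thus "(ze \<longlongrightarrow> ze x) (at x within UNIV)" by (simp add: LIM_zero_iff)
 qed
qed

context stable_setting
begin

lemma kern_has_derivative:
 fixes nu :: "'a::euclidean_space measure"
 assumes "lev nu" "0 < sg"
 shows "(kern es j ph nu sg has_derivative (%y. \<Sum>b\<in>Basis. (y \<bullet> b) * kern (b # es) j (ph + pi/2) nu sg x)) (at x)"
proof -
 obtain B where B: "!!ph x y.
  abs (kern es j ph nu sg (x + y) - kern es j ph nu sg x - (\<Sum>b\<in>Basis. (y \<bullet> b) * kern (b # es) j (ph + pi/2) nu sg x)) <= B * (norm y)^2"
  using kern_x_remainder[OF assms, of es j] by blast
 show ?thesis
  by (rule has_derivative_of_quadratic_remainder[of _ 1])
    (use B in \<open>auto intro!: bounded_linear_sum bounded_linear_mult_const bounded_linear_inner_left\<close>)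
qed

lemma kern_continuous: "lev nu ==> 0 < sg ==> continuous_on UNIV (kern es j ph nu sg)"
 using kern_has_derivative by (intro has_derivative_continuous_on) (blast intro: has_derivative_at_withinI)

lemma kern_directional:
 fixes nu :: "'a::euclidean_space measure"
 assumes "lev nu" "0 < sg"
 shows "((%t. kern es j ph nu sg (z + t *\<^sub>R y)) has_real_derivative
  (\<Sum>b\<in>Basis. (y \<bullet> b) * kern (b # es) j (ph + pi/2) nu sg z)) (at 0)"
proof -
 obtain B where B: "!!ph x y.
  abs (kern es j ph nu sg (x + y) - kern es j ph nu sg x - (\<Sum>b\<in>Basis. (y \<bullet> b) * kern (b # es) j (ph + pi/2) nu sg x)) <= B * (norm y)^2"
  using kern_x_remainder[OF assms, of es j] by blast
 show ?thesis
 proof (rule has_real_derivative_of_quadratic_remainder[where d=1 and B = "B * (norm y)^2"])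
  fix h :: real
  have "(\<Sum>b\<in>Basis. ((h *\<^sub>R y) \<bullet> b) * kern (b # es) j (ph + pi/2) nu sg z) = h * (\<Sum>b\<in>Basis. (y \<bullet> b) * kern (b # es) j (ph + pi/2) nu sg z)"
   by (simp add: sum_distrib_left mult.assoc)
  thus "abs (kern es j ph nu sg (z + (0 + h) *\<^sub>R y) - kern es j ph nu sg (z + 0 *\<^sub>R y)
    - h * (\<Sum>b\<in>Basis. (y \<bullet> b) * kern (b # es) j (ph + pi/2) nu sg z)) <= B * (norm y)^2 * h^2"
   using B[of ph z "h *\<^sub>R y"] by (simp add: power_mult_distrib mult_ac)
 qed simp
qed

text \<open>The commutator of multiplication by the cutoff with the truncated operator.\<close>

definition comm :: "('a::euclidean_space => real) => 'a measure => ('a => real) => 'a => real" where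
 "comm ze nu g x = ze x * (\<integral>y. g (x + y) + g (x - y) - 2 * g x \<partial>trunc nu) -
   (\<integral>y. ze (x + y) * g (x + y) + ze (x - y) * g (x - y) - 2 * (ze x * g x) \<partial>trunc nu)"

definition commint :: "('a::euclidean_space => real) => ('a => real) => 'a => 'a => real" where
 "commint ze g x y = (ze (x + y) - ze x) * g (x + y) + (ze (x - y) - ze x) * g (x - y)"

text \<open>A C^(1,1) bound in difference form. Its constant may depend on the measure and on the
  time; it serves integrability and differentiation under the integral and never enters the
  estimates.\<close>

definition nice :: "real => ('a::euclidean_space => real) => bool" where
 "nice B g \<longleftrightarrow> 0 <= B \<and> (\<forall>x. abs (g x) <= B) \<and> (\<forall>x y. abs (g (x + y) - g x) <= B * norm y) \<and>
   (\<forall>x y. abs (g (x + y) + g (x - y) - 2 * g x) <= B * (norm y)^2)"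

lemma niceD:
 assumes "nice B g"
 shows "0 <= B" "abs (g x) <= B" "abs (g (x + y) - g x) <= B * norm y" "abs (g (x - y) - g x) <= B * norm y"
  "abs (g (x + y) + g (x - y) - 2 * g x) <= B * (norm y)^2"
proof -
 have "abs (g (x + - y) - g x) <= B * norm (- y)" using assms unfolding nice_def by blast
 thus "abs (g (x - y) - g x) <= B * norm y" by simp
qed (use assms in \<open>auto simp: nice_def\<close>)

lemma nice_reflect: "nice B g ==> nice B (%x. g (z - x))"
proof -
 assume n: "nice B g"
 have "abs (g (z - (x + y)) - g (z - x)) <= B * norm y" for x y
  using niceD(4)[OF n, of "z - x" y] by (simp add: algebra_simps)
 moreover have "abs (g (z - (x + y)) + g (z - (x - y)) - 2 * g (z - x)) <= B * (norm y)^2" for x y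
  using niceD(5)[OF n, of "z - x" y] by (simp add: algebra_simps)
 ultimately show ?thesis using niceD(1,2)[OF n] by (simp add: nice_def)
qed

lemma nice_kern:
 fixes nu :: "'a::euclidean_space measure"
 assumes "lev nu" "0 < sg"
 shows "\<exists>B. nice B (kern es j ph nu sg)"
proof -
 obtain B0 where B0: "0 <= B0" "!!x. abs (kern es j ph nu sg x) <= B0" using kern_bounded[OF assms, of es j] by blast
 have "\<forall>b. \<exists>B. 0 <= B \<and> (\<forall>x. abs (kern (b # es) j (ph + pi/2) nu sg x) <= B)" using kern_bounded[OF assms] by blast
 then obtain B1 where B1: "!!b. 0 <= B1 b" "!!b x. abs (kern (b # es) j (ph + pi/2) nu sg x) <= B1 b" by metis
 obtain B where B: "0 <= B" "!!x y. abs (kern es j ph nu sg (x + y) - kern es j ph nu sg x - (\<Sum>b\<in>Basis. (y \<bullet> b) * kern (b # es) j (ph + pi/2) nu sg x)) <= B * (norm y)^2"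
  using kern_x_remainder[OF assms, of es j] by blast
 obtain B2 where B2: "0 <= B2" "!!x y. abs (kern es j ph nu sg (x + y) + kern es j ph nu sg (x - y) - 2 * kern es j ph nu sg x) <= B2 * (norm y)^2"
  using kern_second_difference[OF assms, of es j] by blast
 define S where "S = (\<Sum>b\<in>Basis. B1 b)"
 have S: "0 <= S" unfolding S_def by (intro sum_nonneg B1)
 define L where "L = 2 * B0 + S + B + B2"
 have L: "abs (kern es j ph nu sg (x + y) - kern es j ph nu sg x) <= L * norm y" for x y
 proof (cases "norm y <= 1")
  case True
  have "abs (\<Sum>b\<in>Basis. (y \<bullet> b) * kern (b # es) j (ph + pi/2) nu sg x) <= (\<Sum>b\<in>Basis. norm y * B1 b)"
   by (rule order_trans[OF sum_abs]) (auto simp: abs_mult intro!: sum_mono mult_mono B1 Basis_le_norm)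
  also have "... = S * norm y" by (simp add: S_def sum_distrib_left mult.commute)
  finally have 1: "abs (\<Sum>b\<in>Basis. (y \<bullet> b) * kern (b # es) j (ph + pi/2) nu sg x) <= S * norm y" .
  have "B * (norm y)^2 <= B * norm y"
   using True B(1) by (intro mult_left_mono) (auto simp: power2_eq_square mult_left_le)
  hence "abs (kern es j ph nu sg (x + y) - kern es j ph nu sg x) <= S * norm y + B * norm y"
   using 1 B(2)[of x y] by linarith
  also have "... <= L * norm y" using B0 B2 by (simp add: L_def distrib_right)
  finally show ?thesis .
 next
  case False
  have "abs (kern es j ph nu sg (x + y) - kern es j ph nu sg x) <= 2 * B0 * 1" using B0(2)[of "x+y"] B0(2)[of x] by linarith
  also have "... <= L * norm y" using False B0 B2 B S by (intro mult_mono) (auto simp: L_def)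
  finally show ?thesis .
 qed
 have "nice L (kern es j ph nu sg)"
  unfolding nice_def
 proof (intro conjI allI L)
  show "0 <= L" using B0 B2 B S by (simp add: L_def)
  fix x y :: 'a show "abs (kern es j ph nu sg x) <= L" using B0(2)[of x] B0(1) B2(1) B(1) S by (simp add: L_def)
  have "B2 * (norm y)^2 <= L * (norm y)^2" using B0 B S by (intro mult_right_mono) (auto simp: L_def)
  thus "abs (kern es j ph nu sg (x + y) + kern es j ph nu sg (x - y) - 2 * kern es j ph nu sg x) <= L * (norm y)^2"
   using B2(2)[of x y] by linarith
 qed
 thus ?thesis by blast
qed

lemma nice_cutoff_mult:
 assumes "nice B g" "cutoff Z ze"
 shows "abs (ze (x + y) * g (x + y) + ze (x - y) * g (x - y) - 2 * (ze x * g x)) <= (3 * Z + 1) * B * (norm y)^2"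
  "abs (commint ze g x y) <= 3 * Z * B * (norm y)^2"
  "abs (ze x * g x) <= B"
proof -
 note N = niceD[OF assms(1)] and K = cutoffD[OF assms(2)]
 have "abs (commint ze g x y) <= abs (ze (x + y) - ze x) * abs (g (x + y) - g x) + abs (ze (x - y) - ze x) * abs (g (x - y) - g x)
   + abs (ze (x + y) + ze (x - y) - 2 * ze x) * abs (g x)"
  unfolding commint_def by (rule sphere_second_difference_product)
 also have "... <= (Z * norm y) * (B * norm y) + (Z * norm y) * (B * norm y) + (Z * (norm y)^2) * B"
  using K(3)[of "x + y" x] K(3)[of "x - y" x] K(1)
  by (intro add_mono mult_mono N K(4)) auto
 also have "... = 3 * Z * B * (norm y)^2" by (simp add: power2_eq_square algebra_simps)
 finally show c: "abs (commint ze g x y) <= 3 * Z * B * (norm y)^2" .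
 have "abs (ze x * (g (x + y) + g (x - y) - 2 * g x)) <= 1 * (B * (norm y)^2)"
  unfolding abs_mult by (intro mult_mono N K) auto
 moreover have "ze (x + y) * g (x + y) + ze (x - y) * g (x - y) - 2 * (ze x * g x)
   = ze x * (g (x + y) + g (x - y) - 2 * g x) + commint ze g x y"
  by (simp add: commint_def algebra_simps)
 ultimately have "abs (ze (x + y) * g (x + y) + ze (x - y) * g (x - y) - 2 * (ze x * g x)) <= B * (norm y)^2 + 3 * Z * B * (norm y)^2"
  using c by linarith
 thus "abs (ze (x + y) * g (x + y) + ze (x - y) * g (x - y) - 2 * (ze x * g x)) <= (3 * Z + 1) * B * (norm y)^2"
  by (simp add: algebra_simps)
 show "abs (ze x * g x) <= B" using mult_mono[OF K(2)[of x] N(2)[of x]] by (simp add: abs_mult)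
qed

lemma comm_eq:
 assumes "lev nu" "nice B g" "cutoff Z ze" and [measurable]: "bm g"
 shows "integrable (trunc nu) (%y. g (x + y) + g (x - y) - 2 * g x)"
  "integrable (trunc nu) (%y. ze (x + y) * g (x + y) + ze (x - y) * g (x - y) - 2 * (ze x * g x))"
  "integrable (trunc nu) (commint ze g x)"
  "comm ze nu g x = - (\<integral>y. commint ze g x y \<partial>trunc nu)"
proof -
 note [measurable] = cutoff_measurable[OF assms(3)]
 note i = integrable_mult_right[OF integrable_trunc_sq(1)[OF assms(1)]]
 show 1: "integrable (trunc nu) (%y. g (x + y) + g (x - y) - 2 * g x)"
  by (rule integrable_bound_real[OF i]) (use niceD(5)[OF assms(2)] in auto)
 show 2: "integrable (trunc nu) (%y. ze (x + y) * g (x + y) + ze (x - y) * g (x - y) - 2 * (ze x * g x))"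
  by (rule integrable_bound_real[OF i]) (use nice_cutoff_mult(1)[OF assms(2,3)] in auto)
 show 3: "integrable (trunc nu) (commint ze g x)"
  by (rule integrable_bound_real[OF i]) (use nice_cutoff_mult(2)[OF assms(2,3)] in \<open>auto simp: commint_def[abs_def]\<close>)
 have "comm ze nu g x = (\<integral>y. ze x * (g (x + y) + g (x - y) - 2 * g x) - (ze (x + y) * g (x + y) + ze (x - y) * g (x - y) - 2 * (ze x * g x)) \<partial>trunc nu)"
  unfolding comm_def using 1 2 by (subst Bochner_Integration.integral_diff) auto
 also have "... = (\<integral>y. - commint ze g x y \<partial>trunc nu)"
  by (intro Bochner_Integration.integral_cong refl) (simp add: commint_def algebra_simps)
 finally show "comm ze nu g x = - (\<integral>y. commint ze g x y \<partial>trunc nu)" using 3 by simp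
qed

lemma comm_measurable:
 assumes "lev nu" "cutoff Z ze" and [measurable]: "bm g"
 shows "bm (comm ze nu g)"
proof -
 note [measurable] = cutoff_measurable[OF assms(2)]
 interpret sigma_finite_measure "trunc nu" by (rule sigma_finite_trunc[OF assms(1)])
 show ?thesis unfolding comm_def[abs_def] by measurable
qed

lemma nn_integral_trunc_le:
 assumes "lev nu" "bm f" "!!y. 0 <= f y"
 shows "(\<integral>\<^sup>+y. ennreal (f y) \<partial>trunc nu) <= (\<integral>\<^sup>+y. ennreal (f y) \<partial>nu)"
 unfolding trunc_def using assms levD(1)[OF assms(1)]
 by (subst nn_integral_scaled) (auto intro!: nn_integral_mono ennreal_leI simp: indicator_def)

lemma AE_trunc: "AE y in trunc nu. norm y <= rh"
 unfolding trunc_def scaled_def by (subst AE_density) (auto simp: indicator_def split: if_splits)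

text \<open>Two bounds for the same quantity. The first is quadratic in the jump at the price of one
  derivative of the kernel, and will be used for jumps shorter than \<open>tau\<close>; the second
  pays only |y|^al but leaves the kernel undifferentiated, and will be used for longer jumps. Both
  involve only the kernel far from its pole.\<close>

lemma commint_kern_le:
 fixes nu :: "'a::euclidean_space measure" and es :: "'a list" and j :: nat and ph :: real
 assumes "lev nu" "0 < sg" "cutoff Z ze" "norm x0 <= 1/2" "norm y <= 1/16"
 defines "k \<equiv> kern es j ph nu sg" and "g \<equiv> %x. kern es j ph nu sg (x0 - x)"
 shows "(NN x. ennreal (abs (commint ze g x y)))
   <= ennreal ((norm y)^2) * (ennreal (2 * Z) * (\<Sum>b\<in>Basis. tail_int (kern (b # es) j (ph + pi/2) nu sg)) + ennreal Z * tail_int k)" (is ?A)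
  "(NN x. ennreal (abs (commint ze g x y))) <= ennreal (norm y powr al) * (ennreal (2 * Z) * tail_int k)" (is ?B)
proof -
 note K = cutoffD[OF assms(3)]
 note [measurable] = cutoff_measurable[OF assms(3)]
 have [measurable]: "bm k" unfolding k_def by (rule kern_measurable[OF assms(1)])
 let ?I = "indicator (- ball (0::'a) (1/8)) :: 'a => real"
 let ?e = "%z. commint ze g (x0 - z) y"
 have e: "?e z = (ze (x0 - z + y) - ze (x0 - z)) * k (z - y) + (ze (x0 - z - y) - ze (x0 - z)) * k (z + y)" for z
  by (simp add: commint_def g_def k_def algebra_simps)
 have tr: "(NN x. ennreal (abs (commint ze g x y))) = (NN z. ennreal (abs (?e z)))"
  by (rule nn_integral_translate(3)[symmetric]) (simp add: commint_def g_def k_def[symmetric])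
 \<comment> \<open>1/2 + 1/8 + 1/16 < 3/4, so all three points lie where the cutoff is 1.\<close>
 have zero: "?e z = 0" if "norm z < 1/8" for z
 proof -
  have "norm (x0 - z) <= 3/4" "norm (x0 - z + y) <= 3/4" "norm (x0 - z - y) <= 3/4"
   using that assms(4,5) norm_triangle_ineq4[of x0 z] norm_triangle_ineq[of "x0 - z" y] norm_triangle_ineq4[of "x0 - z" y] by linarith+
  thus ?thesis by (simp add: e K(5))
 qed
 have l1: "abs (ze (x0 - z + y) - ze (x0 - z)) <= Z * norm y" "abs (ze (x0 - z - y) - ze (x0 - z)) <= Z * norm y" for z
  using K(3)[of "x0 - z + y" "x0 - z"] K(3)[of "x0 - z - y" "x0 - z"] by auto
 have Zy: "0 <= Z * norm y" using K(1) by simp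
 show ?A
 proof -
  let ?T = "\<Sum>b\<in>Basis. tail_int (kern (b # es) j (ph + pi/2) nu sg)"
  have "(NN z. ennreal (abs (?e z))) <= (NN z. (ennreal (Z * norm y) * ennreal (?I z * abs (k (z + - y) - k z))
    + ennreal (Z * norm y) * ennreal (?I z * abs (k (z + y) - k z))) + ennreal (Z * (norm y)^2) * ennreal (?I z * abs (k (z + 0))))"
  proof (rule nn_integral_mono)
   fix z :: 'a
   have "abs (?e z) <= (Z * norm y) * (?I z * abs (k (z + - y) - k z)) + (Z * norm y) * (?I z * abs (k (z + y) - k z)) + (Z * (norm y)^2) * (?I z * abs (k (z + 0)))"
   proof (cases "norm z < 1/8")
    case False
    have "abs (?e z) <= abs (ze (x0 - z + y) - ze (x0 - z)) * abs (k (z - y) - k z) + abs (ze (x0 - z - y) - ze (x0 - z)) * abs (k (z + y) - k z)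
      + abs (ze (x0 - z + y) + ze (x0 - z - y) - 2 * ze (x0 - z)) * abs (k z)"
     unfolding e by (rule sphere_second_difference_product)
    also have "... <= (Z * norm y) * abs (k (z - y) - k z) + (Z * norm y) * abs (k (z + y) - k z) + (Z * (norm y)^2) * abs (k z)"
     by (intro add_mono mult_right_mono l1 K(4)) auto
    finally show ?thesis using False by (simp add: indicator_def)
   qed (use Zy K(1) in \<open>simp add: zero indicator_def\<close>)
   hence "ennreal (abs (?e z)) <= ennreal (((Z * norm y) * (?I z * abs (k (z + - y) - k z)) + (Z * norm y) * (?I z * abs (k (z + y) - k z))) + (Z * (norm y)^2) * (?I z * abs (k (z + 0))))"
    by (intro ennreal_leI)
   also have "... = (ennreal (Z * norm y) * ennreal (?I z * abs (k (z + - y) - k z))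
    + ennreal (Z * norm y) * ennreal (?I z * abs (k (z + y) - k z))) + ennreal (Z * (norm y)^2) * ennreal (?I z * abs (k (z + 0)))"
    using Zy K(1) by (simp add: ennreal_mult'[symmetric] ennreal_plus[symmetric] del: ennreal_plus)
   finally show "ennreal (abs (?e z)) <= ..." .
  qed
  also have "... = (ennreal (Z * norm y) * (NN z. ennreal (?I z * abs (k (z + - y) - k z)))
    + ennreal (Z * norm y) * (NN z. ennreal (?I z * abs (k (z + y) - k z)))) + ennreal (Z * (norm y)^2) * (NN z. ennreal (?I z * abs (k (z + 0))))"
   by (subst nn_integral_add, measurable, subst nn_integral_add, measurable) (simp add: nn_integral_cmult)
  also have "... <= (ennreal (Z * norm y) * (ennreal (norm (- y)) * ?T) + ennreal (Z * norm y) * (ennreal (norm y) * ?T)) + ennreal (Z * (norm y)^2) * tail_int k"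
   using assms(5) unfolding k_def
   by (intro add_mono mult_left_mono tail_int_difference tail_int_shift kern_directional kern_continuous kern_measurable assms) auto
  also have "... = ennreal ((norm y)^2) * (ennreal (2 * Z) * ?T + ennreal Z * tail_int k)"
  proof -
   have e1: "ennreal (Z * norm y) = ennreal Z * ennreal (norm y)" using K(1) by (intro ennreal_mult) auto
   have e2: "ennreal ((norm y)^2) = ennreal (norm y) * ennreal (norm y)"
    by (simp add: power2_eq_square ennreal_mult)
   have e3: "ennreal (Z * (norm y)^2) = ennreal Z * ennreal ((norm y)^2)" using K(1) by (intro ennreal_mult) auto
   have "ennreal (Z * norm y) * (ennreal (norm y) * ?T) = ennreal ((norm y)^2) * (ennreal Z * ?T)"
    unfolding e1 e2 by (simp only: mult_ac)
   moreover have "ennreal (Z * (norm y)^2) * tail_int k = ennreal ((norm y)^2) * (ennreal Z * tail_int k)"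
    unfolding e3 by (simp only: mult_ac)
   moreover have "ennreal (2 * Z) = ennreal Z + ennreal Z" using K(1) by (simp flip: ennreal_plus)
   ultimately show ?thesis by (simp only: norm_minus_cancel distrib_left distrib_right)
  qed
  finally show ?thesis unfolding tr .
 qed
 show ?B
 proof -
  have ya: "norm y <= norm y powr al"
  proof (cases "y = 0")
   case False thus ?thesis using powr_mono'[of al 1 "norm y"] al assms(5) by simp
  qed simp
  define q where "q = Z * norm y powr al"
  have q: "0 <= q" "Z * norm y <= q" using K(1) ya by (auto simp: q_def mult_left_mono)
  have "(NN z. ennreal (abs (?e z))) <= (NN z. ennreal q * ennreal (?I z * abs (k (z + - y))) + ennreal q * ennreal (?I z * abs (k (z + y))))"
  proof (rule nn_integral_mono)
   fix z :: 'a
   have "abs (?e z) <= q * (?I z * abs (k (z + - y))) + q * (?I z * abs (k (z + y)))"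
   proof (cases "norm z < 1/8")
    case False
    have "abs (?e z) <= abs (ze (x0 - z + y) - ze (x0 - z)) * abs (k (z - y)) + abs (ze (x0 - z - y) - ze (x0 - z)) * abs (k (z + y))"
     unfolding e by (rule order_trans[OF abs_triangle_ineq]) (simp add: abs_mult)
    also have "... <= q * abs (k (z - y)) + q * abs (k (z + y))"
     by (intro add_mono mult_right_mono order_trans[OF l1(1) q(2)] order_trans[OF l1(2) q(2)]) auto
    finally show ?thesis using False by (simp add: indicator_def)
   qed (use q in \<open>simp add: zero indicator_def\<close>)
   hence "ennreal (abs (?e z)) <= ennreal (q * (?I z * abs (k (z + - y))) + q * (?I z * abs (k (z + y))))" by (rule ennreal_leI)
   also have "... = ennreal q * ennreal (?I z * abs (k (z + - y))) + ennreal q * ennreal (?I z * abs (k (z + y)))"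
    using q by (simp add: ennreal_mult'[symmetric] ennreal_plus[symmetric] del: ennreal_plus)
   finally show "ennreal (abs (?e z)) <= ..." .
  qed
  also have "... = ennreal q * (NN z. ennreal (?I z * abs (k (z + - y)))) + ennreal q * (NN z. ennreal (?I z * abs (k (z + y))))"
   by (subst nn_integral_add, measurable) (simp add: nn_integral_cmult)
  also have "... <= ennreal q * tail_int k + ennreal q * tail_int k"
   using assms(5) by (intro add_mono mult_left_mono tail_int_shift) auto
  also have "... = ennreal (norm y powr al) * (ennreal (2 * Z) * tail_int k)"
  proof -
   have e1: "ennreal q = ennreal Z * ennreal (norm y powr al)" unfolding q_def using K(1) by (intro ennreal_mult) auto
   have e2: "ennreal (2 * Z) = ennreal Z + ennreal Z" using K(1) by (simp flip: ennreal_plus)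
   show ?thesis unfolding e1 e2 by (simp only: distrib_left distrib_right mult_ac)
  qed
  finally show ?thesis unfolding tr .
 qed
qed

text \<open>The jumps are split at length \<open>t = tau sg\<close>. With
  \<open>p = kp es j\<close>, short jumps contribute at most t^(1 - p), while long ones contribute
  t^(2s - p) t^(al - 2s). The long ones dominate and give t^(al - p), the same order as a source
  that is Hoelder continuous with exponent \<open>al\<close>.\<close>

lemma comm_kern_bound:
 assumes rh16: "rh <= 1/16"
 shows "\<exists>D\<ge>0. \<forall>(nu :: 'a::euclidean_space measure) sg x0 ph. lev nu --> 0 < sg --> tau sg <= rh --> norm x0 <= 1/2 --> cutoff Z ze -->
  (NN x. ennreal (abs (comm ze nu (%x. kern es j ph nu sg (x0 - x)) x))) <= ennreal (D * tau sg powr (al - kp es j))"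
proof -
 obtain D0 where D0: "0 <= D0" "!!(nu :: 'a measure) sg ph. lev nu ==> 0 < sg ==> tau sg <= rh ==>
  wint (%x. (norm x)^2) (kern es j ph nu sg) <= ennreal (D0 * tau sg powr (2 * s - kp es j))"
  using wint_kern[where ?'a='a, of es j] by blast
 have "\<forall>b. \<exists>D1. 0 <= D1 \<and> (\<forall>(nu :: 'a measure) sg ph. lev nu --> 0 < sg --> tau sg <= rh -->
  wint (%x. (norm x)^2) (kern (b # es) j ph nu sg) <= ennreal (D1 * tau sg powr (2 * s - kp (b # es) j)))"
 proof
  fix b
  show "\<exists>D1. 0 <= D1 \<and> (\<forall>(nu :: 'a measure) sg ph. lev nu --> 0 < sg --> tau sg <= rh -->
  wint (%x. (norm x)^2) (kern (b # es) j ph nu sg) <= ennreal (D1 * tau sg powr (2 * s - kp (b # es) j)))"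
   using wint_kern[where ?'a='a, of "b # es" j] by blast
 qed
 then obtain D1 where D1: "!!b. 0 <= D1 b" "!!b (nu :: 'a measure) sg ph. lev nu ==> 0 < sg ==> tau sg <= rh ==>
  wint (%x. (norm x)^2) (kern (b # es) j ph nu sg) <= ennreal (D1 b * tau sg powr (2 * s - kp (b # es) j))"
  by metis
 define Q where "Q = (\<Sum>b\<in>Basis. D1 b)"
 have Q: "0 <= Q" unfolding Q_def by (intro sum_nonneg D1)
 define D where "D = 256 * abs Z * C * (2 * Q + 3 * D0)"
 show ?thesis
 proof (intro exI[of _ D] conjI allI impI)
  show "0 <= D" using Q D0(1) C by (simp add: D_def)
  fix nu :: "'a measure" and sg :: real and x0 :: 'a and ph :: real
  assume a: "lev nu" "0 < sg" "tau sg <= rh" "norm x0 <= 1/2" "cutoff Z ze"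
  note L = levD[OF a(1)]
  note [measurable] = cutoff_measurable[OF a(5)] kern_measurable[OF a(1)]
  have Z: "0 <= Z" using cutoffD(1)[OF a(5)] .
  define t where "t = tau sg"
  have t: "0 < t" "t <= 1" using a rh by (auto simp: t_def)
  define p where "p = kp es j"
  define g where "g = (%x. kern es j ph nu sg (x0 - x))"
  have [measurable]: "bm g" unfolding g_def by measurable
  obtain B where nice: "nice B g" using nice_kern[OF a(1,2)] nice_reflect unfolding g_def by blast
  interpret T: sigma_finite_measure "trunc nu" by (rule sigma_finite_trunc[OF a(1)])
  interpret LT: pair_sigma_finite lborel "trunc nu"
   by (rule pair_sigma_finite.intro) (auto intro: sigma_finite_lborel T.sigma_finite_measure_axioms)
  have Tl: "tail_int (kern es j ph nu sg) <= ennreal (256 * D0 * t powr (2 * s - p))"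
  proof -
   have "tail_int (kern es j ph nu sg) <= ennreal 256 * ennreal (D0 * t powr (2 * s - p))"
    unfolding t_def p_def
    by (rule order_trans[OF tail_int_le]) (use a D0 in \<open>auto intro!: mult_left_mono\<close>)
   also have "... = ennreal (256 * (D0 * t powr (2 * s - p)))" using D0(1) by (intro ennreal_mult[symmetric]) auto
   finally show ?thesis by (simp only: mult.assoc)
  qed
  have Tb: "(\<Sum>b\<in>Basis. tail_int (kern (b # es) j (ph + pi/2) nu sg)) <= ennreal (256 * Q * t powr (2 * s - p - 1))"
  proof -
   have kb: "2 * s - kp (b # es) j = 2 * s - p - 1" for b :: 'a by (simp add: kp_def p_def)
   have "(\<Sum>b\<in>Basis. tail_int (kern (b # es) j (ph + pi/2) nu sg)) <= (\<Sum>b\<in>(Basis::'a set). ennreal (256 * (D1 b * t powr (2 * s - p - 1))))"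
   proof (rule sum_mono)
    fix b :: 'a
    have "tail_int (kern (b # es) j (ph + pi/2) nu sg) <= ennreal 256 * ennreal (D1 b * t powr (2 * s - p - 1))"
     unfolding t_def kb[symmetric, of b]
     by (rule order_trans[OF tail_int_le]) (use a D1 in \<open>auto intro!: mult_left_mono\<close>)
    also have "... = ennreal (256 * (D1 b * t powr (2 * s - p - 1)))" using D1(1) by (intro ennreal_mult[symmetric]) auto
    finally show "tail_int (kern (b # es) j (ph + pi/2) nu sg) <= ennreal (256 * (D1 b * t powr (2 * s - p - 1)))" .
   qed
   also have "... = ennreal (\<Sum>b\<in>(Basis::'a set). 256 * (D1 b * t powr (2 * s - p - 1)))"
    using D1(1) by (intro sum_ennreal) auto
   also have "(\<Sum>b\<in>(Basis::'a set). 256 * (D1 b * t powr (2 * s - p - 1))) = 256 * Q * t powr (2 * s - p - 1)"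
    by (simp add: Q_def sum_distrib_left sum_distrib_right mult.assoc)
   finally show ?thesis .
  qed
  define A1 where "A1 = 2 * Z * (256 * Q * t powr (2 * s - p - 1)) + Z * (256 * D0 * t powr (2 * s - p))"
  define A2 where "A2 = 2 * Z * (256 * D0 * t powr (2 * s - p))"
  have A: "0 <= A1" "0 <= A2" using Z Q D0(1) by (auto simp: A1_def A2_def)
  have "(NN x. ennreal (abs (comm ze nu g x))) <= (NN x. (\<integral>\<^sup>+y. ennreal (abs (commint ze g x y)) \<partial>trunc nu))"
  proof (rule nn_integral_mono)
   fix x
   show "ennreal (abs (comm ze nu g x)) <= (\<integral>\<^sup>+y. ennreal (abs (commint ze g x y)) \<partial>trunc nu)"
    using integral_norm_bound_ennreal[OF comm_eq(3)[OF a(1) nice a(5)], of x] comm_eq(4)[OF a(1) nice a(5), of x] by simp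
  qed
  also have "... = (\<integral>\<^sup>+y. (NN x. ennreal (abs (commint ze g x y))) \<partial>trunc nu)"
   by (rule LT.Fubini'[symmetric]) (unfold commint_def, measurable)
  also have "... <= (\<integral>\<^sup>+y. ennreal A1 * ennreal ((norm y)^2 * indicator (cball 0 t) y) + ennreal A2 * ennreal (norm y powr al * indicator (- cball 0 t) y) \<partial>trunc nu)"
  proof (rule nn_integral_mono_AE)
   show "AE y in trunc nu. (NN x. ennreal (abs (commint ze g x y)))
    <= ennreal A1 * ennreal ((norm y)^2 * indicator (cball 0 t) y) + ennreal A2 * ennreal (norm y powr al * indicator (- cball 0 t) y)"
    using AE_trunc
   proof eventually_elim
    fix y :: 'a assume "norm y <= rh"
    hence y: "norm y <= 1/16" using rh16 by simp
    show "(NN x. ennreal (abs (commint ze g x y)))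
     <= ennreal A1 * ennreal ((norm y)^2 * indicator (cball 0 t) y) + ennreal A2 * ennreal (norm y powr al * indicator (- cball 0 t) y)"
    proof (cases "norm y <= t")
     case True
     have "(NN x. ennreal (abs (commint ze g x y)))
       <= ennreal ((norm y)^2) * (ennreal (2 * Z) * (\<Sum>b\<in>Basis. tail_int (kern (b # es) j (ph + pi/2) nu sg)) + ennreal Z * tail_int (kern es j ph nu sg))"
      unfolding g_def by (rule commint_kern_le(1)[OF a(1,2,5,4) y])
     also have "... <= ennreal ((norm y)^2) * (ennreal (2 * Z) * ennreal (256 * Q * t powr (2 * s - p - 1)) + ennreal Z * ennreal (256 * D0 * t powr (2 * s - p)))"
      by (intro mult_left_mono add_mono Tl Tb) auto
     also have "ennreal (2 * Z) * ennreal (256 * Q * t powr (2 * s - p - 1)) + ennreal Z * ennreal (256 * D0 * t powr (2 * s - p)) = ennreal A1"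
      using Z Q D0(1) by (simp add: A1_def ennreal_mult[symmetric] ennreal_plus[symmetric] del: ennreal_plus)
     finally show ?thesis using True by (simp add: indicator_def mult.commute)
    next
     case False
     have "(NN x. ennreal (abs (commint ze g x y))) <= ennreal (norm y powr al) * (ennreal (2 * Z) * tail_int (kern es j ph nu sg))"
      unfolding g_def by (rule commint_kern_le(2)[OF a(1,2,5,4) y])
     also have "... <= ennreal (norm y powr al) * (ennreal (2 * Z) * ennreal (256 * D0 * t powr (2 * s - p)))"
      by (intro mult_left_mono Tl) auto
     also have "ennreal (2 * Z) * ennreal (256 * D0 * t powr (2 * s - p)) = ennreal A2"
      using Z D0(1) by (simp add: A2_def ennreal_mult[symmetric])
     finally show ?thesis using False by (simp add: indicator_def mult.commute)
    qed
   qed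
  qed
  also have "... = ennreal A1 * (\<integral>\<^sup>+y. ennreal ((norm y)^2 * indicator (cball 0 t) y) \<partial>trunc nu) + ennreal A2 * (\<integral>\<^sup>+y. ennreal (norm y powr al * indicator (- cball 0 t) y) \<partial>trunc nu)"
   by (subst nn_integral_add, measurable) (simp add: nn_integral_cmult)
  also have "... <= ennreal A1 * ennreal (C * t powr (2 - 2 * s)) + ennreal A2 * ennreal (C * t powr (al - 2 * s))"
   by (intro add_mono mult_left_mono order_trans[OF nn_integral_trunc_le[OF a(1)]] L(3) L(5) t) auto
  also have "... = ennreal (A1 * (C * t powr (2 - 2 * s)) + A2 * (C * t powr (al - 2 * s)))"
   using A C by (simp add: ennreal_mult[symmetric] ennreal_plus[symmetric] del: ennreal_plus)
  also have "... <= ennreal (D * t powr (al - p))"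
  proof (rule ennreal_leI)
   have pw: "t powr (2 * s - p - 1) * t powr (2 - 2 * s) = t powr (1 - p)" "t powr (2 * s - p) * t powr (2 - 2 * s) = t powr (2 - p)"
    "t powr (2 * s - p) * t powr (al - 2 * s) = t powr (al - p)" by (simp_all flip: powr_add)
   have le: "t powr (1 - p) <= t powr (al - p)" "t powr (2 - p) <= t powr (al - p)"
    using t al by (auto intro!: powr_mono')
   have "A1 * (C * t powr (2 - 2 * s)) + A2 * (C * t powr (al - 2 * s))
    = 2 * Z * 256 * Q * C * (t powr (2 * s - p - 1) * t powr (2 - 2 * s)) + Z * 256 * D0 * C * (t powr (2 * s - p) * t powr (2 - 2 * s))
     + 2 * Z * 256 * D0 * C * (t powr (2 * s - p) * t powr (al - 2 * s))"
    by (simp add: A1_def A2_def algebra_simps)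
   also have "... <= 2 * Z * 256 * Q * C * t powr (al - p) + Z * 256 * D0 * C * t powr (al - p) + 2 * Z * 256 * D0 * C * t powr (al - p)"
    unfolding pw using Z Q C D0(1) le by (intro add_mono mult_left_mono) auto
   also have "... = D * t powr (al - p)" using Z by (simp add: D_def algebra_simps)
   finally show "A1 * (C * t powr (2 - 2 * s)) + A2 * (C * t powr (al - 2 * s)) <= D * t powr (al - p)" .
  qed
  finally show "(NN x. ennreal (abs (comm ze nu (%x. kern es j ph nu sg (x0 - x)) x))) <= ennreal (D * tau sg powr (al - kp es j))"
   by (simp add: g_def t_def p_def)
 qed
qed

end

subsection \<open>Localized solutions\<close>

lemma borel_measurable_of_modulus:
 fixes v :: "'a::real_normed_vector => real"
 assumes "!!x y. abs (v x - v y) <= M * norm (x - y) powr al" "0 < al"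
 shows "continuous_on UNIV v"
 unfolding continuous_on_def
proof
 fix x
 have "((%y. v y - v x) \<longlongrightarrow> 0) (at x within UNIV)"
 proof (rule Lim_null_comparison)
  show "\<forall>\<^sub>F y in at x. norm (v y - v x) <= M * norm (y - x) powr al"
   using assms(1) by (intro always_eventually) auto
  have "((%y. norm (y - x)) \<longlongrightarrow> 0) (at x)" by (auto intro!: tendsto_eq_intros)
  hence "((%y. norm (y - x) powr al) \<longlongrightarrow> 0) (at x)"
   using assms(2) by (intro tendsto_zero_powrI[OF _ tendsto_const]) auto
  thus "((%y. M * norm (y - x) powr al) \<longlongrightarrow> 0) (at x)" by (rule tendsto_mult_right_zero)
 qed
 thus "(v \<longlongrightarrow> v x) (at x within UNIV)" by (simp add: LIM_zero_iff)
qed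

text \<open>Two kinds of constants: \<open>M\<close> is the size of the data and enters the
  estimates, whereas \<open>B\<close> records the smoothness gained by mollification, blows up in
  the limit and is used only to justify derivatives and exchanges of integrals. The source
  \<open>f\<close> already includes the large jumps.\<close>

locale smooth_sol = stable_setting s al c C rh for s al c C rh :: real +
 fixes nu :: "'a::euclidean_space measure" and Z :: real and ze :: "'a => real"
  and u ut f :: "real => 'a => real" and M B :: real and I :: "real set"
 assumes rh16: "rh <= 1/16"
  and lev: "lev nu" and cut: "cutoff Z ze" and M0: "0 <= M" and B0: "0 <= B" and I: "open I" "convex I"
  and u_bd: "!!t x. t \<in> I ==> abs (u t x) <= M"
  and u_hold: "!!t t' x x'. t \<in> I ==> t' \<in> I ==>
    abs (u t x - u t' x') <= M * (abs (t - t') powr (al / (2 * s)) + norm (x - x') powr al)"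
  and u_sd: "!!t x y. t \<in> I ==> abs (u t (x + y) + u t (x - y) - 2 * u t x) <= B * (norm y)^2"
  and u_td: "!!t h x. t \<in> I ==> t + h \<in> I ==> abs (u (t + h) x - u t x - h * ut t x) <= B * h^2"
  and ut_bd: "!!t x. t \<in> I ==> abs (ut t x) <= B"
  and ut_meas: "!!t. t \<in> I ==> ut t \<in> borel_measurable borel"
  and f_meas: "!!t. t \<in> I ==> f t \<in> borel_measurable borel"
  and f_bd: "!!t x. t \<in> I ==> norm x <= 7/8 ==> abs (f t x) <= M"
  and f_hold: "!!t t' x x'. t \<in> I ==> t' \<in> I ==> norm x <= 7/8 ==> norm x' <= 7/8 ==>
    abs (f t x - f t' x') <= M * (abs (t - t') powr (al / (2 * s)) + norm (x - x') powr al)"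
  and eq: "!!t x. t \<in> I ==> norm x <= 7/8 ==>
    ut t x = (\<integral>y. u t (x + y) + u t (x - y) - 2 * u t x \<partial>trunc nu) + f t x"
begin

lemma u_meas: "t \<in> I ==> u t \<in> borel_measurable borel"
 using u_hold[of t t] al by (intro borel_measurable_continuous_onI borel_measurable_of_modulus[where M=M and al=al]) auto

lemma zeta_meas: "bm ze"
 by (rule cutoff_measurable[OF cut])

lemmas K = cutoffD[OF cut]

lemma integrable_zeta_mult:
 assumes [measurable]: "bm h" and h: "!!x. norm x <= 7/8 ==> abs (h x) <= b"
 shows "LI (%x. ze x * h x)" "abs (LBINT x. ze x * h x) <= b * measure lborel (cball (0::'a) 1)"
proof -
 note [measurable] = zeta_meas
 have b: "0 <= b" using h[of 0] by auto
 have i: "LI (%x::'a. b * indicator (cball 0 1) x)"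
  by (intro integrable_mult_right integrable_real_indicator) (auto simp: emeasure_cball)
 have le: "abs (ze x * h x) <= b * indicator (cball 0 1) x" for x
 proof (cases "norm x <= 7/8")
  case True
  have "abs (ze x) * abs (h x) <= 1 * b" by (intro mult_mono K(2) h True) auto
  thus ?thesis using True by (simp add: abs_mult indicator_def)
 qed (use K(6)[of x] b in auto)
 show "LI (%x. ze x * h x)" by (rule integrable_bound_real[OF i]) (use le in auto)
 have "abs (LBINT x. ze x * h x) <= (LBINT x. b * indicator (cball (0::'a) 1) x)"
  by (rule abs_integral_le(2)[OF i]) (use le in auto)
 thus "abs (LBINT x. ze x * h x) <= b * measure lborel (cball (0::'a) 1)" by simp
qed

definition V :: "'a list => nat => real => real => real => 'a => real" where
 "V es j ph sg t x0 = (LBINT x. ze x * (kern es j ph nu sg (x0 - x) * u (t - sg) x))"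

text \<open>This is the derivative of \<open>V\<close> in \<open>sg\<close>, as
  \<open>V_sigma_deriv\<close> shows. No derivative falls on \<open>u\<close> or \<open>f\<close>,
  so the same formula serves all orders of differentiation.\<close>

definition G :: "'a list => nat => real => real => real => 'a => real" where
 "G es j ph sg t x0 = (LBINT x. u (t - sg) x * comm ze nu (%x. kern es j ph nu sg (x0 - x)) x)
   - (LBINT x. ze x * (kern es j ph nu sg (x0 - x) * f (t - sg) x))"

lemma kern_reflect_meas: "bm (%x. kern es j ph nu sg (x0 - x))"
proof -
 note [measurable] = kern_measurable[OF lev]
 show ?thesis by measurable
qed

lemma kern_reflect_nice: "0 < sg ==> \<exists>b. nice b (%x. kern es j ph nu sg (x0 - x))"
 using nice_kern[OF lev] nice_reflect by blast

text \<open>Self-adjointness of the truncated operator. For a fixed jump, translation invariance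
  moves the second difference from \<open>u\<close> to \<open>ze * g\<close>; Fubini then exchanges
  jumps and space. Since \<open>u\<close> is bounded but not integrable, the second integrand needs
  compact support: truncated jumps keep it inside the unit ball.\<close>

lemma trunc_symmetric:
 assumes t: "t \<in> I" and n: "nice b g" and [measurable]: "bm g"
 shows "(LBINT x. ze x * (g x * (\<integral>y. u t (x + y) + u t (x - y) - 2 * u t x \<partial>trunc nu)))
   = (LBINT x. u t x * (\<integral>y. ze (x + y) * g (x + y) + ze (x - y) * g (x - y) - 2 * (ze x * g x) \<partial>trunc nu))"
  "LI (%x. u t x * (\<integral>y. ze (x + y) * g (x + y) + ze (x - y) * g (x - y) - 2 * (ze x * g x) \<partial>trunc nu))"
  "bm (%x. \<integral>y. u t (x + y) + u t (x - y) - 2 * u t x \<partial>trunc nu)"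
  "abs (\<integral>y. u t (x + y) + u t (x - y) - 2 * u t x \<partial>trunc nu) <= B * C"
proof -
 note [measurable] = zeta_meas u_meas[OF t]
 interpret T: sigma_finite_measure "trunc nu" by (rule sigma_finite_trunc[OF lev])
 interpret TL: pair_sigma_finite "trunc nu" lborel
  by (rule pair_sigma_finite.intro) (auto intro: sigma_finite_lborel T.sigma_finite_measure_axioms)
 define w where "w x = ze x * g x" for x
 have [measurable]: "bm w" unfolding w_def by measurable
 have wb: "abs (w x) <= b" for x using nice_cutoff_mult(3)[OF n cut, of x] by (simp add: w_def)
 have b: "0 <= b" using niceD(1)[OF n] .
 have iw: "LI w" unfolding w_def
  by (rule integrable_zeta_mult[where b=b]) (use niceD(2)[OF n] in auto)
 have iwu: "LI (%x. w (x + y) * u t x)" "LI (%x. w x * u t (x + y))"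
  "LI (%x. w (x - y) * u t x)" "LI (%x. w x * u t (x - y))" "LI (%x. w x * u t x)" for y
 proof -
  have *: "LI (%x. w (x + z) * v x)" if [measurable]: "bm v" and "!!x. abs (v x) <= M" for z v
   by (rule integrable_bound_real[OF integrable_mult_right[OF integrable_abs[OF integrable_translate(1)[OF iw, of z]], of M]])
     (use that in \<open>auto simp: abs_mult mult.commute intro!: mult_right_mono\<close>)
  show "LI (%x. w (x + y) * u t x)" by (rule *) (use u_bd[OF t] in auto)
  have "LI (%x. w (x + - y) * u t x)" by (rule *) (use u_bd[OF t] in auto)
  thus "LI (%x. w (x - y) * u t x)" by simp
  have "LI (%x. w (x + 0) * u t (x + y))" by (rule *) (use u_bd[OF t] in auto)
  thus "LI (%x. w x * u t (x + y))" by simp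
  have "LI (%x. w (x + 0) * u t (x - y))" by (rule *) (use u_bd[OF t] in auto)
  thus "LI (%x. w x * u t (x - y))" by simp
  have "LI (%x. w (x + 0) * u t x)" by (rule *) (use u_bd[OF t] in auto)
  thus "LI (%x. w x * u t x)" by simp
 qed
 let ?f = "%y x. w x * (u t (x + y) + u t (x - y) - 2 * u t x)"
 let ?g = "%y x. u t x * (w (x + y) + w (x - y) - 2 * w x)"
 have fg: "(LBINT x. ?f y x) = (LBINT x. ?g y x)" for y
 proof -
  have "(LBINT x. w x * u t (x + y)) = (LBINT x. w (x - y) * u t x)"
   using integral_translate(2)[of "%x. w x * u t (x + y)" y] by simp
  moreover have "(LBINT x. w x * u t (x - y)) = (LBINT x. w (x + y) * u t x)"
   using integral_translate(1)[of "%x. w x * u t (x - y)" y] by simp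
  moreover have "(LBINT x. ?f y x) = (LBINT x. w x * u t (x + y)) + (LBINT x. w x * u t (x - y)) - 2 * (LBINT x. w x * u t x)"
  proof -
   have "(LBINT x. ?f y x) = (LBINT x. w x * u t (x + y) + w x * u t (x - y) - 2 * (w x * u t x))"
    by (intro Bochner_Integration.integral_cong refl) (simp add: algebra_simps)
   thus ?thesis using iwu by simp
  qed
  moreover have "(LBINT x. ?g y x) = (LBINT x. w (x + y) * u t x) + (LBINT x. w (x - y) * u t x) - 2 * (LBINT x. w x * u t x)"
  proof -
   have "(LBINT x. ?g y x) = (LBINT x. w (x + y) * u t x + w (x - y) * u t x - 2 * (w x * u t x))"
    by (intro Bochner_Integration.integral_cong refl) (simp add: algebra_simps)
   thus ?thesis using iwu by simp
  qed
  ultimately show ?thesis by simp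
 qed
 have isq: "integrable (trunc nu) (%y. (norm y)^2)" by (rule integrable_trunc_sq(1)[OF lev])
 have prod: "integrable (trunc nu \<Otimes>\<^sub>M lborel) (%(y, x). (norm y)^2 * h x)" if "LI h" for h :: "'a => real"
 proof (rule TL.Fubini_integrable)
  have [measurable]: "bm h" using that by auto
  show "(%(y, x). (norm y)^2 * h x) \<in> borel_measurable (trunc nu \<Otimes>\<^sub>M lborel)" by measurable
  show "integrable (trunc nu) (%y. \<integral>x. norm (case (y, x) of (y, x) => (norm y)^2 * h x) \<partial>lborel)"
   using isq by (simp add: abs_mult)
 qed (use that in auto)
 have If: "integrable (trunc nu \<Otimes>\<^sub>M lborel) (%(y, x). ?f y x)"
 proof (rule Bochner_Integration.integrable_bound[OF prod[OF integrable_mult_right[OF integrable_abs[OF iw], of B]]])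
  show "AE p in trunc nu \<Otimes>\<^sub>M lborel. norm (case p of (y, x) => ?f y x) <= norm (case p of (y, x) => (norm y)^2 * (B * abs (w x)))"
  proof (rule AE_I2)
   fix p :: "'a \<times> 'a" obtain y x where p: "p = (y, x)" by force
   have "abs (w x) * abs (u t (x + y) + u t (x - y) - 2 * u t x) <= abs (w x) * (B * (norm y)^2)"
    by (intro mult_left_mono u_sd t) auto
   thus "norm (case p of (y, x) => ?f y x) <= norm (case p of (y, x) => (norm y)^2 * (B * abs (w x)))"
    using B0 by (simp add: p abs_mult mult_ac)
  qed
 qed measurable
 define Bw where "Bw = (3 * Z + 1) * b"
 have Bw: "0 <= Bw" using b K(1) by (simp add: Bw_def)
 have Ig: "integrable (trunc nu \<Otimes>\<^sub>M lborel) (%(y, x). ?g y x)"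
 proof (rule Bochner_Integration.integrable_bound[OF prod[of "%x. M * Bw * indicator (cball 0 1) x"]])
  show "LI (%x::'a. M * Bw * indicator (cball 0 1) x)"
   by (intro integrable_mult_right integrable_real_indicator) (auto simp: emeasure_cball)
  have "AE y in trunc nu. AE x in lborel. norm (?g y x) <= norm ((norm y)^2 * (M * Bw * indicator (cball 0 1) x))"
   using AE_trunc
  proof eventually_elim
   fix y :: 'a assume y: "norm y <= rh"
   show "AE x in lborel. norm (?g y x) <= norm ((norm y)^2 * (M * Bw * indicator (cball 0 1) x))"
   proof (rule AE_I2)
    fix x :: 'a
    show "norm (?g y x) <= norm ((norm y)^2 * (M * Bw * indicator (cball 0 1) x))"
    proof (cases "norm x <= 1")
     case True
     have "abs (u t x) * abs (w (x + y) + w (x - y) - 2 * w x) <= M * (Bw * (norm y)^2)"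
      using nice_cutoff_mult(1)[OF n cut, of x y] by (intro mult_mono u_bd t) (auto simp: w_def Bw_def M0)
     thus ?thesis using True M0 Bw by (simp add: abs_mult indicator_def mult_ac)
    next
     case False
     have "7/8 <= norm (x + y)" "7/8 <= norm (x - y)" "7/8 <= norm x"
      using False y rh16 norm_triangle_ineq4[of "x + y" y] norm_triangle_ineq[of "x - y" y] by auto
     thus ?thesis by (simp add: w_def K(6))
    qed
   qed
  qed
  hence "AE p in trunc nu \<Otimes>\<^sub>M lborel. norm (?g (fst p) (snd p)) <= norm ((norm (fst p))^2 * (M * Bw * indicator (cball 0 1) (snd p)))"
  proof (intro TL.AE_pair_measure)
   show "{p \<in> space (trunc nu \<Otimes>\<^sub>M lborel). norm (?g (fst p) (snd p)) <= norm ((norm (fst p))^2 * (M * Bw * indicator (cball 0 1) (snd p)))}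
    \<in> sets (trunc nu \<Otimes>\<^sub>M lborel)" by measurable
  qed (simp only: fst_conv snd_conv)
  thus "AE p in trunc nu \<Otimes>\<^sub>M lborel. norm (case p of (y, x) => ?g y x) <= norm (case p of (y, x) => (norm y)^2 * (M * Bw * indicator (cball 0 1) x))"
   by (simp add: case_prod_unfold)
 qed measurable
 have "(LBINT x. ze x * (g x * (\<integral>y. u t (x + y) + u t (x - y) - 2 * u t x \<partial>trunc nu))) = (LBINT x. (\<integral>y. ?f y x \<partial>trunc nu))"
  by (simp add: w_def mult.assoc)
 also have "... = (\<integral>y. (LBINT x. ?f y x) \<partial>trunc nu)" by (rule TL.Fubini_integral[OF If])
 also have "... = (\<integral>y. (LBINT x. ?g y x) \<partial>trunc nu)" by (simp only: fg)
 also have "... = (LBINT x. (\<integral>y. ?g y x \<partial>trunc nu))" by (rule TL.Fubini_integral[OF Ig, symmetric])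
 also have "... = (LBINT x. u t x * (\<integral>y. ze (x + y) * g (x + y) + ze (x - y) * g (x - y) - 2 * (ze x * g x) \<partial>trunc nu))"
  by (simp add: w_def)
 finally show "(LBINT x. ze x * (g x * (\<integral>y. u t (x + y) + u t (x - y) - 2 * u t x \<partial>trunc nu)))
   = (LBINT x. u t x * (\<integral>y. ze (x + y) * g (x + y) + ze (x - y) * g (x - y) - 2 * (ze x * g x) \<partial>trunc nu))" .
 show "LI (%x. u t x * (\<integral>y. ze (x + y) * g (x + y) + ze (x - y) * g (x - y) - 2 * (ze x * g x) \<partial>trunc nu))"
  using TL.integrable_snd[OF Ig] by (simp add: w_def)
 show "bm (%x. \<integral>y. u t (x + y) + u t (x - y) - 2 * u t x \<partial>trunc nu)" by measurable
 have "abs (\<integral>y. u t (x + y) + u t (x - y) - 2 * u t x \<partial>trunc nu) <= (\<integral>y. B * (norm y)^2 \<partial>trunc nu)"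
  by (rule abs_integral_le(2)) (use isq u_sd[OF t] in auto)
 also have "... <= B * C" using integrable_trunc_sq(2)[OF lev] B0 by (simp add: mult_left_mono)
 finally show "abs (\<integral>y. u t (x + y) + u t (x - y) - 2 * u t x \<partial>trunc nu) <= B * C" .
qed

text \<open>Insert the equation for \<open>ut\<close>, move the operator onto the cutoff kernel and
  commute it with the cutoff. On the kernel the operator raises \<open>j\<close> with a minus sign;
  the commutator and the source form \<open>G\<close>.\<close>

lemma ut_eq:
 assumes t: "t - sg \<in> I" and sg: "0 < sg"
 shows "(LBINT x. ze x * (kern es j ph nu sg (x0 - x) * ut (t - sg) x)) = - V es (Suc j) ph sg t x0 - G es j ph sg t x0"
proof -
 define g where "g = (%x. kern es j ph nu sg (x0 - x))"
 have [measurable]: "bm g" unfolding g_def by (rule kern_reflect_meas)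
 obtain b where n: "nice b g" using kern_reflect_nice[OF sg] unfolding g_def by blast
 note [measurable] = zeta_meas u_meas[OF t] f_meas[OF t] trunc_symmetric(3)[OF t n \<open>g \<in> borel_measurable borel\<close>]
 note ts = trunc_symmetric[OF t n \<open>g \<in> borel_measurable borel\<close>]
 let ?L = "%x. \<integral>y. u (t - sg) (x + y) + u (t - sg) (x - y) - 2 * u (t - sg) x \<partial>trunc nu"
 let ?Lg = "%x. \<integral>y. g (x + y) + g (x - y) - 2 * g x \<partial>trunc nu"
 let ?Lw = "%x. \<integral>y. ze (x + y) * g (x + y) + ze (x - y) * g (x - y) - 2 * (ze x * g x) \<partial>trunc nu"
 have b: "0 <= b" using niceD(1)[OF n] .
 have i1: "LI (%x. ze x * (g x * ?L x))"
  by (rule integrable_zeta_mult[where b="b * (B * C)"])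
    (use niceD(2)[OF n] ts(4) b in \<open>auto simp: abs_mult intro!: mult_mono\<close>)
 have i2: "LI (%x. ze x * (g x * f (t - sg) x))"
  by (rule integrable_zeta_mult[where b="b * M"])
    (use niceD(2)[OF n] f_bd[OF t] b in \<open>auto simp: abs_mult intro!: mult_mono\<close>)
 have Lg: "?Lg x = - kern es (Suc j) ph nu sg (x0 - x)" for x
 proof -
  have "?Lg x = (\<integral>y. kern es j ph nu sg (x0 - x + y) + kern es j ph nu sg (x0 - x - y) - 2 * kern es j ph nu sg (x0 - x) \<partial>trunc nu)"
   unfolding g_def by (intro Bochner_Integration.integral_cong refl) (simp add: algebra_simps)
  thus ?thesis unfolding trunc_kern(2)[OF lev sg] .
 qed
 obtain b1 where b1: "nice b1 (%x. kern es (Suc j) ph nu sg (x0 - x))" using kern_reflect_nice[OF sg] by blast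
 have i3: "LI (%x. ze x * (kern es (Suc j) ph nu sg (x0 - x) * u (t - sg) x))"
  by (rule integrable_zeta_mult[where b="b1 * M"])
    (use niceD(1,2)[OF b1] u_bd[OF t] kern_reflect_meas in \<open>auto simp: abs_mult intro!: mult_mono borel_measurable_times\<close>)
 have "(LBINT x. ze x * (kern es j ph nu sg (x0 - x) * ut (t - sg) x)) = (LBINT x. ze x * (g x * ?L x) + ze x * (g x * f (t - sg) x))"
 proof (intro Bochner_Integration.integral_cong refl)
  fix x
  show "ze x * (kern es j ph nu sg (x0 - x) * ut (t - sg) x) = ze x * (g x * ?L x) + ze x * (g x * f (t - sg) x)"
  proof (cases "norm x <= 7/8")
   case True
   show ?thesis by (simp only: eq[OF t True] g_def distrib_left)
  qed (simp add: K(6))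
 qed
 also have "... = (LBINT x. ze x * (g x * ?L x)) + (LBINT x. ze x * (g x * f (t - sg) x))"
  by (rule Bochner_Integration.integral_add[OF i1 i2])
 also have "(LBINT x. ze x * (g x * ?L x)) = (LBINT x. u (t - sg) x * ?Lw x)" by (rule ts(1))
 also have "(LBINT x. u (t - sg) x * ?Lw x) = - V es (Suc j) ph sg t x0 - (LBINT x. u (t - sg) x * comm ze nu g x)"
 proof -
  have e: "u (t - sg) x * comm ze nu g x = - (ze x * (kern es (Suc j) ph nu sg (x0 - x) * u (t - sg) x)) - u (t - sg) x * ?Lw x" for x
   unfolding comm_def Lg by (simp add: algebra_simps)
  show ?thesis unfolding e V_def using i3 ts(2) by simp
 qed
 finally show ?thesis by (simp add: G_def g_def)
qed

definition Vol :: real where "Vol = measure lborel (cball (0::'a) 1)"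

lemma zeta_bound:
 assumes "bm h" "!!x. norm x <= 7/8 ==> abs (h x) <= b"
 shows "abs (LBINT x. ze x * h x) <= b * Vol"
 unfolding Vol_def by (rule integrable_zeta_mult(2)[OF assms])

lemma prod_bound: "abs a <= A ==> abs b <= B' ==> abs (a * b) <= A * (B'::real)"
 unfolding abs_mult by (rule mult_mono) auto

lemma V_integrable:
 assumes "t - sg \<in> I" "0 < sg" "0 < sg'"
 shows "LI (%x. ze x * (kern es j ph nu sg' (x0 - x) * u (t - sg) x))"
  "LI (%x. ze x * (kern es j ph nu sg' (x0 - x) * ut (t - sg) x))"
proof -
 note [measurable] = kern_reflect_meas u_meas[OF assms(1)] ut_meas[OF assms(1)]
 obtain b where b: "nice b (%x. kern es j ph nu sg' (x0 - x))" using kern_reflect_nice[OF assms(3)] by blast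
 show "LI (%x. ze x * (kern es j ph nu sg' (x0 - x) * u (t - sg) x))"
  by (rule integrable_zeta_mult(1)[where b="b * M"]) (measurable, intro prod_bound niceD(2)[OF b] u_bd assms(1))
 show "LI (%x. ze x * (kern es j ph nu sg' (x0 - x) * ut (t - sg) x))"
  by (rule integrable_zeta_mult(1)[where b="b * B"]) (measurable, intro prod_bound niceD(2)[OF b] ut_bd assms(1))
qed

lemma I_nbhd:
 assumes "t \<in> I"
 obtains d where "0 < d" "!!h. abs h < d ==> t + h \<in> I"
proof -
 obtain d where "0 < d" "!!y. dist y t < d ==> y \<in> I" using I(1) assms unfolding open_dist by blast
 thus thesis using that[of d] by (auto simp: dist_real_def)
qed

text \<open>Differentiating the kernel gives \<open>- V es (Suc j)\<close>; differentiating the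
  shifted time gives minus the integral against \<open>ut\<close>, which by \<open>ut_eq\<close> is
  \<open>V es (Suc j) + G\<close>. The terms of higher order cancel.\<close>

lemma V_sigma_deriv:
 assumes t: "t - sg \<in> I" and sg: "0 < sg"
 shows "((%sg. V es j ph sg t x0) has_real_derivative G es j ph sg t x0) (at sg)"
proof -
 let ?k = "%sg x. kern es j ph nu sg (x0 - x)"
 let ?k1 = "%x. kern es (Suc j) ph nu sg (x0 - x)"
 obtain d0 where d0: "0 < d0" "!!h. abs h < d0 ==> (t - sg) + h \<in> I" by (rule I_nbhd[OF t]) blast
 obtain b0 where b0: "nice b0 (?k sg)" using kern_reflect_nice[OF sg] by blast
 obtain b1 where b1: "nice b1 ?k1" using kern_reflect_nice[OF sg] by blast
 obtain B1 where B1: "!!h x. abs h <= sg / 2 ==>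
  abs (kern es j ph nu (sg + h) x - kern es j ph nu sg x + h * kern es (Suc j) ph nu sg x) <= B1 * h^2"
  using kern_sigma_remainder[OF lev sg] by blast
 have b0n: "0 <= b0" and b1n: "0 <= b1" using niceD(1)[OF b0] niceD(1)[OF b1] .
 define d where "d = min d0 (min 1 (sg / 2))"
 have d: "0 < d" "d <= d0" "d <= 1" "d <= sg / 2" using d0 sg by (auto simp: d_def)
 define Q where "Q = B1 * M + b1 * (2 * B) + b0 * B"
 show ?thesis
 proof (rule has_real_derivative_of_quadratic_remainder[OF d(1), where B = "Q * Vol"])
  fix h :: real assume h: "abs h < d"
  have th: "(t - sg) + - h \<in> I" using h d by (intro d0(2)) auto
  hence th': "t - (sg + h) \<in> I" by (simp add: algebra_simps)
  have sgh: "0 < sg + h" using h d sg by auto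
  note [measurable] = kern_reflect_meas u_meas[OF t] ut_meas[OF t] u_meas[OF th']
  note i = V_integrable(1)[OF th' sgh sgh, of es j ph x0] V_integrable(1)[OF t sg sg, of es j ph x0] V_integrable(1)[OF t sg sg, of es "Suc j" ph x0] V_integrable(2)[OF t sg sg, of es j ph x0]
  let ?R = "%x. ?k (sg + h) x * u (t - (sg + h)) x - ?k sg x * u (t - sg) x + h * (?k1 x * u (t - sg) x) + h * (?k sg x * ut (t - sg) x)"
  have "V es j ph (sg + h) t x0 - V es j ph sg t x0 - h * G es j ph sg t x0
   = V es j ph (sg + h) t x0 - V es j ph sg t x0 + h * V es (Suc j) ph sg t x0 + h * (LBINT x. ze x * (?k sg x * ut (t - sg) x))"
   unfolding ut_eq[OF t sg] by (simp add: algebra_simps)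
  also have "... = (LBINT x. ze x * ?R x)"
   unfolding V_def using i by (simp add: distrib_left right_diff_distrib mult.left_commute[of _ h])
  also have "\<bar>...\<bar> <= (Q * h^2) * Vol"
  proof (rule zeta_bound)
   show "bm ?R" by measurable
   fix x :: 'a
   \<comment> \<open>The product rule for remainders: the remainder of the kernel, a cross term of
     two first-order increments, and the remainder of \<open>u\<close>, each quadratic in
     \<open>h\<close>.\<close>
   have "?R x = (?k (sg + h) x - ?k sg x + h * ?k1 x) * u (t - (sg + h)) x
     + (h * ?k1 x) * (u (t - sg) x - u (t - (sg + h)) x) + ?k sg x * (u (t - (sg + h)) x - u (t - sg) x + h * ut (t - sg) x)"
    by (simp add: algebra_simps)
   also have "\<bar>...\<bar> <= (B1 * h^2) * M + (\<bar>h\<bar> * b1) * (2 * B * \<bar>h\<bar>) + b0 * (B * h^2)"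
   proof (rule order_trans[OF abs_triangle_ineq], rule add_mono, rule order_trans[OF abs_triangle_ineq], rule add_mono)
    show "abs ((?k (sg + h) x - ?k sg x + h * ?k1 x) * u (t - (sg + h)) x) <= (B1 * h^2) * M"
     using h d by (intro prod_bound B1 u_bd th') auto
    have td: "abs (u (t - (sg + h)) x - u (t - sg) x + h * ut (t - sg) x) <= B * h^2"
     using u_td[OF t th, of x] by (simp add: algebra_simps)
    have "abs (h * ut (t - sg) x) <= abs h * B" by (intro prod_bound ut_bd t) auto
    moreover have "B * h^2 <= B * abs h"
    proof (rule mult_left_mono[OF _ B0])
     have "abs h * abs h <= 1 * abs h" using h d by (intro mult_right_mono) auto
     thus "h^2 <= abs h" by (simp add: power2_eq_square)
    qed
    ultimately have "abs (u (t - sg) x - u (t - (sg + h)) x) <= 2 * B * abs h" using td by (auto simp: algebra_simps)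
    thus "abs ((h * ?k1 x) * (u (t - sg) x - u (t - (sg + h)) x)) <= (abs h * b1) * (2 * B * abs h)"
     by (intro prod_bound niceD(2)[OF b1]) auto
    show "abs (?k sg x * (u (t - (sg + h)) x - u (t - sg) x + h * ut (t - sg) x)) <= b0 * (B * h^2)"
     by (intro prod_bound niceD(2)[OF b0] td)
   qed
   also have "... = Q * h^2" by (simp add: Q_def algebra_simps power2_eq_square)
   finally show "abs (?R x) <= Q * h^2" .
  qed
  finally show "abs (V es j ph (sg + h) t x0 - V es j ph sg t x0 - h * G es j ph sg t x0) <= Q * Vol * h^2"
   by (simp add: mult_ac)
 qed
qed

text \<open>In contrast to the derivative in \<open>sg\<close>, nothing cancels here: a time
  derivative raises \<open>j\<close> and hence the parabolic order by 2s.\<close>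

lemma V_t_deriv:
 assumes t: "t - sg \<in> I" and sg: "0 < sg"
 shows "((%t. V es j ph sg t x0) has_real_derivative (- V es (Suc j) ph sg t x0 - G es j ph sg t x0)) (at t)"
proof -
 let ?k = "%x. kern es j ph nu sg (x0 - x)"
 obtain d where d: "0 < d" "!!h. abs h < d ==> (t - sg) + h \<in> I" by (rule I_nbhd[OF t]) blast
 obtain b0 where b0: "nice b0 ?k" using kern_reflect_nice[OF sg] by blast
 show ?thesis
 proof (rule has_real_derivative_of_quadratic_remainder[OF d(1), where B = "(b0 * B) * Vol"])
  fix h :: real assume h: "abs h < d"
  have th: "(t - sg) + h \<in> I" using h by (rule d)
  hence th': "(t + h) - sg \<in> I" by (simp add: algebra_simps)
  note [measurable] = kern_reflect_meas u_meas[OF t] ut_meas[OF t] u_meas[OF th']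
  note i = V_integrable(1)[OF th' sg sg, of es j ph x0] V_integrable(1)[OF t sg sg, of es j ph x0] V_integrable(2)[OF t sg sg, of es j ph x0]
  let ?R = "%x. ?k x * u ((t + h) - sg) x - ?k x * u (t - sg) x - h * (?k x * ut (t - sg) x)"
  have "V es j ph sg (t + h) x0 - V es j ph sg t x0 - h * (- V es (Suc j) ph sg t x0 - G es j ph sg t x0) = (LBINT x. ze x * ?R x)"
   unfolding ut_eq[OF t sg, symmetric] unfolding V_def using i by (simp add: distrib_left right_diff_distrib mult.left_commute[of _ h])
  also have "\<bar>...\<bar> <= (b0 * (B * h^2)) * Vol"
  proof (rule zeta_bound)
   show "bm ?R" by measurable
   fix x :: 'a
   have "?R x = ?k x * (u ((t - sg) + h) x - u (t - sg) x - h * ut (t - sg) x)" by (simp add: algebra_simps)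
   also have "\<bar>...\<bar> <= b0 * (B * h^2)" by (intro prod_bound niceD(2)[OF b0] u_td t th)
   finally show "abs (?R x) <= b0 * (B * h^2)" .
  qed
  finally show "abs (V es j ph sg (t + h) x0 - V es j ph sg t x0 - h * (- V es (Suc j) ph sg t x0 - G es j ph sg t x0)) <= b0 * B * Vol * h^2"
   by (simp add: mult_ac)
 qed
qed

lemma V_x_deriv:
 assumes t: "t - sg \<in> I" and sg: "0 < sg"
 shows "((%x0. V es j ph sg t x0) has_derivative (%y. \<Sum>b\<in>Basis. (y \<bullet> b) * V (b # es) j (ph + pi/2) sg t x0)) (at x0)"
proof -
 obtain B1 where B1: "!!ph x y.
  abs (kern es j ph nu sg (x + y) - kern es j ph nu sg x - (\<Sum>b\<in>Basis. (y \<bullet> b) * kern (b # es) j (ph + pi/2) nu sg x)) <= B1 * (norm y)^2"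
  using kern_x_remainder[OF lev sg, of es j] by blast
 show ?thesis
 proof (rule has_derivative_of_quadratic_remainder[where d=1 and B = "(B1 * M) * Vol"])
  show "bounded_linear (%y. \<Sum>b\<in>Basis. (y \<bullet> b) * V (b # es) j (ph + pi/2) sg t x0)"
   by (intro bounded_linear_sum bounded_linear_mult_const bounded_linear_inner_left)
  fix y :: 'a
  note [measurable] = kern_reflect_meas u_meas[OF t]
  note i = V_integrable(1)[OF t sg sg]
  let ?S = "%x. \<Sum>b\<in>Basis. (y \<bullet> b) * kern (b # es) j (ph + pi/2) nu sg (x0 - x)"
  let ?R = "%x. (kern es j ph nu sg (x0 + y - x) - kern es j ph nu sg (x0 - x) - ?S x) * u (t - sg) x"
  have e: "ze x * ?R x = ze x * (kern es j ph nu sg (x0 + y - x) * u (t - sg) x) - ze x * (kern es j ph nu sg (x0 - x) * u (t - sg) x)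
    - (\<Sum>b\<in>Basis. (y \<bullet> b) * (ze x * (kern (b # es) j (ph + pi/2) nu sg (x0 - x) * u (t - sg) x)))" for x
  proof -
   have "ze x * (?S x * u (t - sg) x) = (\<Sum>b\<in>Basis. (y \<bullet> b) * (ze x * (kern (b # es) j (ph + pi/2) nu sg (x0 - x) * u (t - sg) x)))"
    by (simp add: sum_distrib_left sum_distrib_right mult_ac)
   thus ?thesis by (simp add: left_diff_distrib right_diff_distrib)
  qed
  have "V es j ph sg t (x0 + y) - V es j ph sg t x0 - (\<Sum>b\<in>Basis. (y \<bullet> b) * V (b # es) j (ph + pi/2) sg t x0) = (LBINT x. ze x * ?R x)"
   unfolding e V_def using i by simp
  also have "\<bar>...\<bar> <= ((B1 * (norm y)^2) * M) * Vol"
  proof (rule zeta_bound)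
   show "bm ?R" by measurable
   fix x :: 'a
   have "abs (kern es j ph nu sg (x0 + y - x) - kern es j ph nu sg (x0 - x) - ?S x) <= B1 * (norm y)^2"
    using B1[of ph "x0 - x" y] by (simp add: algebra_simps)
   thus "abs (?R x) <= (B1 * (norm y)^2) * M" by (intro prod_bound u_bd t)
  qed
  finally show "abs (V es j ph sg t (x0 + y) - V es j ph sg t x0 - (\<Sum>b\<in>Basis. (y \<bullet> b) * V (b # es) j (ph + pi/2) sg t x0)) <= B1 * M * Vol * (norm y)^2"
   by (simp add: mult_ac)
 qed simp
qed

end

lemma integral_le_of_nn_integral_le:
 assumes "f \<in> borel_measurable M" "!!x. 0 <= f x" "(\<integral>\<^sup>+x. ennreal (f x) \<partial>M) <= ennreal b" "0 <= b"
 shows "integrable M f" "(\<integral>x. f x \<partial>M) <= b"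
proof -
 show i: "integrable M f"
  using assms by (auto simp: integrable_iff_bounded intro: le_less_trans)
 show "(\<integral>x. f x \<partial>M) <= b"
  using assms(3,4) nn_integral_eq_integral[OF i] assms(2) by auto
qed

lemma integral_reflect:
 fixes f :: "'a::euclidean_space => real"
 assumes "LI f"
 shows "LI (%x. f (z - x))" "(LBINT x. f (z - x)) = (LBINT x. f x)"
 using integrable_translate(3)[OF assms] integral_translate(3)[of f z] assms by auto

section \<open>Bounds for the localized integrals and their sigma-derivatives\<close>

context stable_setting
begin

text \<open>Gathers the kernel bounds for one measure and one order of differentiation in a single
  constant, through which alone the later estimates depend on the measure.\<close>

definition kb :: "'a::euclidean_space measure => ('a => real) => 'a list => nat => real => bool" where
 "kb nu ze es j D \<longleftrightarrow> 0 <= D \<and> (\<forall>sg ph. 0 < sg --> tau sg <= rh -->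
  wint (%x. 1) (kern es j ph nu sg) <= ennreal (D * tau sg powr (- kp es j)) \<and>
  wint (%x. norm x powr al) (kern es j ph nu sg) <= ennreal (D * tau sg powr (al - kp es j)) \<and>
  (\<forall>x0. norm x0 <= 1/2 --> (NN x. ennreal (abs (comm ze nu (%x. kern es j ph nu sg (x0 - x)) x))) <= ennreal (D * tau sg powr (al - kp es j))))"

lemma kb_mono: "kb nu ze es j D ==> D <= D' ==> kb nu ze es j D'"
proof -
 assume k: "kb nu ze es j D" and le: "D <= D'"
 have le': "ennreal (D * x powr y) <= ennreal (D' * x powr y)" for x y
  using le by (intro ennreal_leI mult_right_mono) auto
 show ?thesis unfolding kb_def
  using k le unfolding kb_def by (auto intro: order_trans[OF _ le'])
qed

lemma kb_exists:
 fixes ze :: "'a::euclidean_space => real"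
 assumes "rh <= 1/16" "cutoff Z ze"
 shows "\<exists>D. \<forall>nu. lev nu --> kb nu ze es j D"
proof -
 obtain D1 where D1: "0 <= D1" "!!(nu :: 'a measure) sg ph. lev nu ==> 0 < sg ==> tau sg <= rh ==>
  wint (%x. 1) (kern es j ph nu sg) <= ennreal (D1 * tau sg powr (- kp es j)) \<and>
  wint (%x. norm x powr al) (kern es j ph nu sg) <= ennreal (D1 * tau sg powr (al - kp es j))"
  using wint_kern[where ?'a='a, of es j] by blast
 obtain D2 where D2: "0 <= D2" "!!(nu :: 'a measure) sg x0 ph. lev nu ==> 0 < sg ==> tau sg <= rh ==> norm x0 <= 1/2 ==>
  (NN x. ennreal (abs (comm ze nu (%x. kern es j ph nu sg (x0 - x)) x))) <= ennreal (D2 * tau sg powr (al - kp es j))"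
  using comm_kern_bound[OF assms(1), where ?'a='a, of Z ze es j] assms(2) by blast
 have le: "ennreal (D1 * x powr y) <= ennreal ((D1 + D2) * x powr y)" "ennreal (D2 * x powr y) <= ennreal ((D1 + D2) * x powr y)" for x y
  using D1(1) D2(1) by (auto intro!: ennreal_leI mult_right_mono)
 have "kb nu ze es j (D1 + D2)" if "lev nu" for nu
  unfolding kb_def
 proof (intro conjI allI impI)
  show "0 <= D1 + D2" using D1 D2 by simp
  fix sg ph assume a: "0 < sg" "tau sg <= rh"
  show "wint (%x. 1) (kern es j ph nu sg) <= ennreal ((D1 + D2) * tau sg powr (- kp es j))"
   using D1(2)[OF that a] by (blast intro: order_trans[OF _ le(1)])
  show "wint (%x. norm x powr al) (kern es j ph nu sg) <= ennreal ((D1 + D2) * tau sg powr (al - kp es j))"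
   using D1(2)[OF that a] by (blast intro: order_trans[OF _ le(1)])
  fix x0 :: 'a assume "norm x0 <= 1/2"
  thus "(NN x. ennreal (abs (comm ze nu (%x. kern es j ph nu sg (x0 - x)) x))) <= ennreal ((D1 + D2) * tau sg powr (al - kp es j))"
   using D2(2)[OF that a] by (blast intro: order_trans[OF _ le(2)])
 qed
 thus ?thesis by blast
qed

end

context smooth_sol
begin

lemma kern_abs_integral:
 assumes "kb nu ze es j D" "0 < sg" "tau sg <= rh"
 shows "LI (%x. abs (kern es j ph nu sg (x0 - x)))"
  "(LBINT x. abs (kern es j ph nu sg (x0 - x))) <= D * tau sg powr (- kp es j)"
  "LI (%x. norm (x0 - x) powr al * abs (kern es j ph nu sg (x0 - x)))"
  "(LBINT x. norm (x0 - x) powr al * abs (kern es j ph nu sg (x0 - x))) <= D * tau sg powr (al - kp es j)"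
  "norm x0 <= 1/2 ==> LI (comm ze nu (%x. kern es j ph nu sg (x0 - x)))"
  "norm x0 <= 1/2 ==> (LBINT x. abs (comm ze nu (%x. kern es j ph nu sg (x0 - x)) x)) <= D * tau sg powr (al - kp es j)"
proof -
 note [measurable] = kern_measurable[OF lev]
 have D: "0 <= D" using assms(1) by (simp add: kb_def)
 have n: "(NN x. ennreal (1 * abs (kern es j ph nu sg x))) <= ennreal (D * tau sg powr (- kp es j))"
  "(NN x. ennreal (norm x powr al * abs (kern es j ph nu sg x))) <= ennreal (D * tau sg powr (al - kp es j))"
  using assms unfolding kb_def wint_def by blast+
 have 1: "LI (%x. 1 * abs (kern es j ph nu sg x))" "(LBINT x. 1 * abs (kern es j ph nu sg x)) <= D * tau sg powr (- kp es j)"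
  by (rule integral_le_of_nn_integral_le[OF _ _ n(1)]; use D in auto)+
 have 2: "LI (%x. norm x powr al * abs (kern es j ph nu sg x))" "(LBINT x. norm x powr al * abs (kern es j ph nu sg x)) <= D * tau sg powr (al - kp es j)"
  by (rule integral_le_of_nn_integral_le[OF _ _ n(2)]; use D in auto)+
 show "LI (%x. abs (kern es j ph nu sg (x0 - x)))" "(LBINT x. abs (kern es j ph nu sg (x0 - x))) <= D * tau sg powr (- kp es j)"
  using integral_reflect[OF 1(1), of x0] 1(2) by auto
 show "LI (%x. norm (x0 - x) powr al * abs (kern es j ph nu sg (x0 - x)))"
  "(LBINT x. norm (x0 - x) powr al * abs (kern es j ph nu sg (x0 - x))) <= D * tau sg powr (al - kp es j)"
  using integral_reflect[OF 2(1), of x0] 2(2) by auto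
 assume x0: "norm x0 <= 1/2"
 have m: "comm ze nu (%x. kern es j ph nu sg (x0 - x)) \<in> borel_measurable lborel"
  using comm_measurable[OF lev cut kern_reflect_meas] by simp
 have 3: "(NN x. ennreal (abs (comm ze nu (%x. kern es j ph nu sg (x0 - x)) x))) <= ennreal (D * tau sg powr (al - kp es j))"
  using assms x0 unfolding kb_def by blast
 have 4: "LI (%x. abs (comm ze nu (%x. kern es j ph nu sg (x0 - x)) x))"
  by (rule integral_le_of_nn_integral_le(1)[OF _ _ 3]) (use m D in auto)
 thus "LI (comm ze nu (%x. kern es j ph nu sg (x0 - x)))" using m by (simp add: integrable_iff_bounded)
 show "(LBINT x. abs (comm ze nu (%x. kern es j ph nu sg (x0 - x)) x)) <= D * tau sg powr (al - kp es j)"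
  by (rule integral_le_of_nn_integral_le(2)[OF _ _ 3]) (use m D in auto)
qed

lemma abs_integral_kern_mult_le:
 assumes "kb nu ze es j D" "0 < sg" "tau sg <= rh" and [measurable]: "bm h" and "!!x. abs (h x) <= b" "0 <= b"
 shows "LI (%x. kern es j ph nu sg (x0 - x) * h x)"
  "abs (LBINT x. kern es j ph nu sg (x0 - x) * h x) <= b * (D * tau sg powr (- kp es j))"
proof -
 note [measurable] = kern_reflect_meas
 note k = kern_abs_integral[OF assms(1-3), where ph=ph and ?x0.0=x0]
 have ae: "AE x in lborel. abs (kern es j ph nu sg (x0 - x) * h x) <= b * abs (kern es j ph nu sg (x0 - x))"
  using assms(5) by (auto simp: abs_mult mult.commute intro!: mult_right_mono)
 show "LI (%x. kern es j ph nu sg (x0 - x) * h x)"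
  by (rule abs_integral_le(1)[OF integrable_mult_right[OF k(1)] _ ae]) simp
 have "abs (LBINT x. kern es j ph nu sg (x0 - x) * h x) <= (LBINT x. b * abs (kern es j ph nu sg (x0 - x)))"
  by (rule abs_integral_le(2)[OF integrable_mult_right[OF k(1)] _ ae]) simp
 also have "... <= b * (D * tau sg powr (- kp es j))"
  using k(2) assms(6) by (simp add: mult_left_mono)
 finally show "abs (LBINT x. kern es j ph nu sg (x0 - x) * h x) <= b * (D * tau sg powr (- kp es j))" .
qed

lemma zeta_mult_bd:
 assumes "!!x. norm x <= 7/8 ==> abs (h x) <= b"
 shows "abs (ze x * h x) <= b"
proof (cases "norm x <= 7/8")
 case True
 thus ?thesis using mult_mono[OF K(2)[of x] assms[OF True]] by (simp add: abs_mult)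
next
 case False
 have "0 <= b" using assms[of 0] by force
 thus ?thesis using False by (simp add: K(6))
qed

lemma V_bound:
 assumes "kb nu ze es j D" "0 < sg" "tau sg <= rh" and t: "t - sg \<in> I"
 shows "abs (V es j ph sg t x0) <= M * (D * tau sg powr (- kp es j))"
proof -
 note [measurable] = zeta_meas u_meas[OF t]
 have "abs (LBINT x. kern es j ph nu sg (x0 - x) * (ze x * u (t - sg) x)) <= M * (D * tau sg powr (- kp es j))"
  by (rule abs_integral_kern_mult_le(2)[OF assms(1-3)]) (use M0 u_bd[OF t] in \<open>auto intro!: zeta_mult_bd\<close>)
 thus ?thesis by (simp add: V_def mult_ac)
qed

lemma zeta_powr_le: "abs (ze x - ze y) <= (Z + 2) * norm (x - y) powr al"
proof (cases "norm (x - y) <= 1")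
 case True
 have "norm (x - y) <= norm (x - y) powr al"
 proof (cases "x = y")
  case False thus ?thesis using powr_mono'[of al 1 "norm (x - y)"] al True by simp
 qed simp
 hence "Z * norm (x - y) <= Z * norm (x - y) powr al" using K(1) by (rule mult_left_mono)
 also have "... <= (Z + 2) * norm (x - y) powr al" by (intro mult_right_mono) auto
 finally show ?thesis using K(3)[of x y] by linarith
next
 case False
 have "1 <= norm (x - y) powr al" using False al by (intro ge_one_powr_ge_zero) auto
 hence "2 * 1 <= (Z + 2) * norm (x - y) powr al" using K(1) by (intro mult_mono) auto
 thus ?thesis using K(2)[of x] K(2)[of y] by linarith
qed

lemma zeta_f_holder:
 assumes t: "t \<in> I"
 shows "abs (ze x * f t x - ze y * f t y) <= M * (Z + 3) * norm (x - y) powr al"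
proof -
 have half: "abs (ze x * f t x - ze y * f t y) <= M * (Z + 3) * norm (x - y) powr al" if x: "norm x <= 7/8" for x y
 proof (cases "norm y <= 7/8")
  case True
  have "ze x * f t x - ze y * f t y = (ze x - ze y) * f t x + ze y * (f t x - f t y)" by (simp add: algebra_simps)
  also have "\<bar>...\<bar> <= ((Z + 2) * norm (x - y) powr al) * M + 1 * (M * norm (x - y) powr al)"
   using f_hold[OF t t x True] al
   by (intro order_trans[OF abs_triangle_ineq] add_mono prod_bound zeta_powr_le f_bd t x K(2)) auto
  also have "... = M * (Z + 3) * norm (x - y) powr al" by (simp add: algebra_simps)
  finally show ?thesis .
 next
  case False
  hence z: "ze y = 0" by (simp add: K(6))
  have "abs (ze x * f t x) <= ((Z + 2) * norm (x - y) powr al) * M"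
   using zeta_powr_le[of x y] z by (intro prod_bound f_bd t x) auto
  also have "... <= M * (Z + 3) * norm (x - y) powr al" using M0 by (simp add: algebra_simps)
  finally show ?thesis by (simp add: z)
 qed
 show ?thesis
 proof (cases "norm x <= 7/8 \<or> norm y <= 7/8")
  case True
  thus ?thesis using half[of x y] half[of y x] by (auto simp: norm_minus_commute abs_minus_commute)
 next
  case False
  thus ?thesis using M0 K(1) by (simp add: K(6))
 qed
qed

text \<open>The cutoff source is compared with its value at \<open>x0\<close>. As differentiated
  kernels have mean zero, only the Hoelder increment remains, measured by the weight |x - x0|^al.
  For the kernel itself the mean is \<open>cos ph\<close>, and the value of the source at
  \<open>x0\<close> survives.\<close>

lemma G_bound:
 assumes kb: "kb nu ze es j D" "0 < sg" "tau sg <= rh" and t: "t - sg \<in> I" and x0: "norm x0 <= 1/2"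
 shows "abs (G es j ph sg t x0 + of_bool (es = [] \<and> j = 0) * cos ph * f (t - sg) x0) <= M * (Z + 4) * D * tau sg powr (al - kp es j)"
proof -
 note [measurable] = zeta_meas u_meas[OF t] f_meas[OF t] kern_reflect_meas
 note k = kern_abs_integral[OF kb, where ph=ph and ?x0.0=x0]
 let ?k = "%x. kern es j ph nu sg (x0 - x)"
 let ?F = "%x. ze x * f (t - sg) x"
 have [measurable]: "bm (comm ze nu ?k)" by (rule comm_measurable[OF lev cut kern_reflect_meas])
 define p where "p = tau sg powr (al - kp es j)"
 have 1: "abs (LBINT x. u (t - sg) x * comm ze nu ?k x) <= M * (D * p)"
 proof -
  have "abs (LBINT x. u (t - sg) x * comm ze nu ?k x) <= (LBINT x. M * abs (comm ze nu ?k x))"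
   by (rule abs_integral_le(2)) (use k(5)[OF x0] u_bd[OF t] in \<open>auto simp: abs_mult intro!: mult_right_mono\<close>)
  also have "... <= M * (D * p)" using k(6)[OF x0] M0 by (simp add: p_def mult_left_mono)
  finally show ?thesis .
 qed
 have F0: "?F x0 = f (t - sg) x0" using x0 by (simp add: K(5))
 have ik: "LI ?k" "(LBINT x. ?k x) = of_bool (es = [] \<and> j = 0) * cos ph"
  using integral_reflect[OF integrable_kern[OF lev kb(2,3), where es=es and j=j and ph=ph], where z=x0] integral_kern[OF lev kb(2,3)] by auto
 have iF: "LI (%x. ?k x * ?F x)"
  by (rule abs_integral_kern_mult_le(1)[OF kb, where b=M]) (use M0 f_bd[OF t] in \<open>auto intro!: zeta_mult_bd\<close>)
 have 2: "abs (LBINT x. ?k x * (?F x - ?F x0)) <= M * (Z + 3) * (D * p)"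
 proof -
  have "abs (LBINT x. ?k x * (?F x - ?F x0)) <= (LBINT x. M * (Z + 3) * (norm (x0 - x) powr al * abs (?k x)))"
  proof (rule abs_integral_le(2)[OF integrable_mult_right[OF k(3)]])
   show "AE x in lborel. abs (?k x * (?F x - ?F x0)) <= M * (Z + 3) * (norm (x0 - x) powr al * abs (?k x))"
   proof (rule AE_I2)
    fix x
    have "abs (?k x) * abs (?F x - ?F x0) <= abs (?k x) * (M * (Z + 3) * norm (x - x0) powr al)"
     by (intro mult_left_mono zeta_f_holder t) auto
    thus "abs (?k x * (?F x - ?F x0)) <= M * (Z + 3) * (norm (x0 - x) powr al * abs (?k x))"
     by (simp add: abs_mult norm_minus_commute mult_ac)
   qed
  qed measurable
  also have "... = M * (Z + 3) * (LBINT x. norm (x0 - x) powr al * abs (?k x))" by (rule integral_mult_right_zero)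
  also have "... <= M * (Z + 3) * (D * p)" unfolding p_def by (rule mult_left_mono[OF k(4)]) (use M0 K(1) in auto)
  finally show ?thesis .
 qed
 have "(LBINT x. ?k x * (?F x - ?F x0)) = (LBINT x. ?k x * ?F x) - of_bool (es = [] \<and> j = 0) * cos ph * f (t - sg) x0"
 proof -
  have "(LBINT x. ?k x * (?F x - ?F x0)) = (LBINT x. ?k x * ?F x - ?F x0 * ?k x)"
   by (intro Bochner_Integration.integral_cong refl) (simp add: algebra_simps)
  also have "... = (LBINT x. ?k x * ?F x) - ?F x0 * (LBINT x. ?k x)"
   using iF ik(1) by simp
  finally show ?thesis unfolding ik(2) F0 by (simp add: mult_ac)
 qed
 moreover have "G es j ph sg t x0 = (LBINT x. u (t - sg) x * comm ze nu ?k x) - (LBINT x. ?k x * ?F x)"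
  by (simp add: G_def mult_ac)
 ultimately have "abs (G es j ph sg t x0 + of_bool (es = [] \<and> j = 0) * cos ph * f (t - sg) x0) <= M * (D * p) + M * (Z + 3) * (D * p)"
  using 1 2 by linarith
 also have "... = M * (Z + 4) * D * p" by (simp add: algebra_simps)
 finally show ?thesis by (simp add: p_def)
qed

text \<open>Increments in time are bounded uniformly in space, so the cancellation of the kernel is
  not exploited and no power of \<open>tau\<close> is gained. The bound will be applied only to the
  undifferentiated kernel, where none is required.\<close>

lemma G_time_holder:
 assumes kb: "kb nu ze es j D" "0 < sg" "tau sg <= rh" and t: "t - sg \<in> I" "t' - sg \<in> I" and x0: "norm x0 <= 1/2"
 shows "abs (G es j ph sg t x0 - G es j ph sg t' x0) <= M * abs (t - t') powr (al / (2 * s)) * (2 * D * tau sg powr (- kp es j))"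
proof -
 note [measurable] = zeta_meas u_meas[OF t(1)] u_meas[OF t(2)] f_meas[OF t(1)] f_meas[OF t(2)] kern_reflect_meas
 note k = kern_abs_integral[OF kb, where ph=ph and ?x0.0=x0]
 let ?k = "%x. kern es j ph nu sg (x0 - x)"
 have [measurable]: "bm (comm ze nu ?k)" by (rule comm_measurable[OF lev cut kern_reflect_meas])
 define m where "m = M * abs (t - t') powr (al / (2 * s))"
 have m: "0 <= m" using M0 by (simp add: m_def)
 have D: "0 <= D" using kb by (simp add: kb_def)
 have du: "abs (u (t - sg) x - u (t' - sg) x) <= m" for x
  using u_hold[OF t, of x x] by (simp add: m_def)
 have df: "abs (f (t - sg) x - f (t' - sg) x) <= m" if "norm x <= 7/8" for x
  using f_hold[OF t that that] by (simp add: m_def)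
 have iu: "LI (%x. u r x * comm ze nu ?k x)" if "r \<in> I" for r
  by (rule abs_integral_le(1)[OF integrable_mult_right[OF integrable_abs[OF k(5)[OF x0]], of M]])
    (use u_bd[OF that] u_meas[OF that] in \<open>auto simp: abs_mult intro!: mult_right_mono borel_measurable_times\<close>)
 have iF: "LI (%x. ze x * (?k x * f r x))" if "r \<in> I" for r
 proof -
  have "LI (%x. ?k x * (ze x * f r x))"
   by (rule abs_integral_kern_mult_le(1)[OF kb, where b=M]) (use M0 f_bd[OF that] f_meas[OF that] zeta_meas in \<open>auto intro!: zeta_mult_bd borel_measurable_times\<close>)
  thus ?thesis by (simp add: mult.left_commute)
 qed
 have "G es j ph sg t x0 - G es j ph sg t' x0 = (LBINT x. (u (t - sg) x - u (t' - sg) x) * comm ze nu ?k x)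
   - (LBINT x. ?k x * (ze x * (f (t - sg) x - f (t' - sg) x)))"
 proof -
  have a: "(u (t - sg) x - u (t' - sg) x) * comm ze nu ?k x = u (t - sg) x * comm ze nu ?k x - u (t' - sg) x * comm ze nu ?k x"
   "?k x * (ze x * (f (t - sg) x - f (t' - sg) x)) = ze x * (?k x * f (t - sg) x) - ze x * (?k x * f (t' - sg) x)" for x
   by (simp_all add: algebra_simps)
  show ?thesis unfolding a G_def using iu[OF t(1)] iu[OF t(2)] iF[OF t(1)] iF[OF t(2)] by simp
 qed
 moreover have "abs (LBINT x. (u (t - sg) x - u (t' - sg) x) * comm ze nu ?k x) <= m * (D * tau sg powr (- kp es j))"
 proof -
  have "abs (LBINT x. (u (t - sg) x - u (t' - sg) x) * comm ze nu ?k x) <= (LBINT x. m * abs (comm ze nu ?k x))"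
   by (rule abs_integral_le(2)) (use k(5)[OF x0] du in \<open>auto simp: abs_mult intro!: mult_right_mono\<close>)
  also have "... <= m * (D * tau sg powr (al - kp es j))" using k(6)[OF x0] m by (simp add: mult_left_mono)
  also have "... <= m * (D * tau sg powr (- kp es j))"
   using kb rh al m D less_imp_le[OF tau_pos[OF kb(2)]] by (intro mult_left_mono powr_mono') auto
  finally show ?thesis .
 qed
 moreover have "abs (LBINT x. ?k x * (ze x * (f (t - sg) x - f (t' - sg) x))) <= m * (D * tau sg powr (- kp es j))"
  by (rule abs_integral_kern_mult_le(2)[OF kb]) (use df m in \<open>auto intro!: zeta_mult_bd\<close>)
 ultimately have "abs (G es j ph sg t x0 - G es j ph sg t' x0) <= 2 * (m * (D * tau sg powr (- kp es j)))" by linarith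
 thus ?thesis by (simp add: m_def mult_ac)
qed

end

subsection \<open>Estimates by splitting at the parabolic scale\<close>

text \<open>Both \<open>v\<close> and \<open>- v\<close> are compared, through monotonicity, with
  the antiderivative of the bound, which avoids integrating \<open>g\<close>. The condition
  \<open>p + 1 ~= 0\<close> excludes the logarithmic case.\<close>

lemma deriv_powr_bound:
 fixes v g :: "real => real"
 assumes "0 < a" "a <= b" "p + 1 ~= 0" "0 <= A" "0 <= A0"
  and der: "!!sg. a <= sg ==> sg <= b ==> (v has_real_derivative g sg) (at sg)"
  and bd: "!!sg. a <= sg ==> sg <= b ==> abs (g sg) <= A * sg powr p + A0"
 shows "abs (v b - v a) <= A / (p + 1) * (b powr (p + 1) - a powr (p + 1)) + A0 * (b - a)"
proof -
 define P where "P sg = A / (p + 1) * sg powr (p + 1) + A0 * sg" for sg :: real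
 have dP: "(P has_real_derivative A * sg powr p + A0) (at sg)" if "a <= sg" for sg
  unfolding P_def using that assms(1,3) by (auto intro!: derivative_eq_intros)
 have "(%sg. P sg - v sg) a <= (%sg. P sg - v sg) b"
 proof (rule DERIV_nonneg_imp_nondecreasing[OF assms(2)])
  fix x assume x: "a <= x" "x <= b"
  show "\<exists>y. ((%sg. P sg - v sg) has_real_derivative y) (at x) \<and> 0 <= y"
   using DERIV_diff[OF dP[OF x(1)] der[OF x]] bd[OF x] by (intro exI[of _ "A * x powr p + A0 - g x"]) auto
 qed
 moreover have "(%sg. P sg + v sg) a <= (%sg. P sg + v sg) b"
 proof (rule DERIV_nonneg_imp_nondecreasing[OF assms(2)])
  fix x assume x: "a <= x" "x <= b"
  show "\<exists>y. ((%sg. P sg + v sg) has_real_derivative y) (at x) \<and> 0 <= y"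
   using DERIV_add[OF dP[OF x(1)] der[OF x]] bd[OF x] by (intro exI[of _ "A * x powr p + A0 + g x"]) auto
 qed
 ultimately have "abs (v b - v a) <= P b - P a" by auto
 thus ?thesis by (simp add: P_def algebra_simps)
qed

lemma deriv_powr_bound_pos:
 fixes v g :: "real => real"
 assumes "0 < a" "a <= b" "- 1 < p" "0 <= A" "0 <= A0"
  and "!!sg. a <= sg ==> sg <= b ==> (v has_real_derivative g sg) (at sg)"
  and "!!sg. a <= sg ==> sg <= b ==> abs (g sg) <= A * sg powr p + A0"
 shows "abs (v b - v a) <= A / (p + 1) * b powr (p + 1) + A0 * b"
proof -
 have "abs (v b - v a) <= A / (p + 1) * (b powr (p + 1) - a powr (p + 1)) + A0 * (b - a)"
  by (rule deriv_powr_bound) (use assms in auto)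
 also have "... <= A / (p + 1) * b powr (p + 1) + A0 * b"
  using assms by (intro add_mono mult_left_mono) auto
 finally show ?thesis .
qed

lemma deriv_powr_bound_neg:
 fixes v g :: "real => real"
 assumes "0 < a" "a <= b" "p < - 1" "0 <= A"
  and "!!sg. a <= sg ==> sg <= b ==> (v has_real_derivative g sg) (at sg)"
  and "!!sg. a <= sg ==> sg <= b ==> abs (g sg) <= A * sg powr p"
 shows "abs (v b - v a) <= A / abs (p + 1) * a powr (p + 1)"
proof -
 have "abs (v b - v a) <= A / (p + 1) * (b powr (p + 1) - a powr (p + 1)) + 0 * (b - a)"
  by (rule deriv_powr_bound[where g=g]) (use assms in auto)
 also have "... = A / abs (p + 1) * (a powr (p + 1) - b powr (p + 1))"
 proof -
  have "abs (p + 1) = - (p + 1)" using assms(3) by simp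
  moreover have "A / y * x = A / (- y) * (- x)" for x y :: real by (simp add: divide_minus_right)
  ultimately show ?thesis by (metis add.right_neutral minus_diff_eq mult_zero_left)
 qed
 also have "... <= A / abs (p + 1) * a powr (p + 1)"
  using assms by (intro mult_left_mono) auto
 finally show ?thesis .
qed

text \<open>Two competing bounds for an increment \<open>v\<close>: \<open>vb\<close>, from one more
  derivative, is good at large \<open>sg\<close>, while \<open>bd\<close> is integrable down to 0.
  Following \<open>v\<close> from \<open>min r T\<close> down to \<open>ep\<close> uses the first at
  the switching time and the second below it; if \<open>ep\<close> is already beyond the switch,
  \<open>vb\<close> suffices because \<open>q <= 0\<close>.\<close>

lemma holder_split:
 fixes v g :: "real => real"
 assumes "0 < ep" "ep <= T" "0 < r" "- 1 < p" "q <= 0" "0 <= A1" "0 <= A0" "0 <= A2"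
  and der: "!!sg. ep <= sg ==> sg <= T ==> (v has_real_derivative g sg) (at sg)"
  and bd: "!!sg. ep <= sg ==> sg <= T ==> abs (g sg) <= A1 * sg powr p + A0"
  and vb: "!!sg. ep <= sg ==> sg <= T ==> abs (v sg) <= A2 * sg powr q"
 shows "abs (v ep) <= A2 * min r T powr q + A1 / (p + 1) * min r T powr (p + 1) + A0 * min r T"
proof (cases "min r T <= ep")
 case True
 have "abs (v ep) <= A2 * ep powr q" using assms by (intro vb) auto
 also have "... <= A2 * min r T powr q"
  using True assms by (intro mult_left_mono powr_mono2') auto
 also have "... <= A2 * min r T powr q + (A1 / (p + 1) * min r T powr (p + 1) + A0 * min r T)"
  using assms by simp
 finally show ?thesis by simp
next
 case False
 have "abs (v (min r T) - v ep) <= A1 / (p + 1) * min r T powr (p + 1) + A0 * min r T"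
  by (rule deriv_powr_bound_pos[where g=g]) (use False assms in auto)
 moreover have "abs (v (min r T)) <= A2 * min r T powr q" using False by (intro vb) auto
 ultimately show ?thesis by linarith
qed

text \<open>Hoelder bounds in a form that is stable under pointwise limits.\<close>

primrec HB :: "nat => real => real => 'a::euclidean_space set => ('a => real) => bool" where
 "HB 0 be M D v \<longleftrightarrow> (\<forall>x\<in>D. abs (v x) <= M) \<and> (\<forall>x\<in>D. \<forall>y\<in>D. abs (v x - v y) <= M * dist x y powr be)"
| "HB (Suc k) be M D v \<longleftrightarrow> (\<forall>x\<in>D. abs (v x) <= M) \<and> (\<exists>v'. (\<forall>x\<in>D. (v has_derivative (%y. \<Sum>b\<in>Basis. (y \<bullet> b) * v' b x)) (at x)) \<and>
   (\<forall>b\<in>Basis. HB k be M D (v' b)))"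

lemma HB_bound: "HB k be M D v ==> x \<in> D ==> abs (v x) <= M"
 by (cases k) auto

lemma abs_sum_Basis_le:
 fixes y :: "'a::euclidean_space"
 assumes "!!b. b \<in> Basis ==> abs (g b) <= m"
 shows "abs (\<Sum>b\<in>Basis. (y \<bullet> b) * g b) <= real DIM('a) * m * norm y"
proof -
 have "abs (\<Sum>b\<in>Basis. (y \<bullet> b) * g b) <= (\<Sum>b\<in>(Basis::'a set). norm y * m)"
 proof (rule order_trans[OF sum_abs], rule sum_mono)
  fix b :: 'a assume "b \<in> Basis"
  thus "abs ((y \<bullet> b) * g b) <= norm y * m"
   unfolding abs_mult by (intro mult_mono assms Basis_le_norm) auto
 qed
 thus ?thesis by (simp add: mult_ac)
qed

lemma mean_value_Basis:
 fixes v :: "'a::euclidean_space => real"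
 assumes "convex D" "x \<in> D" "y \<in> D"
  and der: "!!z. z \<in> D ==> (v has_derivative (%h. \<Sum>b\<in>Basis. (h \<bullet> b) * v' b z)) (at z)"
  and bd: "!!z b. z \<in> D ==> b \<in> Basis ==> abs (v' b z) <= m"
 shows "abs (v x - v y) <= real DIM('a) * m * norm (x - y)"
proof -
 have "norm (v x - v y) <= (real DIM('a) * m) * norm (x - y)"
 proof (rule differentiable_bound[OF assms(1) _ _ assms(2,3)])
  fix z assume z: "z \<in> D"
  show "(v has_derivative (%h. \<Sum>b\<in>Basis. (h \<bullet> b) * v' b z)) (at z within D)"
   using der[OF z] by (rule has_derivative_at_withinI)
  show "onorm (%h. \<Sum>b\<in>Basis. (h \<bullet> b) * v' b z) <= real DIM('a) * m"
   using abs_sum_Basis_le[of "%b. v' b z" m] bd[OF z] by (intro onorm_le) auto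
 qed
 thus ?thesis by simp
qed

context stable_setting
begin

text \<open>The summands come from the crude bound at \<open>sg = T\<close>, from integrating the
  power law of \<open>G\<close>, and from the bare source term. The absolute value lets one formula
  serve orders on both sides of \<open>2 * s + al\<close>.\<close>

definition c1 :: "real => real => real => real => real" where
 "c1 D Z T k = D * tau T powr (- k) + (Z + 4) * D / abs ((al - k) / (2 * s) + 1) + 1"

lemma c1_nonneg: "0 <= D ==> 0 <= Z ==> 0 <= c1 D Z T k"
 by (simp add: c1_def)

lemma tau_powr_eq: "tau sg powr a = sg powr (a / (2 * s))"
 by (simp add: tau_def powr_powr)

end

context smooth_sol
begin

context
 fixes T ep :: real
 assumes T: "0 < ep" "ep <= T" "T <= 1" "tau T <= rh"
begin

lemma tau_le: "0 < sg ==> sg <= T ==> tau sg <= rh"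
 using T s powr_mono2[of "1 / (2 * s)" sg T] by (simp add: tau_def)

lemma G_bound':
 assumes kb: "kb nu ze es j D" and sg: "ep <= sg" "sg <= T" and t: "t - sg \<in> I" and x0: "norm x0 <= 1/2"
 shows "abs (G es j ph sg t x0) <= M * (Z + 4) * D * sg powr ((al - kp es j) / (2 * s)) + of_bool (es = [] \<and> j = 0) * M"
proof -
 have sg0: "0 < sg" using sg T by simp
 have "abs (of_bool (es = [] \<and> j = 0) * cos ph * f (t - sg) x0) <= of_bool (es = [] \<and> j = 0) * M"
  using prod_bound[OF abs_cos_le_one[of ph] f_bd[OF t, of x0]] x0 by auto
 thus ?thesis
  using G_bound[OF kb sg0 tau_le[OF sg0 sg(2)] t x0, of ph] by (simp add: tau_powr_eq)
qed

text \<open>Below the critical order \<open>2 * s + al\<close> the power law of \<open>G\<close> is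
  integrable at 0, so starting from the crude bound at \<open>T\<close> gives a bound independent of
  \<open>ep\<close>.\<close>

lemma V_bound_pos:
 assumes kb: "kb nu ze es j D" and sg: "ep <= sg" "sg <= T" and t: "!!sg. ep <= sg ==> sg <= T ==> t - sg \<in> I"
  and x0: "norm x0 <= 1/2" and k: "kp es j < 2 * s + al"
 shows "abs (V es j ph sg t x0) <= M * c1 D Z T (kp es j)"
proof -
 define p where "p = (al - kp es j) / (2 * s)"
 have p: "- 1 < p" using k s by (simp add: p_def field_simps)
 have D: "0 <= D" using kb by (simp add: kb_def)
 have T0: "0 < T" using T by simp
 have "abs (V es j ph T t x0 - V es j ph sg t x0) <= (M * (Z + 4) * D) / (p + 1) * T powr (p + 1) + (of_bool (es = [] \<and> j = 0) * M) * T"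
 proof (rule deriv_powr_bound_pos[where g = "%sg. G es j ph sg t x0"])
  fix r assume r: "sg <= r" "r <= T"
  show "((%sg. V es j ph sg t x0) has_real_derivative G es j ph r t x0) (at r)"
   using r sg T by (intro V_sigma_deriv t) auto
  show "abs (G es j ph r t x0) <= (M * (Z + 4) * D) * r powr p + of_bool (es = [] \<and> j = 0) * M"
   unfolding p_def using r sg by (intro G_bound' kb t x0) auto
 qed (use sg T p M0 K(1) D in auto)
 also have "... <= (M * (Z + 4) * D) / (p + 1) * 1 + M * 1"
  using T T0 p M0 K(1) D by (intro add_mono mult_mono powr_le1) auto
 finally have "abs (V es j ph sg t x0) <= abs (V es j ph T t x0) + ((M * (Z + 4) * D) / (p + 1) + M)" by simp
 also have "abs (V es j ph T t x0) <= M * (D * tau T powr (- kp es j))"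
  using T by (intro V_bound kb t) auto
 also have "M * (D * tau T powr (- kp es j)) + ((M * (Z + 4) * D) / (p + 1) + M) = M * c1 D Z T (kp es j)"
  using p by (simp add: c1_def flip: p_def) (simp add: distrib_left mult_ac)
 finally show ?thesis by simp
qed

text \<open>Above the critical order the lower end of the integral dominates. The crude bound at
  \<open>T\<close> is absorbed, because a negative power of \<open>sg <= 1\<close> is at least 1;
  the order is positive, so the bare source term does not occur.\<close>

lemma V_bound_neg:
 assumes kb: "kb nu ze es j D" and sg: "ep <= sg" "sg <= T" and t: "!!sg. ep <= sg ==> sg <= T ==> t - sg \<in> I"
  and x0: "norm x0 <= 1/2" and k: "2 * s + al < kp es j"
 shows "abs (V es j ph sg t x0) <= M * c1 D Z T (kp es j) * sg powr ((al - kp es j) / (2 * s) + 1)"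
proof -
 define p where "p = (al - kp es j) / (2 * s)"
 have p: "p < - 1" using k s by (simp add: p_def field_simps)
 have D: "0 <= D" using kb by (simp add: kb_def)
 have "0 < 2 * s + al" using s al by simp
 hence nz: "\<not> (es = [] \<and> j = 0)" using k by (auto simp: kp_def intro!: gr0I)
 have sg0: "0 < sg" using sg T by simp
 have "abs (V es j ph T t x0 - V es j ph sg t x0) <= (M * (Z + 4) * D) / abs (p + 1) * sg powr (p + 1)"
 proof (rule deriv_powr_bound_neg[where g = "%sg. G es j ph sg t x0"])
  fix r assume r: "sg <= r" "r <= T"
  show "((%sg. V es j ph sg t x0) has_real_derivative G es j ph r t x0) (at r)"
   using r sg T by (intro V_sigma_deriv t) auto
  show "abs (G es j ph r t x0) <= (M * (Z + 4) * D) * r powr p"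
   using G_bound'[OF kb _ r(2) t x0, of ph] nz r sg by (simp add: p_def)
 qed (use sg T p M0 K(1) D in auto)
 moreover have "abs (V es j ph T t x0) <= M * (D * tau T powr (- kp es j)) * sg powr (p + 1)"
 proof -
  have "1 <= sg powr (p + 1)" using sg0 sg T p powr_mono'[of "p + 1" 0 sg] by simp
  hence "M * (D * tau T powr (- kp es j)) * 1 <= M * (D * tau T powr (- kp es j)) * sg powr (p + 1)"
   using M0 D by (intro mult_left_mono) auto
  moreover have "abs (V es j ph T t x0) <= M * (D * tau T powr (- kp es j))"
   using T by (intro V_bound kb t) auto
  ultimately show ?thesis by simp
 qed
 ultimately have "abs (V es j ph sg t x0) <= M * (D * tau T powr (- kp es j)) * sg powr (p + 1) + (M * (Z + 4) * D) / abs (p + 1) * sg powr (p + 1)"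
  by linarith
 also have "... <= M * c1 D Z T (kp es j) * sg powr (p + 1)"
 proof -
  have "M * (D * tau T powr (- kp es j)) + (M * (Z + 4) * D) / abs (p + 1) <= M * c1 D Z T (kp es j)"
   using M0 by (simp add: c1_def flip: p_def) (simp add: distrib_left mult_ac)
  thus ?thesis unfolding distrib_right[symmetric] by (rule mult_right_mono) simp
 qed
 finally show ?thesis by (simp add: p_def)
qed

text \<open>The order of \<open>es\<close> is the largest integer below \<open>2 * s + al\<close>;
  the next order lies above it and supplies the mean value bound. For points at distance h the two
  bounds meet at the time r = h^(2s) and both give the power h^be with be = 2s + al - k.\<close>

lemma V_space_holder:
 assumes kb: "kb nu ze es 0 D" and kb': "!!b. b \<in> Basis ==> kb nu ze (b # es) 0 D"
  and t: "!!sg. ep <= sg ==> sg <= T ==> t - sg \<in> I"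
  and x: "x \<in> ball 0 (1/2)" "x' \<in> ball 0 (1/2)"
  and k: "real (length es) < 2 * s + al" "2 * s + al < real (length es) + 1"
 shows "abs (V es 0 ph ep t x - V es 0 ph ep t x')
  <= M * (real DIM('a) * c1 D Z T (real (length es) + 1) / tau T + 2 * c1 D Z T (real (length es)) + 1) * dist x x' powr (2 * s + al - real (length es))"
proof (cases "x = x'")
 case False
 define k where "k = real (length es)"
 define be where "be = 2 * s + al - k"
 have be: "0 < be" "be < 1" using k by (auto simp: be_def k_def)
 have kpe: "kp es 0 = k" "!!b. kp (b # es) 0 = k + 1" by (auto simp: kp_def k_def)
 have D: "0 <= D" using kb by (simp add: kb_def)
 have T0: "0 < T" using T by simp
 define h where "h = dist x x'"
 have h: "0 < h" "h <= 1"
 proof -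
  show "0 < h" using False by (simp add: h_def)
  have "dist x x' <= dist x 0 + dist 0 x'" by (rule dist_triangle)
  thus "h <= 1" using x by (simp add: h_def dist_commute)
 qed
 define r where "r = h powr (2 * s)"
 have r: "0 < r" using h by (simp add: r_def)
 define p where "p = (al - k) / (2 * s)"
 define q where "q = (al - (k + 1)) / (2 * s) + 1"
 have p: "- 1 < p" using k s by (simp add: p_def k_def field_simps)
 have q: "q < 0" using k s by (simp add: q_def k_def field_simps)
 have p1: "p + 1 = be / (2 * s)" and q1: "q = (be - 1) / (2 * s)" using s by (auto simp: p_def q_def be_def field_simps)
 let ?n = "real DIM('a)"
 define A2 where "A2 = ?n * (M * c1 D Z T (k + 1)) * h"
 define r0 where "r0 = min r T"
 have n1: "norm x <= 1/2" "norm x' <= 1/2" using x by auto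
 have main: "abs ((%sg. V es 0 ph sg t x - V es 0 ph sg t x') ep) <= A2 * min r T powr q
   + (2 * (M * (Z + 4) * D)) / (p + 1) * min r T powr (p + 1) + (of_bool (es = []) * M * h powr al) * min r T"
 proof (rule holder_split[where g = "%sg. G es 0 ph sg t x - G es 0 ph sg t x'" and v = "%sg. V es 0 ph sg t x - V es 0 ph sg t x'"])
  fix sg assume sg: "ep <= sg" "sg <= T"
  have sg0: "0 < sg" using sg T by simp
  show "((%sg. V es 0 ph sg t x - V es 0 ph sg t x') has_real_derivative G es 0 ph sg t x - G es 0 ph sg t x') (at sg)"
   by (intro DERIV_diff V_sigma_deriv t sg sg0)
  \<comment> \<open>Without space derivatives the values of the source at the two points do not drop
    out of \<open>G\<close>. Their difference is at most M h^al, and over the time r = h^(2s) it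
    contributes h^(2s + al), which is h^be in this case.\<close>
  let ?o = "of_bool (es = []) * cos ph :: real"
  have "abs (?o * (f (t - sg) x - f (t - sg) x')) <= of_bool (es = []) * (M * h powr al)"
  proof (rule prod_bound)
   show "abs (f (t - sg) x - f (t - sg) x') <= M * h powr al"
    using f_hold[OF t[OF sg] t[OF sg], of x x'] n1 by (simp add: h_def dist_norm)
  qed auto
  moreover have "abs (G es 0 ph sg t y + ?o * f (t - sg) y) <= M * (Z + 4) * D * sg powr p" if "norm y <= 1/2" for y
   using G_bound[OF kb sg0 tau_le[OF sg0 sg(2)] t[OF sg] that, of ph] by (simp add: tau_powr_eq kpe p_def)
  from this[OF n1(1)] this[OF n1(2)]
  have "abs ((G es 0 ph sg t x + ?o * f (t - sg) x) - (G es 0 ph sg t x' + ?o * f (t - sg) x')) <= 2 * (M * (Z + 4) * D * sg powr p)" by linarith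
  ultimately show "abs (G es 0 ph sg t x - G es 0 ph sg t x') <= 2 * (M * (Z + 4) * D) * sg powr p + of_bool (es = []) * M * h powr al"
   by (simp add: right_diff_distrib)
  have "abs (V es 0 ph sg t x - V es 0 ph sg t x') <= ?n * (M * c1 D Z T (k + 1) * sg powr q) * norm (x - x')"
  proof (rule mean_value_Basis[OF convex_ball x])
   fix z assume z: "z \<in> ball (0::'a) (1/2)"
   show "((%x. V es 0 ph sg t x) has_derivative (%y. \<Sum>b\<in>Basis. (y \<bullet> b) * V (b # es) 0 (ph + pi/2) sg t z)) (at z)"
    by (rule V_x_deriv[OF t[OF sg] sg0])
   fix b :: 'a assume b: "b \<in> Basis"
   show "abs (V (b # es) 0 (ph + pi/2) sg t z) <= M * c1 D Z T (k + 1) * sg powr q"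
    using V_bound_neg[OF kb'[OF b] sg t, of z "ph + pi/2"] z k by (simp add: kpe q_def k_def)
  qed
  thus "abs (V es 0 ph sg t x - V es 0 ph sg t x') <= A2 * sg powr q"
   by (simp add: A2_def h_def dist_norm mult_ac)
 qed (use T r p q M0 K(1) D h c1_nonneg in \<open>auto simp: A2_def\<close>)
 have r0: "0 < r0" "r0 <= r" "r0 <= T" using r T0 by (auto simp: r0_def)
 have e1: "r0 powr (p + 1) <= h powr be"
 proof -
  have "r0 powr (p + 1) <= r powr (p + 1)" using r0 p by (intro powr_mono2) auto
  also have "... = h powr be" using s by (simp add: r_def powr_powr p1)
  finally show ?thesis .
 qed
 \<comment> \<open>For points closer than \<open>tau T\<close> this is an equality without the
   divisor. For more distant ones the switch happens at \<open>T\<close>, and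
   \<open>1 / tau T\<close> pays for it.\<close>
 have e2: "h * r0 powr q <= h powr be / tau T"
 proof (cases "r <= T")
  case True
  have "r0 powr q = h powr (be - 1)" using True s by (simp add: r0_def r_def powr_powr q1)
  hence "h * r0 powr q = h powr be" using h by (simp add: powr_diff)
  also have "... <= h powr be / tau T"
   using T0 T(4) rh by (simp add: pos_le_divide_eq mult_left_le)
  finally show ?thesis .
 next
  case False
  have "r0 powr q = tau T powr (be - 1)" using False by (simp add: r0_def tau_powr_eq q1)
  hence "h * r0 powr q = h powr 1 * tau T powr be / tau T" using T0 h by (simp add: powr_diff tau_def)
  also have "... <= h powr be * 1 / tau T"
   using h be T T0 rh by (intro divide_right_mono mult_mono powr_mono' powr_le1) (auto simp: tau_def)
  finally show ?thesis by simp
 qed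
 have e3: "of_bool (es = []) * h powr al * r0 <= h powr be"
 proof (cases "es = []")
  case True
  have "h powr al * r0 <= h powr al * r" using r0 by (intro mult_left_mono) auto
  also have "... = h powr be" using True by (simp add: r_def be_def k_def powr_add[symmetric] add.commute)
  finally show ?thesis using True by simp
 qed simp
 have "abs (V es 0 ph ep t x - V es 0 ph ep t x') <= (?n * (M * c1 D Z T (k + 1))) * (h * r0 powr q)
   + (2 * (M * (Z + 4) * D)) / (p + 1) * r0 powr (p + 1) + M * (of_bool (es = []) * h powr al * r0)"
  using main unfolding r0_def A2_def by (simp add: mult_ac)
 also have "... <= (?n * (M * c1 D Z T (k + 1))) * (h powr be / tau T) + (2 * (M * (Z + 4) * D)) / (p + 1) * h powr be + M * h powr be"
  using M0 D K(1) p c1_nonneg[OF D K(1)] by (intro add_mono mult_left_mono e1 e2 e3) auto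
 also have "... = M * (?n * c1 D Z T (k + 1) / tau T + 2 * ((Z + 4) * D / (p + 1)) + 1) * h powr be"
  by (simp add: algebra_simps)
 also have "... <= M * (?n * c1 D Z T (k + 1) / tau T + 2 * c1 D Z T k + 1) * h powr be"
 proof (intro mult_right_mono mult_left_mono add_mono)
  show "(Z + 4) * D / (p + 1) <= c1 D Z T k" using p D by (simp add: c1_def p_def[symmetric])
 qed (use M0 in auto)
 finally show ?thesis by (simp add: k_def h_def be_def)
qed simp

text \<open>The time derivative consists of \<open>V [] 1\<close>, of order 2s below the critical
  order, and \<open>G [] 0\<close>. Increments of the first are split at
  \<open>sg = \<bar>t - t'\<bar>\<close>, with the order 4s, which exceeds 2s + al, providing the
  mean value bound; increments of the second follow directly from the time continuity of the
  data.\<close>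

lemma V_time_bounds:
 assumes kb: "kb nu ze [] 0 D" "kb nu ze [] 1 D" "kb nu ze [] 2 D"
  and J: "convex J" "!!t sg. t \<in> J ==> ep <= sg ==> sg <= T ==> t - sg \<in> I" "!!t t'. t \<in> J ==> t' \<in> J ==> abs (t - t') <= 1"
  and x0: "norm x0 <= 1/2" and t: "t \<in> J"
 defines "w \<equiv> %t. V [] 0 0 ep t x0" and "d \<equiv> %t. - V [] 1 0 ep t x0 - G [] 0 0 ep t x0"
 shows "abs (w t) <= M * c1 D Z T 0" "(w has_real_derivative d t) (at t)"
  "abs (d t) <= M * (c1 D Z T (2 * s) + (Z + 4) * D + 1)"
  "t' \<in> J ==> abs (d t - d t') <= M * ((c1 D Z T (4 * s) + (Z + 4) * D) / T + 2 * c1 D Z T (2 * s) + 2 * D) * abs (t - t') powr (al / (2 * s))"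
proof -
 have D: "0 <= D" using kb by (simp add: kb_def)
 have T0: "0 < T" using T by simp
 define be where "be = al / (2 * s)"
 have be: "0 < be" "be < 1" using al s by (auto simp: be_def)
 have kpe: "kp ([]::'a list) 0 = 0" "kp ([]::'a list) 1 = 2 * s" "kp ([]::'a list) 2 = 4 * s" by (auto simp: kp_def)
 note It = J(2)
 show "abs (w t) <= M * c1 D Z T 0"
  unfolding w_def using V_bound_pos[OF kb(1) _ T(2) It[OF t] x0] T s al by (simp add: kpe)
 have Iep: "t - ep \<in> I" if "t \<in> J" for t using It[OF that, of ep] T by simp
 show "(w has_real_derivative d t) (at t)"
  unfolding w_def d_def using V_t_deriv[OF Iep[OF t] T(1), of "[]" 0 0 x0] by simp
 have e1: "ep powr be <= 1" using T be by (intro powr_le1) auto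
 have G0: "abs (G [] 0 0 ep t x0) <= M * ((Z + 4) * D + 1)"
 proof -
  have "abs (G [] 0 0 ep t x0) <= M * (Z + 4) * D * ep powr be + M"
   using G_bound'[OF kb(1) _ T(2) Iep[OF t] x0, of 0] by (simp add: kpe be_def)
  also have "... <= M * (Z + 4) * D * 1 + M" using M0 K(1) D by (intro add_mono mult_left_mono e1) auto
  finally show ?thesis by (simp add: algebra_simps)
 qed
 have V1: "abs (V [] 1 0 ep t x0) <= M * c1 D Z T (2 * s)"
  using V_bound_pos[OF kb(2) _ T(2) It[OF t] x0, of 0] al by (simp add: kpe del: One_nat_def)
 have "abs (d t) <= abs (V [] 1 0 ep t x0) + abs (G [] 0 0 ep t x0)" unfolding d_def by linarith
 also have "... <= M * c1 D Z T (2 * s) + M * ((Z + 4) * D + 1)" by (intro add_mono V1 G0)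
 finally show "abs (d t) <= M * (c1 D Z T (2 * s) + (Z + 4) * D + 1)" by (simp add: algebra_simps)
 assume t': "t' \<in> J"
 define h where "h = abs (t - t')"
 show "abs (d t - d t') <= M * ((c1 D Z T (4 * s) + (Z + 4) * D) / T + 2 * c1 D Z T (2 * s) + 2 * D) * abs (t - t') powr (al / (2 * s))"
 proof (cases "t = t'")
  case False
  have h: "0 < h" "h <= 1" using False J(3)[OF t t'] by (auto simp: h_def)
  have G1: "abs (G [] 0 0 ep t x0 - G [] 0 0 ep t' x0) <= M * h powr be * (2 * D)"
   using G_time_holder[OF kb(1) T(1) tau_le[OF T(1,2)] Iep[OF t] Iep[OF t'] x0, of 0] T(1) by (simp add: kpe h_def be_def tau_def)
  define B2 where "B2 = M * (c1 D Z T (4 * s) + (Z + 4) * D)"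
  have B2: "0 <= B2" using M0 K(1) D c1_nonneg[OF D K(1)] by (simp add: B2_def)
  define r0 where "r0 = min h T"
  have p1: "be - 1 = (al - 2 * s) / (2 * s)" "be - 1 = (al - 4 * s) / (2 * s) + 1" using s by (auto simp: be_def field_simps)
  have main: "abs ((%sg. V [] 1 0 sg t x0 - V [] 1 0 sg t' x0) ep) <= (B2 * h) * min h T powr (be - 1)
   + (2 * (M * (Z + 4) * D)) / ((be - 1) + 1) * min h T powr ((be - 1) + 1) + 0 * min h T"
  proof (rule holder_split[where g = "%sg. G [] 1 0 sg t x0 - G [] 1 0 sg t' x0" and v = "%sg. V [] 1 0 sg t x0 - V [] 1 0 sg t' x0"])
   fix sg assume sg: "ep <= sg" "sg <= T"
   have sg0: "0 < sg" using sg T by simp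
   show "((%sg. V [] 1 0 sg t x0 - V [] 1 0 sg t' x0) has_real_derivative G [] 1 0 sg t x0 - G [] 1 0 sg t' x0) (at sg)"
    by (intro DERIV_diff V_sigma_deriv It t t' sg sg0)
   have G1b: "abs (G [] 1 0 sg t x0) <= M * (Z + 4) * D * sg powr (be - 1)" if "t \<in> J" for t
    using G_bound'[of "[]" 1 D sg t x0 0, OF kb(2) sg It[OF that sg] x0] by (simp add: kpe p1(1) del: One_nat_def)
   show "abs (G [] 1 0 sg t x0 - G [] 1 0 sg t' x0) <= 2 * (M * (Z + 4) * D) * sg powr (be - 1) + 0"
    using G1b[OF t] G1b[OF t'] by linarith
   have "norm (V [] 1 0 sg t x0 - V [] 1 0 sg t' x0) <= (B2 * sg powr (be - 1)) * norm (t - t')"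
   proof (rule field_differentiable_bound[OF J(1) _ _ t t', of "%t. V [] 1 0 sg t x0" "%t. - V [] 2 0 sg t x0 - G [] 1 0 sg t x0"])
    fix z assume z: "z \<in> J"
    have "((%t. V [] 1 0 sg t x0) has_real_derivative (- V [] (Suc 1) 0 sg z x0 - G [] 1 0 sg z x0)) (at z)"
     by (rule V_t_deriv[OF It[OF z sg] sg0])
    thus "((%t. V [] 1 0 sg t x0) has_real_derivative (- V [] 2 0 sg z x0 - G [] 1 0 sg z x0)) (at z within J)"
     by (simp add: numeral_2_eq_2 has_field_derivative_at_within)
    have "abs (V [] 2 0 sg z x0) <= M * c1 D Z T (4 * s) * sg powr (be - 1)"
     using V_bound_neg[OF kb(3) sg It[OF z] x0, of 0] al by (simp add: kpe p1(2))
    thus "norm (- V [] 2 0 sg z x0 - G [] 1 0 sg z x0) <= B2 * sg powr (be - 1)"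
     using G1b[OF z] by (simp add: B2_def algebra_simps)
   qed
   thus "abs (V [] 1 0 sg t x0 - V [] 1 0 sg t' x0) <= B2 * h * sg powr (be - 1)"
    by (simp add: h_def mult_ac)
  qed (use T be h M0 K(1) D B2 in auto)
  have e1: "r0 powr be <= h powr be" using h T0 be by (intro powr_mono2) (auto simp: r0_def)
  have e2: "h * r0 powr (be - 1) <= h powr be / T"
  proof (cases "h <= T")
   case True
   have "h * r0 powr (be - 1) = h powr be" using True h by (simp add: r0_def powr_diff)
   also have "... <= h powr be / T" using T0 T(3) by (simp add: pos_le_divide_eq mult_left_le)
   finally show ?thesis .
  next
   case False
   hence "h * r0 powr (be - 1) = h powr 1 * T powr be / T" using T0 h by (simp add: r0_def powr_diff)
   also have "... <= h powr be * 1 / T"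
    using h be T T0 by (intro divide_right_mono mult_mono powr_mono' powr_le1) auto
   finally show ?thesis by simp
  qed
  have "abs (V [] 1 0 ep t x0 - V [] 1 0 ep t' x0) <= B2 * (h * r0 powr (be - 1)) + (2 * (M * (Z + 4) * D)) / be * r0 powr be"
   using main by (simp add: r0_def mult_ac)
  also have "... <= B2 * (h powr be / T) + (2 * (M * (Z + 4) * D)) / be * h powr be"
   using B2 M0 K(1) D be by (intro add_mono mult_left_mono e1 e2) auto
  also have "... = M * ((c1 D Z T (4 * s) + (Z + 4) * D) / T + 2 * ((Z + 4) * D / be)) * h powr be"
   by (simp add: B2_def algebra_simps add_divide_distrib)
  also have "... <= M * ((c1 D Z T (4 * s) + (Z + 4) * D) / T + 2 * c1 D Z T (2 * s)) * h powr be"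
  proof (intro mult_right_mono mult_left_mono add_mono)
   have "(al - 2 * s) / (2 * s) + 1 = be" using s by (simp add: be_def field_simps)
   thus "(Z + 4) * D / be <= c1 D Z T (2 * s)" using be D by (simp add: c1_def)
  qed (use M0 in auto)
  finally have V1h: "abs (V [] 1 0 ep t x0 - V [] 1 0 ep t' x0) <= M * ((c1 D Z T (4 * s) + (Z + 4) * D) / T + 2 * c1 D Z T (2 * s)) * h powr be" .
  have "abs (d t - d t') <= abs (V [] 1 0 ep t x0 - V [] 1 0 ep t' x0) + abs (G [] 0 0 ep t x0 - G [] 0 0 ep t' x0)"
   unfolding d_def by linarith
  also have "... <= M * ((c1 D Z T (4 * s) + (Z + 4) * D) / T + 2 * c1 D Z T (2 * s)) * h powr be + M * h powr be * (2 * D)"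
   by (intro add_mono V1h G1)
  also have "... = M * ((c1 D Z T (4 * s) + (Z + 4) * D) / T + 2 * c1 D Z T (2 * s) + 2 * D) * h powr be"
   by (simp add: algebra_simps)
  finally show ?thesis by (simp add: h_def be_def)
 qed simp
qed

end

end

context stable_setting
begin

definition space_const :: "nat => nat => real => real => real => real" where
 "space_const n K D Z T = (\<Sum>i\<le>K. c1 D Z T (real i)) + (real n * c1 D Z T (real K + 1) / tau T + 2 * c1 D Z T (real K) + 1)"

definition time_const :: "real => real => real => real" where
 "time_const D Z T = c1 D Z T 0 + (c1 D Z T (2 * s) + (Z + 4) * D + 1)
   + ((c1 D Z T (4 * s) + (Z + 4) * D) / T + 2 * c1 D Z T (2 * s) + 2 * D)"

end

context smooth_sol
begin

context
 fixes T ep :: real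
 assumes T: "0 < ep" "ep <= T" "T <= 1" "tau T <= rh"
begin

text \<open>\<open>n\<close> counts the derivatives still to be taken. The induction starts at full
  order \<open>K\<close>, where the Hoelder bound is known, and removes one derivative at a time
  until \<open>es = []\<close>.\<close>

lemma V_space_HB:
 assumes kb: "!!es. set es \<subseteq> Basis ==> length es <= Suc K ==> kb nu ze es 0 D"
  and t: "!!sg. ep <= sg ==> sg <= T ==> t - sg \<in> I"
  and K: "real K < 2 * s + al" "2 * s + al < real K + 1"
 shows "n <= K ==> set es \<subseteq> Basis ==> length es = K - n ==>
  HB n (2 * s + al - real K) (M * space_const DIM('a) K D Z T) (ball 0 (1/2)) (V es 0 ph ep t)"
proof (induction n arbitrary: es ph)
 have D: "0 <= D" using kb[of "[]"] by (simp add: kb_def)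
 have T0: "0 < T" using T by simp
 have cn: "0 <= c1 D Z T k" for k using K(1) by (intro c1_nonneg D cutoffD(1)[OF cut])
 have le1: "c1 D Z T (real i) <= space_const DIM('a) K D Z T" if "i <= K" for i
 proof -
  have "c1 D Z T (real i) <= (\<Sum>i\<le>K. c1 D Z T (real i))" using that cn by (intro member_le_sum) auto
  thus ?thesis using cn T0 unfolding space_const_def by (smt (verit) divide_nonneg_nonneg mult_nonneg_nonneg of_nat_0_le_iff tau_pos)
 qed
 have bd: "abs (V es 0 ph ep t x) <= M * space_const DIM('a) K D Z T"
  if es: "set es \<subseteq> Basis" "length es <= K" and x: "x \<in> ball 0 (1/2)" for es ph x
 proof -
  have "abs (V es 0 ph ep t x) <= M * c1 D Z T (kp es 0)"
   using es x K T by (intro V_bound_pos[OF T kb]) (auto simp: kp_def intro!: t)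
  also have "... <= M * space_const DIM('a) K D Z T"
   using le1[OF es(2)] M0 by (intro mult_left_mono) (auto simp: kp_def)
  finally show ?thesis .
 qed
 {
  case 0
  have len: "length es = K" using 0 by simp
  have "real DIM('a) * c1 D Z T (real K + 1) / tau T + 2 * c1 D Z T (real K) + 1 <= space_const DIM('a) K D Z T"
   unfolding space_const_def using sum_nonneg[of "{..K}" "%i. c1 D Z T (real i)"] cn by simp
  hence "M * (real DIM('a) * c1 D Z T (real K + 1) / tau T + 2 * c1 D Z T (real K) + 1) * dist x y powr (2 * s + al - real K)
   <= M * space_const DIM('a) K D Z T * dist x y powr (2 * s + al - real K)" for x y :: 'a
   using M0 by (intro mult_right_mono mult_left_mono) auto
  moreover have "abs (V es 0 ph ep t x - V es 0 ph ep t y)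
   <= M * (real DIM('a) * c1 D Z T (real K + 1) / tau T + 2 * c1 D Z T (real K) + 1) * dist x y powr (2 * s + al - real K)"
   if "x \<in> ball 0 (1/2)" "y \<in> ball 0 (1/2)" for x y
   by (rule V_space_holder[OF T kb kb t that, where es=es and ph=ph, unfolded len]) (use 0 K that in auto)
  ultimately show ?case unfolding HB.simps
   using 0 by (intro conjI ballI bd) (simp_all, blast intro: order_trans)
 next
  case (Suc n)
  have "\<forall>b\<in>Basis. HB n (2 * s + al - real K) (M * space_const DIM('a) K D Z T) (ball 0 (1/2)) (V (b # es) 0 (ph + pi/2) ep t)"
   using Suc.prems by (intro ballI Suc.IH) auto
  moreover have "(V es 0 ph ep t has_derivative (%y. \<Sum>b\<in>Basis. (y \<bullet> b) * V (b # es) 0 (ph + pi/2) ep t x)) (at x)" for x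
   using V_x_deriv[OF t T(1)] T by simp
  ultimately show ?case using bd[of es] Suc.prems
   unfolding HB.simps by (intro conjI exI[of _ "%b. V (b # es) 0 (ph + pi/2) ep t"]) auto
 }
qed

lemma V_time_HB:
 assumes kb: "kb nu ze [] 0 D" "kb nu ze [] 1 D" "kb nu ze [] 2 D"
  and J: "convex J" "!!t sg. t \<in> J ==> ep <= sg ==> sg <= T ==> t - sg \<in> I" "!!t t'. t \<in> J ==> t' \<in> J ==> abs (t - t') <= 1"
  and x0: "norm x0 <= 1/2"
 shows "HB 1 (al / (2 * s)) (M * time_const D Z T) J (%t. V [] 0 0 ep t x0)"
proof -
 have D: "0 <= D" using kb by (simp add: kb_def)
 have T0: "0 < T" using T by simp
 have cn: "0 <= c1 D Z T k" for k by (intro c1_nonneg D K(1))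
 define a1 where "a1 = c1 D Z T 0"
 define a2 where "a2 = c1 D Z T (2 * s) + (Z + 4) * D + 1"
 define a3 where "a3 = (c1 D Z T (4 * s) + (Z + 4) * D) / T + 2 * c1 D Z T (2 * s) + 2 * D"
 have a: "0 <= a1" "0 <= a2" "0 <= a3" using cn D K(1) T0 by (auto simp: a1_def a2_def a3_def)
 have tc: "time_const D Z T = a1 + a2 + a3" by (simp add: time_const_def a1_def a2_def a3_def)
 have le: "M * a1 <= M * time_const D Z T" "M * a2 <= M * time_const D Z T" "M * a3 <= M * time_const D Z T"
  using a M0 by (auto simp: tc intro!: mult_left_mono)
 let ?d = "%t. - V [] 1 0 ep t x0 - G [] 0 0 ep t x0"
 show ?thesis unfolding One_nat_def HB.simps
 proof (intro conjI ballI exI[of _ "%b. ?d"])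
  fix t assume t: "t \<in> J"
  show "abs (V [] 0 0 ep t x0) <= M * time_const D Z T" 
   by (rule order_trans[OF _ le(1)], unfold a1_def, rule V_time_bounds(1)[OF T kb J(1) _ _ x0 t]) (use J in blast)+
  show "((%t. V [] 0 0 ep t x0) has_derivative (%y. \<Sum>b\<in>Basis. (y \<bullet> b) * ?d t)) (at t)"
  proof -
   have "((%t. V [] 0 0 ep t x0) has_real_derivative ?d t) (at t)"
    by (rule V_time_bounds(2)[OF T kb J(1) _ _ x0 t]) (use J in blast)+
   moreover have "(%y. \<Sum>b\<in>Basis. (y \<bullet> b) * ?d t) = (*) (?d t)" by (simp add: fun_eq_iff)
   ultimately show ?thesis unfolding has_field_derivative_def by (simp only:)
  qed
  show "abs (?d t) <= M * time_const D Z T" 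
   by (rule order_trans[OF _ le(2)], unfold a2_def, rule V_time_bounds(3)[OF T kb J(1) _ _ x0 t]) (use J in blast)+
  fix t' assume t': "t' \<in> J"
  have "M * a3 * dist t t' powr (al / (2 * s)) <= M * time_const D Z T * dist t t' powr (al / (2 * s))"
   by (intro mult_right_mono le) auto
  moreover have "abs (?d t - ?d t') <= M * a3 * dist t t' powr (al / (2 * s))"
   unfolding dist_real_def a3_def by (rule V_time_bounds(4)[OF T kb J(1) _ _ x0 t t']) (use J in blast)+
  ultimately show "abs (?d t - ?d t') <= M * time_const D Z T * dist t t' powr (al / (2 * s))" by linarith
 qed
qed

text \<open>The kernel has unit mass and the cutoff is 1 at \<open>x0\<close>, so the error is an
  average of increments. The spatial ones cost
  \<open>tau ep powr al = ep powr (al / (2 * s))\<close>, the same as the time lag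
  \<open>ep\<close>.\<close>

lemma V_approx:
 assumes kb: "kb nu ze [] 0 D" and t: "t \<in> I" "t - ep \<in> I" and x0: "norm x0 <= 1/2"
 shows "abs (V [] 0 0 ep t x0 - u t x0) <= M * (D * (Z + 4)) * ep powr (al / (2 * s))"
proof -
 note [measurable] = zeta_meas u_meas[OF t(2)] kern_reflect_meas
 have ep: "tau ep <= rh" by (rule tau_le[OF T]) (use T in simp_all)
 define be where "be = al / (2 * s)"
 define k where "k x = kern [] 0 0 nu ep (x0 - x)" for x
 have [measurable]: "bm k" unfolding k_def by measurable
 note ka = kern_abs_integral[OF kb T(1) ep, where ph=0 and ?x0.0=x0, folded k_def]
 have kpe: "kp ([]::'a list) 0 = 0" by (simp add: kp_def)
 have ik: "LI k" using ka(1) by (subst (asm) integrable_abs_iff) auto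
 have k1: "(LBINT x. k x) = 1"
  using integral_reflect(2)[OF integrable_kern[OF lev T(1) ep], where z=x0 and es1="[]" and j1=0 and ph1=0] integral_kern[OF lev T(1) ep, of "[]" 0 0] by (simp add: k_def)
 have iV: "LI (%x. ze x * (k x * u (t - ep) x))"
 proof (rule abs_integral_le(1)[OF integrable_mult_right[OF ka(1), of M]])
  show "AE x in lborel. abs (ze x * (k x * u (t - ep) x)) <= M * abs (k x)"
  proof (rule AE_I2)
   fix x
   have "abs (ze x) * (abs (k x) * abs (u (t - ep) x)) <= 1 * (abs (k x) * M)" by (intro mult_mono K(2) u_bd t mult_nonneg_nonneg) auto
   thus "abs (ze x * (k x * u (t - ep) x)) <= M * abs (k x)" by (simp add: abs_mult mult_ac)
  qed
 qed simp
 have e: "V [] 0 0 ep t x0 - u t x0 = (LBINT x. k x * (ze x * u (t - ep) x - u t x0))"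
 proof -
  have "(LBINT x. k x * (ze x * u (t - ep) x - u t x0)) = (LBINT x. ze x * (k x * u (t - ep) x) - k x * u t x0)"
   by (intro Bochner_Integration.integral_cong refl) (simp add: algebra_simps)
  thus ?thesis using iV ik k1 unfolding V_def k_def[symmetric] by simp
 qed
 have le: "abs (k x * (ze x * u (t - ep) x - u t x0)) <= M * (Z + 3) * (norm (x0 - x) powr al * abs (k x)) + M * ep powr be * abs (k x)" for x
 proof -
  have "abs (ze x - 1) <= (Z + 2) * norm (x0 - x) powr al"
  proof (cases "norm (x0 - x) <= 1")
   case True
   have "abs (ze x - ze x0) <= Z * norm (x0 - x)" using K(3)[of x x0] by (simp add: norm_minus_commute)
   also have "... <= (Z + 2) * norm (x0 - x) powr al"
    using True al K(1) powr_mono'[of al 1 "norm (x0 - x)"] by (intro mult_mono) auto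
   finally show ?thesis using K(5)[of x0] x0 by simp
  next
   case False
   have "abs (ze x - 1) <= 2 * 1" using K(2)[of x] by simp
   also have "... <= (Z + 2) * norm (x0 - x) powr al"
    using False al K(1) by (intro mult_mono ge_one_powr_ge_zero) auto
   finally show ?thesis .
  qed
  hence "abs ((ze x - 1) * u (t - ep) x) <= (Z + 2) * norm (x0 - x) powr al * M"
   by (intro prod_bound u_bd t)
  moreover have "abs (u (t - ep) x - u t x0) <= M * (ep powr be + norm (x0 - x) powr al)"
   using u_hold[OF t(2,1), of x x0] T by (simp add: be_def norm_minus_commute)
  ultimately have "abs (ze x * u (t - ep) x - u t x0) <= M * (Z + 3) * norm (x0 - x) powr al + M * ep powr be"
   by (simp add: algebra_simps)
  hence "abs (k x) * abs (ze x * u (t - ep) x - u t x0) <= abs (k x) * (M * (Z + 3) * norm (x0 - x) powr al + M * ep powr be)"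
   by (rule mult_left_mono) simp
  thus ?thesis unfolding abs_mult by (rule order_trans) (simp add: algebra_simps)
 qed
 have "abs (V [] 0 0 ep t x0 - u t x0) <= (LBINT x. M * (Z + 3) * (norm (x0 - x) powr al * abs (k x)) + M * ep powr be * abs (k x))"
  unfolding e using ka(1,3) le by (intro abs_integral_le(2)) auto
 also have "... = M * (Z + 3) * (LBINT x. norm (x0 - x) powr al * abs (k x)) + M * ep powr be * (LBINT x. abs (k x))"
  using ka(1,3) by simp
 also have "... <= M * (Z + 3) * (D * tau ep powr (al - kp ([]::'a list) 0)) + M * ep powr be * (D * tau ep powr (- kp ([]::'a list) 0))"
  using ka(2,4) M0 K(1) by (intro add_mono mult_left_mono) auto
 also have "... = M * (D * (Z + 4)) * ep powr be"
  using tau_powr_eq[of ep al] tau_powr_eq[of ep 0] T(1) by (simp add: kpe be_def algebra_simps)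
 finally show ?thesis by (simp add: be_def)
qed

end

end

subsection \<open>Limits in Hoelder classes\<close>

lemma HB_modulus:
 fixes v :: "'a::euclidean_space => real"
 assumes hb: "HB k be M D v" and D: "convex D" and be: "0 < be" "be <= 1" and x: "x \<in> D" "y \<in> D" "norm (x - y) <= 1"
 shows "abs (v x - v y) <= (real DIM('a) + 1) * M * norm (x - y) powr be"
proof -
 have M: "0 <= M" using HB_bound[OF hb x(1)] by linarith
 show ?thesis
 proof (cases k)
  case 0
  hence "abs (v x - v y) <= 1 * M * norm (x - y) powr be" using hb x by (simp add: dist_norm)
  also have "... <= (real DIM('a) + 1) * M * norm (x - y) powr be" using M by (intro mult_right_mono) auto
  finally show ?thesis .
 next
  case (Suc l)
  then obtain v' where v': "!!z. z \<in> D ==> (v has_derivative (%y. \<Sum>b\<in>Basis. (y \<bullet> b) * v' b z)) (at z)"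
   "!!b. b \<in> Basis ==> HB l be M D (v' b)" using hb by auto
  have "abs (v x - v y) <= real DIM('a) * M * norm (x - y)"
   by (rule mean_value_Basis[OF D x(1,2) v'(1)]) (use HB_bound[OF v'(2)] in auto)
  also have "... <= (real DIM('a) + 1) * M * norm (x - y) powr be"
   using M x(3) be powr_mono'[of be 1 "norm (x - y)"] by (intro mult_mono) auto
  finally show ?thesis .
 qed
qed

text \<open>The mean value bound is applied to \<open>v\<close> minus its linear part at
  \<open>x\<close>, on the part of \<open>D\<close> within distance |y| of \<open>x\<close>, where
  the gradient varies by at most a multiple of |y|^be.\<close>

lemma HB_remainder:
 fixes v :: "'a::euclidean_space => real"
 assumes D: "convex D" and be: "0 < be" "be <= 1" and x: "x \<in> D" "x + y \<in> D" "norm y <= 1"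
  and der: "!!z. z \<in> D ==> (v has_derivative (%y. \<Sum>b\<in>Basis. (y \<bullet> b) * v' b z)) (at z)"
  and hb: "!!b. b \<in> Basis ==> HB k be M D (v' b)"
 shows "abs (v (x + y) - v x - (\<Sum>b\<in>Basis. (y \<bullet> b) * v' b x)) <= real DIM('a) * ((real DIM('a) + 1) * M) * norm y powr be * norm y"
proof -
 obtain b0 :: 'a where b0: "b0 \<in> Basis" by (meson nonempty_Basis ex_in_conv)
 have M: "0 <= M" using HB_bound[OF hb[OF b0] x(1)] by linarith
 define w where "w z = v z - (\<Sum>b\<in>Basis. (z \<bullet> b) * v' b x)" for z
 have "abs (w (x + y) - w x) <= real DIM('a) * ((real DIM('a) + 1) * M * norm y powr be) * norm (x + y - x)"
 proof (rule mean_value_Basis[where D = "D \<inter> cball x (norm y)"])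
  fix z assume z: "z \<in> D \<inter> cball x (norm y)"
  have n: "norm (z - x) <= norm y" using z by (simp add: dist_norm norm_minus_commute)
  have "(w has_derivative (%h. (\<Sum>b\<in>Basis. (h \<bullet> b) * v' b z) - (\<Sum>b\<in>Basis. (h \<bullet> b) * v' b x))) (at z)"
   unfolding w_def using z by (intro has_derivative_diff der has_derivative_sum) (auto intro!: derivative_eq_intros)
  thus "(w has_derivative (%h. \<Sum>b\<in>Basis. (h \<bullet> b) * (v' b z - v' b x))) (at z)"
   by (simp add: right_diff_distrib sum_subtractf)
  fix b :: 'a assume b: "b \<in> Basis"
  have "abs (v' b z - v' b x) <= (real DIM('a) + 1) * M * norm (z - x) powr be"
   using z n x by (intro HB_modulus[OF hb[OF b] D be]) auto
  also have "... <= (real DIM('a) + 1) * M * norm y powr be"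
   using M n be by (intro mult_left_mono powr_mono2) auto
  finally show "abs (v' b z - v' b x) <= (real DIM('a) + 1) * M * norm y powr be" .
 qed (use D x in \<open>auto intro!: convex_Int simp: dist_norm\<close>)
 thus ?thesis by (simp add: w_def inner_add_left distrib_right sum.distrib algebra_simps)
qed

lemma small_powr:
 assumes "0 < be" "0 <= N" "0 < et" "0 < e"
 shows "\<exists>d>0. d < e \<and> (\<forall>h. 0 <= h --> h <= d --> N * h powr be <= (et::real))"
proof (intro exI conjI allI impI)
 define d where "d = min (e / 2) ((et / (N + 1)) powr (1 / be))"
 show "0 < d" "d < e" using assms by (auto simp: d_def)
 fix h assume h: "0 <= h" "h <= d"
 have "N * h powr be <= (N + 1) * ((et / (N + 1)) powr (1 / be)) powr be"
  using h assms by (intro mult_mono powr_mono2) (auto simp: d_def)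
 also have "... = et" using assms by (simp add: powr_powr)
 finally show "N * h powr be <= et" .
qed

text \<open>Convergence of the derivatives is not assumed. The Taylor remainder is uniform over the
  class, so difference quotients with a small fixed step approximate all derivatives equally well
  and force them to be Cauchy; the limits are identified by passing to the limit in the remainder
  inequality itself. No compactness argument is involved.\<close>

lemma HB_limit:
 fixes v :: "nat => 'a::euclidean_space => real"
 assumes D: "open D" "convex D" and be: "0 < be" "be <= 1"
 shows "(!!j. HB k be M D (v j)) ==> (!!x. x \<in> D ==> (%j. v j x) \<longlonglongrightarrow> w x) ==> HB k be M D w"
proof (induction k arbitrary: v w)
 case 0
 show ?case unfolding HB.simps
 proof (intro conjI ballI)
  fix x assume x: "x \<in> D"
  show "abs (w x) <= M" by (rule LIMSEQ_le_const2[OF tendsto_rabs[OF 0(2)[OF x]]]) (use 0(1) x in auto)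
  fix y assume y: "y \<in> D"
  show "abs (w x - w y) <= M * dist x y powr be"
   by (rule LIMSEQ_le_const2[OF tendsto_rabs[OF tendsto_diff[OF 0(2)[OF x] 0(2)[OF y]]]]) (use 0(1) x y in auto)
 qed
next
 case (Suc k)
 have "\<exists>v'. (\<forall>x\<in>D. (v j has_derivative (%y. \<Sum>b\<in>Basis. (y \<bullet> b) * v' b x)) (at x)) \<and> (\<forall>b\<in>Basis. HB k be M D (v' b))" for j
  using Suc.prems(1)[of j] by simp
 from choice[OF allI[OF this]] obtain v' where
  v0: "\<forall>j. (\<forall>x\<in>D. (v j has_derivative (%y. \<Sum>b\<in>Basis. (y \<bullet> b) * v' j b x)) (at x)) \<and> (\<forall>b\<in>Basis. HB k be M D (v' j b))" ..
 hence v': "!!j x. x \<in> D ==> (v j has_derivative (%y. \<Sum>b\<in>Basis. (y \<bullet> b) * v' j b x)) (at x)"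
  "!!j b. b \<in> Basis ==> HB k be M D (v' j b)" by auto
 define N where "N = real DIM('a) * ((real DIM('a) + 1) * M)"
 define L where "L b x = lim (%j. v' j b x)" for b x
 have rem: "abs (v j (x + y) - v j x - (\<Sum>b\<in>Basis. (y \<bullet> b) * v' j b x)) <= N * norm y powr be * norm y"
  if "x \<in> D" "x + y \<in> D" "norm y <= 1" for j x y
  unfolding N_def by (rule HB_remainder[OF D(2) be that v']) auto
 have N: "0 <= N" if "x \<in> D" for x
  using HB_bound[OF Suc.prems(1)[of 0] that] by (auto simp: N_def intro!: mult_nonneg_nonneg)
 have conv: "(%j. v' j b x) \<longlonglongrightarrow> L b x" if x: "x \<in> D" and b: "b \<in> Basis" for x b
 proof -
  obtain e where e: "0 < e" "ball x e \<subseteq> D" using D(1) x by (meson open_contains_ball)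
  have "Cauchy (%j. v' j b x)" unfolding Cauchy_def
  proof (intro allI impI)
   fix et :: real assume et: "0 < et"
   \<comment> \<open>The step is fixed before the indices: at this step the difference quotients
     \<open>a j\<close> converge, and each lies within \<open>et / 4\<close> of the corresponding
     derivative.\<close>
   obtain h where h: "0 < h" "h < min e 1" "N * h powr be <= et / 4"
    using small_powr[OF be(1) N[OF x], of "et / 4" "min e 1"] et e by auto
   have xh: "x + h *\<^sub>R b \<in> D" using e h b by (intro subsetD[OF e(2)]) (auto simp: dist_norm)
   define a where "a j = (v j (x + h *\<^sub>R b) - v j x) / h" for j
   have "abs (a j - v' j b x) <= et / 4" for j
   proof -
    have "(\<Sum>c\<in>Basis. (h *\<^sub>R b \<bullet> c) * v' j c x) = h * v' j b x"
     using b by (simp add: inner_Basis if_distrib if_distribR cong: if_cong)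
    hence "abs (v j (x + h *\<^sub>R b) - v j x - h * v' j b x) <= N * h powr be * h"
     using rem[OF x xh, of j] h b by simp
    also have "... <= et / 4 * h" using h by (intro mult_right_mono) auto
    also have "v j (x + h *\<^sub>R b) - v j x - h * v' j b x = h * (a j - v' j b x)" using h(1) by (simp add: a_def right_diff_distrib[of h "_ / h"])
    finally have "abs (h * (a j - v' j b x)) <= et / 4 * h" .
    thus ?thesis using h(1) by (simp add: abs_mult mult.commute[of h])
   qed
   note al = this
   have "convergent a" unfolding a_def
    using tendsto_divide[OF tendsto_diff[OF Suc.prems(2)[OF xh] Suc.prems(2)[OF x]] tendsto_const[of h]] h
    by (auto simp: convergent_def)
   then obtain n where n: "\<forall>i\<ge>n. \<forall>j\<ge>n. dist (a i) (a j) < et / 4"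
    using et unfolding Cauchy_convergent_iff[symmetric] Cauchy_def by (meson divide_pos_pos zero_less_numeral)
   show "\<exists>n. \<forall>i\<ge>n. \<forall>j\<ge>n. dist (v' i b x) (v' j b x) < et"
   proof (intro exI allI impI)
    fix i j assume "i >= n" "j >= n"
    hence "abs (a i - a j) < et / 4" using n by (simp add: dist_real_def)
    thus "dist (v' i b x) (v' j b x) < et" using al[of i] al[of j] et unfolding dist_real_def by linarith
   qed
  qed
  thus ?thesis unfolding L_def by (simp add: Cauchy_convergent_iff convergent_LIMSEQ_iff)
 qed
 have limrem: "abs (w (x + y) - w x - (\<Sum>b\<in>Basis. (y \<bullet> b) * L b x)) <= N * norm y powr be * norm y"
  if "x \<in> D" "x + y \<in> D" "norm y <= 1" for x y
 proof (rule LIMSEQ_le_const2)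
  show "(%j. abs (v j (x + y) - v j x - (\<Sum>b\<in>Basis. (y \<bullet> b) * v' j b x))) \<longlonglongrightarrow> abs (w (x + y) - w x - (\<Sum>b\<in>Basis. (y \<bullet> b) * L b x))"
   using that by (intro tendsto_intros Suc.prems(2) conv)
 qed (use rem[OF that] in auto)
 show ?case unfolding HB.simps
 proof (intro conjI ballI exI[of _ L])
  fix x assume x: "x \<in> D"
  show "abs (w x) <= M" by (rule LIMSEQ_le_const2[OF tendsto_rabs[OF Suc.prems(2)[OF x]]]) (use HB_bound[OF Suc.prems(1) x] in auto)
  obtain e where e: "0 < e" "ball x e \<subseteq> D" using D(1) x by (meson open_contains_ball)
  show "(w has_derivative (%y. \<Sum>b\<in>Basis. (y \<bullet> b) * L b x)) (at x)"
   unfolding has_derivative_at_alt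
  proof (intro conjI allI impI)
   show "bounded_linear (%y. \<Sum>b\<in>Basis. (y \<bullet> b) * L b x)"
    by (intro bounded_linear_sum bounded_linear_mult_const bounded_linear_inner_left)
   fix et :: real assume "0 < et"
   then obtain d where d: "0 < d" "d < min e 1" "!!h. 0 <= h ==> h <= d ==> N * h powr be <= et"
    using small_powr[OF be(1) N[OF x], of "et" "min e 1"] e by auto
   show "\<exists>d>0. \<forall>y. norm (y - x) < d --> norm (w y - w x - (\<Sum>b\<in>Basis. ((y - x) \<bullet> b) * L b x)) <= et * norm (y - x)"
   proof (intro exI[of _ d] conjI allI impI d)
    fix y assume y: "norm (y - x) < d"
    have "y \<in> D" using y d by (intro subsetD[OF e(2)]) (auto simp: dist_norm norm_minus_commute)
    hence "abs (w y - w x - (\<Sum>b\<in>Basis. ((y - x) \<bullet> b) * L b x)) <= N * norm (y - x) powr be * norm (y - x)"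
     using limrem[OF x, of "y - x"] y d by simp
    also have "... <= et * norm (y - x)" using y d by (intro mult_right_mono d(3)) auto
    finally show "norm (w y - w x - (\<Sum>b\<in>Basis. ((y - x) \<bullet> b) * L b x)) <= et * norm (y - x)" by simp
   qed
  qed
 next
  fix b :: 'a assume b: "b \<in> Basis"
  show "HB k be M D (L b)" by (rule Suc.IH[of "%j. v' j b"]) (use v'(2) conv b in auto)
 qed
qed

lemma HB_cong: "HB k be M D v ==> open D ==> (!!x. x \<in> D ==> v x = w x) ==> HB k be M D w"
proof (induction k)
 case (Suc k)
 have "(w has_derivative f') (at x)" if "x \<in> D" "(v has_derivative f') (at x)" for f' x
  using that Suc.prems by (intro has_derivative_transform_within_open[OF that(2) Suc.prems(2)]) auto
 moreover obtain v' where "\<forall>x\<in>D. (v has_derivative (%y. \<Sum>b\<in>Basis. (y \<bullet> b) * v' b x)) (at x)" "\<forall>b\<in>Basis. HB k be M D (v' b)"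
  using Suc.prems(1) by auto
 ultimately show ?case using Suc.prems unfolding HB.simps by (intro conjI exI[of _ v']) auto
qed auto

lemma HB_iter_deriv:
 fixes v :: "'a::euclidean_space => real"
 assumes D: "open D" and be: "0 < be"
 shows "HB k be M D v ==> Ck_on k D v \<and> (\<forall>es. set es \<subseteq> Basis -->
  (length es <= k --> (\<forall>x\<in>D. abs (iter_deriv es v x) <= M)) \<and>
  (length es = k --> (\<forall>x\<in>D. \<forall>y\<in>D. abs (iter_deriv es v x - iter_deriv es v y) <= M * dist x y powr be)))"
proof (induction k arbitrary: v)
 case 0
 have "continuous_on D v" unfolding continuous_on_def
 proof
  fix x assume x: "x \<in> D"
  have "((%y. v y - v x) \<longlongrightarrow> 0) (at x within D)"
  proof (rule Lim_null_comparison)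
   show "\<forall>\<^sub>F y in at x within D. norm (v y - v x) <= M * dist y x powr be"
    using 0 x by (auto simp: eventually_at_filter)
   have "((%y. dist y x) \<longlongrightarrow> 0) (at x within D)" by (auto intro!: tendsto_eq_intros)
   hence "((%y. dist y x powr be) \<longlongrightarrow> 0) (at x within D)"
    using be by (intro tendsto_zero_powrI[OF _ tendsto_const]) auto
   thus "((%y. M * dist y x powr be) \<longlongrightarrow> 0) (at x within D)" by (rule tendsto_mult_right_zero)
  qed
  thus "(v \<longlongrightarrow> v x) (at x within D)" by (simp add: LIM_zero_iff)
 qed
 thus ?case using 0 by auto
next
 case (Suc k)
 obtain v' where v': "!!z. z \<in> D ==> (v has_derivative (%y. \<Sum>b\<in>Basis. (y \<bullet> b) * v' b z)) (at z)"
  "!!b. b \<in> Basis ==> HB k be M D (v' b)" using Suc.prems by auto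
 have "frechet_derivative v (at x) b = v' b x" if "x \<in> D" "b \<in> Basis" for x b
  unfolding frechet_derivative_at[OF v'(1)[OF that(1)], symmetric]
  using that by (simp add: inner_Basis if_distrib if_distribR cong: if_cong)
 hence hb: "HB k be M D (%x. frechet_derivative v (at x) b)" if "b \<in> Basis" for b
  using that by (intro HB_cong[OF v'(2)[OF that] D]) auto
 show ?case
 proof (intro conjI allI impI)
  show "Ck_on (Suc k) D v"
   using v'(1) Suc.IH[OF hb] by (auto simp: differentiable_def)
  fix es :: "'a list" assume es: "set es \<subseteq> Basis"
  show "\<forall>x\<in>D. abs (iter_deriv es v x) <= M" if "length es <= Suc k"
   using es that Suc.IH[OF hb] HB_bound[OF Suc.prems] by (cases es) auto
  show "\<forall>x\<in>D. \<forall>y\<in>D. abs (iter_deriv es v x - iter_deriv es v y) <= M * dist x y powr be" if "length es = Suc k"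
   using es that Suc.IH[OF hb] by (cases es) auto
 qed
qed

text \<open>\<open>M\<close> bounds each derivative separately, so the number of lists appears; the
  factor 2 accounts for the sup part and the seminorm part, the latter enlarged to the same index
  set.\<close>

lemma holder_norm_le:
 fixes v :: "'a::euclidean_space => real"
 assumes D: "open D" and M: "0 <= M" and be: "0 < be" "be < 1" and hb: "HB k be M D v" and ga: "ga = real k + be"
 shows "holder_norm ga D v <= ennreal (2 * real (card {es::'a list. set es \<subseteq> Basis \<and> length es <= k}) * M)"
proof -
 have "\<lfloor>ga\<rfloor> = int k" using be ga by (intro floor_unique) auto
 hence k: "nat \<lfloor>ga\<rfloor> = k" "frac ga = be" using ga by (auto simp: frac_def)
 let ?A = "{es::'a list. set es \<subseteq> Basis \<and> length es <= k}" and ?B = "{es::'a list. set es \<subseteq> Basis \<and> length es = k}"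
 have fin: "finite ?A" by (rule finite_lists_length_le) simp
 have sub: "?B \<subseteq> ?A" by auto
 note ck = HB_iter_deriv[OF D be(1) hb]
 have "(\<Sum>es\<in>?A. SUP x\<in>D. ennreal (abs (iter_deriv es v x))) <= (\<Sum>es\<in>?A. ennreal M)"
  using ck by (intro sum_mono SUP_least ennreal_leI) auto
 moreover have "(\<Sum>es\<in>?B. holder_seminorm be D (iter_deriv es v)) <= (\<Sum>es\<in>?A. ennreal M)"
 proof -
  have "holder_seminorm be D (iter_deriv es v) <= ennreal M" if es: "es \<in> ?B" for es
   unfolding holder_seminorm_def
  proof (rule SUP_least, clarify, rule ennreal_leI)
   fix x y assume "x \<in> D" "y \<in> D" "x ~= y"
   thus "abs (iter_deriv es v x - iter_deriv es v y) / dist x y powr be <= M"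
    using ck es by (subst pos_divide_le_eq) auto
  qed
  hence "(\<Sum>es\<in>?B. holder_seminorm be D (iter_deriv es v)) <= (\<Sum>es\<in>?B. ennreal M)" by (rule sum_mono)
  also have "... <= (\<Sum>es\<in>?A. ennreal M)" by (rule sum_mono2[OF fin sub]) simp
  finally show ?thesis .
 qed
 ultimately have "holder_norm ga D v <= (\<Sum>es\<in>?A. ennreal M) + (\<Sum>es\<in>?A. ennreal M)"
  using ck unfolding holder_norm_def Let_def k by (simp add: add_mono)
 also have "... = ennreal (2 * real (card ?A) * M)"
  using M by (simp add: ennreal_of_nat_eq_real_of_nat ennreal_mult[symmetric] ennreal_plus[symmetric] algebra_simps del: ennreal_plus)
 finally show ?thesis .
qed

subsection \<open>Mollifiers and cutoffs\<close>

text \<open>The powers in the denominator make the family closed under differentiation, so that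
  smoothness of the standard bump follows from the first derivatives alone.\<close>

definition hexp :: "nat => real => real" where
 "hexp n x = (if 0 < x then exp (- 1 / x) / x ^ n else 0)"

text \<open>One term of the exponential series: exp (1/x) >= x^(- n - 2) / (n + 2)!. The quadratic
  bound yields the derivative 0 at the origin.\<close>

lemma hexp_le: "abs (hexp n x) <= fact (n + 2) * x^2"
proof (cases "0 < x")
 case True
 have "(\<Sum>k\<in>{n + 2}. (1 / x) ^ k /\<^sub>R fact k) <= exp (1 / x)"
  unfolding exp_def by (rule sum_le_suminf[OF summable_exp_generic]) (use True in auto)
 hence "exp (- 1 / x) <= fact (n + 2) * x ^ (n + 2)"
  using True by (simp add: exp_minus divide_simps mult.commute[of "exp _"] del: fact_Suc)
 thus ?thesis using True by (simp add: hexp_def power_add divide_le_eq mult_ac power2_eq_square del: fact_Suc)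
qed (simp add: hexp_def)

lemma hexp_deriv: "(hexp n has_real_derivative (hexp (n + 2) x - real n * hexp (n + 1) x)) (at x)"
proof (cases x "0::real" rule: linorder_cases)
 case less
 have "((%x. 0) has_real_derivative 0) (at x)" by simp
 hence "(hexp n has_real_derivative 0) (at x)"
  by (rule has_field_derivative_transform_within_open[of _ _ _ "{..<0}"]) (use less in \<open>auto simp: hexp_def\<close>)
 thus ?thesis using less by (simp add: hexp_def)
next
 case equal
 show ?thesis
  by (rule has_real_derivative_of_quadratic_remainder[of 1 _ _ _ "fact (n + 2)"])
    (use hexp_le[of n] equal in \<open>auto simp: hexp_def simp del: fact_Suc\<close>)
next
 case greater
 have "((%x. exp (- 1 / x) / x ^ n) has_real_derivative (hexp (n + 2) x - real n * hexp (n + 1) x)) (at x)"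
 proof (cases n)
  case 0
  show ?thesis using greater 0 by (auto intro!: derivative_eq_intros simp: hexp_def field_simps power2_eq_square)
 next
  case (Suc m)
  show ?thesis using greater Suc
   by (auto intro!: derivative_eq_intros simp: hexp_def field_simps power2_eq_square) (cases m, auto)
 qed
 thus ?thesis
  by (rule has_field_derivative_transform_within_open[of _ _ _ "{0<..}"]) (use greater in \<open>auto simp: hexp_def\<close>)
qed

text \<open>A class closed under differentiation by construction and just rich enough to contain the
  bump functions; membership gives \<open>Ck_on k\<close> for every \<open>k\<close> by one
  induction.\<close>

inductive smooth :: "('a::euclidean_space => real) => bool" where
 const: "smooth (%x. c)"
| inner: "smooth (%x. x \<bullet> e)"
| bump: "smooth (%x. hexp n (d - (x - a) \<bullet> (x - a)))"
| add: "smooth v ==> smooth w ==> smooth (%x. v x + w x)"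
| mult: "smooth v ==> smooth w ==> smooth (%x. v x * w x)"

lemma smooth_deriv: "smooth v ==> \<exists>v'. (\<forall>h. smooth (v' h)) \<and> (\<forall>x. (v has_derivative (%h. v' h x)) (at x))"
proof (induction rule: smooth.induct)
 case (const c)
 show ?case by (intro exI[of _ "%h x. 0"]) (auto intro: smooth.const)
next
 case (inner e)
 show ?case by (intro exI[of _ "%h x. h \<bullet> e"]) (auto intro!: smooth.const derivative_eq_intros)
next
 case (bump n d a)
 let ?q = "%x. d - (x - a) \<bullet> (x - a)"
 let ?v' = "%h x. (hexp (n + 2) (?q x) + (- real n) * hexp (n + 1) (?q x)) * ((- 2) * (x \<bullet> h + (- (a \<bullet> h))))"
 have "smooth (?v' h)" for h by (intro smooth.intros)
 moreover have "((%x. hexp n (?q x)) has_derivative (%h. ?v' h x)) (at x)" for x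
 proof -
  have "(?q has_derivative (%h. - 2 * ((x - a) \<bullet> h))) (at x)"
   by (auto intro!: derivative_eq_intros simp: inner_commute)
  from has_derivative_compose[OF this has_field_derivative_imp_has_derivative[OF hexp_deriv[of n]]]
  show ?thesis by (simp add: inner_diff_left algebra_simps)
 qed
 ultimately show ?case by (intro exI[of _ ?v']) blast
next
 case (add v w)
 then obtain v' w' where "!!h. smooth (v' h)" "!!x. (v has_derivative (%h. v' h x)) (at x)"
  "!!h. smooth (w' h)" "!!x. (w has_derivative (%h. w' h x)) (at x)" by blast
 thus ?case
  by (intro exI[of _ "%h x. v' h x + w' h x"]) (auto intro: smooth.intros has_derivative_add)
next
 case (mult v w)
 then obtain v' w' where *: "!!h. smooth (v' h)" "!!x. (v has_derivative (%h. v' h x)) (at x)"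
  "!!h. smooth (w' h)" "!!x. (w has_derivative (%h. w' h x)) (at x)" by blast
 show ?case
 proof (intro exI[of _ "%h x. v x * w' h x + v' h x * w x"] conjI allI)
  show "smooth (%x. v x * w' h x + v' h x * w x)" for h
   using * mult.hyps by (intro smooth.intros) auto
 qed (intro has_derivative_mult *)
qed

lemma smooth_continuous: "smooth v ==> continuous_on UNIV v"
 using smooth_deriv by (metis continuous_at_imp_continuous_on has_derivative_continuous)

lemma smooth_Ck: "smooth v ==> Ck_on k UNIV v"
proof (induction k arbitrary: v)
 case (Suc k)
 obtain v' where v': "!!h. smooth (v' h)" "!!x. (v has_derivative (%h. v' h x)) (at x)"
  using smooth_deriv[OF Suc.prems] by blast
 have "frechet_derivative v (at x) = (%h. v' h x)" for x
  using frechet_derivative_at[OF v'(2)] by simp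
 thus ?case using v' Suc.IH by (auto simp: differentiable_def)
qed (simp add: smooth_continuous)

definition smooth_supp :: "'a::euclidean_space => real => ('a => real) => bool" where
 "smooth_supp a r v \<longleftrightarrow> smooth v \<and> (\<forall>x. r < norm (x - a) --> v x = 0)"

lemma smooth_supp_bounded:
 assumes "smooth_supp a r v" shows "\<exists>B\<ge>0. \<forall>x. abs (v x) <= B"
proof -
 have "compact (v ` cball a r)"
  using assms smooth_continuous by (intro compact_continuous_image) (auto simp: smooth_supp_def intro: continuous_on_subset)
 then obtain B where B: "!!x. x \<in> cball a r ==> abs (v x) <= B"
  using compact_imp_bounded bounded_iff by (metis image_eqI real_norm_def)
 have "abs (v x) <= max B 0" for x
  using B[of x] assms by (cases "x \<in> cball a r") (auto simp: smooth_supp_def dist_norm norm_minus_commute)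
 thus ?thesis by (meson max.cobounded2)
qed

lemma smooth_supp_deriv:
 assumes "smooth_supp a r v"
 shows "\<exists>v'. (\<forall>h. smooth_supp a r (v' h)) \<and> (\<forall>x. (v has_derivative (%h. v' h x)) (at x))"
proof -
 obtain v' where v': "!!h. smooth (v' h)" "!!x. (v has_derivative (%h. v' h x)) (at x)"
  using smooth_deriv assms unfolding smooth_supp_def by blast
 have "v' h x = 0" if x: "r < norm (x - a)" for h x
 proof -
  have "((%x. 0) has_derivative (%h. 0)) (at x)" by simp
  hence "(v has_derivative (%h. 0)) (at x)"
   by (rule has_derivative_transform_within_open[of _ _ _ _ "- cball a r"])
     (use x assms in \<open>auto simp: smooth_supp_def dist_norm norm_minus_commute\<close>)
  thus ?thesis using has_derivative_unique[OF _ v'(2)] by metis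
 qed
 thus ?thesis using v' by (auto simp: smooth_supp_def)
qed

lemma linear_Basis:
 assumes "(v has_derivative f') (at x)"
 shows "f' h = (\<Sum>b\<in>Basis. (h \<bullet> b) * f' b)"
proof -
 have l: "linear f'" using has_derivative_bounded_linear[OF assms] by (rule bounded_linear.linear)
 have "f' h = f' (\<Sum>b\<in>Basis. (h \<bullet> b) *\<^sub>R b)" by (simp add: euclidean_representation)
 thus ?thesis by (simp add: linear_sum[OF l] linear_scale[OF l])
qed

lemma smooth_supp_lipschitz:
 fixes v :: "'a::euclidean_space => real"
 assumes "smooth_supp a r v"
 shows "\<exists>B\<ge>0. \<forall>x y. abs (v x - v y) <= B * norm (x - y)"
proof -
 obtain v' where v': "!!h. smooth_supp a r (v' h)" "!!x. (v has_derivative (%h. v' h x)) (at x)"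
  using smooth_supp_deriv[OF assms] by blast
 have "\<forall>b. \<exists>B\<ge>0. \<forall>x. abs (v' b x) <= B" using smooth_supp_bounded[OF v'(1)] by blast
 from choice[OF this] obtain B where B: "!!b. 0 <= B b" "!!b x. abs (v' b x) <= B b" by blast
 have le: "abs (v' b x) <= (\<Sum>b\<in>Basis. B b)" if "b \<in> Basis" for b x
  using B(2)[of b x] member_le_sum[OF that, of B] B(1) by fastforce
 have "abs (v x - v y) <= real DIM('a) * (\<Sum>b\<in>Basis. B b) * norm (x - y)" for x y
 proof (rule mean_value_Basis[OF convex_UNIV])
  show "(v has_derivative (%h. \<Sum>b\<in>Basis. (h \<bullet> b) * v' b z)) (at z)" for z
   unfolding linear_Basis[OF v'(2)[of z], symmetric] by (rule v')
 qed (use le in auto)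
 thus ?thesis by (intro exI[of _ "real DIM('a) * (\<Sum>b\<in>Basis. B b)"]) (auto intro!: mult_nonneg_nonneg sum_nonneg B)
qed

lemma smooth_supp_remainder:
 fixes v :: "'a::euclidean_space => real"
 assumes "smooth_supp a r v"
 shows "\<exists>v' B. 0 <= B \<and> (\<forall>h. smooth_supp a r (v' h)) \<and> (\<forall>x. (v has_derivative (%h. v' h x)) (at x)) \<and>
  (\<forall>x y. abs (v (x + y) - v x - v' y x) <= B * (norm y)^2)"
proof -
 obtain v' where v': "!!h. smooth_supp a r (v' h)" "!!x. (v has_derivative (%h. v' h x)) (at x)"
  using smooth_supp_deriv[OF assms] by blast
 have "\<forall>b. \<exists>B\<ge>0. \<forall>x y. abs (v' b x - v' b y) <= B * norm (x - y)" using smooth_supp_lipschitz[OF v'(1)] by blast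
 from choice[OF this] obtain B where B: "!!b. 0 <= B b" "!!b x y. abs (v' b x - v' b y) <= B b * norm (x - y)" by blast
 define S where "S = (\<Sum>b\<in>Basis. B b)"
 have S: "0 <= S" unfolding S_def using B(1) by (intro sum_nonneg) auto
 have le: "abs (v' b x - v' b y) <= S * norm (x - y)" if "b \<in> Basis" for b x y
 proof -
  have "B b <= S" unfolding S_def using that B(1) by (intro member_le_sum) auto
  thus ?thesis using B(2)[of b x y] mult_right_mono[of "B b" S "norm (x - y)"] by simp
 qed
 have "abs (v (x + y) - v x - v' y x) <= (real DIM('a) * S) * (norm y)^2" for x y
 proof -
  define w where "w z = v z - v' (z - x) x" for z
  have lin: "linear (%h. v' h x)" using has_derivative_bounded_linear[OF v'(2)] by (rule bounded_linear.linear)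
  have "abs (w (x + y) - w x) <= real DIM('a) * (S * norm y) * norm (x + y - x)"
  proof (rule mean_value_Basis[where D = "cball x (norm y)"])
   fix z assume z: "z \<in> cball x (norm y)"
   have "((%z. v' (z - x) x) has_derivative (%h. v' h x)) (at z)"
    by (rule has_derivative_eq_rhs, rule bounded_linear.has_derivative[OF has_derivative_bounded_linear[OF v'(2)]])
      (auto intro!: derivative_eq_intros)
   hence "(w has_derivative (%h. v' h z - v' h x)) (at z)"
    unfolding w_def by (intro has_derivative_diff v')
   thus "(w has_derivative (%h. \<Sum>b\<in>Basis. (h \<bullet> b) * (v' b z - v' b x))) (at z)"
    unfolding right_diff_distrib sum_subtractf linear_Basis[OF v'(2), symmetric] .
   fix b :: 'a assume b: "b \<in> Basis"
   have "abs (v' b z - v' b x) <= S * norm (z - x)" by (rule le[OF b])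
   also have "... <= S * norm y" using z S by (intro mult_left_mono) (auto simp: dist_norm norm_minus_commute)
   finally show "abs (v' b z - v' b x) <= S * norm y" .
  qed (auto simp: dist_norm)
  moreover have "v' 0 x = 0" using linear_0[OF lin] .
  ultimately show ?thesis by (simp add: w_def power2_eq_square mult_ac)
 qed
 moreover have "0 <= real DIM('a) * S" using S by simp
 ultimately show ?thesis using v' by blast
qed

definition mollifier :: "'a::euclidean_space => real => ('a => real) => bool" where
 "mollifier a r b \<longleftrightarrow> smooth_supp a r b \<and> (\<forall>x. 0 <= b x) \<and> LI b \<and> (LBINT x. b x) = 1"

lemma smooth_supp_measurable: "smooth_supp a r v ==> v \<in> borel_measurable borel"
 by (auto simp: smooth_supp_def intro: borel_measurable_continuous_onI smooth_continuous)

lemma smooth_supp_integrable: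
 fixes v :: "'a::euclidean_space => real"
 assumes v: "smooth_supp a r v" shows "LI v"
proof -
 obtain B where B: "0 <= B" "!!x. abs (v x) <= B" using smooth_supp_bounded[OF v] by blast
 show ?thesis
 proof (rule integrable_bound_real[where g = "%x. B * indicator (cball a r) x"])
  show "LI (%x. B * indicator (cball a r) x)"
   using emeasure_lborel_cball_finite[of a r] by (intro integrable_mult_right integrable_real_indicator) auto
 qed (use v B smooth_supp_measurable[OF v] in \<open>auto simp: smooth_supp_def indicator_def dist_norm norm_minus_commute\<close>)
qed

lemma mollifier_exists:
 assumes r: "0 < r"
 shows "\<exists>b. mollifier (a::'a::euclidean_space) r b"
proof -
 define v where "v = (%x::'a. hexp 0 (r^2 - (x - a) \<bullet> (x - a)))"
 have pos: "v x ~= 0 \<longleftrightarrow> norm (x - a) < r" "0 <= v x" for x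
  using r by (auto simp: v_def hexp_def norm_lt_square)
 have v: "smooth_supp a r v"
  unfolding smooth_supp_def
 proof (intro conjI allI impI)
  show "smooth v" unfolding v_def by (rule smooth.bump)
  show "v x = 0" if "r < norm (x - a)" for x using pos(1)[of x] that by auto
 qed
 note [measurable] = smooth_supp_measurable[OF v]
 have i: "LI v" by (rule smooth_supp_integrable[OF v])
 have "(LBINT x. v x) ~= 0"
 proof
  assume "(LBINT x. v x) = 0"
  hence "AE x in lborel. v x = 0" using integral_nonneg_eq_0_iff_AE[OF i] pos(2) by simp
  hence "AE x in lborel. x \<notin> ball a r" by eventually_elim (use pos(1) in \<open>auto simp: dist_norm norm_minus_commute\<close>)
  hence "emeasure lborel (ball a r) = 0" by (subst (asm) AE_iff_null_sets[symmetric]) auto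
  moreover have "0 < measure lborel (ball a r)" by (rule content_ball_pos[OF r])
  ultimately show False by (simp add: measure_def)
 qed
 moreover have "0 <= (LBINT x. v x)" using pos(2) by (intro integral_nonneg_AE) auto
 ultimately have c: "0 < (LBINT x. v x)" by simp
 define b where "b = (%x. (1 / (LBINT x. v x)) * v x)"
 have "smooth b" using v unfolding b_def smooth_supp_def by (intro smooth.intros) auto
 hence "mollifier a r b"
  using v pos(2) i c unfolding mollifier_def smooth_supp_def by (auto simp: b_def)
 thus ?thesis by blast
qed

lemma mollifierD:
 assumes "mollifier a r b"
 shows "smooth_supp a r b" "0 <= b x" "LI b" "(LBINT x. b x) = 1" "bm b"
  "r < norm (x - a) ==> b x = 0"
 using assms smooth_supp_measurable by (auto simp: mollifier_def smooth_supp_def)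

lemma abs_integral_supp_le:
 fixes h :: "'a::euclidean_space => real"
 assumes [measurable]: "bm h" and h: "!!x. abs (h x) <= B" "!!x. R < norm (x - a) ==> h x = 0"
 shows "LI h" "(LBINT x. abs (h x)) <= B * measure lborel (cball a R)" "abs (LBINT x. h x) <= B * measure lborel (cball a R)"
proof -
 have B: "0 <= B" using h(1)[of a] by linarith
 have i: "LI (%x. B * indicator (cball a R) x)"
  using emeasure_lborel_cball_finite[of a R] by (intro integrable_mult_right integrable_real_indicator) auto
 have le: "AE x in lborel. abs (h x) <= B * indicator (cball a R) x"
  using h B by (intro AE_I2) (auto simp: indicator_def dist_norm norm_minus_commute)
 show "LI h" by (rule abs_integral_le(1)[OF i _ le]) simp
 have "abs (LBINT x. abs (h x)) <= (LBINT x. B * indicator (cball a R) x)"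
  by (rule abs_integral_le(2)[OF i]) (use le in auto)
 thus *: "(LBINT x. abs (h x)) <= B * measure lborel (cball a R)" by simp
 thus "abs (LBINT x. h x) <= B * measure lborel (cball a R)" using integral_abs_bound[of lborel h] by linarith
qed

text \<open>The indicator of the ball of radius 13/16, midway between 3/4 and 7/8, is mollified at
  scale 1/32, which is less than the margin 1/16 on either side.\<close>

lemma cutoff_exists: "\<exists>Z (ze::'a::euclidean_space => real). cutoff Z ze"
proof -
 obtain b where b: "mollifier (0::'a) (1/32) b" using mollifier_exists[of "1/32"] by auto
 note bD = mollifierD[OF b] and [measurable] = mollifierD(5)[OF b]
 obtain B1 where B1: "0 <= B1" "!!x y. abs (b x - b y) <= B1 * norm (x - y)" using smooth_supp_lipschitz[OF bD(1)] by blast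
 obtain b' B2 where b': "!!x. (b has_derivative (%h. b' h x)) (at x)" "0 <= B2" "!!x y. abs (b (x + y) - b x - b' y x) <= B2 * (norm y)^2"
  using smooth_supp_remainder[OF bD(1)] by blast
 have b0: "0 <= b z" for z using b by (simp add: mollifier_def)
 define A where "A = ball (0::'a) (13/16)"
 define ze where "ze x = (LBINT q. indicator A q * b (x - q))" for x
 define W where "W = measure lborel (cball (0::'a) 1)"
 have sup: "abs (LBINT q. indicator A q * g q) <= m * W" if [measurable]: "bm g" and "!!x. abs (g x) <= m" for g m
  unfolding W_def using that by (intro abs_integral_supp_le) (auto simp: A_def indicator_def intro: order_trans[OF abs_ge_zero])
 have ib: "LI (%q. b (x - q))" "(LBINT q. b (x - q)) = 1" for x
  using integral_reflect[OF bD(3), of x] bD(4) by auto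
 have ia: "LI (%q. indicator A q * b (x - q))" for x
  by (rule integrable_bound_real[OF ib(1)[of x]]) (auto simp: A_def indicator_def b0)
 have "cutoff (B1 * W + 2 * B2 * W) ze" unfolding cutoff_def
 proof (intro conjI allI impI)
  show "0 <= B1 * W + 2 * B2 * W" using B1 b' by (simp add: W_def)
  fix x y :: 'a
  have "abs (ze x) <= (LBINT q. b (x - q))"
   unfolding ze_def by (intro abs_integral_le(2)[OF ib(1)]) (auto simp: A_def indicator_def b0)
  thus "abs (ze x) <= 1" by (simp add: ib)
  have "ze x - ze y = (LBINT q. indicator A q * (b (x - q) - b (y - q)))"
   unfolding ze_def right_diff_distrib using ia by simp
  also have "\<bar>...\<bar> <= B1 * norm (x - y) * W"
  proof (rule sup)
   show "abs (b (x - q) - b (y - q)) <= B1 * norm (x - y)" for q using B1(2)[of "x - q" "y - q"] by simp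
  qed simp
  also have "... <= (B1 * W + 2 * B2 * W) * norm (x - y)" using b' by (simp add: W_def algebra_simps)
  finally show "abs (ze x - ze y) <= (B1 * W + 2 * B2 * W) * norm (x - y)" .
  have "ze (x + y) + ze (x - y) - 2 * ze x = (LBINT q. indicator A q * (b (x - q + y) + b (x - q - y) - 2 * b (x - q)))"
  proof -
   have e: "indicator A q * (b (x - q + y) + b (x - q - y) - 2 * b (x - q)) =
    indicator A q * b (x + y - q) + indicator A q * b (x - y - q) - 2 * (indicator A q * b (x - q))" for q
    by (simp add: algebra_simps)
   show ?thesis unfolding e ze_def using ia by simp
  qed
  also have "\<bar>...\<bar> <= 2 * B2 * (norm y)^2 * W"
  proof (rule sup)
   fix z
   have "b' (- y) (x - z) = - b' y (x - z)"
    using linear_neg[OF bounded_linear.linear[OF has_derivative_bounded_linear[OF b'(1)]]] by simp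
   thus "abs (b (x - z + y) + b (x - z - y) - 2 * b (x - z)) <= 2 * B2 * (norm y)^2"
    using b'(3)[of "x - z" y] b'(3)[of "x - z" "- y"] by simp
  qed simp
  also have "... <= (B1 * W + 2 * B2 * W) * (norm y)^2" using B1 by (simp add: W_def algebra_simps)
  finally show "abs (ze (x + y) + ze (x - y) - 2 * ze x) <= (B1 * W + 2 * B2 * W) * (norm y)^2" .
 next
  fix x :: 'a assume x: "norm x <= 3/4"
  have "indicator A q * b (x - q) = b (x - q)" for q
   using x bD(6)[of "x - q"] norm_triangle_ineq4[of x "x - q"] by (cases "q \<in> A") (auto simp: A_def)
  thus "ze x = 1" unfolding ze_def by (simp only: ib)
 next
  fix x :: 'a assume x: "7/8 <= norm x"
  have "indicator A q * b (x - q) = 0" for q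
   using x bD(6)[of "x - q"] norm_triangle_ineq[of "x - q" q] by (cases "q \<in> A") (auto simp: A_def)
  thus "ze x = 0" unfolding ze_def by (simp only: Bochner_Integration.integral_zero)
 qed
 thus ?thesis by blast
qed

subsection \<open>Spectral measures\<close>

lemma nn_integral_even:
 fixes g :: "real => ennreal"
 assumes [measurable]: "bm g" and even: "!!r. g (- r) = g r"
 shows "(NN r. g r) = 2 * (NN r. g r * indicator {0..} r)"
proof -
 have "(NN r. g r * indicator {..<0} r) = (NN r. g r * indicator {0<..} r)"
  using nn_integral_translate(3)[of "%r. g r * indicator {..<0} r" 0] even by (simp add: indicator_def)
 also have "... = (NN r. g r * indicator {0..} r)"
  by (rule nn_integral_cong_AE) (use AE_lborel_singleton[of 0] in \<open>auto elim!: eventually_mono simp: indicator_def\<close>)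
 moreover have "(NN r. g r) = (NN r. g r * indicator {0..} r + g r * indicator {..<0} r)"
  by (intro nn_integral_cong) (auto simp: indicator_def)
 ultimately show ?thesis by (simp add: nn_integral_add mult_2)
qed

lemma ennreal_double: "2 * ennreal x = ennreal (2 * x)"
 by (simp add: ennreal_mult' flip: ennreal_numeral)

lemma nn_integral_abs_powr:
 fixes R :: real
 assumes "0 < R"
 shows "- 1 < a ==> (NN r. ennreal (abs r powr a * indicator {..R} (abs r))) = ennreal (2 * (R powr (a + 1) / (a + 1)))"
  "a < - 1 ==> (NN r. ennreal (abs r powr a * indicator {R<..} (abs r))) = ennreal (2 * (R powr (a + 1) / (- (a + 1))))"
proof -
 assume a: "- 1 < a"
 have "(NN r. ennreal (abs r powr a * indicator {..R} (abs r))) = 2 * (NN r. ennreal (abs r powr a * indicator {..R} (abs r)) * indicator {0..} r)"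
  by (rule nn_integral_even) auto
 also have "(NN r. ennreal (abs r powr a * indicator {..R} (abs r)) * indicator {0..} r) = (NN r. ennreal (r powr a) * indicator {0..R} r)"
  by (intro nn_integral_cong) (auto simp: indicator_def)
 also have "... = ennreal (R powr (a + 1) / (a + 1))"
  by (rule nn_integral_has_integral_lebesgue'[OF _ has_integral_powr_from_0[OF a]]) (use assms in auto)
 finally show "(NN r. ennreal (abs r powr a * indicator {..R} (abs r))) = ennreal (2 * (R powr (a + 1) / (a + 1)))"
  by (simp only: ennreal_double)
next
 assume a: "a < - 1"
 have "(NN r. ennreal (abs r powr a * indicator {R<..} (abs r))) = 2 * (NN r. ennreal (abs r powr a * indicator {R<..} (abs r)) * indicator {0..} r)"
  by (rule nn_integral_even) auto
 also have "(NN r. ennreal (abs r powr a * indicator {R<..} (abs r)) * indicator {0..} r) = (NN r. ennreal (r powr a) * indicator {R..} r)"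
  by (rule nn_integral_cong_AE) (use AE_lborel_singleton[of R] assms in \<open>auto elim!: eventually_mono simp: indicator_def\<close>)
 also have "... = ennreal (- (R powr (a + 1)) / (a + 1))"
  by (rule nn_integral_has_integral_lebesgue'[OF _ has_integral_powr_to_inf[OF a assms]]) auto
 also have "- (R powr (a + 1)) / (a + 1) = R powr (a + 1) / (- (a + 1))"
  by (simp only: minus_divide_left[symmetric] minus_divide_right[symmetric])
 finally show "(NN r. ennreal (abs r powr a * indicator {R<..} (abs r))) = ennreal (2 * (R powr (a + 1) / (- (a + 1))))"
  by (simp only: ennreal_double)
qed

definition radial :: "real => real measure" where
 "radial s = density lborel (%r. ennreal (abs r powr (- 1 - 2 * s)))"

text \<open>The Levy measure in polar coordinates. As in \<open>stable_op\<close>, the radial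
  variable runs over the whole line, so every direction also contributes its opposite and the
  measure is symmetric.\<close>

definition jump_measure :: "real => 'a::euclidean_space measure => 'a measure" where
 "jump_measure s mu = distr (mu \<Otimes>\<^sub>M radial s) borel (%(th, r). r *\<^sub>R th)"

lemma sets_radial [measurable_cong, simp]: "sets (radial s) = sets borel"
 by (simp add: radial_def)

lemma sigma_finite_radial: "sigma_finite_measure (radial s)"
 unfolding radial_def by (subst sigma_finite_measure.sigma_finite_iff_density_finite[OF lborel.sigma_finite_measure_axioms]) auto

context
 fixes s lam Lam :: real and mu :: "'a::euclidean_space measure"
 assumes s: "0 < s" "s < 1" and lam: "0 < lam" "lam <= Lam" and spec: "spectral_measure s lam Lam mu"
begin

lemma spec_sets: "sets mu = sets (restrict_space borel (sphere 0 1))"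
 and spec_mass: "emeasure mu (space mu) <= ennreal Lam"
 and spec_lower: "norm e = 1 ==> ennreal lam <= (\<integral>\<^sup>+th. ennreal (abs (e \<bullet> th) powr (2 * s)) \<partial>mu)"
 using spec by (auto simp: spectral_measure_def le_INF_iff)

lemma spec_norm: "th \<in> space mu ==> norm th = 1"
 using sets_eq_imp_space_eq[OF spec_sets] by (auto simp: space_restrict_space)

lemma spec_id: "(%th. th) \<in> measurable mu borel"
 by (subst measurable_cong_sets[OF spec_sets refl]) (rule measurable_restrict_space1, simp)

lemma polar_measurable: "(%(th, r). r *\<^sub>R th) \<in> measurable (mu \<Otimes>\<^sub>M radial s) borel"
proof -
 note [measurable_cong] = spec_sets and [measurable] = spec_id
 have [measurable]: "fst \<in> measurable (mu \<Otimes>\<^sub>M radial s) borel" using measurable_compose[OF measurable_fst spec_id] by simp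
 have [measurable]: "snd \<in> measurable (mu \<Otimes>\<^sub>M radial s) borel" by measurable
 show ?thesis unfolding case_prod_beta by measurable
qed

lemma spec_finite: "finite_measure mu"
 by (rule finite_measureI) (use spec_mass in \<open>auto simp: top_unique\<close>)

lemma nn_integral_jump:
 assumes [measurable]: "bm g"
 shows "(\<integral>\<^sup>+y. g y \<partial>jump_measure s mu) = (\<integral>\<^sup>+th. (NN r. ennreal (abs r powr (- 1 - 2 * s)) * g (r *\<^sub>R th)) \<partial>mu)"
proof -
 note [measurable_cong] = spec_sets and [measurable] = spec_id polar_measurable
 interpret R: sigma_finite_measure "radial s" by (rule sigma_finite_radial)
 have "(\<integral>\<^sup>+y. g y \<partial>jump_measure s mu) = (\<integral>\<^sup>+p. (case p of (th, r) => g (r *\<^sub>R th)) \<partial>(mu \<Otimes>\<^sub>M radial s))"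
  unfolding jump_measure_def by (subst nn_integral_distr) (auto simp: case_prod_unfold)
 also have "... = (\<integral>\<^sup>+th. (\<integral>\<^sup>+r. g (r *\<^sub>R th) \<partial>radial s) \<partial>mu)"
 proof (subst R.nn_integral_fst[symmetric])
  show "(%(th, r). g (r *\<^sub>R th)) \<in> borel_measurable (mu \<Otimes>\<^sub>M radial s)"
   using measurable_compose[OF polar_measurable assms] by (simp add: case_prod_beta)
 qed simp
 finally show ?thesis by (simp add: radial_def nn_integral_density)
qed

lemma nn_integral_jump_radial:
 assumes "bm g"
  and "!!th. norm th = 1 ==> (NN r. ennreal (abs r powr (- 1 - 2 * s)) * g (r *\<^sub>R th)) <= ennreal (K * m)"
  and "0 <= K" "0 <= m"
 shows "(\<integral>\<^sup>+y. g y \<partial>jump_measure s mu) <= ennreal (Lam * K * m)"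
proof -
 have "(\<integral>\<^sup>+y. g y \<partial>jump_measure s mu) <= (\<integral>\<^sup>+th. ennreal (K * m) \<partial>mu)"
  unfolding nn_integral_jump[OF assms(1)] by (intro nn_integral_mono assms(2) spec_norm)
 also have "... = ennreal (K * m) * emeasure mu (space mu)" by simp
 also have "... <= ennreal (K * m) * ennreal Lam" by (intro mult_left_mono spec_mass) auto
 also have "... = ennreal (Lam * K * m)" using assms lam by (simp add: ennreal_mult[symmetric] mult_ac)
 finally show ?thesis .
qed

text \<open>Ellipticity is given for the power 2s but needed for the power 2. Directions with
  \<open>\<bar>e \<bullet> th\<bar> <= et\<close> contribute at most et^(2s) Lam <= lam/2, which is
  absorbed; on the others the power 2s is at most et^(2s - 2) times the square, because 2s <
  2.\<close>

lemma spec_quadratic: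
 assumes e: "norm e = 1" and et: "0 < et" "et powr (2 * s) * Lam <= lam / 2"
 shows "ennreal (lam / 2 * et powr (2 - 2 * s)) <= (\<integral>\<^sup>+th. ennreal ((th \<bullet> e)^2) \<partial>mu)"
proof -
 note [measurable_cong] = spec_sets and [measurable] = spec_id polar_measurable
 have [measurable]: "(%th. th \<bullet> e) \<in> borel_measurable mu" by measurable
 have pw: "abs (e \<bullet> th) powr (2 * s) <= et powr (2 * s) + et powr (2 * s - 2) * (th \<bullet> e)^2" for th
 proof (cases "abs (e \<bullet> th) <= et")
  case True
  hence "abs (e \<bullet> th) powr (2 * s) <= et powr (2 * s)" using s by (intro powr_mono2) auto
  thus ?thesis by (simp add: add_increasing2)
 next
  case False
  have "abs (e \<bullet> th) powr (2 * s) = abs (e \<bullet> th) powr (2 * s - 2) * (th \<bullet> e)^2"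
   using False et powr_add[of "abs (e \<bullet> th)" "2 * s - 2" 2] by (simp add: inner_commute)
  also have "... <= et powr (2 * s - 2) * (th \<bullet> e)^2"
   using False et s by (intro mult_right_mono powr_mono2') auto
  finally show ?thesis by (simp add: add_increasing)
 qed
 define I where "I = (\<integral>\<^sup>+th. ennreal ((th \<bullet> e)^2) \<partial>mu)"
 have "ennreal lam <= (\<integral>\<^sup>+th. ennreal (abs (e \<bullet> th) powr (2 * s)) \<partial>mu)" by (rule spec_lower[OF e])
 also have "... <= (\<integral>\<^sup>+th. ennreal (et powr (2 * s)) + ennreal (et powr (2 * s - 2)) * ennreal ((th \<bullet> e)^2) \<partial>mu)"
  by (intro nn_integral_mono) (use pw in \<open>simp add: ennreal_mult[symmetric] ennreal_plus[symmetric] ennreal_leI del: ennreal_plus\<close>)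
 also have "... = ennreal (et powr (2 * s)) * emeasure mu (space mu) + ennreal (et powr (2 * s - 2)) * I"
  by (simp add: nn_integral_add nn_integral_cmult I_def)
 also have "... <= ennreal (et powr (2 * s)) * ennreal Lam + ennreal (et powr (2 * s - 2)) * I"
  by (intro add_mono mult_left_mono spec_mass) auto
 also have "... <= ennreal (lam / 2) + ennreal (et powr (2 * s - 2)) * I"
  using et lam by (intro add_mono) (auto simp: ennreal_mult[symmetric] intro!: ennreal_leI)
 finally have *: "ennreal lam <= ennreal (lam / 2) + ennreal (et powr (2 * s - 2)) * I" .
 show ?thesis
 proof (cases I)
  case (real i)
  have "ennreal lam <= ennreal (lam / 2 + et powr (2 * s - 2) * i)"
   using * lam real by (simp add: ennreal_mult[symmetric] ennreal_plus[symmetric] del: ennreal_plus)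
  hence "lam / 2 <= et powr (2 * s - 2) * i" using real lam by (subst (asm) ennreal_le_iff) auto
  hence "lam / 2 * et powr (2 - 2 * s) <= et powr (2 * s - 2) * i * et powr (2 - 2 * s)" by (rule mult_right_mono) simp
  also have "... = (et powr (2 * s - 2) * et powr (2 - 2 * s)) * i" by simp
  also have "... = i" using et(1) by (simp add: powr_add[symmetric])
  finally show ?thesis using real unfolding I_def[symmetric] by (simp add: ennreal_leI)
 qed (simp add: I_def)
qed

text \<open>The summands of the upper constant are the radial integrals of r^2 over the inner range
  and of 1 and r^al over the tail, each doubled for the two half-lines; \<open>al < 2 * s\<close>
  makes the last one converge. The lower constant is the quadratic bound on directions times the
  first radial integral.\<close>

lemma jump_levy:
 assumes al: "0 < al" "al < 2 * s" and et: "0 < et" "et powr (2 * s) * Lam <= lam / 2"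
 shows "levy s al (lam / 2 * et powr (2 - 2 * s) / (1 - s)) (Lam * (1 / (1 - s) + 1 / s + 2 / (2 * s - al))) (jump_measure s mu)"
 unfolding levy_def
proof (intro conjI allI impI)
 note [measurable_cong] = spec_sets and [measurable] = spec_id polar_measurable
 let ?C = "Lam * (1 / (1 - s) + 1 / s + 2 / (2 * s - al))"
 have mono: "ennreal (Lam * K * m) <= ennreal (?C * m)" if "K \<in> {1 / (1 - s), 1 / s, 2 / (2 * s - al)}" "0 <= m" for K m
  using that s al lam by (intro ennreal_leI mult_right_mono mult_left_mono) (auto simp: add_increasing add_increasing2)
 show "sets (jump_measure s mu) = sets borel" by (simp add: jump_measure_def)
 have *: "abs r powr a * (abs r powr b * c) = abs r powr (a + b) * c" for r a b c :: real by (simp add: powr_add)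
 have mm: "ennreal (abs r powr a) * ennreal x = ennreal (abs r powr a * x)" for r a x :: real by (simp add: ennreal_mult')
 have sq: "(norm (r *\<^sub>R th))^2 = abs r powr 2" if "norm th = 1" for r and th :: 'a using that by (cases "r = 0") auto
 have ind: "indicator (cball 0 R) (r *\<^sub>R th) = (indicator {..R} (abs r) :: real)" "indicator (- cball 0 R) (r *\<^sub>R th) = (indicator {R<..} (abs r) :: real)"
  if "norm th = 1" for r R and th :: 'a using that by (auto simp: indicator_def)
 have "emeasure (jump_measure s mu) {0} = (\<integral>\<^sup>+y. indicator {0} y \<partial>jump_measure s mu)"
  by (simp add: jump_measure_def)
 also have "... = (\<integral>\<^sup>+th. 0 \<partial>mu)"
  unfolding nn_integral_jump[OF borel_measurable_indicator[OF borel_singleton[OF sets.empty_sets]]]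
 proof (intro nn_integral_cong)
  fix th assume "th \<in> space mu"
  \<comment> \<open>For \<open>r = 0\<close> the product vanishes because \<open>0 powr a\<close> is
    0 by convention; for other \<open>r\<close> the point is not the origin.\<close>
  hence e: "ennreal (abs r powr (- 1 - 2 * s)) * indicator {0} (r *\<^sub>R th) = 0" for r
   using spec_norm[of th] by (auto simp: indicator_def)
  show "(NN r. ennreal (abs r powr (- 1 - 2 * s)) * indicator {0} (r *\<^sub>R th)) = 0" by (simp only: e nn_integral_const mult_zero_left)
 qed
 finally show "emeasure (jump_measure s mu) {0} = 0" by simp
 fix R :: real assume R: "0 < R"
 note [measurable] = borel_closed[OF closed_cball]
 have m: "bm (%y::'a. (norm y)^2 * indicator (cball 0 R) y)" "bm (%y::'a. (y \<bullet> e)^2 * indicator (cball 0 R) y)"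
  "bm (%y::'a. norm y powr al * indicator (- cball 0 R) y)" for e by measurable
 have sqi: "(NN r. ennreal (abs r powr (- 1 - 2 * s)) * ennreal (abs r powr 2 * indicator {..R} (abs r))) = ennreal (1 / (1 - s) * R powr (2 - 2 * s))"
  unfolding mm * using nn_integral_abs_powr(1)[OF R, of "1 - 2 * s"] s by (simp add: divide_simps algebra_simps)
 show "(\<integral>\<^sup>+y. ennreal ((norm y)^2 * indicator (cball 0 R) y) \<partial>jump_measure s mu) <= ennreal (?C * R powr (2 - 2 * s))"
  by (rule order_trans[OF nn_integral_jump_radial mono[of "1 / (1 - s)"]]) (use s sqi m in \<open>auto simp: sq ind\<close>)
 show "(\<integral>\<^sup>+y. ennreal (indicator (- cball 0 R) y) \<partial>jump_measure s mu) <= ennreal (?C * R powr (- 2 * s))"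
  by (rule order_trans[OF nn_integral_jump_radial mono[of "1 / s"]])
    (use s nn_integral_abs_powr(2)[OF R, of "- 1 - 2 * s"] in \<open>auto simp: ind mm\<close>)
 show "(\<integral>\<^sup>+y. ennreal (norm y powr al * indicator (- cball 0 R) y) \<partial>jump_measure s mu) <= ennreal (?C * R powr (al - 2 * s))"
  by (rule order_trans[OF nn_integral_jump_radial mono[of "2 / (2 * s - al)"]])
    (use s al nn_integral_abs_powr(2)[OF R, of "- 1 - 2 * s + al"] m in \<open>auto simp: ind mm *\<close>)
 fix e :: 'a assume e: "norm e = 1"
 have q: "ennreal (abs r powr (- 1 - 2 * s)) * ennreal ((r *\<^sub>R th \<bullet> e)^2 * indicator (cball 0 R) (r *\<^sub>R th))
  = ennreal ((th \<bullet> e)^2) * (ennreal (abs r powr (- 1 - 2 * s)) * ennreal (abs r powr 2 * indicator {..R} (abs r)))" if "norm th = 1" for th r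
 proof -
  have "abs r powr 2 = r^2" by (cases "r = 0") auto
  thus ?thesis using that by (simp add: ind ennreal_mult'[symmetric] power_mult_distrib mult_ac)
 qed
 have "ennreal (lam / 2 * et powr (2 - 2 * s) / (1 - s) * R powr (2 - 2 * s)) = ennreal (lam / 2 * et powr (2 - 2 * s)) * ennreal (1 / (1 - s) * R powr (2 - 2 * s))"
  using lam s by (simp add: ennreal_mult[symmetric])
 also have "... <= (\<integral>\<^sup>+th. ennreal ((th \<bullet> e)^2) \<partial>mu) * ennreal (1 / (1 - s) * R powr (2 - 2 * s))"
  by (intro mult_right_mono spec_quadratic e et) auto
 also have "... = (\<integral>\<^sup>+th. ennreal ((th \<bullet> e)^2) * ennreal (1 / (1 - s) * R powr (2 - 2 * s)) \<partial>mu)"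
  by (rule nn_integral_multc[symmetric]) measurable
 also have "... = (\<integral>\<^sup>+y. ennreal ((y \<bullet> e)^2 * indicator (cball 0 R) y) \<partial>jump_measure s mu)"
  unfolding sqi[symmetric] nn_integral_jump[OF measurable_compose[OF m(2) measurable_ennreal]]
 proof (rule nn_integral_cong)
  fix th assume "th \<in> space mu"
  note qs = q[OF spec_norm[OF this]]
  show "ennreal ((th \<bullet> e)^2) * (NN r. ennreal (abs r powr (- 1 - 2 * s)) * ennreal (abs r powr 2 * indicator {..R} (abs r)))
   = (NN r. ennreal (abs r powr (- 1 - 2 * s)) * ennreal ((r *\<^sub>R th \<bullet> e)^2 * indicator (cball 0 R) (r *\<^sub>R th)))"
   unfolding qs by (intro nn_integral_cmult[symmetric]) measurable
 qed
 finally show "ennreal (lam / 2 * et powr (2 - 2 * s) / (1 - s) * R powr (2 - 2 * s)) <= (\<integral>\<^sup>+y. ennreal ((y \<bullet> e)^2 * indicator (cball 0 R) y) \<partial>jump_measure s mu)" .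
qed

lemma stable_op_eq:
 assumes g: "!!y. w (t, x + y) + w (t, x - y) - 2 * w (t, x) = g y"
  and i: "integrable (jump_measure s mu) g" and [measurable]: "bm g"
 shows "stable_op s mu w (t, x) = (\<integral>y. g y \<partial>jump_measure s mu)"
proof -
 note [measurable_cong] = spec_sets and [measurable] = spec_id polar_measurable
 interpret M: finite_measure mu by (rule spec_finite)
 interpret R: sigma_finite_measure "radial s" by (rule sigma_finite_radial)
 interpret P: pair_sigma_finite mu "radial s" ..
 have i2: "integrable (mu \<Otimes>\<^sub>M radial s) (%p. g (case p of (th, r) => r *\<^sub>R th))"
  using i unfolding jump_measure_def by (subst (asm) integrable_distr_eq) auto
 have "(\<integral>y. g y \<partial>jump_measure s mu) = (\<integral>p. g (case p of (th, r) => r *\<^sub>R th) \<partial>(mu \<Otimes>\<^sub>M radial s))"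
  unfolding jump_measure_def by (rule integral_distr) measurable
 also have "... = (\<integral>th. (\<integral>r. g (r *\<^sub>R th) \<partial>radial s) \<partial>mu)"
  using P.integral_fst'[OF i2] by simp
 also have "... = (\<integral>th. (LBINT r. g (r *\<^sub>R th) / abs r powr (1 + 2 * s)) \<partial>mu)"
 proof (rule Bochner_Integration.integral_cong[OF refl])
  fix th
  have [measurable]: "bm (%r. g (r *\<^sub>R th))"
   by (rule measurable_compose[of "%r. r *\<^sub>R th" borel borel g]) auto
  have "(\<integral>r. g (r *\<^sub>R th) \<partial>radial s) = (LBINT r. abs r powr (- 1 - 2 * s) *\<^sub>R g (r *\<^sub>R th))"
   unfolding radial_def by (rule integral_density) auto
  also have "... = (LBINT r. g (r *\<^sub>R th) / abs r powr (1 + 2 * s))"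
  proof (intro Bochner_Integration.integral_cong refl)
   fix r :: real
   have "abs r powr (- 1 - 2 * s) = inverse (abs r powr (1 + 2 * s))" using powr_minus[of "abs r" "1 + 2 * s"] by simp
   thus "abs r powr (- 1 - 2 * s) *\<^sub>R g (r *\<^sub>R th) = g (r *\<^sub>R th) / abs r powr (1 + 2 * s)" by (simp add: divide_inverse)
  qed
  finally show "(\<integral>r. g (r *\<^sub>R th) \<partial>radial s) = (LBINT r. g (r *\<^sub>R th) / abs r powr (1 + 2 * s))" .
 qed
 finally show ?thesis by (simp add: stable_op_def g)
qed

end

section \<open>Convolution with a mollifier\<close>

lemma smooth_reflect: "smooth v ==> smooth (%q. v (p - q))"
proof (induction rule: smooth.induct)
 case (inner e)
 have "smooth (%q. p \<bullet> e + (- 1) * (q \<bullet> e))" by (intro smooth.intros)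
 thus ?case by (simp add: inner_diff_left)
next
 case (bump n d a)
 have "(p - q - a) \<bullet> (p - q - a) = (q - (p - a)) \<bullet> (q - (p - a))" for q
  using inner_minus_left[of "q - (p - a)" "- (q - (p - a))"] by (simp add: algebra_simps)
 thus ?case using smooth.bump[of n d "p - a"] by simp
qed (auto intro: smooth.intros)

text \<open>The remainder is needed in L1, since it will be convolved with a function that is merely
  bounded. For |y| <= 1 it is at most a multiple of |y|^2 and supported in a ball larger by 1; for
  |y| > 1 its three terms are bounded one by one, with both 1 and |y| at most |y|^2.\<close>

lemma smooth_supp_L1:
 fixes v :: "'a::euclidean_space => real"
 assumes v: "smooth_supp a r v"
 shows "\<exists>v' K. 0 <= K \<and> (\<forall>h. smooth_supp a r (v' h)) \<and> (\<forall>x. (v has_derivative (%h. v' h x)) (at x)) \<and>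
  (\<forall>x y. abs (v (x + y) - v x - v' y x) <= K * (norm y)^2) \<and>
  (\<forall>y. (LBINT x. abs (v (x + y) - v x - v' y x)) <= K * (norm y)^2)"
proof -
 obtain v' B where B: "0 <= B" and v': "!!h. smooth_supp a r (v' h)" "!!x. (v has_derivative (%h. v' h x)) (at x)"
  and rem: "!!x y. abs (v (x + y) - v x - v' y x) <= B * (norm y)^2"
  using smooth_supp_remainder[OF v] by blast
 note [measurable] = smooth_supp_measurable[OF v] smooth_supp_measurable[OF v'(1)]
 note iv = integrable_abs[OF smooth_supp_integrable[OF v]] and iv' = integrable_abs[OF smooth_supp_integrable[OF v'(1)]]
 define W where "W = measure lborel (cball a (r + 1))"
 define S where "S = (\<Sum>c\<in>Basis. \<integral>x. abs (v' c x) \<partial>lborel)"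
 define A where "A = (LBINT x. abs (v x))"
 have nn: "0 <= W" "0 <= S" "0 <= A" by (auto simp: W_def S_def A_def intro!: sum_nonneg)
 define K where "K = B + B * W + 2 * A + S"
 have "(LBINT x. abs (v (x + y) - v x - v' y x)) <= K * (norm y)^2" for y
 proof (cases "norm y <= 1")
  case True
  have "(LBINT x. abs (v (x + y) - v x - v' y x)) <= (B * (norm y)^2) * measure lborel (cball a (r + 1))"
  proof (rule abs_integral_supp_le(2)[OF _ rem])
   fix x assume x: "r + 1 < norm (x - a)"
   have "norm (x - a) <= norm (x + y - a) + norm y" using norm_triangle_ineq4[of "x + y - a" y] by (simp add: algebra_simps)
   thus "v (x + y) - v x - v' y x = 0" using x True v v'(1) by (auto simp: smooth_supp_def)
  qed measurable
  also have "... <= K * (norm y)^2" using nn B by (simp add: K_def W_def algebra_simps)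
  finally show ?thesis .
 next
  case False
  have le: "abs (v' y x) <= norm y * (\<Sum>c\<in>Basis. abs (v' c x))" for x
  proof -
   have "abs (v' y x) <= (\<Sum>c\<in>Basis. abs (y \<bullet> c) * abs (v' c x))"
    unfolding linear_Basis[OF v'(2)[of x], of y] abs_mult[symmetric] by (rule sum_abs)
   also have "... <= (\<Sum>c\<in>Basis. norm y * abs (v' c x))" by (intro sum_mono mult_right_mono Basis_le_norm) auto
   finally show ?thesis by (simp add: sum_distrib_left)
  qed
  have i: "LI (%x. abs (v (x + y)))" "(LBINT x. abs (v (x + y))) = A"
   using integrable_translate(1)[OF iv, of y] integral_translate(1)[of "%x. abs (v x)" y] by (auto simp: A_def)
  have "(LBINT x. abs (v (x + y) - v x - v' y x)) <= (LBINT x. abs (v (x + y)) + abs (v x) + norm y * (\<Sum>c\<in>Basis. abs (v' c x)))"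
  proof (rule order_trans[OF abs_ge_self], rule abs_integral_le(2))
   show "LI (%x. abs (v (x + y)) + abs (v x) + norm y * (\<Sum>c\<in>Basis. abs (v' c x)))"
    using i iv iv' by auto
   have "abs (abs (v (x + y) - v x - v' y x)) <= abs (v (x + y)) + abs (v x) + norm y * (\<Sum>c\<in>Basis. abs (v' c x))" for x
    using le[of x] by linarith
   thus "AE x in lborel. abs (abs (v (x + y) - v x - v' y x)) <= abs (v (x + y)) + abs (v x) + norm y * (\<Sum>c\<in>Basis. abs (v' c x))" by simp
  qed measurable
  also have "... = 2 * A + norm y * S" using i iv iv' by (simp add: A_def[symmetric] S_def)
  also have "... <= (2 * A) * (norm y)^2 + (norm y)^2 * S"
  proof -
   have y: "1 <= (norm y)^2" "norm y <= (norm y)^2" using False by (auto intro: self_le_power)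
   show ?thesis using mult_left_mono[OF y(1), of "2 * A"] mult_right_mono[OF y(2), of S] nn by simp
  qed
  also have "... <= K * (norm y)^2" using nn B by (simp add: K_def algebra_simps)
  finally show ?thesis .
 qed
 moreover have "B <= K" "0 <= K" using nn B by (auto simp: K_def)
 moreover have "abs (v (x + y) - v x - v' y x) <= K * (norm y)^2" for x y
  using rem[of x y] mult_right_mono[OF \<open>B <= K\<close>, of "(norm y)^2"] by simp
 ultimately show ?thesis using v' by blast
qed

definition conv :: "('a::euclidean_space => real) => ('a => real) => 'a => real" where
 "conv g b p = (LBINT q. g q * b (p - q))"

lemma conv_bound:
 assumes [measurable]: "bm g" and g: "!!q. abs (g q) <= m" and b: "LI b"
 shows "LI (%q. g q * b (p - q))" "abs (conv g b p) <= m * (LBINT z. abs (b z))"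
  "conv g b p = (LBINT q. g (p - q) * b q)" "LI (%q. g (p - q) * b q)"
proof -
 have [measurable]: "bm b" using b by auto
 note r = integral_reflect[OF integrable_abs[OF b], of p]
 have i: "LI (%q. m * abs (b (p - q)))" using r(1) by simp
 have le: "AE q in lborel. abs (g q * b (p - q)) <= m * abs (b (p - q))"
  unfolding abs_mult by (intro AE_I2 mult_right_mono g) auto
 show i1: "LI (%q. g q * b (p - q))" by (rule abs_integral_le(1)[OF i _ le]) simp
 have "abs (conv g b p) <= (LBINT q. m * abs (b (p - q)))"
  unfolding conv_def by (rule abs_integral_le(2)[OF i _ le]) simp
 thus "abs (conv g b p) <= m * (LBINT z. abs (b z))" using r(2) by simp
 show "conv g b p = (LBINT q. g (p - q) * b q)" "LI (%q. g (p - q) * b q)"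
  using integral_reflect[OF i1, of p] by (auto simp: conv_def)
qed

lemma conv_measurable:
 assumes [measurable]: "bm g" "bm b"
 shows "bm (conv g b)"
 unfolding conv_def by measurable

lemma conv_lin:
 assumes g: "bm g" "!!q. abs (g q) <= m" and b: "LI b" "LI b'" "LI b''"
 shows "conv g (%z. b z - b' z - b'' z) p = conv g b p - conv g b' p - conv g b'' p"
 using conv_bound(1)[OF g b(1), of p] conv_bound(1)[OF g b(2), of p] conv_bound(1)[OF g b(3), of p]
 by (simp add: conv_def right_diff_distrib)

lemma conv_shift: "conv g (%z. b (z + y)) p = conv g b (p + y)"
 unfolding conv_def by (simp add: algebra_simps)

lemma conv_remainder:
 assumes g: "bm g" "!!q. abs (g q) <= m" and b: "LI b" "LI b'"
  and K: "(LBINT x. abs (b (x + y) - b x - b' x)) <= k"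
 shows "abs (conv g b (p + y) - conv g b p - conv g b' p) <= m * k"
proof -
 have m: "0 <= m" using g(2)[of 0] by linarith
 have i: "LI (%z. b (z + y))" by (rule integrable_translate(1)[OF b(1)])
 have "conv g b (p + y) - conv g b p - conv g b' p = conv g (%z. b (z + y) - b z - b' z) p"
  by (simp add: conv_lin[OF g i b] conv_shift)
 also have "\<bar>...\<bar> <= m * (LBINT z. \<bar>b (z + y) - b z - b' z\<bar>)" using i b by (intro conv_bound(2) g) auto
 also have "... <= m * k" using m K by (intro mult_left_mono) auto
 finally show ?thesis .
qed

lemma levy_integrable:
 assumes l: "levy s al c C nu" and [measurable]: "bm h"
  and h: "!!y. norm y <= 1 ==> abs (h y) <= A * (norm y)^2" "!!y. abs (h y) <= A" and A: "0 <= A"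
 shows "integrable nu h"
proof -
 note L = levyD[OF l]
 note [measurable_cong] = L(1) and [measurable] = borel_closed[OF closed_cball[of "0::'a" 1]]
 have "(\<integral>\<^sup>+y. ennreal (abs (h y)) \<partial>nu) <= (\<integral>\<^sup>+y. ennreal A * ennreal ((norm y)^2 * indicator (cball 0 1) y) + ennreal A * ennreal (indicator (- cball 0 1) y) \<partial>nu)"
 proof (rule nn_integral_mono)
  fix y :: 'a
  have "abs (h y) <= A * ((norm y)^2 * indicator (cball 0 1) y) + A * indicator (- cball 0 1) y"
   using h(1)[of y] h(2)[of y] by (simp add: indicator_def)
  thus "ennreal (abs (h y)) <= ennreal A * ennreal ((norm y)^2 * indicator (cball 0 1) y) + ennreal A * ennreal (indicator (- cball 0 1) y)"
   using A by (simp add: ennreal_mult[symmetric] ennreal_plus[symmetric] ennreal_leI del: ennreal_plus)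
 qed
 also have "... = ennreal A * (\<integral>\<^sup>+y. ennreal ((norm y)^2 * indicator (cball 0 1) y) \<partial>nu) + ennreal A * (\<integral>\<^sup>+y. ennreal (indicator (- cball 0 1) y) \<partial>nu)"
  by (subst nn_integral_add) (simp_all add: nn_integral_cmult)
 also have "... <= ennreal A * ennreal (C * 1 powr (2 - 2 * s)) + ennreal A * ennreal (C * 1 powr (- 2 * s))"
  by (intro add_mono mult_left_mono L) auto
 also have "... < \<infinity>" by (simp add: ennreal_mult_less_top)
 finally show ?thesis unfolding integrable_iff_bounded by (simp add: measurable_cong_sets[OF L(1) refl])
qed

subsection \<open>Mollified weak solutions\<close>

lemma continuous_on_parabolic_holder:
 fixes w :: "real \<times> 'a::real_normed_vector => real"
 assumes ab: "0 < al" "0 < be" and h: "!!t x t' x'. (t, x) \<in> A ==> (t', x') \<in> A ==>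
  abs (w (t, x) - w (t', x')) <= M * (abs (t - t') powr be + norm (x - x') powr al)"
 shows "continuous_on A w"
 unfolding continuous_on_def
proof
 fix p assume p: "p \<in> A"
 have "((%q. w q - w p) \<longlongrightarrow> 0) (at p within A)"
 proof (rule Lim_null_comparison)
  show "\<forall>\<^sub>F q in at p within A. norm (w q - w p) <= M * (abs (fst q - fst p) powr be + norm (snd q - snd p) powr al)"
   unfolding eventually_at_filter using h[of _ _ "fst p" "snd p"] p by (intro always_eventually) auto
  have "((%q. abs (fst q - fst p)) \<longlongrightarrow> 0) (at p within A)" "((%q. norm (snd q - snd p)) \<longlongrightarrow> 0) (at p within A)"
   by (auto intro!: tendsto_eq_intros)
  hence "((%q. abs (fst q - fst p) powr be + norm (snd q - snd p) powr al) \<longlongrightarrow> 0 + 0) (at p within A)"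
   using ab by (intro tendsto_add tendsto_zero_powrI[OF _ tendsto_const]) auto
  thus "((%q. M * (abs (fst q - fst p) powr be + norm (snd q - snd p) powr al)) \<longlongrightarrow> 0) (at p within A)"
   by (intro tendsto_mult_right_zero) simp
 qed
 thus "(w \<longlongrightarrow> w p) (at p within A)" by (simp add: LIM_zero_iff)
qed

locale weak_sol = stable_setting s al c C rh for s al c C rh :: real +
 fixes lam Lam :: real and mu :: "'a::euclidean_space measure" and u f :: "real \<times> 'a => real" and M :: real
 assumes lam: "0 < lam" "lam <= Lam" and spec: "spectral_measure s lam Lam mu" and lv: "lev (jump_measure s mu)"
  and weak: "weak_solution s mu {-1<..<0} (ball 0 1) u f" and M0: "0 <= M"
  and u_bd: "!!t x. t \<in> {-1<..<0} ==> abs (u (t, x)) <= M"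
  and u_hold: "!!t t' x x'. t \<in> {-1<..<0} ==> t' \<in> {-1<..<0} ==>
   abs (u (t, x) - u (t', x')) <= M * (abs (t - t') powr (al / (2 * s)) + norm (x - x') powr al)"
  and f_bd: "!!t x. t \<in> {-1<..<0} ==> norm x < 1 ==> abs (f (t, x)) <= M"
  and f_hold: "!!t t' x x'. t \<in> {-1<..<0} ==> t' \<in> {-1<..<0} ==> norm x < 1 ==> norm x' < 1 ==>
   abs (f (t, x) - f (t', x')) <= M * (abs (t - t') powr (al / (2 * s)) + norm (x - x') powr al)"
begin

abbreviation "nu \<equiv> jump_measure s mu"

text \<open>Extension by zero makes the convolutions integrals over the whole space. At the points
  where the equation is used, the mollifier sees only values from the original domains.\<close>

definition u0 :: "real \<times> 'a => real" where "u0 p = indicator ({-1<..<0} \<times> UNIV) p *\<^sub>R u p"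
definition f0 :: "real \<times> 'a => real" where "f0 p = indicator ({-1<..<0} \<times> ball 0 1) p *\<^sub>R f p"

lemma u0_meas: "bm u0" and f0_meas: "bm f0"
proof -
 have be: "0 < al / (2 * s)" using s al by simp
 show "bm u0" unfolding u0_def
  using u_hold by (intro borel_measurable_continuous_on_indicator continuous_on_parabolic_holder[OF al(1) be, where M=M])
   (auto intro!: borel_open open_Times)
 show "bm f0" unfolding f0_def
  using f_hold by (intro borel_measurable_continuous_on_indicator continuous_on_parabolic_holder[OF al(1) be, where M=M])
   (auto intro!: borel_open open_Times)
qed

lemma u0_bd: "abs (u0 p) <= M" and f0_bd: "abs (f0 p) <= M"
 using u_bd[of "fst p" "snd p"] f_bd[of "fst p" "snd p"] M0 by (auto simp: u0_def f0_def indicator_def)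

text \<open>The mollifier is centred at \<open>(2 de, 0)\<close> and so looks only into the past: the mollified functions
are controlled up to time \<open>0\<close>.\<close>

context
 fixes de :: real and b :: "real \<times> 'a => real"
 assumes de: "0 < de" "de <= 1/16" and b: "mollifier (2 * de, 0) de b"
begin

lemmas bD = mollifierD[OF b]

lemma mol_supp:
 assumes "b q ~= 0"
 shows "abs (fst q - 2 * de) <= de" "norm (snd q) <= de"
proof -
 have "norm (q - (2 * de, 0)) <= de" using bD(6)[of q] assms by force
 thus "abs (fst q - 2 * de) <= de" "norm (snd q) <= de"
  using norm_fst_le[of "fst q - 2 * de" "snd q"] norm_snd_le[of "snd q" "fst q - 2 * de"]
  by (cases q; auto)+
qed

lemma average_le:
 assumes [measurable]: "bm h" and h: "!!q. b q ~= 0 ==> abs (h q) <= m"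
 shows "abs (LBINT q. h q * b q) <= m"
proof -
 note [measurable] = bD(5)
 have "abs (LBINT q. h q * b q) <= (LBINT q. m * b q)"
 proof (rule abs_integral_le(2))
  have "abs (h q * b q) <= m * b q" for q
   using h[of q] bD(2)[of q] by (cases "b q = 0") (auto simp: abs_mult intro!: mult_right_mono)
  thus "AE q in lborel. abs (h q * b q) <= m * b q" by simp
 qed (use bD(3) in auto)
 thus ?thesis using bD(4) by simp
qed

lemma conv_diff_le:
 assumes g: "bm g" "!!q. abs (g q) <= M" and h: "!!q. b q ~= 0 ==> abs (g (p - q) - g (p' - q)) <= m"
 shows "abs (conv g b p - conv g b p') <= m"
proof -
 note [measurable] = g(1)
 have "conv g b p - conv g b p' = (LBINT q. (g (p - q) - g (p' - q)) * b q)"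
  using conv_bound(3,4)[OF g bD(3), of p] conv_bound(3,4)[OF g bD(3), of p'] by (simp add: left_diff_distrib)
 thus ?thesis using average_le[OF _ h] by simp
qed

text \<open>The mollifier is supported at times between \<open>de\<close> and \<open>3 * de\<close>,
  so these are times from which looking back never leaves (-1, 0).\<close>

definition "J = {-1 + 3 * de<..<de}"
abbreviation "P \<equiv> conv u0 b"
abbreviation "F \<equiv> conv f0 b"

lemma mol_time: "t \<in> J ==> b q ~= 0 ==> t - fst q \<in> {-1<..<0}"
 using mol_supp(1)[of q] by (auto simp: J_def abs_le_iff)

lemma mol_space: "norm x < 1 - de ==> b q ~= 0 ==> norm (x - snd q) < 1"
 using mol_supp(2)[of q] norm_triangle_ineq4[of x "snd q"] by simp

lemma P_bd: "abs (P p) <= M" and F_bd: "abs (F p) <= M"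
 using conv_bound(2)[OF u0_meas u0_bd bD(3), of p] conv_bound(2)[OF f0_meas f0_bd bD(3), of p] bD(2,4)
 by (simp_all add: abs_of_nonneg)

lemma P_hold:
 assumes "t \<in> J" "t' \<in> J"
 shows "abs (P (t, x) - P (t', x')) <= M * (abs (t - t') powr (al / (2 * s)) + norm (x - x') powr al)"
proof (rule conv_diff_le[OF u0_meas u0_bd])
 fix q assume q: "b q ~= 0"
 obtain r y where qe: "q = (r, y)" by force
 show "abs (u0 ((t, x) - q) - u0 ((t', x') - q)) <= M * (abs (t - t') powr (al / (2 * s)) + norm (x - x') powr al)"
  using mol_time[OF assms(1) q] mol_time[OF assms(2) q] u_hold[of "t - r" "t' - r" "x - y" "x' - y"]
  by (simp add: u0_def qe)
qed

lemma F_hold: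
 assumes "t \<in> J" "t' \<in> J" "norm x < 1 - de" "norm x' < 1 - de"
 shows "abs (F (t, x) - F (t', x')) <= M * (abs (t - t') powr (al / (2 * s)) + norm (x - x') powr al)"
proof (rule conv_diff_le[OF f0_meas f0_bd])
 fix q assume q: "b q ~= 0"
 obtain r y where qe: "q = (r, y)" by force
 show "abs (f0 ((t, x) - q) - f0 ((t', x') - q)) <= M * (abs (t - t') powr (al / (2 * s)) + norm (x - x') powr al)"
  using mol_time[OF assms(1) q] mol_time[OF assms(2) q] mol_space[OF assms(3) q] mol_space[OF assms(4) q]
   f_hold[of "t - r" "t' - r" "x - y" "x' - y"]
  by (simp add: f0_def qe)
qed

lemma P_approx:
 assumes t: "t \<in> J" "t \<in> {-1<..<0}"
 shows "abs (P (t, x) - u (t, x)) <= M * ((3 * de) powr (al / (2 * s)) + de powr al)"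
proof -
 note [measurable] = u0_meas
 have "P (t, x) - u (t, x) = (LBINT q. (u0 ((t, x) - q) - u (t, x)) * b q)"
  using conv_bound(3,4)[OF u0_meas u0_bd bD(3), of "(t, x)"] bD(3,4) by (simp add: left_diff_distrib)
 also have "\<bar>...\<bar> <= M * ((3 * de) powr (al / (2 * s)) + de powr al)"
 proof (rule average_le)
  fix q assume q: "b q ~= 0"
  obtain r y where qe: "q = (r, y)" by force
  have "abs (u0 ((t, x) - q) - u (t, x)) <= M * (abs r powr (al / (2 * s)) + norm y powr al)"
   using mol_time[OF t(1) q] u_hold[of "t - r" t "x - y" x] t by (simp add: u0_def qe)
  also have "... <= M * ((3 * de) powr (al / (2 * s)) + de powr al)"
   using mol_supp[OF q] M0 al s by (intro mult_left_mono add_mono powr_mono2) (auto simp: qe)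
  finally show "abs (u0 ((t, x) - q) - u (t, x)) <= M * ((3 * de) powr (al / (2 * s)) + de powr al)" .
 qed measurable
 finally show ?thesis .
qed

end

text \<open>The reflected mollifier centred at p is an admissible test function as long as its
  support stays in the domain, and the weak formulation for it is the mollified equation at p.
  Reflection reverses the sign of the time derivative, and Fubini moves the operator through the
  convolution; it applies because the second differences of \<open>b\<close> have L1 norm at most a
  multiple of min (1, |y|^2).\<close>

lemma mollified_equation:
 assumes de: "0 < de" "de <= 1/16" and b: "mollifier (2 * de, 0) de b"
 shows "\<exists>bt K. LI bt \<and> 0 <= K \<and>
  (\<forall>p y. abs (conv u0 b (p + y) + conv u0 b (p - y) - 2 * conv u0 b p) <= M * (2 * K) * (norm y)^2) \<and>
  (\<forall>t x h. abs (conv u0 b (t + h, x) - conv u0 b (t, x) - h * conv u0 bt (t, x)) <= M * K * h^2) \<and>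
  (\<forall>t x. t \<in> J de --> norm x < 1 - de -->
   conv u0 bt (t, x) = (\<integral>y. conv u0 b (t, x + y) + conv u0 b (t, x - y) - 2 * conv u0 b (t, x) \<partial>nu) + conv f0 b (t, x))"
proof -
 let ?P = "conv u0 b"
 note bD = mollifierD[OF b]
 obtain b' K where K: "0 <= K" and b': "!!h. smooth_supp (2 * de, 0) de (b' h)" "!!x. (b has_derivative (%h. b' h x)) (at x)"
  and rem: "!!x y. abs (b (x + y) - b x - b' y x) <= K * (norm y)^2"
   "!!y. (LBINT x. abs (b (x + y) - b x - b' y x)) <= K * (norm y)^2"
  using smooth_supp_L1[OF bD(1)] by blast
 have lin: "b' (h *\<^sub>R e) x = h * b' e x" for h e x
  using linear_scale[OF bounded_linear.linear[OF has_derivative_bounded_linear[OF b'(2)]]] by simp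
 have neg: "b' (- y) = (%x. - b' y x)" for y using lin[of "-1" y] by auto
 define bt where "bt = b' (1, 0)"
 have ib': "LI (b' h)" for h by (rule smooth_supp_integrable[OF b'(1)])
 note [measurable] = u0_meas f0_meas bD(5) smooth_supp_measurable[OF b'(1)]
 note cr = conv_remainder[OF u0_meas u0_bd bD(3) ib' rem(2)]
 have sd: "abs (?P (p + y) + ?P (p - y) - 2 * ?P p) <= M * (2 * K) * (norm y)^2" for p y
  using cr[of p y] cr[of p "- y"] unfolding neg by (simp add: conv_def)
 have td: "abs (?P (t + h, x) - ?P (t, x) - h * conv u0 bt (t, x)) <= M * K * h^2" for t x h
 proof -
  have e: "b' (h, 0) = (%z. h * bt z)" using lin[of h "(1, 0)"] by (simp add: bt_def fun_eq_iff)
  show ?thesis using cr[of "(t, x)" "(h, 0)"] unfolding e by (simp add: conv_def mult.left_commute[of _ h])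
 qed
 define Dy where "Dy y z = b (z + (0, y)) + b (z - (0, y)) - 2 * b z" for y :: 'a and z
 obtain Bb where Bb: "0 <= Bb" "!!x. abs (b x) <= Bb" using smooth_supp_bounded[OF bD(1)] by blast
 \<comment> \<open>One constant for the four bounds on \<open>Dy\<close>: \<open>2 * K\<close> for
   the two quadratic ones, \<open>4 * Bb\<close> for the pointwise one, and 4 for the L1 norm, since
   \<open>b\<close> has mass 1.\<close>
 define A where "A = 2 * K + 4 * Bb + 4"
 have A: "0 <= A" using K Bb by (simp add: A_def)
 have [measurable]: "(%p. Dy (fst p) (snd p)) \<in> borel_measurable (borel \<Otimes>\<^sub>M borel)" unfolding Dy_def by measurable
 have [measurable]: "bm (Dy y)" for y unfolding Dy_def by measurable
 have bs: "abs (b z) = b z" for z using bD(2) by simp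
 have ibs: "LI (%z. b (z + w))" "(LBINT z. b (z + w)) = 1" for w
  using integrable_translate(1)[OF bD(3)] integral_translate(1)[OF bD(5)] bD(4) by auto
 have iD: "LI (Dy y)" for y unfolding Dy_def diff_conv_add_uminus using ibs bD(3) by auto
 have Dy1: "abs (Dy y z) <= A * (norm y)^2" for y z
 proof -
  have e: "z - (0, y) = z + (0, - y)" by (cases z) simp
  have "abs (Dy y z) <= 2 * K * (norm y)^2"
   using rem(1)[of z "(0, y)"] rem(1)[of z "- (0, y)"] unfolding neg Dy_def e by simp
  also have "... <= A * (norm y)^2" using Bb by (intro mult_right_mono) (auto simp: A_def)
  finally show ?thesis .
 qed
 have Dy2: "abs (Dy y z) <= A" for y z
  using Bb(2)[of "z + (0, y)"] Bb(2)[of "z - (0, y)"] Bb(2)[of z] K unfolding Dy_def A_def by linarith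
 have iDa: "LI (%z. abs (Dy y z))" for y using iD by auto
 have Dy3: "(LBINT z. abs (Dy y z)) <= A * (norm y)^2" for y
 proof -
  have i: "LI (%z. abs (b (z + w) - b z - b' h z))" for w h using ibs(1) bD(3) ib' by auto
  have "abs (LBINT z. abs (Dy y z)) <= (LBINT z. abs (b (z + (0, y)) - b z - b' (0, y) z) + abs (b (z + - (0, y)) - b z - b' (- (0, y)) z))"
  proof (rule abs_integral_le(2))
   show "AE z in lborel. abs (abs (Dy y z)) <= abs (b (z + (0, y)) - b z - b' (0, y) z) + abs (b (z + - (0, y)) - b z - b' (- (0, y)) z)"
    unfolding neg Dy_def by (intro AE_I2) (simp add: diff_conv_add_uminus del: add_uminus_conv_diff)
  qed (use i[of "(0, y)"] i[of "- (0, y)"] in auto)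
  also have "... <= K * (norm y)^2 + K * (norm y)^2"
   using i[of "(0, y)"] i[of "- (0, y)"] rem(2)[of "(0, y)"] rem(2)[of "- (0, y)"] by (subst Bochner_Integration.integral_add) auto
  also have "... <= A * (norm y)^2" using Bb by (simp add: A_def algebra_simps)
  finally show ?thesis by simp
 qed
 have Dy4: "(LBINT z. abs (Dy y z)) <= A" for y
 proof -
  have "abs (LBINT z. abs (Dy y z)) <= (LBINT z. b (z + (0, y)) + b (z + - (0, y)) + 2 * b z)"
  proof (rule abs_integral_le(2))
   show "LI (%z. b (z + (0, y)) + b (z + - (0, y)) + 2 * b z)" using ibs(1) bD(3) by auto
   have "abs (abs (Dy y z)) <= b (z + (0, y)) + b (z + - (0, y)) + 2 * b z" for z
    using bD(2)[of z] bD(2)[of "z + (0, y)"] bD(2)[of "z + - (0, y)"] unfolding Dy_def diff_conv_add_uminus[of z] by linarith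
   thus "AE z in lborel. abs (abs (Dy y z)) <= b (z + (0, y)) + b (z + - (0, y)) + 2 * b z" by simp
  qed (use iDa in auto)
  also have "... = 4" using ibs bD(3,4) by (simp del: add_uminus_conv_diff)
  also have "... <= A" using K Bb by (simp add: A_def)
  finally show ?thesis by simp
 qed
 have l: "levy s al c C nu" using lv by (simp add: lev_def)
 interpret N: sigma_finite_measure nu by (rule sigma_finite_lev[OF lv])
 interpret NL: pair_sigma_finite nu lborel ..
 have sN [measurable_cong]: "sets nu = sets borel" by (rule levyD(1)[OF l])
 define La where "La z = (\<integral>y. Dy y z \<partial>nu)" for z
 have "(%(z, y). Dy y z) \<in> borel_measurable (borel \<Otimes>\<^sub>M nu)" unfolding Dy_def by measurable
 from N.borel_measurable_lebesgue_integral[OF this] have [measurable]: "bm La" unfolding La_def .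
 have eq: "conv u0 bt (t, x) = (\<integral>y. ?P (t, x + y) + ?P (t, x - y) - 2 * ?P (t, x) \<partial>nu) + conv f0 b (t, x)"
  if t: "t \<in> J de" and x: "norm x < 1 - de" for t x
 proof -
  define p where "p = (t, x)"
  define et where "et q = b (p - q)" for q
  have et0: "et q ~= 0 ==> q \<in> cball (t - 2 * de, x) de" for q
  proof -
   assume "et q ~= 0"
   hence "norm (p - q - (2 * de, 0)) <= de" using bD(6)[of "p - q"] unfolding et_def by force
   also have "p - q - (2 * de, 0) = (t - 2 * de, x) - q" by (cases q) (simp add: p_def)
   finally show ?thesis by (simp add: dist_norm)
  qed
  have sub: "cball (t - 2 * de, x) de \<subseteq> {-1<..<0} \<times> ball 0 1"
  proof
   fix q :: "real \<times> 'a" obtain r y where q: "q = (r, y)" by force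
   assume "q \<in> cball (t - 2 * de, x) de"
   hence n: "norm (t - 2 * de - r, x - y) <= de" by (simp add: q dist_norm)
   have "abs (t - 2 * de - r) <= de" "norm (x - y) <= de"
    using order_trans[OF norm_fst_le n] order_trans[OF norm_snd_le n] by auto
   thus "q \<in> {-1<..<0} \<times> ball 0 1"
    using t x norm_triangle_ineq2[of y x] by (auto simp: q J_def[OF de b] abs_le_iff norm_minus_commute)
  qed
  have cl: "closure {q. et q ~= 0} \<subseteq> cball (t - 2 * de, x) de" using et0 by (intro closure_minimal) auto
  have test: "test_function ({-1<..<0} \<times> ball 0 1) et"
   unfolding test_function_def
  proof (intro conjI allI)
   show "Ck_on k UNIV et" for k
    unfolding et_def using bD(1) by (intro smooth_Ck smooth_reflect) (simp add: smooth_supp_def)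
   show "compact (closure {q. et q ~= 0})"
    using cl by (simp add: compact_eq_bounded_closed) (meson bounded_cball bounded_subset)
   show "closure {q. et q ~= 0} \<subseteq> {-1<..<0} \<times> ball 0 1" using cl sub by blast
  qed
  have tdv: "time_deriv et q = - bt (p - q)" for q
  proof -
   obtain r y where q: "q = (r, y)" by force
   have "((%ta. p - (ta, y)) has_derivative (%h. - (h, 0))) (at r)"
    by (auto intro!: derivative_eq_intros)
   from has_derivative_compose[OF this b'(2)]
   have "((%ta. et (ta, y)) has_derivative (%h. b' (- (h, 0)) (p - (r, y)))) (at r)" by (simp add: et_def)
   also have "(%h. b' (- (h, 0)) (p - (r, y))) = (*) (- bt (p - (r, y)))"
   proof
    fix h show "b' (- (h, 0)) (p - (r, y)) = - bt (p - (r, y)) * h"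
     using lin[of h "(1, 0)" "p - (r, y)"] unfolding neg bt_def by simp
   qed
   finally have "((%ta. et (ta, y)) has_real_derivative (- bt (p - (r, y)))) (at r)"
    by (simp only: has_field_derivative_def)
   thus ?thesis by (simp add: time_deriv_def q DERIV_imp_deriv)
  qed
  have sop: "stable_op s mu et q = La (p - q)" for q
  proof -
   obtain r y where q: "q = (r, y)" by force
   have [measurable]: "bm (%h. Dy h z)" for z unfolding Dy_def by measurable
   have "stable_op s mu et (r, y) = (\<integral>h. Dy h (p - q) \<partial>nu)"
   proof (rule stable_op_eq[OF s lam spec])
    show "integrable nu (%h. Dy h (p - q))"
     by (rule levy_integrable[OF l _ Dy1 Dy2 A]) simp
    show "et (r, y + h) + et (r, y - h) - 2 * et (r, y) = Dy h (p - q)" for h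
    proof -
     have "p - (r, y + h) = p - q - (0, h)" "p - (r, y - h) = p - q + (0, h)" by (auto simp: p_def q algebra_simps)
     thus ?thesis unfolding et_def Dy_def q by (simp only: add.commute)
    qed
   qed simp
   thus ?thesis by (simp add: La_def q)
  qed
  have "(LINT q:{-1<..<0} \<times> UNIV|lebesgue. u q * (- time_deriv et q - stable_op s mu et q)) = (LINT q:{-1<..<0} \<times> ball 0 1|lebesgue. f q * et q)"
   using weak test unfolding weak_solution_def by blast
  moreover have "(LINT q:{-1<..<0} \<times> UNIV|lebesgue. u q * (- time_deriv et q - stable_op s mu et q)) = (LBINT q. u0 q * (bt (p - q) - La (p - q)))"
  proof -
   have "(LINT q:{-1<..<0} \<times> UNIV|lebesgue. u q * (- time_deriv et q - stable_op s mu et q)) = (\<integral>q. u0 q * (bt (p - q) - La (p - q)) \<partial>lebesgue)"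
    unfolding set_lebesgue_integral_def tdv sop by (intro Bochner_Integration.integral_cong refl) (simp add: u0_def)
   also have "... = (LBINT q. u0 q * (bt (p - q) - La (p - q)))" unfolding bt_def by (rule integral_completion) measurable
   finally show ?thesis .
  qed
  moreover have "(LINT q:{-1<..<0} \<times> ball 0 1|lebesgue. f q * et q) = conv f0 b p"
  proof -
   have "(LINT q:{-1<..<0} \<times> ball 0 1|lebesgue. f q * et q) = (\<integral>q. f0 q * b (p - q) \<partial>lebesgue)"
    unfolding set_lebesgue_integral_def by (intro Bochner_Integration.integral_cong refl) (simp add: f0_def et_def)
   also have "... = (LBINT q. f0 q * b (p - q))" by (rule integral_completion) measurable
   finally show ?thesis by (simp add: conv_def)
  qed
  ultimately have main: "(LBINT q. u0 q * (bt (p - q) - La (p - q))) = conv f0 b p" by simp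
  define h where "h y = (LBINT q. abs (u0 q * Dy y (p - q)))" for y
  have iq: "LI (%q. u0 q * Dy y (p - q))" for y by (rule conv_bound(1)[OF u0_meas u0_bd iD])
  have hle: "0 <= h y" "h y <= M * (LBINT z. abs (Dy y z))" for y
  proof -
   show "0 <= h y" by (simp add: h_def)
   have "abs (u0 q * Dy y (p - q)) <= M * abs (Dy y (p - q))" for q unfolding abs_mult by (intro mult_right_mono u0_bd) auto
   hence "abs (h y) <= (LBINT q. M * abs (Dy y (p - q)))"
    unfolding h_def using integral_reflect(1)[OF iDa, of y p] by (intro abs_integral_le(2)) auto
   thus "h y <= M * (LBINT z. abs (Dy y z))" using integral_reflect(2)[OF iDa, of y p] by simp
  qed
  have jm: "(%(y, q). u0 q * Dy y (p - q)) \<in> borel_measurable (nu \<Otimes>\<^sub>M lborel)" unfolding Dy_def by measurable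
  have hm: "bm h"
  proof -
   have "(%(y, q). abs (u0 q * Dy y (p - q))) \<in> borel_measurable (borel \<Otimes>\<^sub>M lborel)" unfolding Dy_def by measurable
   from lborel.borel_measurable_lebesgue_integral[OF this] show ?thesis unfolding h_def .
  qed
  have ih: "integrable nu h"
  proof (rule levy_integrable[OF l hm])
   fix y
   show "abs (h y) <= (M * A) * (norm y)^2" using hle[of y] mult_left_mono[OF Dy3[of y] M0] by (simp add: mult_ac)
   show "abs (h y) <= M * A" using hle[of y] mult_left_mono[OF Dy4[of y] M0] by simp
  qed (use A M0 in simp)
  have Ip: "integrable (nu \<Otimes>\<^sub>M lborel) (%(y, q). u0 q * Dy y (p - q))"
   by (rule NL.Fubini_integrable[OF jm]) (use ih[unfolded h_def] iq in auto)
  have "(LBINT q. u0 q * La (p - q)) = (LBINT q. (\<integral>y. u0 q * Dy y (p - q) \<partial>nu))" by (simp add: La_def)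
  also have "... = (\<integral>y. (LBINT q. u0 q * Dy y (p - q)) \<partial>nu)" by (rule NL.Fubini_integral[OF Ip])
  also have "... = (\<integral>y. ?P (t, x + y) + ?P (t, x - y) - 2 * ?P (t, x) \<partial>nu)"
  proof (intro Bochner_Integration.integral_cong refl)
   fix y
   note cb = conv_bound(1)[OF u0_meas u0_bd bD(3)]
   have "(LBINT q. u0 q * Dy y (p - q)) = (LBINT q. u0 q * b ((p + (0, y)) - q) + u0 q * b ((p - (0, y)) - q) - 2 * (u0 q * b (p - q)))"
    by (intro Bochner_Integration.integral_cong refl) (simp add: Dy_def algebra_simps)
   also have "... = ?P (p + (0, y)) + ?P (p - (0, y)) - 2 * ?P p" using cb by (simp add: conv_def)
   finally show "(LBINT q. u0 q * Dy y (p - q)) = ?P (t, x + y) + ?P (t, x - y) - 2 * ?P (t, x)" by (simp add: p_def)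
  qed
  finally have e2: "(LBINT q. u0 q * La (p - q)) = (\<integral>y. ?P (t, x + y) + ?P (t, x - y) - 2 * ?P (t, x) \<partial>nu)" .
  have i2: "LI (%q. u0 q * La (p - q))"
   using NL.integrable_snd[OF Ip] by (simp add: La_def)
  have i1: "LI (%q. u0 q * bt (p - q))" unfolding bt_def by (rule conv_bound(1)[OF u0_meas u0_bd ib'])
  show ?thesis using main i1 i2 e2 by (simp add: right_diff_distrib conv_def p_def)
 qed
 show ?thesis using K sd td eq ib'[of "(1, 0)"] unfolding bt_def by blast
qed

lemma tail_integral:
 assumes [measurable]: "bm h" and h: "!!y. abs (h y) <= m"
 shows "integrable nu (%y. indicator (- cball 0 rh) y * h y)"
  "abs (\<integral>y. indicator (- cball 0 rh) y * h y \<partial>nu) <= m * (C * rh powr (- 2 * s))"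
proof -
 note [measurable_cong] = levD(1)[OF lv] and [measurable] = borel_closed[OF closed_cball[of "0::'a" rh]]
 have m: "0 <= m" using h[of 0] by linarith
 have iI: "integrable nu (indicator (- cball 0 rh) :: 'a => real)" "(\<integral>y. indicator (- cball 0 rh) y \<partial>nu) <= C * rh powr (- 2 * s)"
  using C by (intro integral_le_of_nn_integral_le[OF _ _ levD(4)[OF lv rh(1)]]; simp)+
 have i: "integrable nu (%y. m * indicator (- cball 0 rh) y)" using iI(1) by simp
 have le: "AE y in nu. abs (indicator (- cball 0 rh) y * h y) <= m * indicator (- cball 0 rh) y"
  using h m by (intro AE_I2) (auto simp: indicator_def)
 show "integrable nu (%y. indicator (- cball 0 rh) y * h y)" by (rule abs_integral_le(1)[OF i _ le]) measurable
 have "abs (\<integral>y. indicator (- cball 0 rh) y * h y \<partial>nu) <= (\<integral>y. m * indicator (- cball 0 rh) y \<partial>nu)"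
  by (rule abs_integral_le(2)[OF i _ le]) measurable
 also have "... <= m * (C * rh powr (- 2 * s))" using iI m by (simp add: mult_left_mono)
 finally show "abs (\<integral>y. indicator (- cball 0 rh) y * h y \<partial>nu) <= m * (C * rh powr (- 2 * s))" .
qed

text \<open>The jumps longer than \<open>rh\<close> form the term \<open>Q\<close>, which joins the
  source. In it \<open>u\<close> enters with coefficients 1, 1 and -2, so \<open>Q\<close> is
  bounded and Hoelder continuous with 4 M times the tail mass C rh^(-2s). Long jumps reach
  arbitrarily far, which is why \<open>u\<close> must be controlled on the whole space.\<close>

lemma smooth_sol_mollified:
 assumes rh16: "rh <= 1/16" and cut: "cutoff Z ze" and de: "0 < de" "de <= 1/16" and b: "mollifier (2 * de, 0) de b"
 shows "\<exists>ut g B. smooth_sol s al c C rh nu Z ze (%t x. conv u0 b (t, x)) ut g (M * (1 + 4 * (C * rh powr (- 2 * s)))) B (J de)"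
proof -
 let ?P = "conv u0 b"
 note bD = mollifierD[OF b] and PH = P_hold[OF de b] and FH = F_hold[OF de b] and Pb = P_bd[OF de b] and Fb = F_bd[OF de b]
 obtain bt K where bt: "LI bt" and K: "0 <= K"
  and sd: "!!p y. abs (?P (p + y) + ?P (p - y) - 2 * ?P p) <= M * (2 * K) * (norm y)^2"
  and td: "!!t x h. abs (?P (t + h, x) - ?P (t, x) - h * conv u0 bt (t, x)) <= M * K * h^2"
  and eq: "!!t x. t \<in> J de ==> norm x < 1 - de ==>
   conv u0 bt (t, x) = (\<integral>y. ?P (t, x + y) + ?P (t, x - y) - 2 * ?P (t, x) \<partial>nu) + conv f0 b (t, x)"
  using mollified_equation[OF de b] by blast
 have [measurable]: "bm bt" using bt by auto
 note [measurable] = conv_measurable[OF u0_meas bD(5)] conv_measurable[OF f0_meas bD(5)] conv_measurable[OF u0_meas \<open>bt \<in> borel_measurable borel\<close>]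
  and [measurable_cong] = levD(1)[OF lv] and [measurable] = borel_closed[OF closed_cball[of "0::'a" rh]]
 define S where "S t x y = ?P (t, x + y) + ?P (t, x - y) - 2 * ?P (t, x)" for t and x y :: 'a
 have Sm [measurable]: "bm (S t x)" for t x unfolding S_def by measurable
 have S1: "abs (S t x y) <= M * (2 * K) * (norm y)^2" for t x y using sd[of "(t, x)" "(0, y)"] by (simp add: S_def)
 have S2: "abs (S t x y) <= 4 * M" for t x y
  using Pb[of "(t, x + y)"] Pb[of "(t, x - y)"] Pb[of "(t, x)"] unfolding S_def by linarith
 define A where "A = M * (2 * K) + 4 * M"
 have A: "0 <= A" using K M0 by (simp add: A_def)
 have iS: "integrable nu (S t x)" for t x
 proof (rule levy_integrable[OF lv[unfolded lev_def] Sm _ _ A])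
  show "abs (S t x y) <= A * (norm y)^2" for y using S1[of t x y] M0 by (simp add: A_def distrib_right add_increasing2)
  show "abs (S t x y) <= A" for y using S2[of t x y] M0 K by (simp add: A_def add_increasing)
 qed
 define Q where "Q t x = (\<integral>y. indicator (- cball 0 rh) y * S t x y \<partial>nu)" for t x
 have split: "(\<integral>y. S t x y \<partial>nu) = (\<integral>y. S t x y \<partial>trunc nu) + Q t x" for t x
 proof -
  have i2: "integrable nu (%y. indicator (cball 0 rh) y * S t x y)"
   using integrable_mult_indicator[OF _ iS, of "cball 0 rh"] levD(1)[OF lv] by simp
  have "(\<integral>y. S t x y \<partial>nu) = (\<integral>y. indicator (cball 0 rh) y * S t x y + indicator (- cball 0 rh) y * S t x y \<partial>nu)"
   by (intro Bochner_Integration.integral_cong refl) (simp add: indicator_def)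
  also have "... = (\<integral>y. indicator (cball 0 rh) y * S t x y \<partial>nu) + Q t x"
   unfolding Q_def by (rule Bochner_Integration.integral_add[OF i2 tail_integral(1)[OF Sm S2]])
  finally show ?thesis unfolding trunc_def by (subst integral_scaled(1)) (auto simp: levD(1)[OF lv])
 qed
 define m where "m = C * rh powr (- 2 * s)"
 have m: "0 <= m" using C by (simp add: m_def)
 define M' where "M' = M * (1 + 4 * m)"
 have M': "M <= M'" "0 <= M'" "M + 4 * M * m = M'" using M0 m by (auto simp: M'_def algebra_simps)
 have Qb: "abs (Q t x) <= 4 * M * m" for t x
  unfolding Q_def m_def by (rule tail_integral(2)[OF Sm S2])
 have Qh: "abs (Q t x - Q t' x') <= 4 * M * m * (abs (t - t') powr (al / (2 * s)) + norm (x - x') powr al)" (is "_ <= _ * ?d")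
  if tt: "t \<in> J de" "t' \<in> J de" for t t' x x'
 proof -
  have "Q t x - Q t' x' = (\<integral>y. indicator (- cball 0 rh) y * (S t x y - S t' x' y) \<partial>nu)"
   unfolding Q_def right_diff_distrib
   by (rule Bochner_Integration.integral_diff[symmetric]; rule tail_integral(1)[OF Sm S2])
  also have "\<bar>...\<bar> <= (4 * (M * ?d)) * (C * rh powr (- 2 * s))"
  proof (rule tail_integral(2))
   show "abs (S t x y - S t' x' y) <= 4 * (M * ?d)" for y
    using PH[OF tt, of "x + y" "x' + y"] PH[OF tt, of "x - y" "x' - y"] PH[OF tt, of x x'] unfolding S_def by simp
  qed measurable
  finally show ?thesis unfolding m_def mult.assoc by (simp only: mult_ac)
 qed
 have n78: "norm x < 1 - de" if "norm x <= 7/8" for x :: 'a using that de by simp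
 define B where "B = M * (2 * K) + M * (LBINT z. abs (bt z))"
 have Kb: "0 <= M * K" "0 <= M * (LBINT z. abs (bt z))" using M0 K by auto
 have le: "4 * M * m * d + M * d = M' * d" for d using M'(3) by (simp add: algebra_simps M'_def)
 have "smooth_sol s al c C rh nu Z ze (%t x. ?P (t, x)) (%t x. conv u0 bt (t, x)) (%t x. conv f0 b (t, x) + Q t x) M' B (J de)"
 proof
  show "rh <= 1/16" "cutoff Z ze" "0 <= M'" "lev nu" by (fact rh16 cut M' lv)+
  show "0 <= B" using Kb by (simp add: B_def)
  show "open (J de)" "convex (J de)" by (auto simp: J_def[OF de b])
  fix t assume t: "t \<in> J de"
  show "bm (%x. conv u0 bt (t, x))" by measurable
  have "bm (%x. Q t x)"
   using Qh[OF t t] by (intro borel_measurable_continuous_onI borel_measurable_of_modulus[OF _ al(1), where M = "4 * M * m"]) simp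
  thus "bm (%x. conv f0 b (t, x) + Q t x)" by measurable
  fix x :: 'a
  show "abs (?P (t, x)) <= M'" using Pb[of "(t, x)"] M' by simp
  have "abs (conv u0 bt (t, x)) <= M * (LBINT z. abs (bt z))" by (rule conv_bound(2)[OF u0_meas u0_bd bt])
  thus "abs (conv u0 bt (t, x)) <= B" using Kb by (simp add: B_def)
  show "abs (conv f0 b (t, x) + Q t x) <= M'" using Fb[of "(t, x)"] Qb[of t x] M'(3) by linarith
  show "conv u0 bt (t, x) = (\<integral>y. ?P (t, x + y) + ?P (t, x - y) - 2 * ?P (t, x) \<partial>trunc nu) + (conv f0 b (t, x) + Q t x)" if "norm x <= 7/8"
   using eq[OF t n78[OF that]] split[of t x] unfolding S_def by simp
  show "abs (?P (t, x + y) + ?P (t, x - y) - 2 * ?P (t, x)) <= B * (norm y)^2" for y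
   using S1[of t x y] Kb unfolding S_def B_def by (simp add: distrib_right add_increasing2)
  show "abs (?P (t + h, x) - ?P (t, x) - h * conv u0 bt (t, x)) <= B * h^2" for h
  proof -
   have "M * K * h^2 <= B * h^2" using Kb by (intro mult_right_mono) (auto simp: B_def mult.commute[of K])
   thus ?thesis using td[of t h x] by simp
  qed
  fix t' x' assume t': "t' \<in> J de"
  let ?d = "abs (t - t') powr (al / (2 * s)) + norm (x - x') powr al"
  have "M * ?d <= M' * ?d" using M' by (intro mult_right_mono) auto
  thus "abs (?P (t, x) - ?P (t', x')) <= M' * ?d" using PH[OF t t', of x x'] by linarith
  show "abs (conv f0 b (t, x) + Q t x - (conv f0 b (t', x') + Q t' x')) <= M' * ?d" if "norm x <= 7/8" "norm x' <= 7/8"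
   using FH[OF t t' n78[OF that(1)] n78[OF that(2)]] Qh[OF t t', of x x'] le[of ?d] by linarith
 qed
 thus ?thesis unfolding M'_def m_def by blast
qed

text \<open>The mollification radius doubles as the smallest time \<open>ep\<close>, so a single
  parameter tends to 0. With \<open>T <= 1/4\<close> and \<open>de <= 1/16\<close>, times t - sg for
  t > -1/2 stay above -3/4 and hence in \<open>J de\<close>.\<close>

lemma approximation:
 assumes rh16: "rh <= 1/16" and cut: "cutoff Z ze"
  and kb: "!!es. set es \<subseteq> Basis ==> length es <= Suc K ==> kb nu ze es 0 D" "kb nu ze [] 1 D" "kb nu ze [] 2 D"
  and K: "real K < 2 * s + al" "2 * s + al < real K + 1"
  and T: "T <= 1/4" "tau T <= rh" and de: "0 < de" "de <= T" "de <= 1/16"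
 defines "M' \<equiv> M * (1 + 4 * (C * rh powr (- 2 * s)))" and "be \<equiv> al / (2 * s)"
 shows "\<exists>w. (\<forall>t\<in>{-1/2<..<0}. HB K (2 * s + al - real K) (M' * space_const DIM('a) K D Z T) (ball 0 (1/2)) (w t)) \<and>
  (\<forall>x\<in>ball 0 (1/2). HB 1 be (M' * time_const D Z T) {-1/2<..<0} (%t. w t x)) \<and>
  (\<forall>t\<in>{-1/2<..<0}. \<forall>x\<in>ball 0 (1/2). abs (w t x - u (t, x)) <= M' * (D * (Z + 4)) * de powr be + M * ((3 * de) powr be + de powr al))"
proof -
 obtain b where b: "mollifier (2 * de, 0::'a) de b" using mollifier_exists[OF de(1)] by blast
 obtain ut g B where S: "smooth_sol s al c C rh nu Z ze (%t x. conv u0 b (t, x)) ut g M' B (J de)"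
  using smooth_sol_mollified[OF rh16 cut de(1,3) b] unfolding M'_def by blast
 interpret S: smooth_sol s al c C rh nu Z ze "%t x. conv u0 b (t, x)" ut g M' B "J de" by (rule S)
 have T': "0 < de" "de <= T" "T <= 1" "tau T <= rh" using de T by auto
 have Jt: "t - sg \<in> J de" if "t \<in> {-1/2<..<0}" "de <= sg" "sg <= T" for t sg
  using that de T by (simp add: J_def[OF de(1,3) b])
 have Jt0: "t \<in> J de" if "t \<in> {-1/2<..<0}" for t
  using that de by (simp add: J_def[OF de(1,3) b])
 have kb0: "kb nu ze [] 0 D" using kb(1)[of "[]"] by simp
 show ?thesis
 proof (intro exI[of _ "S.V [] 0 0 de"] conjI ballI)
  fix t :: real assume t: "t \<in> {-1/2<..<0}"
  show "HB K (2 * s + al - real K) (M' * space_const DIM('a) K D Z T) (ball 0 (1/2)) (S.V [] 0 0 de t)"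
   by (rule S.V_space_HB[OF T' kb(1) Jt[OF t] K]) auto
  fix x :: 'a assume x: "x \<in> ball 0 (1/2)"
  have "abs (S.V [] 0 0 de t x - conv u0 b (t, x)) <= M' * (D * (Z + 4)) * de powr be"
   unfolding be_def using x by (intro S.V_approx[OF T' kb0 Jt0[OF t] Jt[OF t]]) (use de in auto)
  moreover have "abs (conv u0 b (t, x) - u (t, x)) <= M * ((3 * de) powr be + de powr al)"
   unfolding be_def using t by (intro P_approx[OF de(1,3) b Jt0[OF t]]) auto
  ultimately show "abs (S.V [] 0 0 de t x - u (t, x)) <= M' * (D * (Z + 4)) * de powr be + M * ((3 * de) powr be + de powr al)"
   by linarith
 next
  fix x :: 'a assume x: "x \<in> ball 0 (1/2)"
  show "HB 1 be (M' * time_const D Z T) {-1/2<..<0} (%t. S.V [] 0 0 de t x)"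
   unfolding be_def by (rule S.V_time_HB[OF T' kb0 kb(2,3) _ Jt]) (use x in auto)
 qed
qed

lemma weak_sol_HB:
 assumes rh16: "rh <= 1/16" and cut: "cutoff Z ze"
  and kb: "!!es. set es \<subseteq> Basis ==> length es <= Suc K ==> kb nu ze es 0 D" "kb nu ze [] 1 D" "kb nu ze [] 2 D"
  and K: "real K < 2 * s + al" "2 * s + al < real K + 1"
  and T: "0 < T" "T <= 1/4" "tau T <= rh"
 defines "M' \<equiv> M * (1 + 4 * (C * rh powr (- 2 * s)))" and "be \<equiv> al / (2 * s)"
 shows "t \<in> {-1/2<..<0} ==> HB K (2 * s + al - real K) (M' * space_const DIM('a) K D Z T) (ball 0 (1/2)) (%x. u (t, x))"
  "x \<in> ball 0 (1/2) ==> HB 1 be (M' * time_const D Z T) {-1/2<..<0} (%t. u (t, x))"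
proof -
 define de where "de j = min T (1/16) / real (Suc j)" for j
 have de: "0 < de j" "de j <= T" "de j <= 1/16" for j
 proof -
  show "0 < de j" using T by (simp add: de_def)
  have "de j <= min T (1/16) / 1" unfolding de_def using T by (intro divide_left_mono) auto
  thus "de j <= T" "de j <= 1/16" by auto
 qed
 have de0: "de \<longlonglongrightarrow> 0"
  unfolding de_def using LIMSEQ_Suc[OF lim_const_over_n[of "min T (1/16)"]] by simp
 define Q where "Q d w \<longleftrightarrow> (\<forall>t\<in>{-1/2<..<0}. HB K (2 * s + al - real K) (M' * space_const DIM('a) K D Z T) (ball 0 (1/2)) (w t)) \<and>
  (\<forall>x\<in>ball 0 (1/2). HB 1 be (M' * time_const D Z T) {-1/2<..<0} (%t. w t x)) \<and>
  (\<forall>t\<in>{-1/2<..<0}. \<forall>x\<in>ball 0 (1/2). abs (w t x - u (t, x)) <= M' * (D * (Z + 4)) * d powr be + M * ((3 * d) powr be + d powr al))" for d w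
 have "\<forall>j. \<exists>w. Q (de j) w"
  using approximation[OF rh16 cut kb K T(2,3) de] unfolding Q_def M'_def be_def by blast
 from choice[OF this] obtain w where w: "\<forall>j. Q (de j) (w j)" ..
 have w1: "HB K (2 * s + al - real K) (M' * space_const DIM('a) K D Z T) (ball 0 (1/2)) (w j t)" if "t \<in> {-1/2<..<0}" for j t
  by (rule bspec[OF conjunct1[OF HOL.spec[OF w, unfolded Q_def]] that])
 have w2: "HB 1 be (M' * time_const D Z T) {-1/2<..<0} (%t. w j t x)" if "x \<in> ball 0 (1/2)" for j x
  by (rule bspec[OF conjunct1[OF conjunct2[OF HOL.spec[OF w, unfolded Q_def]]] that])
 have be: "0 < be" "be < 1" using s al by (auto simp: be_def)
 have lim: "(%j. w j t x) \<longlonglongrightarrow> u (t, x)" if "t \<in> {-1/2<..<0}" "x \<in> ball 0 (1/2)" for t x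
 proof -
  have "(%j. w j t x - u (t, x)) \<longlonglongrightarrow> 0"
  proof (rule Lim_null_comparison)
   show "\<forall>\<^sub>F j in sequentially. norm (w j t x - u (t, x)) <= M' * (D * (Z + 4)) * de j powr be + M * ((3 * de j) powr be + de j powr al)"
    using bspec[OF bspec[OF conjunct2[OF conjunct2[OF HOL.spec[OF w, unfolded Q_def]]] that(1)] that(2)]
    unfolding real_norm_def by (intro always_eventually allI)
   have p: "(%j. (k * de j) powr a) \<longlonglongrightarrow> 0" if "0 < a" "0 < k" for a k
    using tendsto_mult_right_zero[OF de0, of k] that de(1)
    by (intro tendsto_zero_powrI[OF _ tendsto_const]) (auto intro!: always_eventually simp: less_imp_le)
   show "(%j. M' * (D * (Z + 4)) * de j powr be + M * ((3 * de j) powr be + de j powr al)) \<longlonglongrightarrow> 0"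
    using p[OF be(1), of 1] p[OF be(1), of 3] p[OF al(1), of 1]
    by (intro tendsto_add_zero tendsto_mult_right_zero) auto
  qed
  thus ?thesis by (simp add: LIM_zero_iff)
 qed
 show "HB K (2 * s + al - real K) (M' * space_const DIM('a) K D Z T) (ball 0 (1/2)) (%x. u (t, x))" if t: "t \<in> {-1/2<..<0}"
 proof (rule HB_limit[where v = "%j. w j t"])
  show "HB K (2 * s + al - real K) (M' * space_const DIM('a) K D Z T) (ball 0 (1/2)) (w j t)" for j by (rule w1[OF t])
 qed (use lim[OF t] K in auto)
 show "HB 1 be (M' * time_const D Z T) {-1/2<..<0} (%t. u (t, x))" if x: "x \<in> ball 0 (1/2)"
 proof (rule HB_limit[where v = "%j t. w j t x"])
  show "HB 1 be (M' * time_const D Z T) {-1/2<..<0} (%t. w j t x)" for j by (rule w2[OF x])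
 qed (use lim[OF _ x] be in auto)
qed

end

section \<open>From the norms to pointwise bounds, and the final constant\<close>

text \<open>The sup part of the norm is only essential. The seminorm makes the function continuous,
  so the set where the pointwise bound fails is open; being null, it is empty.\<close>

lemma holder_norm_txD:
 fixes w :: "real \<times> 'a::euclidean_space => real"
 assumes I: "open I" "open D" and ab: "0 < al" "0 < be" and M: "0 <= M" and le: "holder_norm_tx be al I D w <= ennreal M"
 shows "t \<in> I ==> t' \<in> I ==> x \<in> D ==> x' \<in> D ==> abs (w (t, x) - w (t', x')) <= M * (abs (t - t') powr be + norm (x - x') powr al)"
  "t \<in> I ==> x \<in> D ==> abs (w (t, x)) <= M"
proof -
 have sn: "holder_seminorm_tx be al I D w <= ennreal M" and es: "esssup (lebesgue_on (I \<times> D)) (%p. ennreal (abs (w p))) <= ennreal M"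
  by (rule order_trans[OF _ le], simp add: holder_norm_tx_def add_increasing add_increasing2)+
 have h: "abs (w (t, x) - w (t', x')) <= M * (abs (t - t') powr be + norm (x - x') powr al)"
  if a: "t \<in> I" "t' \<in> I" "x \<in> D" "x' \<in> D" for t t' x x'
 proof (cases "(t, x) = (t', x')")
  case False
  let ?d = "abs (t - t') powr be + norm (x - x') powr al"
  have d: "0 < ?d"
  proof (cases "t = t'")
   case True
   hence "0 < norm (x - x') powr al" using False by simp
   thus ?thesis using True by simp
  qed (simp add: add_pos_nonneg)
  have "ennreal (abs (w (t, x) - w (t', x')) / ?d) <= holder_seminorm_tx be al I D w"
   unfolding holder_seminorm_tx_def using a False by (intro SUP_upper2[of "((t, x), (t', x'))"]) auto
  also note sn
  finally have "abs (w (t, x) - w (t', x')) / ?d <= M" using M by (subst (asm) ennreal_le_iff) auto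
  thus ?thesis using d by (simp add: pos_divide_le_eq)
 qed simp
 thus "t \<in> I ==> t' \<in> I ==> x \<in> D ==> x' \<in> D ==> abs (w (t, x) - w (t', x')) <= M * (abs (t - t') powr be + norm (x - x') powr al)" .
 have op: "open (I \<times> D)" by (intro open_Times I)
 have cont: "continuous_on (I \<times> D) w"
  by (rule continuous_on_parabolic_holder[OF ab, where M=M]) (use h in auto)
 have opE: "open ((I \<times> D) \<inter> w -` {y. M < abs y})"
  by (rule continuous_open_preimage[OF cont op]) (auto intro!: open_Collect_less continuous_intros)
 have "AE p in lebesgue_on (I \<times> D). ennreal (abs (w p)) <= ennreal M"
  using esssup_AE[of "%p. ennreal (abs (w p))" "lebesgue_on (I \<times> D)"] by eventually_elim (rule order_trans[OF _ es])
 hence ae: "AE p in lebesgue. p \<in> I \<times> D --> ennreal (abs (w p)) <= ennreal M"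
  using op by (subst (asm) AE_restrict_space_iff) auto
 have "AE p in lebesgue. p \<notin> (I \<times> D) \<inter> w -` {y. M < abs y}"
  using ae by eventually_elim (use M in \<open>auto simp: ennreal_le_iff\<close>)
 hence "negligible ((I \<times> D) \<inter> w -` {y. M < abs y})"
  using opE by (subst (asm) AE_iff_null_sets[symmetric]) (auto simp: negligible_iff_null_sets)
 hence "(I \<times> D) \<inter> w -` {y. M < abs y} = {}" using open_not_negligible[OF opE] by blast
 thus "t \<in> I ==> x \<in> D ==> abs (w (t, x)) <= M" by (auto simp: set_eq_iff not_less)
qed

theorem theorem1p1:
  fixes s \<alpha> lam Lam :: real
  assumes "0 < s" "s < 1"
    and "0 < lam" "lam \<le> Lam"
    and "0 < \<alpha>" "\<alpha> < 1"
    and "0 < \<alpha> / (2 * s)" "\<alpha> / (2 * s) < 1"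
    and "\<alpha> + 2 * s \<notin> \<int>"
  shows "\<exists>C::real. C > 0 \<and>
    (\<forall>(\<mu> :: (real ^ 'n) measure) (u :: real \<times> (real ^ 'n) \<Rightarrow> real) f.
       spectral_measure s lam Lam \<mu> \<longrightarrow>
       weak_solution s \<mu> {-1<..<0} (ball 0 1) u f \<longrightarrow>
       holder_norm_t (1 + \<alpha> / (2 * s)) {-1/2<..<0} (ball 0 (1/2)) u
         + holder_norm_x (2 * s + \<alpha>) {-1/2<..<0} (ball 0 (1/2)) u
       \<le> ennreal C *
           (holder_norm_tx (\<alpha> / (2 * s)) \<alpha> {-1<..<0} UNIV u
            + holder_norm_tx (\<alpha> / (2 * s)) \<alpha> {-1<..<0} (ball 0 1) f))"
proof -
 note s = assms(1,2) and lam = assms(3,4)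
 have \<alpha>: "0 < \<alpha>" "\<alpha> < 1" "\<alpha> < 2 * s" using assms by (auto simp: pos_divide_less_eq)
 define \<beta> where "\<beta> = \<alpha> / (2 * s)"
 have \<beta>: "0 < \<beta>" "\<beta> < 1" using assms by (auto simp: \<beta>_def)
 \<comment> \<open>Chosen for equality in the smallness condition of \<open>spec_quadratic\<close>:
   \<open>\<eta> powr (2 * s) * Lam = lam / 2\<close>.\<close>
 define \<eta> where "\<eta> = (lam / (2 * Lam)) powr (1 / (2 * s))"
 have \<eta>: "0 < \<eta>" "\<eta> powr (2 * s) * Lam <= lam / 2" using lam s by (auto simp: \<eta>_def powr_powr)
 define c where "c = lam / 2 * \<eta> powr (2 - 2 * s) / (1 - s)"
 define Cc where "Cc = Lam * (1 / (1 - s) + 1 / s + 2 / (2 * s - \<alpha>))"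
 \<comment> \<open>The truncation radius 1/16 is the one for which the geometry of the cutoff was
   laid out.\<close>
 interpret stable_setting s \<alpha> c Cc "1/16"
  using s lam \<alpha> \<eta> by unfold_locales (auto simp: c_def Cc_def intro!: mult_nonneg_nonneg add_nonneg_nonneg)
 \<comment> \<open>The largest integer below \<open>2 * s + \<alpha>\<close>. That this sum is not
   an integer makes both inequalities for \<open>K\<close> strict, as the two regimes of the
   estimates demand.\<close>
 define K where "K = nat \<lfloor>2 * s + \<alpha>\<rfloor>"
 have rK: "real K = real_of_int \<lfloor>2 * s + \<alpha>\<rfloor>" using s \<alpha> by (simp add: K_def)
 have K: "real K < 2 * s + \<alpha>" "2 * s + \<alpha> < real K + 1"
 proof -
  have "real K ~= 2 * s + \<alpha>" using assms(9) by (metis Ints_of_nat add.commute)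
  thus "real K < 2 * s + \<alpha>" "2 * s + \<alpha> < real K + 1" unfolding rK by linarith+
 qed
 \<comment> \<open>The bound 1/4 keeps the backward time window inside (-1, 0); the other term makes
   the parabolic length of \<open>T\<close> at most the truncation radius.\<close>
 define T :: real where "T = min (1/4) ((1/16) powr (2 * s))"
 have T: "0 < T" "T <= 1/4" "tau T <= 1/16"
 proof -
  show "0 < T" "T <= 1/4" by (auto simp: T_def)
  hence "tau T <= ((1/16) powr (2 * s)) powr (1 / (2 * s))"
   using s unfolding tau_def by (intro powr_mono2) (auto simp: T_def)
  also have "... = 1/16" using s by (simp add: powr_powr)
  finally show "tau T <= 1/16" .
 qed
 obtain Z and \<zeta> :: "real ^ 'n => real" where cut: "cutoff Z \<zeta>" using cutoff_exists by blast
 \<comment> \<open>The measure is quantified inside the constant, so \<open>D\<close> below is the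
   same for all spectral measures.\<close>
 have "\<forall>p. \<exists>D. \<forall>\<nu>. lev \<nu> --> kb \<nu> \<zeta> (fst p) (snd p) D" using kb_exists[OF _ cut] by simp
 from choice[OF this] obtain Df where Df: "!!\<nu> es j. lev \<nu> ==> kb \<nu> \<zeta> es j (Df (es, j))" by auto
 \<comment> \<open>The finitely many kernel orders in use: space derivatives up to one above
   \<open>K\<close>, and one and two time derivatives.\<close>
 define A where "A = {es::(real ^ 'n) list. set es \<subseteq> Basis \<and> length es <= Suc K} \<times> {0::nat} \<union> {([], 1), ([], 2)}"
 have fA: "finite A" unfolding A_def by (intro finite_UnI finite_cartesian_product finite_lists_length_le) auto
 define D where "D = (\<Sum>p\<in>A. \<bar>Df p\<bar>)"
 have kb: "kb \<nu> \<zeta> es j D" if "(es, j) \<in> A" "lev \<nu>" for \<nu> es j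
 proof (rule kb_mono[OF Df[OF that(2)]])
  have "\<bar>Df (es, j)\<bar> <= D" unfolding D_def using that fA by (intro member_le_sum) auto
  thus "Df (es, j) <= D" by simp
 qed
 define m where "m = 1 + 4 * (Cc * (1/16) powr (- 2 * s))"
 define Nx where "Nx = real (card {es::(real ^ 'n) list. set es \<subseteq> Basis \<and> length es <= K})"
 define Nt where "Nt = real (card {es::real list. set es \<subseteq> Basis \<and> length es <= 1})"
 define C1 where "C1 = 2 * Nt * (m * time_const D Z T)"
 define C2 where "C2 = 2 * Nx * (m * space_const DIM(real ^ 'n) K D Z T)"
 define CC where "CC = \<bar>C1\<bar> + \<bar>C2\<bar> + 1"
 show ?thesis
 proof (intro exI[of _ CC] conjI allI impI)
  show "0 < CC" by (simp add: CC_def)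
  fix \<mu> :: "(real ^ 'n) measure" and u f :: "real \<times> (real ^ 'n) => real"
  assume spec: "spectral_measure s lam Lam \<mu>" and weak: "weak_solution s \<mu> {-1<..<0} (ball 0 1) u f"
  define Nu where "Nu = holder_norm_tx \<beta> \<alpha> {-1<..<0} UNIV u + holder_norm_tx \<beta> \<alpha> {-1<..<0} (ball 0 1) f"
  have "holder_norm_t (1 + \<beta>) {-1/2<..<0} (ball 0 (1/2)) u + holder_norm_x (2 * s + \<alpha>) {-1/2<..<0} (ball 0 (1/2)) u <= ennreal CC * Nu"
  proof (cases Nu)
   \<comment> \<open>With infinite data the right-hand side is infinite, because \<open>CC\<close>
     is positive.\<close>
   case top
   thus ?thesis by (simp add: CC_def ennreal_mult_top)
  next
   case (real M)
   have lev: "lev (jump_measure s \<mu>)"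
    unfolding lev_def unfolding c_def Cc_def by (rule jump_levy[OF s lam spec \<alpha>(1,3) \<eta>])
   have le: "holder_norm_tx \<beta> \<alpha> {-1<..<0} UNIV u <= ennreal M" "holder_norm_tx \<beta> \<alpha> {-1<..<0} (ball 0 1) f <= ennreal M"
    unfolding real(2)[symmetric] Nu_def by (auto simp: add_increasing add_increasing2)
   note uD = holder_norm_txD[OF open_greaterThanLessThan open_UNIV \<alpha>(1) \<beta>(1) real(1) le(1)]
    and fD = holder_norm_txD[OF open_greaterThanLessThan open_ball \<alpha>(1) \<beta>(1) real(1) le(2)]
   interpret weak_sol s \<alpha> c Cc "1/16" lam Lam \<mu> u f M
    using lam spec lev weak real(1) uD fD by unfold_locales (auto simp: \<beta>_def)
   have kbs: "!!es. set es \<subseteq> Basis ==> length es <= Suc K ==> kb (jump_measure s \<mu>) \<zeta> es 0 D"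
    "kb (jump_measure s \<mu>) \<zeta> [] 1 D" "kb (jump_measure s \<mu>) \<zeta> [] 2 D"
    by (rule kb[OF _ lev]; auto simp: A_def)+
   have HBx: "HB K (2 * s + \<alpha> - real K) (M * m * space_const DIM(real ^ 'n) K D Z T) (ball 0 (1/2)) (%x. u (t, x))" if "t \<in> {-1/2<..<0}" for t
    unfolding m_def by (rule weak_sol_HB(1)[OF order_refl cut kbs(1) kbs(2,3) K T that])
   have HBt: "HB 1 \<beta> (M * m * time_const D Z T) {-1/2<..<0} (%t. u (t, x))" if "x \<in> ball 0 (1/2)" for x
    unfolding m_def \<beta>_def by (rule weak_sol_HB(2)[OF order_refl cut kbs(1) kbs(2,3) K T that])
   have nn: "0 <= M * m * time_const D Z T" "0 <= M * m * space_const DIM(real ^ 'n) K D Z T"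
    using HB_bound[OF HBt[of 0], of "-1/4"] HB_bound[OF HBx[of "-1/4"], of 0] by auto
   have "holder_norm_t (1 + \<beta>) {-1/2<..<0} (ball 0 (1/2)) u <= ennreal (C1 * M)"
    unfolding holder_norm_t_def
   proof (rule SUP_least)
    fix x :: "real ^ 'n" assume x: "x \<in> ball 0 (1/2)"
    have "holder_norm (1 + \<beta>) {-1/2<..<0} (%t. u (t, x)) <= ennreal (2 * Nt * (M * m * time_const D Z T))"
     unfolding Nt_def by (rule holder_norm_le[OF open_greaterThanLessThan nn(1) \<beta> HBt[OF x]]) simp
    thus "holder_norm (1 + \<beta>) {-1/2<..<0} (%t. u (t, x)) <= ennreal (C1 * M)" by (simp add: C1_def mult_ac)
   qed
   also have "... <= ennreal (\<bar>C1\<bar> * M)" using real(1) by (intro ennreal_leI mult_right_mono) auto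
   finally have 1: "holder_norm_t (1 + \<beta>) {-1/2<..<0} (ball 0 (1/2)) u <= ennreal (\<bar>C1\<bar> * M)" .
   have "holder_norm_x (2 * s + \<alpha>) {-1/2<..<0} (ball 0 (1/2)) u <= ennreal (C2 * M)"
    unfolding holder_norm_x_def
   proof (rule SUP_least)
    fix t :: real assume t: "t \<in> {-1/2<..<0}"
    have "holder_norm (2 * s + \<alpha>) (ball 0 (1/2)) (%x. u (t, x)) <= ennreal (2 * Nx * (M * m * space_const DIM(real ^ 'n) K D Z T))"
     unfolding Nx_def by (rule holder_norm_le[OF open_ball nn(2) _ _ HBx[OF t]]) (use K in auto)
    thus "holder_norm (2 * s + \<alpha>) (ball 0 (1/2)) (%x. u (t, x)) <= ennreal (C2 * M)" by (simp add: C2_def mult_ac)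
   qed
   also have "... <= ennreal (\<bar>C2\<bar> * M)" using real(1) by (intro ennreal_leI mult_right_mono) auto
   finally have 2: "holder_norm_x (2 * s + \<alpha>) {-1/2<..<0} (ball 0 (1/2)) u <= ennreal (\<bar>C2\<bar> * M)" .
   have "ennreal (\<bar>C1\<bar> * M) + ennreal (\<bar>C2\<bar> * M) <= ennreal (CC * M)"
    using real(1) by (subst ennreal_plus[symmetric]) (auto simp: CC_def distrib_right intro!: ennreal_leI)
   also have "... = ennreal CC * Nu" unfolding real(2) by (rule ennreal_mult) (auto simp: CC_def real(1))
   finally show ?thesis using add_mono[OF 1 2] by (rule order_trans[rotated])
  qed
  thus "holder_norm_t (1 + \<alpha> / (2 * s)) {-1/2<..<0} (ball 0 (1/2)) u + holder_norm_x (2 * s + \<alpha>) {-1/2<..<0} (ball 0 (1/2)) u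
   <= ennreal CC * (holder_norm_tx (\<alpha> / (2 * s)) \<alpha> {-1<..<0} UNIV u + holder_norm_tx (\<alpha> / (2 * s)) \<alpha> {-1<..<0} (ball 0 1) f)"
   by (simp only: Nu_def \<beta>_def)
 qed
qed

end
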